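(* Let $d\ge 2$ and let $\tau=\{\tau_e\}_{e\in E^d}$ be i.i.d. non-negative random variables with common distribution $F$. Suppose that $F$ is useful and that $\mathbb{E}[\tau_e^{2m}]<\infty$ for some positive integer $m$. Then for any $\theta\in\mathbb{S}^{d-1}=\{x\in\mathbb{R}^d : |x|=1\}$ and any $r>0$, there exist constants $c,C>0$ such that for any $t>0$ and any closed convex set $\Gamma\subset\mathbb{R}^d$ containing $0$, $$\mathbb{P}\left(\mathrm{F}_{L(\theta,r)}(B(t),\Gamma)\le c\log t\right)\le C\,t^{-2dm}.$$
   Context: First-passage percolation on $\mathbb{Z}^d$: the edge set is $E^d=\{\{v,w\} : v,w\in\mathbb{Z}^d,\ |v-w|_1=1\}$ (non-oriented edges), where $|v|_1=\sum_{i=1}^d|v_i|$. A path is a finite sequence of vertices $(x_1,\dots,x_l)$ in $\mathbb{Z}^d$ with $\{x_i,x_{i+1}\}\in E^d$ for $1\le i\le l-1$; it is also regarded as the set of its edges. The passage time of a path $\gamma$ is $T(\gamma)=\sum_{e\in\gamma}\tau_e$. For $x\in\mathbb{R}^d$, $[x]=([x_1],\dots,[x_d])$, where $[a]$ is the greatest integer $\le a$. For $v,w\in\mathbb{R}^d$, the first passage time is $T(v,w)=\inf_{\gamma:[v]\to[w]}T(\gamma)$, the infimum being over all finite paths from $[v]$ to $[w]$. For $t>0$, $B(t)=\{x\in\mathbb{R}^d : T(0,x)\le t\}$. Useful distributions: let $F^-$ be the infimum of the support of $F$. $F$ is called useful if $\mathbb{P}(\tau_e=F^-)<p_c(d)$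 when $F^-=0$, and $\mathbb{P}(\tau_e=F^-)<\vec{p}_c(d)$ when $F^->0$. Here $p_c(d)$ and $\vec{p}_c(d)$ are the critical probabilities of $d$-dimensional (bond) percolation and oriented (bond) percolation on $\mathbb{Z}^d$, respectively. Fluctuation: let $d(\cdot,\cdot)$ denote Euclidean distance (the distance from a point to the empty set being $+\infty$). For $l>0$ and $\Gamma\subset\mathbb{R}^d$, let $\Gamma^-_l=\{v\in\Gamma : d(v,\Gamma^c)\ge l\}$ and $\Gamma^+_l=\{v\in\mathbb{R}^d : d(v,\Gamma)\le l\}$. For sets $A,B,C\subset\mathbb{R}^d$, the fluctuation of $A$ from $B$ inside $C$ is $$\mathrm{F}_C(A,B)=\inf\{\delta>0 : B^-_\delta\cap C\subset A\cap C\subset B^+_\delta\cap C\},$$ with $\inf\emptyset=+\infty$. Cone: for $\theta\in\mathbb{R}^d$ and $r>0$, $L(\theta,r)=\{a\mathbf{v} : a\in[0,\infty),\ \mathbf{v}\in B(\theta,r)\}$, where $B(\theta,r)$ (two arguments) is the closed Euclidean ball with center $\theta$ and radius $r$. *)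

theory Defs
  imports "HOL-Probability.Probability"
begin

text \<open>The lattice of dimension \<open>d = CARD('n)\<close> is the type \<open>int ^ 'n\<close>. A random environment is
  considered pointwise, as a function from edges to real numbers (passage times) or to Booleans
  (open/closed).\<close>

definition edges :: "(int ^ 'n::finite) set set" where
  "edges = {{v, w} | v w. (\<Sum>i\<in>UNIV. \<bar>v $ i - w $ i\<bar>) = 1}"

definition path_between :: "int ^ 'n::finite \<Rightarrow> int ^ 'n \<Rightarrow> (int ^ 'n) list \<Rightarrow> bool" where
  "path_between v w xs \<longleftrightarrow>
     xs \<noteq> [] \<and> hd xs = v \<and> last xs = w \<and> successively (\<lambda>x y. {x, y} \<in> edges) xs"

definition path_edges :: "'v list \<Rightarrow> 'v set set" where
  "path_edges xs = {{xs ! i, xs ! Suc i} | i. Suc i < length xs}"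

subsection \<open>Percolation\<close>

definition percolation :: "real \<Rightarrow> ((int ^ 'n::finite) set \<Rightarrow> bool) measure" where
  "percolation p = PiM edges (\<lambda>_. measure_pmf (bernoulli_pmf p))"

definition open_cluster :: "((int ^ 'n::finite) set \<Rightarrow> bool) \<Rightarrow> (int ^ 'n) set" where
  "open_cluster \<omega> = {v. \<exists>xs. path_between 0 v xs \<and> (\<forall>e\<in>path_edges xs. \<omega> e)}"

text \<open>In oriented percolation every edge may be traversed in the positive coordinate direction
  only. As each non-oriented edge carries exactly one such orientation, both models live on the
  same space of configurations.\<close>

definition oriented_path_between :: "int ^ 'n::finite \<Rightarrow> int ^ 'n \<Rightarrow> (int ^ 'n) list \<Rightarrow> bool" where
  "oriented_path_between v w xs \<longleftrightarrow>
     xs \<noteq> [] \<and> hd xs = v \<and> last xs = w \<and> successively (\<lambda>x y. \<exists>i. y = x + axis i 1) xs"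

definition oriented_open_cluster :: "((int ^ 'n::finite) set \<Rightarrow> bool) \<Rightarrow> (int ^ 'n) set" where
  "oriented_open_cluster \<omega> =
     {v. \<exists>xs. oriented_path_between 0 v xs \<and> (\<forall>e\<in>path_edges xs. \<omega> e)}"

definition percolation_prob ::
  "(((int ^ 'n::finite) set \<Rightarrow> bool) \<Rightarrow> (int ^ 'n) set) \<Rightarrow> real \<Rightarrow> real" where
  "percolation_prob cluster p =
     measure (percolation p) {\<omega> \<in> space (percolation p). infinite (cluster \<omega>)}"

definition p_crit :: "'n::finite itself \<Rightarrow> real" where
  "p_crit _ = Sup {p \<in> {0..1}.
     percolation_prob (open_cluster :: ((int ^ 'n) set \<Rightarrow> bool) \<Rightarrow> _) p = 0}"

definition p_crit_oriented :: "'n::finite itself \<Rightarrow> real" where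
  "p_crit_oriented _ = Sup {p \<in> {0..1}.
     percolation_prob (oriented_open_cluster :: ((int ^ 'n) set \<Rightarrow> bool) \<Rightarrow> _) p = 0}"

subsection \<open>Useful distributions\<close>

definition measure_support :: "real measure \<Rightarrow> real set" where
  "measure_support F = {x. \<forall>U. open U \<and> x \<in> U \<longrightarrow> measure F U > 0}"

definition F_minus :: "real measure \<Rightarrow> real" where
  "F_minus F = Inf (measure_support F)"

text \<open>The type argument provides the dimension \<open>CARD('n)\<close>.\<close>

definition useful :: "'n::finite itself \<Rightarrow> real measure \<Rightarrow> bool" where
  "useful N F \<longleftrightarrow>
     (F_minus F = 0 \<longrightarrow> measure F {F_minus F} < p_crit N) \<and>
     (F_minus F > 0 \<longrightarrow> measure F {F_minus F} < p_crit_oriented N)"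

subsection \<open>First-passage percolation\<close>

definition lattice_floor :: "real ^ 'n::finite \<Rightarrow> int ^ 'n" where
  "lattice_floor x = (\<chi> i. \<lfloor>x $ i\<rfloor>)"

text \<open>Every edge of a path is counted once, even if the path traverses it several times.\<close>

definition passage_time :: "((int ^ 'n::finite) set \<Rightarrow> real) \<Rightarrow> (int ^ 'n) list \<Rightarrow> real" where
  "passage_time \<tau> xs = (\<Sum>e\<in>path_edges xs. \<tau> e)"

definition first_passage_time ::
  "((int ^ 'n::finite) set \<Rightarrow> real) \<Rightarrow> real ^ 'n \<Rightarrow> real ^ 'n \<Rightarrow> real" where
  "first_passage_time \<tau> v w =
     (INF xs\<in>{xs. path_between (lattice_floor v) (lattice_floor w) xs}. passage_time \<tau> xs)"

definition fpp_ball :: "((int ^ 'n::finite) set \<Rightarrow> real) \<Rightarrow> real \<Rightarrow> (real ^ 'n) set" where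
  "fpp_ball \<tau> t = {x. first_passage_time \<tau> 0 x \<le> t}"

subsection \<open>Fluctuation\<close>

text \<open>Unlike \<^const>\<open>infdist\<close>, the distance to the empty set is infinite here.\<close>

definition edist_set :: "'a::metric_space \<Rightarrow> 'a set \<Rightarrow> ereal" where
  "edist_set v S = (INF w\<in>S. ereal (dist v w))"

definition inner_part :: "real \<Rightarrow> 'a::metric_space set \<Rightarrow> 'a set" where
  "inner_part l G = {v \<in> G. ereal l \<le> edist_set v (- G)}"

definition outer_part :: "real \<Rightarrow> 'a::metric_space set \<Rightarrow> 'a set" where
  "outer_part l G = {v. edist_set v G \<le> ereal l}"

definition fluctuation :: "'a::metric_space set \<Rightarrow> 'a set \<Rightarrow> 'a set \<Rightarrow> ereal" where
  "fluctuation C A B = Inf {ereal \<delta> | \<delta>. \<delta> > 0 \<and>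
     inner_part \<delta> B \<inter> C \<subseteq> A \<inter> C \<and> A \<inter> C \<subseteq> outer_part \<delta> B \<inter> C}"

definition direction_cone :: "'a::real_normed_vector \<Rightarrow> real \<Rightarrow> 'a set" where
  "direction_cone \<theta> r = {a *\<^sub>R v | a v. 0 \<le> a \<and> v \<in> cball \<theta> r}"

end

theory Submission
  imports Defs
begin

text \<open>Write \<open>d\<close> for the dimension. If the fluctuation inside the cone is at most \<open>c * ln t\<close>, then every
point of the cone that lies deeper than this inside \<open>\<Gamma>\<close> has been reached at time \<open>t\<close>, and no
point of the cone that is further than this from \<open>\<Gamma>\<close> has (\<open>fluctuation_inside\<close>,
\<open>fluctuation_outside\<close>). The boundary of a convex set is too regular for that of a randomly
growing set: there are of the order of \<open>sqrt t\<close> well separated places at which a local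
configuration of probability at least \<open>t powr (- 1 / 4)\<close> would contradict the two properties,
and the probability that none of them occurs is smaller than every power of \<open>t\<close>.

The local configuration. It concerns two lattice points at distance of the order of \<open>ln t\<close>, the
point \<open>z\<close> inside \<open>\<Gamma>\<close> and the point \<open>w\<close> outside, and it forces \<open>w\<close> to be reached no later than
\<open>z\<close> (\<open>spoilable\<close>). If the weight zero has positive probability, a segment of zero weights from
\<open>z\<close> to \<open>w\<close> will do (\<open>spoilable_atom\<close>). Otherwise \<open>z\<close> sits in a box with \<open>w\<close> on its surface; a
grid of \<open>O(ln t)\<close> edges with weights at most \<open>a\<close> covers the surface, while inside the box passages
take time \<open>b > a\<close> per unit of length. A path that enters the box and proceeds to \<open>z\<close> could have
reached \<open>w\<close> along the grid earlier (\<open>grid_block\<close>, \<open>spoilable_no_atom\<close>). Only the grid is expensive,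
and it costs a fixed factor for each of its edges.

The numbers \<open>a < b\<close> come from usefulness. If \<open>F_minus F = 0\<close> and zero is not an atom, most edges
of a path have weight at least some \<open>\<eta> > 0\<close>, by counting paths (\<open>slow_no_atom_at_zero\<close>). If
\<open>F_minus F > 0\<close>, a path whose time is close to \<open>F_minus F\<close> times the distance of its endpoints uses
mostly edges with weights near the minimum and moves almost always in the directions of one orthant; below the
critical probability of oriented percolation this is exponentially unlikely
(\<open>slow_positive_minimum\<close>). It is enough to know that the expected number of vertices that oriented
percolation reaches at some level is at most one half. This is a form of the sharpness of the
phase transition, and it is derived here from a product inequality for exponential moments of the
cluster (\<open>cluster_exponential_moment\<close>, \<open>oriented_subcritical_level\<close>).

The places. Consider of the order of \<open>sqrt t\<close> rays of direction \<open>\<theta>\<close>, at mutual distance \<open>sqrt t\<close>,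
which start near \<open>(\<epsilon> * t) *\<^sub>R \<theta>\<close> and stay in the cone. If a ball of radius \<open>sqrt t / 4\<close> that moves
along a ray leaves \<open>\<Gamma>\<close>, convexity provides a half-space that contains \<open>\<Gamma>\<close> and almost touches the
ball, and near the point of contact there is room for \<open>w\<close> outside the half-space and for \<open>z\<close> inside
the ball (\<open>exit_points\<close>, \<open>tracks_avoided\<close>). Two exceptional cases remain. If the ball never leaves
\<open>\<Gamma>\<close>, infinitely many points would be reached at time \<open>t\<close>, which has probability zero
(\<open>track_inside_null\<close>). If the rays do not even start inside \<open>\<Gamma>\<close>, some point of the cone has
distance of order \<open>t\<close> from \<open>\<Gamma>\<close>, although it is so close to the origin that it is reached at time
\<open>t\<close> except with probability \<open>O(t powr (- 2 * d * m))\<close> (\<open>core_missing\<close>). The last estimate uses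
\<open>2 * d\<close> edge-disjoint paths, each of which is slow with probability \<open>O(t powr (- m))\<close> by the moment
assumption (\<open>passage_upper_bound\<close>); it determines the rate in the theorem.\<close>

section \<open>Subcritical oriented percolation\<close>

text \<open>The expectation of \<open>f S\<close> when \<open>S\<close> contains every element of the finite set \<open>D\<close> independently with
probability \<open>p\<close>. A finite sum avoids all measurability questions and permits induction over
\<open>D\<close>.\<close>

definition expect_subset :: "real \<Rightarrow> 'e set \<Rightarrow> ('e set \<Rightarrow> real) \<Rightarrow> real" where
  "expect_subset p D f = (\<Sum>S\<in>Pow D. p ^ card S * (1 - p) ^ card (D - S) * f S)"

lemma expect_subset_empty [simp]: "expect_subset p {} f = f {}"
  by (simp add: expect_subset_def)

lemma expect_subset_insert:
  assumes "finite D" "e \<notin> D"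
  shows "expect_subset p (insert e D) f =
    p * expect_subset p D (\<lambda>S. f (insert e S)) + (1 - p) * expect_subset p D f"
proof -
  have inj: "inj_on (insert e) (Pow D)"
    using assms(2) by (auto simp: inj_on_def)
  have "expect_subset p (insert e D) f
      = (\<Sum>S\<in>Pow D. p ^ card S * (1 - p) ^ card (insert e D - S) * f S)
        + (\<Sum>S\<in>insert e ` Pow D. p ^ card S * (1 - p) ^ card (insert e D - S) * f S)"
    unfolding expect_subset_def Pow_insert
    using assms by (intro sum.union_disjoint) auto
  also have "(\<Sum>S\<in>Pow D. p ^ card S * (1 - p) ^ card (insert e D - S) * f S)
      = (1 - p) * expect_subset p D f"
    unfolding expect_subset_def sum_distrib_left
  proof (intro sum.cong refl)
    fix S assume S: "S \<in> Pow D"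
    then have "insert e D - S = insert e (D - S)" using assms by auto
    then have "card (insert e D - S) = Suc (card (D - S))" using assms by simp
    then show "p ^ card S * (1 - p) ^ card (insert e D - S) * f S =
       (1 - p) * (p ^ card S * (1 - p) ^ card (D - S) * f S)" by simp
  qed
  also have "(\<Sum>S\<in>insert e ` Pow D. p ^ card S * (1 - p) ^ card (insert e D - S) * f S)
      = p * expect_subset p D (\<lambda>S. f (insert e S))"
    unfolding expect_subset_def sum_distrib_left
  proof (subst sum.reindex[OF inj], intro sum.cong refl)
    fix S assume S: "S \<in> Pow D"
    then have "insert e D - insert e S = D - S" "e \<notin> S" "finite S"
      using assms by (auto intro: finite_subset)
    then show "((\<lambda>S. p ^ card S * (1 - p) ^ card (insert e D - S) * f S) \<circ> insert e) S =
         p * (p ^ card S * (1 - p) ^ card (D - S) * f (insert e S))" by simp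
  qed
  finally show ?thesis by simp
qed

lemma expect_subset_const: "finite D \<Longrightarrow> expect_subset p D (\<lambda>_. c) = c"
  by (induction D rule: finite_induct) (simp_all add: expect_subset_insert algebra_simps)

lemma expect_subset_mono:
  assumes "0 \<le> p" "p \<le> 1" "\<And>S. S \<subseteq> D \<Longrightarrow> f S \<le> g S"
  shows "expect_subset p D f \<le> expect_subset p D g"
  unfolding expect_subset_def using assms by (intro sum_mono mult_left_mono) auto

lemma expect_subset_pos:
  assumes "finite D" "0 \<le> p" "p \<le> 1" "\<And>S. 0 < f S"
  shows "0 < expect_subset p D f"
  using assms(1,4)
proof (induction D arbitrary: f rule: finite_induct)
  case (insert e D)
  have "0 < expect_subset p D (\<lambda>S. f (insert e S))" "0 < expect_subset p D f"
    using insert by auto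
  then show ?case using insert.hyps assms(2,3)
    by (cases "p = 0") (auto simp: expect_subset_insert intro!: add_pos_nonneg)
qed simp

lemma expect_subset_cong:
  "(\<And>S. S \<subseteq> D \<Longrightarrow> f S = g S) \<Longrightarrow> expect_subset p D f = expect_subset p D g"
  unfolding expect_subset_def by (intro sum.cong) auto

lemma expect_subset_cmult: "expect_subset p D (\<lambda>S. c * f S) = c * expect_subset p D f"
  unfolding expect_subset_def by (simp add: sum_distrib_left algebra_simps)

lemma expect_subset_sum:
  "expect_subset p D (\<lambda>S. \<Sum>i\<in>I. f i S) = (\<Sum>i\<in>I. expect_subset p D (f i))"
  unfolding expect_subset_def by (simp add: sum_distrib_left sum.swap[of _ I])

text \<open>Harris' inequality for two decreasing functions. Conditioning on one further element leaves two
pairs of conditional expectations that are ordered in the same way.\<close>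

lemma expect_subset_harris:
  assumes "finite D" "0 \<le> p" "p \<le> 1"
    and "\<And>S S'. S \<subseteq> S' \<Longrightarrow> f S' \<le> f S" "\<And>S S'. S \<subseteq> S' \<Longrightarrow> g S' \<le> (g S :: real)"
  shows "expect_subset p D f * expect_subset p D g \<le> expect_subset p D (\<lambda>S. f S * g S)"
  using assms(1,4,5)
proof (induction D arbitrary: f g rule: finite_induct)
  case empty
  then show ?case by simp
next
  case (insert e D)
  define f0 f1 g0 g1 where "f0 = expect_subset p D f" "f1 = expect_subset p D (\<lambda>S. f (insert e S))"
    "g0 = expect_subset p D g" "g1 = expect_subset p D (\<lambda>S. g (insert e S))"
  note d = this
  have "f1 \<le> f0" "g1 \<le> g0" unfolding d
    using assms(2,3) by (auto intro!: expect_subset_mono insert.prems)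
  then have "0 \<le> p * (1 - p) * ((f0 - f1) * (g0 - g1))"
    using assms(2,3) by (intro mult_nonneg_nonneg) auto
  then have "(p * f1 + (1 - p) * f0) * (p * g1 + (1 - p) * g0) \<le> p * (f1 * g1) + (1 - p) * (f0 * g0)"
    by (simp add: algebra_simps)
  also have "\<dots> \<le> p * expect_subset p D (\<lambda>S. f (insert e S) * g (insert e S))
       + (1 - p) * expect_subset p D (\<lambda>S. f S * g S)"
  proof (intro add_mono mult_left_mono)
    show "f1 * g1 \<le> expect_subset p D (\<lambda>S. f (insert e S) * g (insert e S))"
      unfolding d by (rule insert.IH) (auto intro!: insert.prems)
    show "f0 * g0 \<le> expect_subset p D (\<lambda>S. f S * g S)"
      unfolding d by (rule insert.IH) (use insert.prems in auto)
  qed (use assms in auto)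
  finally show ?case
    using insert.hyps by (simp add: expect_subset_insert d)
qed

lemma expect_subset_antimono_set:
  assumes "finite D" "D' \<subseteq> D" "0 \<le> p" "p \<le> 1" "\<And>S S'. S \<subseteq> S' \<Longrightarrow> f S' \<le> f S"
  shows "expect_subset p D f \<le> expect_subset p D' f"
proof -
  have "expect_subset p (D' \<union> A) f \<le> expect_subset p D' f" if "finite A" "A \<inter> D' = {}" for A
    using that
  proof (induction A rule: finite_induct)
    case (insert e A)
    have fin: "finite (D' \<union> A)" using assms insert by (auto intro: finite_subset)
    have "expect_subset p (D' \<union> A) (\<lambda>S. f (insert e S)) \<le> expect_subset p (D' \<union> A) f"
      using assms(3,4) by (intro expect_subset_mono assms(5)) auto
    then have "expect_subset p (insert e (D' \<union> A)) f \<le>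
        p * expect_subset p (D' \<union> A) f + (1 - p) * expect_subset p (D' \<union> A) f"
      using insert assms fin by (subst expect_subset_insert) (auto intro!: mult_left_mono)
    also have "\<dots> = expect_subset p (D' \<union> A) f" by (simp add: algebra_simps)
    also have "\<dots> \<le> expect_subset p D' f" using insert by auto
    finally show ?case by simp
  qed simp
  from this[of "D - D'"] assms show ?thesis
    by (simp add: Un_absorb1 Int_commute)
qed

lemma expect_subset_restrict:
  assumes "finite D" "\<And>S. S \<subseteq> D \<Longrightarrow> f S = f (S \<inter> D')"
  shows "expect_subset p D f = expect_subset p (D \<inter> D') f"
proof -
  have "expect_subset p (B \<union> A) f = expect_subset p B f"
    if "finite A" "finite B" "A \<inter> D' = {}" "B \<subseteq> D'" "A \<union> B \<subseteq> D" for A B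
    using that(1,3,5)
  proof (induction A rule: finite_induct)
    case (insert e A)
    have e: "e \<notin> B \<union> A" using insert that by auto
    have "expect_subset p (B \<union> A) (\<lambda>S. f (insert e S)) = expect_subset p (B \<union> A) f"
    proof (rule expect_subset_cong)
      fix S assume "S \<subseteq> B \<union> A"
      then have "f (insert e S) = f (insert e S \<inter> D')" "f S = f (S \<inter> D')"
        using insert.prems assms(2)[of "insert e S"] assms(2)[of S] by blast+
      moreover have "insert e S \<inter> D' = S \<inter> D'" using insert by auto
      ultimately show "f (insert e S) = f S" by simp
    qed
    then have "expect_subset p (insert e (B \<union> A)) f = expect_subset p (B \<union> A) f"
      using e insert that by (subst expect_subset_insert) (auto simp: algebra_simps)
    then show ?case using insert by simp
  qed simp
  from this[of "D - D'" "D \<inter> D'"] assms(1) show ?thesis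
    by (simp add: Un_Diff_Int Un_commute Int_assoc) (metis Diff_disjoint Int_commute Int_Diff Un_Diff_Int Un_commute finite_Diff finite_Int inf_le1 inf_le2 Diff_subset Un_least)
qed

lemma expect_subset_image:
  assumes "inj_on h D"
  shows "expect_subset p (h ` D) f = expect_subset p D (\<lambda>S. f (h ` S))"
proof -
  have b: "bij_betw (image h) (Pow D) (Pow (h ` D))"
    using assms by (simp add: bij_betw_Pow inj_on_imp_bij_betw)
  have "expect_subset p (h ` D) f
      = (\<Sum>S\<in>Pow D. p ^ card (h ` S) * (1 - p) ^ card (h ` D - h ` S) * f (h ` S))"
    unfolding expect_subset_def by (rule sum.reindex_bij_betw[OF b, symmetric])
  also have "\<dots> = expect_subset p D (\<lambda>S. f (h ` S))"
    unfolding expect_subset_def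
  proof (intro sum.cong refl)
    fix S assume "S \<in> Pow D"
    then have "inj_on h S" "h ` D - h ` S = h ` (D - S)" "inj_on h (D - S)"
      using assms by (auto intro: inj_on_subset simp: inj_on_image_set_diff)
    then show "p ^ card (h ` S) * (1 - p) ^ card (h ` D - h ` S) * f (h ` S) =
       p ^ card S * (1 - p) ^ card (D - S) * f (h ` S)" by (simp add: card_image)
  qed
  finally show ?thesis .
qed

lemma finite_rtrancl_Image:
  assumes "finite S" "finite A" shows "finite (S\<^sup>* `` A)"
proof (rule finite_subset)
  show "S\<^sup>* `` A \<subseteq> A \<union> snd ` S"
  proof
    fix y assume "y \<in> S\<^sup>* `` A"
    then obtain x where "x \<in> A" "(x, y) \<in> S\<^sup>*" by auto
    then show "y \<in> A \<union> snd ` S"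
      using rtranclE[of x y S] by (metis UnI1 UnI2 image_eqI snd_conv)
  qed
qed (use assms in auto)

lemma rtrancl_insert_Image:
  assumes "x \<in> A"
  shows "(insert (x, y) S)\<^sup>* `` A = S\<^sup>* `` (insert y A)"
proof -
  have "(u, w) \<in> (insert (x, y) S)\<^sup>* \<Longrightarrow> u \<in> insert y A \<Longrightarrow> w \<in> S\<^sup>* `` (insert y A)" for u w
    by (induction rule: rtrancl_induct) (auto intro: rtrancl.rtrancl_into_rtrancl)
  moreover have "S\<^sup>* `` A \<subseteq> (insert (x, y) S)\<^sup>* `` A"
    using rtrancl_mono[of S "insert (x, y) S"] by auto
  moreover have "S\<^sup>* `` {y} \<subseteq> (insert (x, y) S)\<^sup>* `` A"
  proof
    fix z assume "z \<in> S\<^sup>* `` {y}"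
    then have "(y, z) \<in> (insert (x, y) S)\<^sup>*"
      using rtrancl_mono[of S "insert (x, y) S"] by auto
    then have "(x, z) \<in> (insert (x, y) S)\<^sup>*"
      by (meson converse_rtrancl_into_rtrancl insertI1)
    then show "z \<in> (insert (x, y) S)\<^sup>* `` A" using assms by auto
  qed
  moreover have "S\<^sup>* `` (insert y A) = S\<^sup>* `` A \<union> S\<^sup>* `` {y}" by auto
  ultimately show ?thesis by (smt (verit, ccfv_threshold) ImageE Un_least subsetI subset_antisym insertI2)
qed

lemma rtrancl_Image_closed:
  assumes "\<And>x y. (x, y) \<in> S \<Longrightarrow> x \<in> A \<Longrightarrow> y \<in> A"
  shows "S\<^sup>* `` A = A"
proof -
  have "(x, y) \<in> S\<^sup>* \<Longrightarrow> x \<in> A \<Longrightarrow> y \<in> A" for x y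
    by (induction rule: rtrancl_induct) (use assms in auto)
  then show ?thesis by auto
qed

text \<open>Mark every vertex independently with probability \<open>1 - g\<close>, so that \<open>g ^ card\<close> is the conditional
probability that the cluster of \<open>A\<close> has no mark. Consider the law at \<open>p\<close> conditioned on this. When
the cluster is explored edge by edge, the next edge is open with conditional probability at least
\<open>p * \<rho>\<close>, since by Harris' inequality it adds a cluster without marks with probability at least
\<open>\<rho>\<close>. Hence the conditional law dominates percolation at any \<open>q \<le> p * \<rho>\<close>, and integrating the
increasing function \<open>inverse g ^ card\<close> yields the product inequality. The induction over the
unexplored edges carries out this argument without constructing a coupling.\<close>

lemma cluster_exponential_moment:
  fixes D :: "('v \<times> 'v) set"
  assumes "finite D" "finite A" and p: "0 \<le> p" "p \<le> 1" and q: "0 \<le> q" "q \<le> p * \<rho>" and g: "0 < g" "g \<le> 1"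
    and \<rho>: "\<And>y. \<rho> \<le> expect_subset p D (\<lambda>S. g ^ card (S\<^sup>* `` {y}))" and \<rho>1: "0 < \<rho>" "\<rho> \<le> 1"
  shows "expect_subset q D (\<lambda>S. inverse g ^ card (S\<^sup>* `` A)) * expect_subset p D (\<lambda>S. g ^ card (S\<^sup>* `` A)) \<le> 1"
proof -
  let ?u = "\<lambda>D A. expect_subset p D (\<lambda>S. g ^ card (S\<^sup>* `` A))"
  let ?v = "\<lambda>D A. expect_subset q D (\<lambda>S. inverse g ^ card (S\<^sup>* `` A))"
  have q1: "q \<le> 1" using q p \<rho>1 mult_le_one[of p \<rho>] by linarith
  have "?v D' A * ?u D' A \<le> 1" if "finite D'" "D' \<subseteq> D" "finite A" for D' A
    using that
  proof (induction "card D'" arbitrary: D' A)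
    case 0
    then have "D' = {}" by simp
    then show ?case using g by (simp add: power_mult_distrib[symmetric])
  next
    case (Suc n)
    have pos: "0 < ?u D'' A''" if "finite D''" for D'' A''
    proof -
      show ?thesis using that g p by (intro expect_subset_pos) auto
    qed
    show ?case
    proof (cases "\<exists>x y. (x, y) \<in> D' \<and> x \<in> A \<and> y \<notin> A")
      case False
      have "card (S\<^sup>* `` A) = card A" if "S \<subseteq> D'" for S
        by (subst rtrancl_Image_closed) (use that False in auto)
      then have "?v D' A = inverse g ^ card A" "?u D' A = g ^ card A"
        using Suc.prems by (simp_all cong: expect_subset_cong add: expect_subset_const)
      then show ?thesis using g by (simp add: power_mult_distrib[symmetric])
    next
      case True
      then obtain x y where xy: "(x, y) \<in> D'" "x \<in> A" "y \<notin> A" by auto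
      define D0 where "D0 = D' - {(x, y)}"
      have D0: "D' = insert (x, y) D0" "(x, y) \<notin> D0" "finite D0" "D0 \<subseteq> D" "card D0 = n"
        using xy Suc by (auto simp: D0_def)
      have eq: "expect_subset r D' (\<lambda>S. f (S\<^sup>* `` A)) =
          r * expect_subset r D0 (\<lambda>S. f (S\<^sup>* `` (insert y A))) + (1 - r) * expect_subset r D0 (\<lambda>S. f (S\<^sup>* `` A))"
        for r and f :: "'v set \<Rightarrow> real"
        unfolding D0(1) using D0 xy by (subst expect_subset_insert) (simp_all add: rtrancl_insert_Image)
      define u0 u1 where "u0 = ?u D0 A" "u1 = ?u D0 (insert y A)"
      note u = this
      have pos: "0 < u0" "0 < u1" unfolding u using pos D0 by auto
      have v0: "?v D0 A \<le> 1 / u0" "?v D0 (insert y A) \<le> 1 / u1"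
        using Suc.hyps(1)[of D0 A] Suc.hyps(1)[of D0 "insert y A"] D0 Suc.prems pos
        by (auto simp: u field_simps)
      have u01: "u1 \<le> u0" unfolding u
        using p g D0 Suc.prems
        by (intro expect_subset_mono power_decreasing card_mono finite_rtrancl_Image)
          (auto intro: finite_subset)
      have "u0 * \<rho> \<le> u1"
      proof -
        have anti: "g ^ card ((S' \<inter> D0)\<^sup>* `` B) \<le> g ^ card ((S \<inter> D0)\<^sup>* `` B)" if "S \<subseteq> S'" "finite B" for S S' B
          using g that D0 rtrancl_mono[of "S \<inter> D0" "S' \<inter> D0"]
          by (intro power_decreasing card_mono finite_rtrancl_Image) auto
        have r: "?u D0 B = expect_subset p D0 (\<lambda>S. g ^ card ((S \<inter> D0)\<^sup>* `` B))" for B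
          by (intro expect_subset_cong) (simp add: Int_absorb2)
        have "\<rho> \<le> ?u D {y}" by (rule \<rho>)
        also have "\<dots> = expect_subset p D (\<lambda>S. g ^ card ((S \<inter> D)\<^sup>* `` {y}))"
          by (intro expect_subset_cong) (simp add: Int_absorb2)
        also have "\<dots> \<le> expect_subset p D0 (\<lambda>S. g ^ card ((S \<inter> D)\<^sup>* `` {y}))"
          using D0 assms(1) p
        proof (intro expect_subset_antimono_set)
          fix S S' :: "('v \<times> 'v) set" assume "S \<subseteq> S'"
          then show "g ^ card ((S' \<inter> D)\<^sup>* `` {y}) \<le> g ^ card ((S \<inter> D)\<^sup>* `` {y})"
            using g assms(1) rtrancl_mono[of "S \<inter> D" "S' \<inter> D"]
            by (intro power_decreasing card_mono finite_rtrancl_Image) auto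
        qed auto
        also have "\<dots> = ?u D0 {y}" using D0
          by (intro expect_subset_cong) (metis Int_absorb2 order_trans)
        finally have "\<rho> \<le> ?u D0 {y}" .
        then have "u0 * \<rho> \<le> ?u D0 A * ?u D0 {y}" using pos u by simp
        also have "\<dots> \<le> expect_subset p D0 (\<lambda>S. g ^ card ((S \<inter> D0)\<^sup>* `` A) * g ^ card ((S \<inter> D0)\<^sup>* `` {y}))"
          unfolding r using D0 p anti Suc.prems by (intro expect_subset_harris) auto
        also have "\<dots> \<le> u1" unfolding u power_add[symmetric]
        proof (intro expect_subset_mono power_decreasing p)
          fix S assume S: "S \<subseteq> D0"
          then have "S\<^sup>* `` insert y A = S\<^sup>* `` A \<union> S\<^sup>* `` {y}" "S \<inter> D0 = S" by auto
          then show "card (S\<^sup>* `` insert y A) \<le> card ((S \<inter> D0)\<^sup>* `` A) + card ((S \<inter> D0)\<^sup>* `` {y})"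
            by (simp add: card_Un_le)
        qed (use g in auto)
        finally show ?thesis .
      qed
      then have rho: "q * u0 \<le> p * u1"
      proof -
        have "q * u0 \<le> p * \<rho> * u0" using q pos by (intro mult_right_mono) auto
        also have "\<dots> = p * (u0 * \<rho>)" by simp
        also have "\<dots> \<le> p * u1" using \<open>u0 * \<rho> \<le> u1\<close> p by (intro mult_left_mono)
        finally show ?thesis .
      qed
      have "?v D' A = q * ?v D0 (insert y A) + (1 - q) * ?v D0 A"
        using eq[of q "\<lambda>C. inverse g ^ card C"] by simp
      also have "\<dots> \<le> q * (1 / u1) + (1 - q) * (1 / u0)"
        using v0 q q1 by (intro add_mono mult_left_mono) auto
      finally have v: "?v D' A \<le> q / u1 + (1 - q) / u0" by simp
      have uu: "?u D' A = p * u1 + (1 - p) * u0"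
        using eq[of p "\<lambda>C. g ^ card C"] u by simp
      have "(q * u0 + (1 - q) * u1) * (p * u1 + (1 - p) * u0) \<le> u0 * u1"
      proof -
        have "u0 * u1 - (q * u0 + (1 - q) * u1) * (p * u1 + (1 - p) * u0)
           = (u0 - u1) * (p * u1 - q * (p * u1 + (1 - p) * u0))" by algebra
        moreover have "q * (p * u1 + (1 - p) * u0) \<le> q * u0"
          using q p u01 mult_left_mono[of u1 u0 p] by (intro mult_left_mono) (auto simp: algebra_simps)
        ultimately show ?thesis using rho u01
          by (smt (verit) mult_nonneg_nonneg)
      qed
      then have "(q / u1 + (1 - q) / u0) * (p * u1 + (1 - p) * u0) \<le> 1"
        using pos by (simp add: field_simps)
      moreover have "?v D' A * ?u D' A \<le> (q / u1 + (1 - q) / u0) * (p * u1 + (1 - p) * u0)"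
        unfolding uu using v pos p by (intro mult_right_mono) auto
      ultimately show ?thesis by linarith
    qed
  qed
  then show ?thesis using assms by blast
qed

lemma path_edges_Nil [simp]: "path_edges [] = {}"
  and path_edges_single [simp]: "path_edges [x] = {}"
  by (auto simp: path_edges_def)

lemma path_edges_Cons2 [simp]: "path_edges (x # y # xs) = insert {x, y} (path_edges (y # xs))"
proof -
  have "path_edges (x # y # xs) = (\<lambda>i. {(x # y # xs) ! i, (x # y # xs) ! Suc i}) ` {..<Suc (length xs)}"
    unfolding path_edges_def by auto
  also have "{..<Suc (length xs)} = insert 0 (Suc ` {..<length xs})"
    by (rule lessThan_Suc_eq_insert_0)
  also have "(\<lambda>i. {(x # y # xs) ! i, (x # y # xs) ! Suc i}) ` \<dots> = insert {x, y} (path_edges (y # xs))"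
    unfolding path_edges_def image_insert image_image by auto
  finally show ?thesis .
qed

lemma path_edges_append:
  "xs \<noteq> [] \<Longrightarrow> ys \<noteq> [] \<Longrightarrow>
    path_edges (xs @ ys) = insert {last xs, hd ys} (path_edges xs \<union> path_edges ys)"
proof (induction xs rule: induct_list012)
  case (2 x)
  then show ?case by (cases ys) auto
qed auto

lemma path_edges_snoc: "xs \<noteq> [] \<Longrightarrow> path_edges (xs @ [z]) = insert {last xs, z} (path_edges xs)"
  by (simp add: path_edges_append)

lemma (in prob_space) prob_open_set:
  assumes "finite D"
    and meas: "\<And>S. S \<subseteq> D \<Longrightarrow> {\<omega> \<in> space M. \<forall>e\<in>D. Y e \<omega> \<longleftrightarrow> e \<in> S} \<in> events"
    and law: "\<And>S. S \<subseteq> D \<Longrightarrow> prob {\<omega> \<in> space M. \<forall>e\<in>D. Y e \<omega> \<longleftrightarrow> e \<in> S} = p ^ card S * (1 - p) ^ card (D - S)"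
  shows "{\<omega> \<in> space M. P {e \<in> D. Y e \<omega>}} \<in> events" (is ?A)
    and "prob {\<omega> \<in> space M. P {e \<in> D. Y e \<omega>}} = expect_subset p D (\<lambda>S. if P S then 1 else 0)" (is ?B)
proof -
  let ?E = "\<lambda>S. {\<omega> \<in> space M. \<forall>e\<in>D. Y e \<omega> \<longleftrightarrow> e \<in> S}"
  let ?Q = "{S \<in> Pow D. P S}"
  have eq: "{\<omega> \<in> space M. P {e \<in> D. Y e \<omega>}} = (\<Union>S\<in>?Q. ?E S)"
  proof (intro equalityI subsetI)
    fix \<omega> assume "\<omega> \<in> {\<omega> \<in> space M. P {e \<in> D. Y e \<omega>}}"
    then show "\<omega> \<in> (\<Union>S\<in>?Q. ?E S)" by (intro UN_I[of "{e \<in> D. Y e \<omega>}"]) auto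
  next
    fix \<omega> assume "\<omega> \<in> (\<Union>S\<in>?Q. ?E S)"
    then obtain S where S: "S \<subseteq> D" "P S" "\<omega> \<in> space M" "\<forall>e\<in>D. Y e \<omega> \<longleftrightarrow> e \<in> S" by auto
    then have "{e \<in> D. Y e \<omega>} = S" by auto
    then show "\<omega> \<in> {\<omega> \<in> space M. P {e \<in> D. Y e \<omega>}}" using S by simp
  qed
  have disj: "disjoint_family_on ?E ?Q"
    by (auto simp: disjoint_family_on_def)
  show ?A unfolding eq using assms by (intro sets.finite_UN) auto
  have "prob (\<Union>S\<in>?Q. ?E S) = (\<Sum>S\<in>?Q. prob (?E S))"
    by (rule finite_measure_finite_Union) (use assms(1) meas disj in auto)
  also have "\<dots> = (\<Sum>S\<in>?Q. p ^ card S * (1 - p) ^ card (D - S))"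
    by (intro sum.cong refl law) auto
  also have "\<dots> = expect_subset p D (\<lambda>S. if P S then 1 else 0)"
    unfolding expect_subset_def using assms(1)
    by (intro sum.mono_neutral_cong_left) auto
  finally show ?B unfolding eq .
qed

text \<open>The oriented edges of the positive orthant that start below level \<open>K\<close>, where the level of a
vertex is the sum of its coordinates.\<close>

definition ostep_box :: "nat \<Rightarrow> ((int ^ 'n::finite) \<times> (int ^ 'n)) set" where
  "ostep_box K = {(x, x + axis i 1) | x i. (\<forall>j. 0 \<le> x $ j) \<and> (\<Sum>j\<in>UNIV. x $ j) < int K}"

definition box_cluster :: "nat \<Rightarrow> ((int ^ 'n::finite) set \<Rightarrow> bool) \<Rightarrow> (int ^ 'n) set" where
  "box_cluster K \<omega> = {e \<in> ostep_box K. \<omega> {fst e, snd e}}\<^sup>* `` {0}"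

lemma finite_int_box: "finite {x :: int ^ 'n::finite. \<forall>j. x $ j \<in> A j}" if "\<And>j. finite (A j)"
proof -
  have "(\<lambda>x :: int ^ 'n. ($) x) ` {x. \<forall>j. x $ j \<in> A j} \<subseteq> PiE UNIV A" by auto
  moreover have "finite (PiE UNIV A)" using that by (intro finite_PiE) auto
  moreover have "inj (\<lambda>x :: int ^ 'n. ($) x)" by (auto intro!: injI simp: vec_eq_iff fun_eq_iff)
  ultimately show ?thesis by (meson finite_imageD finite_subset inj_on_subset subset_UNIV)
qed

lemma sum_axis: "(\<Sum>j\<in>UNIV. axis i (c::int) $ j) = c"
  by (simp add: axis_def)

lemma finite_ostep_box: "finite (ostep_box K :: ((int ^ 'n::finite) \<times> (int ^ 'n)) set)"
proof -
  let ?B = "{x :: int ^ 'n. \<forall>j. x $ j \<in> {0..int K}}"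
  have "ostep_box K \<subseteq> (\<lambda>(x, i). (x, x + axis i 1)) ` (?B \<times> UNIV)"
  proof
    fix e :: "(int ^ 'n) \<times> (int ^ 'n)" assume "e \<in> ostep_box K"
    then obtain x i where e: "e = (x, x + axis i 1)" "\<forall>j. 0 \<le> x $ j" "(\<Sum>j\<in>UNIV. x $ j) < int K"
      by (auto simp: ostep_box_def)
    have "x $ j \<le> (\<Sum>j\<in>UNIV. x $ j)" for j
      using e by (intro member_le_sum) auto
    then have "x $ j \<le> int K" for j using e(3) by (meson le_less_trans less_imp_le)
    then have "x \<in> ?B" using e by auto
    then show "e \<in> (\<lambda>(x, i). (x, x + axis i 1)) ` (?B \<times> UNIV)" using e by auto
  qed
  moreover have "finite ?B" by (rule finite_int_box) auto
  ultimately show ?thesis by (elim finite_subset) (intro finite_imageI finite_cartesian_product, auto)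
qed

lemma ostep_box_mono: "K \<le> L \<Longrightarrow> ostep_box K \<subseteq> ostep_box L"
  by (auto simp: ostep_box_def)

text \<open>Oriented paths increase all coordinates and the level, so that a path from \<open>x\<close> to \<open>y\<close> uses only
edges that start above \<open>x\<close> and below the level of \<open>y\<close>.\<close>

lemma ostep_reach:
  assumes "(x, y) \<in> S\<^sup>*" "S \<subseteq> ostep_box K"
  shows "(x, y) \<in> (S \<inter> {(z, w). (\<forall>j. x $ j \<le> z $ j) \<and> (\<Sum>j\<in>UNIV. z $ j) < (\<Sum>j\<in>UNIV. y $ j)})\<^sup>*
    \<and> (\<forall>j. x $ j \<le> y $ j)"
  using assms(1)
proof (induction rule: rtrancl_induct)
  case (step y z)
  from step(2) assms(2) obtain i where z: "z = y + axis i 1"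
    by (auto simp: ostep_box_def)
  have le: "y $ j \<le> z $ j" for j by (auto simp: z axis_def)
  have s: "(\<Sum>j\<in>UNIV. z $ j) = (\<Sum>j\<in>UNIV. y $ j) + 1"
    by (simp add: z sum.distrib sum_axis)
  let ?R = "\<lambda>y. S \<inter> {(z, w). (\<forall>j. x $ j \<le> z $ j) \<and> (\<Sum>j\<in>UNIV. z $ j) < (\<Sum>j\<in>UNIV. y $ j)}"
  have "?R y \<subseteq> ?R z" using s by auto
  from rtrancl_mono[OF this] step.IH have "(x, y) \<in> (?R z)\<^sup>*" by blast
  moreover have "(y, z) \<in> ?R z" using step.IH step(2) s by auto
  ultimately have "(x, z) \<in> (?R z)\<^sup>*" by (rule rtrancl_into_rtrancl)
  moreover have "\<forall>j. x $ j \<le> z $ j" using step.IH le order_trans by blast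
  ultimately show ?case ..
qed auto

text \<open>Started from another vertex the cluster is smaller, since a translate of the orthant sees fewer
edges of the box. This supplies the uniform bound that \<open>cluster_exponential_moment\<close> asks for.\<close>

lemma ostep_translate:
  fixes y :: "int ^ 'n::finite"
  assumes "0 \<le> p" "p \<le> 1" "0 < g" "g \<le> 1"
  shows "expect_subset p (ostep_box K) (\<lambda>S. g ^ card (S\<^sup>* `` {0 :: int ^ 'n})) \<le>
         expect_subset p (ostep_box K) (\<lambda>S. g ^ card (S\<^sup>* `` {y}))"
proof -
  let ?D = "ostep_box K :: ((int ^ 'n) \<times> (int ^ 'n)) set"
  define h where "h = (\<lambda>e :: (int ^ 'n) \<times> (int ^ 'n). (y + fst e, y + snd e))"
  have inj: "inj_on h A" for A by (auto simp: h_def inj_on_def prod_eq_iff)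
  have mem: "(u, v) \<in> ?D \<Longrightarrow> \<forall>j. y $ j \<le> u $ j \<Longrightarrow> 0 \<le> (\<Sum>j\<in>UNIV. y $ j) \<Longrightarrow> (u, v) \<in> h ` ?D" for u v
  proof -
    assume *: "(u, v) \<in> ?D" "\<forall>j. y $ j \<le> u $ j" "0 \<le> (\<Sum>j\<in>UNIV. y $ j)"
    then obtain i where v: "v = u + axis i 1" and u: "(\<Sum>j\<in>UNIV. u $ j) < int K"
      by (auto simp: ostep_box_def)
    have "(\<Sum>j\<in>UNIV. (u - y) $ j) < int K" using u * by (simp add: sum_subtractf)
    moreover have "v - y = (u - y) + axis i 1" by (simp add: v)
    ultimately have "(u - y, v - y) \<in> ?D" unfolding ostep_box_def using * by force
    moreover have "(u, v) = h (u - y, v - y)" by (simp add: h_def)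
    ultimately show ?thesis by blast
  qed
  have red: "S\<^sup>* `` {y} = (S \<inter> h ` ?D)\<^sup>* `` {y}" if S: "S \<subseteq> ?D" for S
  proof (intro equalityI subsetI)
    fix z assume "z \<in> S\<^sup>* `` {y}"
    then have yz: "(y, z) \<in> S\<^sup>*" by simp
    show "z \<in> (S \<inter> h ` ?D)\<^sup>* `` {y}"
    proof (cases "z = y")
      case False
      with yz obtain w where "(y, w) \<in> S" by (metis converse_rtranclE)
      then have "\<forall>j. 0 \<le> y $ j" using S by (auto simp: ostep_box_def)
      then have y0: "0 \<le> (\<Sum>j\<in>UNIV. y $ j)" by (simp add: sum_nonneg)
      have "S \<inter> {(u, w). (\<forall>j. y $ j \<le> u $ j) \<and> (\<Sum>j\<in>UNIV. u $ j) < (\<Sum>j\<in>UNIV. z $ j)} \<subseteq> S \<inter> h ` ?D"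
        using S mem y0 by blast
      from rtrancl_mono[OF this] ostep_reach[OF yz S] have "(y, z) \<in> (S \<inter> h ` ?D)\<^sup>*" by blast
      then show ?thesis by simp
    qed simp
  qed (use rtrancl_mono[of "S \<inter> h ` ?D" S] in auto)
  have img: "((h ` S)\<^sup>* `` {y}) = (\<lambda>x. y + x) ` (S\<^sup>* `` {0})" for S
  proof -
    have 1: "(0, x) \<in> S\<^sup>* \<Longrightarrow> (y, y + x) \<in> (h ` S)\<^sup>*" for x
    proof (induction rule: rtrancl_induct)
      case (step a b)
      have "(y + a, y + b) \<in> h ` S" using step(2) by (force simp: h_def)
      with step.IH show ?case by (rule rtrancl_into_rtrancl)
    qed simp
    have 2: "(y, z) \<in> (h ` S)\<^sup>* \<Longrightarrow> (0, z - y) \<in> S\<^sup>*" for z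
    proof (induction rule: rtrancl_induct)
      case (step a b)
      have "(a - y, b - y) \<in> S" using step(2) by (auto simp: h_def)
      with step.IH show ?case by (rule rtrancl_into_rtrancl)
    qed simp
    show ?thesis
    proof (intro equalityI subsetI)
      fix z assume "z \<in> (h ` S)\<^sup>* `` {y}"
      then have "z - y \<in> S\<^sup>* `` {0}" using 2 by auto
      then show "z \<in> (\<lambda>x. y + x) ` (S\<^sup>* `` {0})" by (intro image_eqI[of _ _ "z - y"]) auto
    qed (use 1 in auto)
  qed
  have "expect_subset p ?D (\<lambda>S. g ^ card (S\<^sup>* `` {0 :: int ^ 'n}))
      = expect_subset p ?D (\<lambda>S. g ^ card ((h ` S)\<^sup>* `` {y}))"
    unfolding img by (simp add: card_image)
  also have "\<dots> = expect_subset p (h ` ?D) (\<lambda>S. g ^ card (S\<^sup>* `` {y}))"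
    using expect_subset_image[OF inj, of p ?D "\<lambda>S. g ^ card (S\<^sup>* `` {y})"] by simp
  also have "\<dots> = expect_subset p (h ` ?D) (\<lambda>S. g ^ card ((S \<inter> h ` ?D)\<^sup>* `` {y}))"
    by (intro expect_subset_cong) (simp add: Int_absorb2)
  also have "\<dots> \<le> expect_subset p (?D \<inter> h ` ?D) (\<lambda>S. g ^ card ((S \<inter> h ` ?D)\<^sup>* `` {y}))"
  proof (intro expect_subset_antimono_set)
    fix S S' :: "((int ^ 'n) \<times> (int ^ 'n)) set" assume "S \<subseteq> S'"
    then show "g ^ card ((S' \<inter> h ` ?D)\<^sup>* `` {y}) \<le> g ^ card ((S \<inter> h ` ?D)\<^sup>* `` {y})"
      using assms finite_ostep_box[of K] rtrancl_mono[of "S \<inter> h ` ?D" "S' \<inter> h ` ?D"]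
      by (intro power_decreasing card_mono finite_rtrancl_Image) auto
  qed (use assms in \<open>auto simp: finite_ostep_box\<close>)
  also have "\<dots> = expect_subset p ?D (\<lambda>S. g ^ card ((S \<inter> h ` ?D)\<^sup>* `` {y}))"
    by (rule expect_subset_restrict[symmetric]) (auto simp: finite_ostep_box)
  also have "\<dots> = expect_subset p ?D (\<lambda>S. g ^ card (S\<^sup>* `` {y}))"
    by (intro expect_subset_cong) (use red in simp)
  finally show ?thesis .
qed

lemma inj_on_edge_ostep_box: "inj_on (\<lambda>e. {fst e, snd e}) (ostep_box K)"
proof (rule inj_onI)
  fix e e' :: "(int ^ 'n) \<times> (int ^ 'n)" assume "e \<in> ostep_box K" "e' \<in> ostep_box K" "{fst e, snd e} = {fst e', snd e'}"
  then obtain x i x' i' where e: "e = (x, x + axis i 1)" "e' = (x', x' + axis i' 1)"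
     "{x, x + axis i 1} = {x', x' + axis i' 1}" by (auto simp: ostep_box_def)
  have "\<not> (x = x' + axis i' 1 \<and> x' = x + axis i 1)"
  proof
    assume "x = x' + axis i' 1 \<and> x' = x + axis i 1"
    then have "(\<Sum>j\<in>UNIV. x $ j) = (\<Sum>j\<in>UNIV. (x' + axis i' 1) $ j)" "(\<Sum>j\<in>UNIV. x' $ j) = (\<Sum>j\<in>UNIV. (x + axis i 1) $ j)" by metis+
    then show False by (simp add: sum.distrib sum_axis)
  qed
  then show "e = e'" using e by (auto simp: doubleton_eq_iff)
qed

lemma axis_edge: "{x, x + axis i 1} \<in> edges" "{x + axis i 1, x} \<in> edges"
proof -
  have "(\<Sum>j\<in>UNIV. \<bar>(x + axis i 1) $ j - x $ j\<bar>) = (\<Sum>j\<in>UNIV. axis i (1::int) $ j)"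
    by (intro sum.cong) (auto simp: axis_def)
  then have "(\<Sum>j\<in>UNIV. \<bar>(x + axis i 1) $ j - x $ j\<bar>) = 1" by (simp add: sum_axis)
  then show "{x + axis i 1, x} \<in> edges" unfolding edges_def by blast
  then show "{x, x + axis i 1} \<in> edges" by (simp add: insert_commute)
qed

lemma ostep_box_edge:
  assumes "e \<in> ostep_box K"
  shows "{fst e, snd e} \<in> edges"
proof -
  obtain x i where "e = (x, x + axis i 1)" using assms by (auto simp: ostep_box_def)
  then show ?thesis using axis_edge(1)[of x i] by simp
qed

lemma prob_box:
  fixes P :: "((int ^ 'n::finite) \<times> (int ^ 'n)) set \<Rightarrow> bool"
  assumes "0 \<le> p" "p \<le> 1"
  shows "{\<omega> \<in> space (percolation p). P {e \<in> ostep_box K. \<omega> {fst e, snd e}}} \<in> sets (percolation p)"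
    "measure (percolation p) {\<omega> \<in> space (percolation p). P {e \<in> ostep_box K. \<omega> {fst e, snd e}}} =
       expect_subset p (ostep_box K) (\<lambda>S. if P S then 1 else 0)"
proof -
  let ?D = "ostep_box K :: ((int ^ 'n) \<times> (int ^ 'n)) set"
  let ?N = "\<lambda>_ :: (int ^ 'n) set. measure_pmf (bernoulli_pmf p)"
  interpret P: product_prob_space ?N edges
    by unfold_locales
  interpret N: prob_space "percolation p :: ((int ^ 'n) set \<Rightarrow> bool) measure"
    unfolding percolation_def by unfold_locales
  let ?h = "\<lambda>e :: (int ^ 'n) \<times> (int ^ 'n). {fst e, snd e}"
  let ?E = "\<lambda>S. {\<omega> \<in> space (percolation p). \<forall>e\<in>?D. \<omega> (?h e) \<longleftrightarrow> e \<in> S}"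
  have sub: "?h ` ?D \<subseteq> edges" using ostep_box_edge by blast
  have E: "?E S = prod_emb edges ?N (?h ` ?D) (PiE (?h ` ?D) (\<lambda>e. {e \<in> ?h ` S}))" if "S \<subseteq> ?D" for S
  proof -
    have iff: "?h e \<in> ?h ` S \<longleftrightarrow> e \<in> S" if "e \<in> ?D" for e
      by (rule inj_on_image_mem_iff[OF inj_on_edge_ostep_box that \<open>S \<subseteq> ?D\<close>])
    have "(\<forall>e\<in>?h ` ?D. x e \<in> {e \<in> ?h ` S}) \<longleftrightarrow> (\<forall>e\<in>?D. x (?h e) \<longleftrightarrow> e \<in> S)" for x
      unfolding ball_simps using iff by simp
    then show ?thesis
      unfolding percolation_def space_PiM prod_emb_def by (intro set_eqI) (simp add: PiE_iff conj_commute)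
  qed
  have fin: "finite (?h ` ?D)" by (simp add: finite_ostep_box)
  have 1: "?E S \<in> N.events" if "S \<subseteq> ?D" for S
    unfolding E[OF that] unfolding percolation_def using sub fin
    by (intro sets_PiM_I) auto
  have 2: "N.prob (?E S) = p ^ card S * (1 - p) ^ card (?D - S)" if S: "S \<subseteq> ?D" for S
  proof -
    have iff: "?h e \<in> ?h ` S \<longleftrightarrow> e \<in> S" if "e \<in> ?D" for e
      by (rule inj_on_image_mem_iff[OF inj_on_edge_ostep_box that \<open>S \<subseteq> ?D\<close>])
    have "N.prob (?E S) = (\<Prod>e\<in>?h ` ?D. measure (?N e) {e \<in> ?h ` S})"
      unfolding E[OF that] unfolding percolation_def using sub fin
      by (intro P.measure_PiM_emb) auto
    also have "\<dots> = (\<Prod>e\<in>?D. measure (?N (?h e)) {?h e \<in> ?h ` S})"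
      by (rule prod.reindex[OF inj_on_edge_ostep_box, unfolded comp_def])
    also have "\<dots> = (\<Prod>e\<in>?D. if e \<in> S then p else 1 - p)"
      using assms by (intro prod.cong refl) (auto simp: measure_pmf_single iff)
    also have "\<dots> = p ^ card S * (1 - p) ^ card (?D - S)"
      using S finite_ostep_box[of K]
      by (subst prod.If_cases) (auto simp: Int_absorb1 Diff_eq[symmetric])
    finally show ?thesis .
  qed
  from N.prob_open_set[OF finite_ostep_box 1 2, where P = P]
  show "{\<omega> \<in> space (percolation p). P {e \<in> ?D. \<omega> (?h e)}} \<in> sets (percolation p)"
    "N.prob {\<omega> \<in> space (percolation p). P {e \<in> ?D. \<omega> (?h e)}} = expect_subset p ?D (\<lambda>S. if P S then 1 else 0)"
    by blast+
qed

text \<open>Whether a vertex of level \<open>k\<close> is reached depends only on the edges that start below level \<open>k\<close>.\<close>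

lemma expect_subset_level_sum:
  assumes "k \<le> K" "0 \<le> q" "q \<le> 1"
  shows "expect_subset q (ostep_box K) (\<lambda>S. real (card {y \<in> S\<^sup>* `` {0 :: int ^ 'n::finite}. (\<Sum>j\<in>UNIV. y $ j) = int k}))
       = expect_subset q (ostep_box k) (\<lambda>S. real (card {y \<in> S\<^sup>* `` {0 :: int ^ 'n}. (\<Sum>j\<in>UNIV. y $ j) = int k}))"
proof -
  let ?Dk = "ostep_box k :: ((int ^ 'n) \<times> (int ^ 'n)) set"
  have "{y \<in> S\<^sup>* `` {0 :: int ^ 'n}. (\<Sum>j\<in>UNIV. y $ j) = int k} =
      {y \<in> (S \<inter> ?Dk)\<^sup>* `` {0 :: int ^ 'n}. (\<Sum>j\<in>UNIV. y $ j) = int k}" if S: "S \<subseteq> ostep_box K" for S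
  proof -
    have "(0, y) \<in> (S \<inter> ?Dk)\<^sup>*" if y: "(0, y) \<in> S\<^sup>*" "(\<Sum>j\<in>UNIV. y $ j) = int k" for y
    proof -
      have "S \<inter> {(u, w). (\<forall>j. (0 :: int ^ 'n) $ j \<le> u $ j) \<and> (\<Sum>j\<in>UNIV. u $ j) < (\<Sum>j\<in>UNIV. y $ j)} \<subseteq> S \<inter> ?Dk"
      proof
        fix e assume e: "e \<in> S \<inter> {(u, w). (\<forall>j. (0 :: int ^ 'n) $ j \<le> u $ j) \<and> (\<Sum>j\<in>UNIV. u $ j) < (\<Sum>j\<in>UNIV. y $ j)}"
        then obtain u i where u: "e = (u, u + axis i 1)" "\<forall>j. 0 \<le> u $ j" using S by (auto simp: ostep_box_def)
        moreover have "(\<Sum>j\<in>UNIV. u $ j) < int k" using e u(1) y(2) by simp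
        ultimately show "e \<in> S \<inter> ?Dk" using e unfolding ostep_box_def by blast
      qed
      from rtrancl_mono[OF this] ostep_reach[OF y(1) S] show ?thesis by blast
    qed
    moreover have "(S \<inter> ?Dk)\<^sup>* \<subseteq> S\<^sup>*" by (rule rtrancl_mono) auto
    ultimately show ?thesis by auto
  qed
  then have "expect_subset q (ostep_box K) (\<lambda>S. real (card {y \<in> S\<^sup>* `` {0 :: int ^ 'n}. (\<Sum>j\<in>UNIV. y $ j) = int k}))
       = expect_subset q (ostep_box K \<inter> ?Dk) (\<lambda>S. real (card {y \<in> S\<^sup>* `` {0 :: int ^ 'n}. (\<Sum>j\<in>UNIV. y $ j) = int k}))"
    by (intro expect_subset_restrict[OF finite_ostep_box] arg_cong[of _ _ "\<lambda>A. real (card A)"])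
  also have "ostep_box K \<inter> ?Dk = ?Dk" using ostep_box_mono[OF assms(1)] by blast
  finally show ?thesis .
qed

lemma oriented_cluster_box:
  fixes \<omega> :: "(int ^ 'n::finite) set \<Rightarrow> bool"
  shows "oriented_open_cluster \<omega> = (\<Union>K. box_cluster K \<omega>)"
proof (intro equalityI subsetI)
  fix v :: "int ^ 'n" assume "v \<in> oriented_open_cluster \<omega>"
  then obtain xs where xs: "oriented_path_between 0 v xs" "\<forall>e\<in>path_edges xs. \<omega> e"
    by (auto simp: oriented_open_cluster_def)
  have "xs \<noteq> [] \<Longrightarrow> hd xs = 0 \<Longrightarrow> successively (\<lambda>x y. \<exists>i. y = x + axis i 1) xs \<Longrightarrow> \<forall>e\<in>path_edges xs. \<omega> e \<Longrightarrow>
     last xs \<in> box_cluster (length xs) \<omega> \<and> (\<forall>j. 0 \<le> last xs $ j) \<and> (\<Sum>j\<in>UNIV. last xs $ j) < int (length xs)" for xs :: "(int ^ 'n) list"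
  proof (induction xs rule: rev_induct)
    case (snoc z ys)
    show ?case
    proof (cases "ys = []")
      case True
      then show ?thesis using snoc.prems by (simp add: box_cluster_def)
    next
      case False
      define u where "u = last ys"
      have ys: "hd ys = 0" "successively (\<lambda>x y. \<exists>i. y = x + axis i 1) ys" "\<exists>i. z = u + axis i 1"
        using snoc.prems False by (auto simp: successively_append_iff u_def)
      then obtain i where z: "z = u + axis i 1" by auto
      have pe: "path_edges ys \<subseteq> path_edges (ys @ [z])" "{u, z} \<in> path_edges (ys @ [z])"
        using False by (auto simp: path_edges_snoc u_def)
      then have open_edge: "\<omega> {u, z}" using snoc.prems by blast
      have IH: "u \<in> box_cluster (length ys) \<omega>" "\<forall>j. 0 \<le> u $ j" "(\<Sum>j\<in>UNIV. u $ j) < int (length ys)"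
      proof -
        have "\<forall>e\<in>path_edges ys. \<omega> e" using pe snoc.prems by blast
        from snoc.IH[OF False ys(1,2) this] show "u \<in> box_cluster (length ys) \<omega>" "\<forall>j. 0 \<le> u $ j"
          "(\<Sum>j\<in>UNIV. u $ j) < int (length ys)" by (simp_all add: u_def)
      qed
      have "box_cluster (length ys) \<omega> \<subseteq> box_cluster (length (ys @ [z])) \<omega>"
        unfolding box_cluster_def by (intro Image_mono rtrancl_mono) (use ostep_box_mono[of "length ys" "length (ys @ [z])"] in auto)
      then have "u \<in> box_cluster (length (ys @ [z])) \<omega>" using IH by blast
      moreover have "(u, z) \<in> {e \<in> ostep_box (length (ys @ [z])). \<omega> {fst e, snd e}}"
        using IH z open_edge unfolding ostep_box_def by auto
      ultimately have "z \<in> box_cluster (length (ys @ [z])) \<omega>"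
        unfolding box_cluster_def Image_singleton_iff by (rule rtrancl_into_rtrancl)
      moreover have "\<forall>j. 0 \<le> z $ j" using IH(2) by (auto simp: z axis_def)
      moreover have "(\<Sum>j\<in>UNIV. z $ j) = (\<Sum>j\<in>UNIV. u $ j) + 1" by (simp add: z sum.distrib sum_axis)
      ultimately show ?thesis using IH(3) by simp
    qed
  qed simp
  from this[of xs] xs show "v \<in> (\<Union>K. box_cluster K \<omega>)"
    by (auto simp: oriented_path_between_def)
next
  fix v :: "int ^ 'n" assume "v \<in> (\<Union>K. box_cluster K \<omega>)"
  then obtain K where "(0, v) \<in> {e \<in> ostep_box K. \<omega> {fst e, snd e}}\<^sup>*" by (auto simp: box_cluster_def)
  then have "\<exists>xs. oriented_path_between 0 v xs \<and> (\<forall>e\<in>path_edges xs. \<omega> e)"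
  proof (induction rule: rtrancl_induct)
    case base
    show ?case by (rule exI[of _ "[0]"]) (auto simp: oriented_path_between_def path_edges_def)
  next
    case (step y z)
    then obtain xs where xs: "oriented_path_between 0 y xs" "\<forall>e\<in>path_edges xs. \<omega> e" by auto
    have z: "\<exists>i. z = y + axis i 1" "\<omega> {y, z}" using step(2) by (auto simp: ostep_box_def)
    have "oriented_path_between 0 z (xs @ [z])"
      using xs(1) z(1) by (auto simp: oriented_path_between_def successively_append_iff)
    moreover have "\<forall>e\<in>path_edges (xs @ [z]). \<omega> e"
      using xs z by (auto simp: path_edges_snoc oriented_path_between_def)
    ultimately show ?case by blast
  qed
  then show "v \<in> oriented_open_cluster \<omega>" by (auto simp: oriented_open_cluster_def)
qed

lemma finite_box_cluster: "finite (box_cluster K \<omega>)"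
  unfolding box_cluster_def by (intro finite_rtrancl_Image finite_subset[OF _ finite_ostep_box[of K]]) auto

lemma box_cluster_mono: "K \<le> L \<Longrightarrow> box_cluster K \<omega> \<subseteq> box_cluster L \<omega>"
  unfolding box_cluster_def by (intro Image_mono rtrancl_mono) (use ostep_box_mono[of K L] in auto)

lemma finite_oriented_cluster_iff:
  "finite (oriented_open_cluster \<omega>) \<longleftrightarrow> (\<exists>R. \<forall>K. card (box_cluster K \<omega>) \<le> R)"
proof
  assume "finite (oriented_open_cluster \<omega>)"
  then have "card (box_cluster K \<omega>) \<le> card (oriented_open_cluster \<omega>)" for K
    by (rule card_mono) (auto simp: oriented_cluster_box)
  then show "\<exists>R. \<forall>K. card (box_cluster K \<omega>) \<le> R" by blast
next
  assume "\<exists>R. \<forall>K. card (box_cluster K \<omega>) \<le> R"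
  then obtain R where R: "\<And>K. card (box_cluster K \<omega>) \<le> R" by auto
  show "finite (oriented_open_cluster \<omega>)"
  proof (rule ccontr)
    assume "infinite (oriented_open_cluster \<omega>)"
    then obtain B where B: "B \<subseteq> oriented_open_cluster \<omega>" "finite B" "card B = Suc R"
      using infinite_arbitrarily_large by blast
    have "B \<subseteq> \<Union> (range (\<lambda>K. box_cluster K \<omega>))" using B by (simp add: oriented_cluster_box)
    moreover have "subset.chain UNIV (range (\<lambda>K. box_cluster K \<omega>))"
    proof -
      have "box_cluster K \<omega> \<subset> box_cluster L \<omega> \<or> box_cluster K \<omega> = box_cluster L \<omega> \<or> box_cluster L \<omega> \<subset> box_cluster K \<omega>" for K L
        using box_cluster_mono[of K L \<omega>] box_cluster_mono[of L K \<omega>] linorder_linear[of K L] by blast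
      then show ?thesis unfolding subset.chain_def by blast
    qed
    ultimately obtain K where "B \<subseteq> box_cluster K \<omega>"
      using finite_subset_Union_chain[OF B(2), of "range (\<lambda>K. box_cluster K \<omega>)" UNIV]
      by (metis (no_types, lifting) empty_iff imageE rangeI)
    then have "card B \<le> card (box_cluster K \<omega>)" by (intro card_mono finite_box_cluster)
    then show False using R[of K] B by simp
  qed
qed

lemma measure_eq_0_if_AE:
  assumes "AE x in N. \<not> P x" shows "measure N {x \<in> space N. P x} = 0"
proof (cases "{x \<in> space N. P x} \<in> sets N")
  case True
  then have "emeasure N {x \<in> space N. P x} = 0"
    using assms AE_iff_measurable[OF True] by auto
  then show ?thesis by (simp add: measure_def)
qed (simp add: measure_notin_sets)

lemma countable_edges: "countable (edges :: (int ^ 'n::finite) set set)"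
proof -
  have inj: "inj (\<lambda>x :: int ^ 'n. ($) x)" by (auto intro!: injI simp: vec_eq_iff fun_eq_iff)
  have "countable ((\<lambda>x :: int ^ 'n. ($) x) ` UNIV)"
    by (rule countable_subset[of _ "PiE UNIV (\<lambda>_. UNIV)"]) (auto intro: countable_PiE)
  then have "countable (UNIV :: (int ^ 'n) set)"
    using inj by (metis countable_image_inj_on)
  moreover have "edges \<subseteq> (\<lambda>(v, w). {v, w}) ` (UNIV :: ((int ^ 'n) \<times> (int ^ 'n)) set)"
    by (auto simp: edges_def)
  ultimately show ?thesis
    by (metis UNIV_Times_UNIV countable_SIGMA countable_image countable_subset)
qed

lemma AE_closed: "AE \<omega> in percolation 0. \<forall>e\<in>edges. \<not> \<omega> e"
proof (rule AE_ball_countable[THEN iffD2, OF countable_edges], rule ballI)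
  fix e :: "(int ^ 'n) set" assume e: "e \<in> edges"
  show "AE \<omega> in percolation 0. \<not> \<omega> e" unfolding percolation_def
    by (rule AE_PiM_component[OF _ e]) (auto simp: AE_measure_pmf_iff prob_space_measure_pmf set_pmf_iff)
qed

lemma percolation_prob_0:
  assumes "\<And>\<omega>. \<forall>e\<in>edges. \<not> \<omega> e \<Longrightarrow> cluster \<omega> \<subseteq> {0 :: int ^ 'n::finite}"
  shows "percolation_prob cluster 0 = 0"
  unfolding percolation_prob_def
proof (rule measure_eq_0_if_AE)
  show "AE \<omega> in percolation 0. \<not> infinite (cluster \<omega>)"
    using AE_closed
  proof eventually_elim
    case (elim \<omega>)
    from assms[OF this] show ?case by (simp add: finite_subset)
  qed
qed

lemma edge_of_ostep: "\<exists>i. y = x + axis i 1 \<Longrightarrow> {x, y} \<in> edges"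
  using axis_edge(1) by blast

lemma path_edges_trivial:
  assumes "successively R xs" "xs \<noteq> []" "\<And>x y. R x y \<Longrightarrow> {x, y} \<in> edges" "\<forall>e\<in>edges. \<not> \<omega> e" "\<forall>e\<in>path_edges xs. \<omega> e"
  shows "hd xs = last xs"
  using assms(1,2,5) by (induction xs rule: induct_list012) (use assms(3,4) in auto)

lemma p_crit_le_1: "p_crit TYPE('n::finite) \<le> 1"
  and oriented_zero: "percolation_prob (oriented_open_cluster :: ((int ^ 'n) set \<Rightarrow> bool) \<Rightarrow> _) 0 = 0"
proof -
  show "percolation_prob (oriented_open_cluster :: ((int ^ 'n) set \<Rightarrow> bool) \<Rightarrow> _) 0 = 0"
  proof (rule percolation_prob_0)
    fix \<omega> :: "(int ^ 'n) set \<Rightarrow> bool" assume "\<forall>e\<in>edges. \<not> \<omega> e"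
    then show "oriented_open_cluster \<omega> \<subseteq> {0}"
      using path_edges_trivial[of "\<lambda>x y. \<exists>i. y = x + axis i 1" _ \<omega>, OF _ _ edge_of_ostep]
      by (auto simp: oriented_open_cluster_def oriented_path_between_def)
  qed
  have 2: "percolation_prob (open_cluster :: ((int ^ 'n) set \<Rightarrow> bool) \<Rightarrow> _) 0 = 0"
  proof (rule percolation_prob_0)
    fix \<omega> :: "(int ^ 'n) set \<Rightarrow> bool" assume "\<forall>e\<in>edges. \<not> \<omega> e"
    then show "open_cluster \<omega> \<subseteq> {0}"
      using path_edges_trivial[of "\<lambda>x y. {x, y} \<in> edges" _ \<omega>]
      by (auto simp: open_cluster_def path_between_def)
  qed
  show "p_crit TYPE('n::finite) \<le> 1" unfolding p_crit_def
    by (rule cSup_least) (use 2 in \<open>auto intro!: exI[of _ 0]\<close>)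
qed

lemma sum_card_levels_le:
  assumes "finite A"
  shows "(\<Sum>k=1..K. real (card {y \<in> A. f y = int k})) \<le> real (card A)"
proof -
  have "(\<Sum>k=1..K. card {y \<in> A. f y = int k}) = card (\<Union>k\<in>{1..K}. {y \<in> A. f y = int k})"
    using assms by (intro card_UN_disjoint[symmetric]) auto
  also have "\<dots> \<le> card A" using assms by (intro card_mono) auto
  finally show ?thesis by (metis of_nat_mono of_nat_sum)
qed

text \<open>Choose \<open>p\<close> strictly between \<open>q\<close> and the critical probability. At \<open>p\<close> the
cluster is finite almost surely, so its size is at most some \<open>R\<close> with probability close to one, and
for \<open>g\<close> close to one the expectation of \<open>g ^ card\<close> is close to one as well. The product inequality
then bounds an exponential moment of the cluster at \<open>q\<close>, and a fortiori its expected size. The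
expected sizes of its levels are therefore summable, and some level has a small one.\<close>

lemma oriented_subcritical_level:
  assumes q: "0 \<le> q" "q < p_crit_oriented TYPE('n::finite)"
  shows "\<exists>k\<ge>1. expect_subset q (ostep_box k) (\<lambda>S. real (card {y \<in> S\<^sup>* `` {0 :: int ^ 'n}. (\<Sum>j\<in>UNIV. y $ j) = int k})) \<le> 1 / 2"
proof -
  obtain p where p: "0 \<le> p" "p \<le> 1" "q < p"
    and theta: "percolation_prob (oriented_open_cluster :: ((int ^ 'n) set \<Rightarrow> bool) \<Rightarrow> _) p = 0"
    using q(2) oriented_zero[where 'n='n] unfolding p_crit_oriented_def
    by (subst (asm) less_cSup_iff) (auto intro!: exI[of _ 0] bdd_aboveI[of _ 1])
  \<comment> \<open>\<open>s\<^sup>2\<close> will bound the expectation of \<open>g ^ card\<close> from below, so \<open>q \<le> p * s\<^sup>2\<close> is required;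
    the maximum keeps \<open>s\<close> positive when \<open>q = 0\<close>\<close>
  define s where "s = max (1/2) (sqrt (q / p))"
  have "sqrt (q / p) < 1" using p q by (simp add: divide_less_eq)
  then have s: "0 < s" "s < 1" by (auto simp: s_def)
  have "q / p \<le> s ^ 2"
  proof -
    have "q / p = (sqrt (q / p))^2" using p q by simp
    also have "\<dots> \<le> s ^ 2" using p q by (intro power_mono) (auto simp: s_def)
    finally show ?thesis .
  qed
  then have qs: "q \<le> p * s ^ 2" using p q by (simp add: field_simps)
  let ?P = "percolation p :: ((int ^ 'n) set \<Rightarrow> bool) measure"
  interpret P: product_prob_space "\<lambda>_ :: (int ^ 'n) set. measure_pmf (bernoulli_pmf p)" edges
    by unfold_locales
  interpret N: prob_space ?P
    unfolding percolation_def by unfold_locales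
  define H where "H = (\<lambda>R. {\<omega> \<in> space ?P. \<forall>K. card (box_cluster K \<omega>) \<le> R})"
  have cm: "{\<omega> \<in> space ?P. card (box_cluster K \<omega>) \<le> R} \<in> N.events" for K R
    unfolding box_cluster_def using prob_box(1)[OF p(1,2), of "\<lambda>S. card (S\<^sup>* `` {0}) \<le> R" K] .
  have "H R = (\<Inter>K. {\<omega> \<in> space ?P. card (box_cluster K \<omega>) \<le> R})" for R by (auto simp: H_def)
  then have Hm: "H R \<in> N.events" for R using cm by (auto intro!: sets.countable_INT')
  have "(\<lambda>R. N.prob (H R)) \<longlonglongrightarrow> N.prob (\<Union>R. H R)"
    using Hm by (intro N.finite_Lim_measure_incseq) (auto simp: incseq_def H_def intro: order_trans)
  moreover have "N.prob (\<Union>R. H R) = 1"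
  proof -
    have "(\<Union>R. H R) = space ?P - {\<omega> \<in> space ?P. infinite (oriented_open_cluster \<omega>)}"
      by (auto simp: H_def finite_oriented_cluster_iff)
    moreover have "{\<omega> \<in> space ?P. infinite (oriented_open_cluster \<omega>)} = space ?P - (\<Union>R. H R)"
      by (auto simp: H_def finite_oriented_cluster_iff)
    then have "{\<omega> \<in> space ?P. infinite (oriented_open_cluster \<omega>)} \<in> N.events" using Hm by auto
    ultimately show ?thesis using theta by (simp add: N.prob_compl percolation_prob_def)
  qed
  ultimately have "\<forall>\<^sub>F R in sequentially. s < N.prob (H R)" using s(2) by (intro order_tendstoD(1)) auto
  then obtain R where R: "s < N.prob (H R)" by (auto simp: eventually_sequentially)
  define g where "g = root (Suc R) s"
  have g: "0 < g" "g < 1" "g ^ Suc R = s" using s real_root_pow_pos[of "Suc R" s] by (auto simp: g_def real_root_lt_1_iff simp del: power_Suc)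
  let ?D = "\<lambda>K. ostep_box K :: ((int ^ 'n) \<times> (int ^ 'n)) set"
  have rho0: "s ^ 2 \<le> expect_subset p (?D K) (\<lambda>S. g ^ card (S\<^sup>* `` {0}))" for K
  proof -
    have "s ^ 2 = g ^ Suc R * s" using g by (simp add: power2_eq_square)
    also have "\<dots> \<le> g ^ Suc R * N.prob {\<omega> \<in> space ?P. card (box_cluster K \<omega>) \<le> R}"
      using R g cm by (intro mult_left_mono order_trans[OF less_imp_le[OF R]] N.finite_measure_mono) (auto simp: H_def)
    also have "\<dots> = expect_subset p (?D K) (\<lambda>S. g ^ Suc R * (if card (S\<^sup>* `` {0}) \<le> R then 1 else 0))"
      unfolding expect_subset_cmult box_cluster_def by (subst prob_box(2)[OF p(1,2)]) simp
    also have "\<dots> \<le> expect_subset p (?D K) (\<lambda>S. g ^ card (S\<^sup>* `` {0}))"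
      using p g power_decreasing[of _ "Suc R" g] by (intro expect_subset_mono) auto
    finally show ?thesis .
  qed
  define C where "C = 1 / (s ^ 2 * (inverse g - 1))"
  have ig: "1 < inverse g" using g by (simp add: one_less_inverse)
  have q1: "q \<le> 1" using p by linarith
  have tot: "expect_subset q (?D K) (\<lambda>S. real (card (S\<^sup>* `` {0 :: int ^ 'n}))) \<le> C" for K
  proof -
    let ?v = "expect_subset q (?D K) (\<lambda>S. inverse g ^ card (S\<^sup>* `` {0 :: int ^ 'n}))"
    let ?u = "expect_subset p (?D K) (\<lambda>S. g ^ card (S\<^sup>* `` {0 :: int ^ 'n}))"
    have "?v * ?u \<le> 1"
    proof (rule cluster_exponential_moment[where \<rho> = "s ^ 2"])
      show "s\<^sup>2 \<le> expect_subset p (?D K) (\<lambda>S. g ^ card (S\<^sup>* `` {y}))" for y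
        using rho0[of K] ostep_translate[of p g K y] p g by simp
    qed (use p q qs g s in \<open>auto simp: finite_ostep_box power_le_one\<close>)
    moreover have v0: "0 \<le> ?v"
      using expect_subset_mono[of q "?D K" "\<lambda>_. 0" "\<lambda>S. inverse g ^ card (S\<^sup>* `` {0 :: int ^ 'n})"] q q1 less_imp_le[OF g(1)]
      by (simp add: expect_subset_const[OF finite_ostep_box])
    ultimately have "?v * s ^ 2 \<le> 1"
      using mult_left_mono[OF rho0[of K] v0] by linarith
    then have v: "?v \<le> 1 / s ^ 2" using s by (simp add: field_simps)
    have "(inverse g - 1) * expect_subset q (?D K) (\<lambda>S. real (card (S\<^sup>* `` {0 :: int ^ 'n}))) \<le> ?v"
      unfolding expect_subset_cmult[symmetric]
    proof (intro expect_subset_mono q q1)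
      fix S :: "((int ^ 'n) \<times> (int ^ 'n)) set"
      have "1 + real (card (S\<^sup>* `` {0 :: int ^ 'n})) * (inverse g - 1) \<le> (1 + (inverse g - 1)) ^ card (S\<^sup>* `` {0 :: int ^ 'n})"
        using ig by (intro Bernoulli_inequality) linarith
      then show "(inverse g - 1) * real (card (S\<^sup>* `` {0 :: int ^ 'n})) \<le> inverse g ^ card (S\<^sup>* `` {0 :: int ^ 'n})"
        by (simp add: mult.commute)
    qed
    then have "(inverse g - 1) * expect_subset q (?D K) (\<lambda>S. real (card (S\<^sup>* `` {0 :: int ^ 'n}))) \<le> 1 / s ^ 2"
      using v by linarith
    then have "expect_subset q (?D K) (\<lambda>S. real (card (S\<^sup>* `` {0 :: int ^ 'n}))) \<le> (1 / s ^ 2) / (inverse g - 1)"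
      using ig by (subst pos_le_divide_eq) (simp_all only: mult.commute diff_gt_0_iff_gt)
    then show ?thesis by (simp add: C_def)
  qed
  define \<nu> where "\<nu> = (\<lambda>k. expect_subset q (?D k) (\<lambda>S. real (card {y \<in> S\<^sup>* `` {0 :: int ^ 'n}. (\<Sum>j\<in>UNIV. y $ j) = int k})))"
  have sum: "(\<Sum>k=1..K. \<nu> k) \<le> C" for K
  proof -
    have "(\<Sum>k=1..K. \<nu> k) = (\<Sum>k=1..K. expect_subset q (?D K) (\<lambda>S. real (card {y \<in> S\<^sup>* `` {0 :: int ^ 'n}. (\<Sum>j\<in>UNIV. y $ j) = int k})))"
      unfolding \<nu>_def using q q1 by (intro sum.cong refl expect_subset_level_sum[symmetric]) auto
    also have "\<dots> = expect_subset q (?D K) (\<lambda>S. \<Sum>k=1..K. real (card {y \<in> S\<^sup>* `` {0 :: int ^ 'n}. (\<Sum>j\<in>UNIV. y $ j) = int k}))"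
      by (rule expect_subset_sum[symmetric])
    also have "\<dots> \<le> expect_subset q (?D K) (\<lambda>S. real (card (S\<^sup>* `` {0 :: int ^ 'n})))"
    proof (intro expect_subset_mono q q1)
      fix S :: "((int ^ 'n) \<times> (int ^ 'n)) set" assume "S \<subseteq> ?D K"
      then have fin: "finite (S\<^sup>* `` {0 :: int ^ 'n})"
        by (intro finite_rtrancl_Image finite_subset[OF _ finite_ostep_box[of K]]) auto
      show "(\<Sum>k=1..K. real (card {y \<in> S\<^sup>* `` {0 :: int ^ 'n}. (\<Sum>j\<in>UNIV. y $ j) = int k})) \<le> real (card (S\<^sup>* `` {0 :: int ^ 'n}))"
        by (rule sum_card_levels_le[OF fin])
    qed
    also have "\<dots> \<le> C" by (rule tot)
    finally show ?thesis .
  qed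
  show ?thesis
  proof (rule ccontr)
    assume neg: "\<not> ?thesis"
    have "1 / 2 \<le> \<nu> k" if "1 \<le> k" for k
      using neg that unfolding \<nu>_def by (meson linear)
    then have "(\<Sum>k=1..K. 1 / 2) \<le> (\<Sum>k=1..K. \<nu> k)" for K by (intro sum_mono) auto
    then have "(\<Sum>k=1..K. 1 / 2) \<le> C" for K :: nat using sum[of K] by (rule order_trans)
    then have le: "real K / 2 \<le> C" for K by simp
    obtain K where "2 * C < real K" using reals_Archimedean2 by blast
    then show False using le[of K] by linarith
  qed
qed

section \<open>Lattice paths and passage times\<close>

definition l1 :: "int ^ 'n::finite \<Rightarrow> int" where
  "l1 x = (\<Sum>i\<in>UNIV. \<bar>x $ i\<bar>)"

lemma l1_nonneg [simp]: "0 \<le> l1 x"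
  by (simp add: l1_def sum_nonneg)

lemma l1_eq_0_iff [simp]: "l1 x = 0 \<longleftrightarrow> x = 0"
  by (simp add: l1_def sum_nonneg_eq_0_iff vec_eq_iff)

lemma l1_zero [simp]: "l1 0 = 0"
  by simp

lemma l1_triangle: "l1 (x + y) \<le> l1 x + l1 y"
  unfolding l1_def sum.distrib[symmetric] by (intro sum_mono) (simp add: abs_triangle_ineq)

lemma l1_minus_commute: "l1 (x - y) = l1 (y - x)"
  by (simp add: l1_def abs_minus_commute)

lemma l1_axis [simp]: "l1 (axis i c) = \<bar>c\<bar>"
proof -
  have "l1 (axis i c) = (\<Sum>j\<in>UNIV. axis i \<bar>c\<bar> $ j)"
    unfolding l1_def by (intro sum.cong) (auto simp: axis_def)
  then show ?thesis by (simp add: sum_axis)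
qed

lemma abs_component_le_l1: "\<bar>x $ i\<bar> \<le> l1 x"
  unfolding l1_def by (rule member_le_sum) auto

lemma edge_iff: "{x, y} \<in> edges \<longleftrightarrow> l1 (x - y) = 1"
proof -
  have "l1 (y - x) = l1 (x - y)" by (rule l1_minus_commute)
  then show ?thesis
    unfolding edges_def l1_def by (auto simp: doubleton_eq_iff)
qed

lemma edgeE:
  assumes "e \<in> edges" obtains x y where "e = {x, y}" "l1 (x - y) = 1"
  using assms unfolding edges_def l1_def by auto

lemma l1_eq_1D:
  assumes "l1 x = 1"
  obtains i where "\<bar>x $ i\<bar> = 1" "x = axis i (x $ i)"
proof -
  obtain i where i: "x $ i \<noteq> 0" using assms by (metis l1_eq_0_iff vec_eq_iff zero_index zero_neq_one)
  have "l1 x = \<bar>x $ i\<bar> + (\<Sum>j\<in>UNIV - {i}. \<bar>x $ j\<bar>)"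
    unfolding l1_def by (simp add: sum.remove[of _ i])
  moreover have "0 \<le> (\<Sum>j\<in>UNIV - {i}. \<bar>x $ j\<bar>)" by (simp add: sum_nonneg)
  ultimately have *: "\<bar>x $ i\<bar> = 1" "(\<Sum>j\<in>UNIV - {i}. \<bar>x $ j\<bar>) = 0" using i assms by linarith+
  then have "\<forall>j. j \<noteq> i \<longrightarrow> x $ j = 0" by (simp add: sum_nonneg_eq_0_iff)
  then have "x = axis i (x $ i)" by (simp add: vec_eq_iff axis_def)
  with * show ?thesis using that by blast
qed

lemma finite_path_edges [simp]: "finite (path_edges xs)"
proof -
  have "path_edges xs = (\<lambda>i. {xs ! i, xs ! Suc i}) ` {i. Suc i < length xs}"
    by (auto simp: path_edges_def)
  moreover have "finite {i. Suc i < length xs}"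
    by (rule finite_subset[of _ "{..<length xs}"]) auto
  ultimately show ?thesis by simp
qed

lemma card_path_edges: "card (path_edges xs) \<le> length xs - 1"
  by (induction xs rule: induct_list012) (auto simp: card_insert_if)

lemma path_edges_subset_edges:
  "successively (\<lambda>x y. {x, y} \<in> edges) xs \<Longrightarrow> path_edges xs \<subseteq> edges"
  by (induction xs rule: induct_list012) auto

lemma path_edges_vertices: "e \<in> path_edges xs \<Longrightarrow> e \<subseteq> set xs"
  by (induction xs rule: induct_list012) auto

lemma path_edges_rev: "path_edges (rev xs) = path_edges xs"
proof (induction xs rule: induct_list012)
  case (3 x y zs)
  have "path_edges (rev (x # y # zs)) = path_edges (rev (y # zs) @ [x])" by simp
  also have "\<dots> = insert {last (rev (y # zs)), x} (path_edges (rev (y # zs)))"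
    by (rule path_edges_snoc) simp
  finally show ?case using 3 by (simp add: insert_commute)
qed auto

lemma path_between_edges: "path_between x y xs \<Longrightarrow> path_edges xs \<subseteq> edges"
  by (simp add: path_between_def path_edges_subset_edges)

lemma path_between_refl: "path_between x x [x]"
  by (simp add: path_between_def)

lemma path_between_rev: "path_between x y xs \<Longrightarrow> path_between y x (rev xs)"
  by (auto simp: path_between_def hd_rev last_rev successively_rev insert_commute)

lemma path_between_append:
  assumes "path_between x y xs" "path_between y z ys"
  shows "path_between x z (xs @ tl ys)" "path_edges (xs @ tl ys) = path_edges xs \<union> path_edges ys"
    "set (xs @ tl ys) = set xs \<union> set ys"
proof -
  obtain zs where ys: "ys = y # zs" using assms(2) by (cases ys) (auto simp: path_between_def)
  show "path_between x z (xs @ tl ys)"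
    using assms by (cases zs) (auto simp: ys path_between_def successively_append_iff)
  show "path_edges (xs @ tl ys) = path_edges xs \<union> path_edges ys"
    using assms by (cases zs) (auto simp: ys path_between_def path_edges_append)
  show "set (xs @ tl ys) = set xs \<union> set ys"
    using assms by (auto simp: ys path_between_def)
qed

lemma path_straight:
  assumes "l1 u = 1"
  obtains xs where "path_between x (x + int n *s u) xs" "set xs = (\<lambda>k. x + int k *s u) ` {..n}"
    "length xs = Suc n" "path_edges xs = (\<lambda>k. {x + int k *s u, x + int (Suc k) *s u}) ` {..<n}"
proof -
  have "\<exists>xs. path_between x (x + int n *s u) xs \<and> set xs = (\<lambda>k. x + int k *s u) ` {..n} \<and>
    length xs = Suc n \<and> path_edges xs = (\<lambda>k. {x + int k *s u, x + int (Suc k) *s u}) ` {..<n}"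
  proof (induction n)
    case 0
    show ?case by (rule exI[of _ "[x]"]) (simp add: path_between_refl)
  next
    case (Suc n)
    then obtain xs where xs: "path_between x (x + int n *s u) xs" "set xs = (\<lambda>k. x + int k *s u) ` {..n}"
      "length xs = Suc n" "path_edges xs = (\<lambda>k. {x + int k *s u, x + int (Suc k) *s u}) ` {..<n}" by auto
    have "x + int n *s u - (x + int (Suc n) *s u) = - u" by (simp add: vec_eq_iff algebra_simps)
    then have "{x + int n *s u, x + int (Suc n) *s u} \<in> edges"
      using assms by (simp add: edge_iff l1_def)
    then show ?case using xs
      by (intro exI[of _ "xs @ [x + int (Suc n) *s u]"])
        (auto simp: path_between_def successively_append_iff path_edges_snoc atMost_Suc lessThan_Suc)
  qed
  then show ?thesis using that by blast
qed

text \<open>Changing the coordinates in \<open>S\<close> from those of \<open>x\<close> to those of \<open>y\<close>: as \<open>S\<close> grows by one coordinate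
at a time, this interpolates between \<open>x\<close> and \<open>y\<close> along axis-parallel segments.\<close>

definition mix :: "'n set \<Rightarrow> int ^ 'n::finite \<Rightarrow> int ^ 'n \<Rightarrow> int ^ 'n" where
  "mix S x y = (\<chi> i. if i \<in> S then y $ i else x $ i)"

lemma mix_empty [simp]: "mix {} x y = x" and mix_UNIV [simp]: "mix UNIV x y = y"
  by (auto simp: mix_def vec_eq_iff)

lemma mix_nth [simp]: "mix S x y $ i = (if i \<in> S then y $ i else x $ i)"
  by (simp add: mix_def)

lemma mix_insert: "i \<notin> S \<Longrightarrow> mix (insert i S) x y = mix S x y + axis i (y $ i - x $ i)"
  by (auto simp: mix_def vec_eq_iff axis_def)

lemma axis_multiple: "axis i (c::int) = \<bar>c\<bar> *s axis i (sgn c)"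
  by (auto simp: vec_eq_iff axis_def abs_mult_sgn)

lemma path_exists:
  fixes x y :: "int ^ 'n::finite"
  shows "\<exists>xs. path_between x y xs"
proof -
  have "\<exists>xs. path_between x (mix S x y) xs" if "finite S" for S
    using that
  proof (induction S rule: finite_induct)
    case empty
    then show ?case using path_between_refl by auto
  next
    case (insert i S)
    then obtain xs where xs: "path_between x (mix S x y) xs" by auto
    show ?case
    proof (cases "y $ i = x $ i")
      case True
      then have "axis i (y $ i - x $ i) = 0" by (simp add: axis_def vec_eq_iff)
      then have "mix (insert i S) x y = mix S x y" using insert by (simp add: mix_insert)
      then show ?thesis using xs by auto
    next
      case False
      let ?c = "y $ i - x $ i"
      have "l1 (axis i (sgn ?c) :: int ^ 'n) = 1" using False by (simp add: sgn_if)
      then obtain ys where "path_between (mix S x y) (mix S x y + int (nat \<bar>?c\<bar>) *s axis i (sgn ?c)) ys"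
        by (rule path_straight)
      then have "path_between (mix S x y) (mix (insert i S) x y) ys"
        using insert axis_multiple[of i ?c] by (simp add: mix_insert)
      then show ?thesis using path_between_append(1)[OF xs] by blast
    qed
  qed
  from this[of UNIV] show ?thesis by simp
qed

lemma path_distinct:
  assumes "path_between x y xs"
  shows "\<exists>ys. path_between x y ys \<and> distinct ys \<and> path_edges ys \<subseteq> path_edges xs"
  using assms
proof (induction "length xs" arbitrary: xs rule: less_induct)
  case less
  show ?case
  proof (cases "distinct xs")
    case False
    then obtain as bs cs a where xs: "xs = as @ [a] @ bs @ [a] @ cs" using not_distinct_decomp by blast
    have p: "path_between x y (as @ a # cs)"
      using less.prems by (auto simp: xs path_between_def successively_append_iff successively_Cons
          hd_append split: if_splits)
    have "path_edges (as @ a # cs) \<subseteq> path_edges xs"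
    proof -
      have "path_edges (a # cs) \<subseteq> path_edges (a # bs @ a # cs)"
        using path_edges_append[of "a # bs" "a # cs"] by auto
      then show ?thesis by (cases "as = []") (auto simp: xs path_edges_append)
    qed
    then show ?thesis using less.hyps[of "as @ a # cs"] p by (auto simp: xs)
  qed (use less.prems in auto)
qed

lemma path_edges_distinct_split:
  assumes "distinct (xs @ x # ys)" "successively (\<lambda>x y. {x, y} \<in> edges) (xs @ x # ys)"
  shows "path_edges (xs @ [x]) \<inter> path_edges (x # ys) = {}"
proof -
  have False if e: "e \<in> path_edges (xs @ [x])" "e \<in> path_edges (x # ys)" for e
  proof -
    have "e \<subseteq> {x}" using path_edges_vertices[OF e(1)] path_edges_vertices[OF e(2)] assms(1) by auto
    moreover have "successively (\<lambda>x y. {x, y} \<in> edges) (x # ys)" using assms(2) by (simp add: successively_append_iff)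
    then have "e \<in> edges" using path_edges_subset_edges e(2) by blast
    ultimately show False by (elim edgeE) (auto dest!: subset_singletonD simp: doubleton_eq_iff)
  qed
  then show ?thesis by auto
qed

subsection \<open>Passage times\<close>

definition nonneg_env :: "((int ^ 'n::finite) set \<Rightarrow> real) \<Rightarrow> bool" where
  "nonneg_env \<tau> \<longleftrightarrow> (\<forall>e\<in>edges. 0 \<le> \<tau> e)"

text \<open>The first passage time to a lattice point; \<open>rvec\<close> translates between lattice points and points
of the Euclidean space.\<close>

definition ptime :: "((int ^ 'n::finite) set \<Rightarrow> real) \<Rightarrow> int ^ 'n \<Rightarrow> real" where
  "ptime \<tau> x = (INF xs\<in>{xs. path_between 0 x xs}. passage_time \<tau> xs)"

definition rvec :: "int ^ 'n::finite \<Rightarrow> real ^ 'n" where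
  "rvec x = (\<chi> i. of_int (x $ i))"

lemma rvec_nth [simp]: "rvec x $ i = of_int (x $ i)"
  by (simp add: rvec_def)

lemma first_passage_time_eq:
  fixes x :: "int ^ 'n::finite"
  shows "first_passage_time \<tau> 0 (rvec x) = ptime \<tau> x"
proof -
  have "lattice_floor (rvec x) = x" "lattice_floor (0 :: real ^ 'n) = 0"
    by (simp_all add: lattice_floor_def vec_eq_iff)
  then show ?thesis by (simp add: first_passage_time_def ptime_def)
qed

lemma fpp_ball_rvec: "rvec x \<in> fpp_ball \<tau> t \<longleftrightarrow> ptime \<tau> x \<le> t"
  by (simp add: fpp_ball_def first_passage_time_eq)

lemma passage_time_nonneg:
  "nonneg_env \<tau> \<Longrightarrow> path_between x y xs \<Longrightarrow> 0 \<le> passage_time \<tau> xs"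
  unfolding passage_time_def nonneg_env_def by (intro sum_nonneg) (use path_between_edges in blast)

lemma ptime_le:
  assumes "nonneg_env \<tau>" "path_between 0 x xs"
  shows "ptime \<tau> x \<le> passage_time \<tau> xs"
  unfolding ptime_def
proof (rule cINF_lower)
  show "bdd_below (passage_time \<tau> ` {xs. path_between 0 x xs})"
    by (rule bdd_belowI2[of _ 0]) (use passage_time_nonneg[OF assms(1)] in blast)
qed (use assms in simp)

lemma ptime_less_path:
  assumes "ptime \<tau> x < c"
  shows "\<exists>xs. path_between 0 x xs \<and> passage_time \<tau> xs < c"
proof -
  have "{xs. path_between 0 x xs} \<noteq> {}" using path_exists by auto
  then show ?thesis using cInf_lessD[of "passage_time \<tau> ` {xs. path_between 0 x xs}" c] assms
    by (auto simp: ptime_def)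
qed

text \<open>The restriction to the edges in \<open>R\<close> makes this a property of finitely many weights when \<open>R\<close> is finite.\<close>

definition conn :: "((int ^ 'n::finite) set \<Rightarrow> real) \<Rightarrow> (int ^ 'n) set set \<Rightarrow> int ^ 'n \<Rightarrow> int ^ 'n \<Rightarrow> real \<Rightarrow> bool" where
  "conn \<tau> R x y c \<longleftrightarrow> (\<exists>xs. path_between x y xs \<and> path_edges xs \<subseteq> R \<and> passage_time \<tau> xs \<le> c)"

lemma passage_time_append:
  assumes "nonneg_env \<tau>" "path_between x y xs" "path_between y z ys"
  shows "passage_time \<tau> (xs @ tl ys) \<le> passage_time \<tau> xs + passage_time \<tau> ys"
proof -
  have "passage_time \<tau> (xs @ tl ys) + (\<Sum>e\<in>path_edges xs \<inter> path_edges ys. \<tau> e) = passage_time \<tau> xs + passage_time \<tau> ys"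
    unfolding passage_time_def path_between_append(2)[OF assms(2,3)]
    by (rule sum.union_inter) auto
  moreover have "0 \<le> (\<Sum>e\<in>path_edges xs \<inter> path_edges ys. \<tau> e)"
    using assms(1) path_between_edges[OF assms(2)] by (intro sum_nonneg) (auto simp: nonneg_env_def)
  ultimately show ?thesis by linarith
qed

lemma conn_trans:
  assumes "nonneg_env \<tau>" "conn \<tau> R x y c" "conn \<tau> R y z c'"
  shows "conn \<tau> R x z (c + c')"
proof -
  obtain xs ys where p: "path_between x y xs" "path_edges xs \<subseteq> R" "passage_time \<tau> xs \<le> c"
    "path_between y z ys" "path_edges ys \<subseteq> R" "passage_time \<tau> ys \<le> c'"
    using assms by (auto simp: conn_def)
  have "passage_time \<tau> (xs @ tl ys) \<le> c + c'"
    using passage_time_append[OF assms(1) p(1,4)] p by linarith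
  then show ?thesis
    unfolding conn_def using path_between_append[OF p(1,4)] p by blast
qed

lemma conn_refl: "0 \<le> c \<Longrightarrow> conn \<tau> R x x c"
  unfolding conn_def by (rule exI[of _ "[x]"]) (simp add: path_between_refl passage_time_def)

lemma conn_sym:
  assumes "conn \<tau> R x y c" shows "conn \<tau> R y x c"
proof -
  obtain xs where "path_between x y xs" "path_edges xs \<subseteq> R" "passage_time \<tau> xs \<le> c"
    using assms by (auto simp: conn_def)
  then have "path_between y x (rev xs)" "path_edges (rev xs) \<subseteq> R" "passage_time \<tau> (rev xs) \<le> c"
    by (simp_all add: path_between_rev path_edges_rev passage_time_def)
  then show ?thesis unfolding conn_def by blast
qed

lemma conn_mono:
  assumes "conn \<tau> R x y c" "R \<subseteq> R'" "c \<le> c'" shows "conn \<tau> R' x y c'"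
proof -
  obtain xs where "path_between x y xs" "path_edges xs \<subseteq> R" "passage_time \<tau> xs \<le> c"
    using assms by (auto simp: conn_def)
  then have "path_between x y xs" "path_edges xs \<subseteq> R'" "passage_time \<tau> xs \<le> c'"
    using assms by auto
  then show ?thesis unfolding conn_def by blast
qed

lemma conn_env_mono:
  assumes "conn \<tau> R x y c" "\<And>e. e \<in> R \<inter> edges \<Longrightarrow> \<tau>' e \<le> \<tau> e"
  shows "conn \<tau>' R x y c"
proof -
  obtain xs where xs: "path_between x y xs" "path_edges xs \<subseteq> R" "passage_time \<tau> xs \<le> c"
    using assms by (auto simp: conn_def)
  have "passage_time \<tau>' xs \<le> passage_time \<tau> xs"
    unfolding passage_time_def using path_between_edges[OF xs(1)] xs(2) by (intro sum_mono assms(2)) auto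
  then show ?thesis using xs unfolding conn_def by (meson order_trans)
qed

text \<open>Although \<open>ptime\<close> counts an edge only once per path, it is subadditive: concatenating two paths
never counts more than the sum of both.\<close>

lemma conn_ptime:
  assumes "nonneg_env \<tau>" "conn \<tau> R x y c"
  shows "ptime \<tau> y \<le> ptime \<tau> x + c"
proof -
  obtain ys where ys: "path_between x y ys" "passage_time \<tau> ys \<le> c"
    using assms(2) by (auto simp: conn_def)
  show ?thesis
  proof (rule field_le_epsilon)
    fix \<epsilon> :: real assume "0 < \<epsilon>"
    then obtain xs where xs: "path_between 0 x xs" "passage_time \<tau> xs < ptime \<tau> x + \<epsilon>"
      using ptime_less_path[of \<tau> x "ptime \<tau> x + \<epsilon>"] by auto
    have "ptime \<tau> y \<le> passage_time \<tau> (xs @ tl ys)"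
      by (intro ptime_le assms path_between_append(1)[OF xs(1) ys(1)])
    also have "\<dots> \<le> passage_time \<tau> xs + passage_time \<tau> ys"
      by (rule passage_time_append[OF assms(1) xs(1) ys(1)])
    finally show "ptime \<tau> y \<le> ptime \<tau> x + c + \<epsilon>" using xs ys by linarith
  qed
qed

lemma conn_mix:
  fixes x y :: "int ^ 'n::finite"
  assumes "nonneg_env \<tau>" "\<And>S i. i \<notin> S \<Longrightarrow> conn \<tau> R (mix S x y) (mix (insert i S) x y) c" "0 \<le> c"
  shows "conn \<tau> R x y (real CARD('n) * c)"
proof -
  have "conn \<tau> R x (mix S x y) (real (card S) * c)" if "finite S" for S
    using that
  proof (induction S rule: finite_induct)
    case (insert i S)
    then have "conn \<tau> R x (mix (insert i S) x y) (real (card S) * c + c)"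
      using assms by (intro conn_trans[OF assms(1) insert.IH]) auto
    then show ?case using insert by (simp add: algebra_simps)
  qed (simp add: conn_refl)
  from this[of UNIV] show ?thesis by simp
qed

lemma conn_straight:
  assumes "l1 u = 1" "\<And>k. k < n \<Longrightarrow> \<tau> {x + int k *s u, x + int (Suc k) *s u} \<le> a"
    and "(\<lambda>k. {x + int k *s u, x + int (Suc k) *s u}) ` {..<n} \<subseteq> R" "0 \<le> a"
  shows "conn \<tau> R x (x + int n *s u) (a * n)"
proof -
  obtain xs where xs: "path_between x (x + int n *s u) xs" "length xs = Suc n"
    "path_edges xs = (\<lambda>k. {x + int k *s u, x + int (Suc k) *s u}) ` {..<n}"
    by (rule path_straight[OF assms(1), of x n])
  have "passage_time \<tau> xs \<le> real (card (path_edges xs)) * a"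
    unfolding passage_time_def
  proof (rule sum_bounded_above)
    fix e assume "e \<in> path_edges xs"
    then obtain k where "k < n" "e = {x + int k *s u, x + int (Suc k) *s u}" unfolding xs(3) by blast
    then show "\<tau> e \<le> a" using assms(2) by simp
  qed
  also have "real (card (path_edges xs)) \<le> n" using card_path_edges[of xs] xs(2) by simp
  then have "real (card (path_edges xs)) * a \<le> a * n" using assms(4) by (simp add: mult.commute mult_left_mono)
  finally have "passage_time \<tau> xs \<le> a * n" .
  moreover have "path_edges xs \<subseteq> R" using assms(3) unfolding xs(3) .
  ultimately show ?thesis unfolding conn_def using xs(1) by blast
qed

lemma path_vertex_l1:
  assumes "path_between x y xs" "z \<in> set xs"
  shows "l1 (z - x) < int (length xs)"
proof -
  have "xs \<noteq> [] \<Longrightarrow> successively (\<lambda>x y. {x, y} \<in> edges) xs \<Longrightarrow> \<forall>z\<in>set xs. l1 (z - hd xs) < int (length xs)" for xs :: "(int ^ 'n) list"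
  proof (induction xs rule: induct_list012)
    case (3 x y zs)
    have xy: "l1 (x - y) = 1" using 3 by (simp add: edge_iff)
    have IH: "\<forall>z\<in>set (y # zs). l1 (z - y) < int (length (y # zs))" using "3.IH"(2) "3.prems" by simp
    have "l1 (z - x) < int (length (x # y # zs))" if "z \<in> set (y # zs)" for z
    proof -
      have "z - x = (z - y) + (y - x)" by simp
      then have "l1 (z - x) \<le> l1 (z - y) + l1 (y - x)" by (metis l1_triangle)
      then show ?thesis using IH that xy l1_minus_commute[of x y] by force
    qed
    then show ?case by auto
  qed auto
  then show ?thesis using assms by (auto simp: path_between_def)
qed

lemma axis_zero [simp]: "axis i (0 :: int) = 0"
  by (simp add: axis_def vec_eq_iff)

definition path_within :: "int ^ 'n::finite \<Rightarrow> int ^ 'n \<Rightarrow> (int ^ 'n) set \<Rightarrow> nat \<Rightarrow> bool" where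
  "path_within x y A L \<longleftrightarrow> (\<exists>xs. path_between x y xs \<and> set xs \<subseteq> A \<and> length xs \<le> L)"

lemma path_within_trans:
  assumes "path_within x y A L" "path_within y z A L'" shows "path_within x z A (L + L')"
proof -
  obtain xs ys where "path_between x y xs" "set xs \<subseteq> A" "length xs \<le> L" "path_between y z ys" "set ys \<subseteq> A" "length ys \<le> L'"
    using assms by (auto simp: path_within_def)
  then show ?thesis unfolding path_within_def
    using path_between_append[of x y xs z ys] by (intro exI[of _ "xs @ tl ys"]) auto
qed

lemma path_within_axis:
  assumes "\<And>k. min 0 c \<le> k \<Longrightarrow> k \<le> max 0 c \<Longrightarrow> x + axis j k \<in> A"
  shows "path_within x (x + axis j c) A (nat \<bar>c\<bar> + 1)"
proof (cases "c = 0")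
  case True
  then show ?thesis unfolding path_within_def using path_between_refl assms[of 0] True by (intro exI[of _ "[x]"]) simp
next
  case False
  then have "l1 (axis j (sgn c)) = 1" by (simp add: sgn_if)
  then obtain xs where xs: "path_between x (x + int (nat \<bar>c\<bar>) *s axis j (sgn c)) xs"
    "set xs = (\<lambda>k. x + int k *s axis j (sgn c)) ` {..nat \<bar>c\<bar>}" "length xs = Suc (nat \<bar>c\<bar>)"
    by (rule path_straight[of _ x "nat \<bar>c\<bar>"])
  have "x + int k *s axis j (sgn c) \<in> A" if "k \<le> nat \<bar>c\<bar>" for k
  proof -
    have "int k *s axis j (sgn c) = axis j (int k * sgn c)" by (auto simp: vec_eq_iff axis_def)
    moreover have "min 0 c \<le> int k * sgn c" "int k * sgn c \<le> max 0 c" using that by (auto simp: sgn_if)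
    ultimately show ?thesis using assms[of "int k * sgn c"] by simp
  qed
  moreover have "int (nat \<bar>c\<bar>) *s axis j (sgn c) = axis j c" using axis_multiple[of j c] by simp
  ultimately show ?thesis unfolding path_within_def using xs by (intro exI[of _ xs]) auto
qed

text \<open>Both endpoints have degree \<open>2 * CARD('n)\<close>, so this is the largest possible number of edge-disjoint
paths. One path is straight, the paths that start in a direction \<open>j \<noteq> i\<close> run parallel to it, and the
path that starts backwards makes a detour at distance two.\<close>

lemma axis_edge_disjoint_paths:
  fixes v :: "int ^ 'n::finite"
  assumes "CARD('n) \<ge> 2" "2 \<le> n"
  shows "\<exists>P :: 'n \<times> bool \<Rightarrow> (int ^ 'n) list.
    (\<forall>q. path_between v (v + axis i (int n)) (P q) \<and> length (P q) \<le> n + 13) \<and>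
    (\<forall>q q'. q \<noteq> q' \<longrightarrow> path_edges (P q) \<inter> path_edges (P q') = {})"
proof -
  have "UNIV \<noteq> {i}"
  proof
    assume "UNIV = {i}"
    then have "CARD('n) = card {i}" by (rule arg_cong)
    with assms show False by simp
  qed
  then obtain j0 where j0: "j0 \<noteq> i" by blast
  \<comment> \<open>disjoint corridors, in coordinates relative to \<open>v\<close>: the path with index \<open>(j, b)\<close> will stay in
    its corridor except at its endpoints\<close>
  define I where "I = (\<lambda>(j, b) (w :: int ^ 'n).
     if j \<noteq> i then w $ j = (if b then 1 else -1) \<and> 0 \<le> w $ i \<and> w $ i \<le> int n \<and> (\<forall>k. k \<noteq> i \<and> k \<noteq> j \<longrightarrow> w $ k = 0)
     else if b then 0 < w $ i \<and> w $ i < int n \<and> (\<forall>k. k \<noteq> i \<longrightarrow> w $ k = 0)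
     else w $ i = -1 \<or> w $ i = int n + 1 \<or> w $ j0 = 2)"
  define z where "z = v + axis i (int n)"
  define A where "A = (\<lambda>q. {v, z} \<union> {x. I q (x - v)})"
  have shiftD: "w $ j = (if b then 1 else -1)" "0 \<le> w $ i" "w $ i \<le> int n" "k \<noteq> i \<Longrightarrow> k \<noteq> j \<Longrightarrow> w $ k = 0"
    "\<not> I (i, b') w"
    if "I (j, b) w" "j \<noteq> i" for j b w k b'
  proof -
    show *: "w $ j = (if b then 1 else -1)" "0 \<le> w $ i" "w $ i \<le> int n" "k \<noteq> i \<Longrightarrow> k \<noteq> j \<Longrightarrow> w $ k = 0" for k
      using that by (auto simp: I_def)
    have "w $ j0 \<noteq> 2" using * j0 by (cases "j0 = j") auto
    then show "\<not> I (i, b') w" using * that(2) by (auto simp: I_def split: if_splits)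
  qed
  have I_inj: "q = q'" if w: "I q w" "I q' w" for q q' w
  proof -
    obtain j b j' b' where q: "q = (j, b)" "q' = (j', b')" by (metis surj_pair)
    consider "j \<noteq> i" "j' \<noteq> i" | "j \<noteq> i" "j' = i" | "j = i" "j' \<noteq> i" | "j = i" "j' = i" by blast
    then show ?thesis
    proof cases
      case 1
      have "j = j'"
      proof (rule ccontr)
        assume "j \<noteq> j'"
        then have "w $ j = 0" using shiftD(4)[of j' b' w j] w 1 q by simp
        then show False using shiftD(1)[of j b w] w 1 q by (auto split: if_splits)
      qed
      then show ?thesis using shiftD(1)[of j b w] shiftD(1)[of j' b' w] w 1 q by (auto split: if_splits)
    next
      case 2
      then show ?thesis using shiftD(5)[of j b w b'] w q by simp
    next
      case 3
      then show ?thesis using shiftD(5)[of j' b' w b] w q by simp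
    next
      case 4
      have "\<not> (I (i, True) w \<and> I (i, False) w)" using j0 by (auto simp: I_def)
      then show ?thesis using w 4 q by (cases b; cases b') auto
    qed
  qed
  have "path_within v z (A q) (n + 13)" for q
  proof -
    obtain j b where q: "q = (j, b)" by (metis surj_pair)
    consider (shift) "j \<noteq> i" | (straight) "j = i" b | (loop) "j = i" "\<not> b" by auto
    then show ?thesis
    proof cases
      case straight
      have "path_within v (v + axis i (int n)) (A q) (nat \<bar>int n\<bar> + 1)"
      proof (rule path_within_axis)
        fix k assume k: "min 0 (int n) \<le> k" "k \<le> max 0 (int n)"
        consider "k = 0" | "k = int n" | "0 < k" "k < int n" using k by force
        then show "v + axis i k \<in> A q"
        proof cases
          case 1
          then have "axis i k = 0" by (simp add: axis_def vec_eq_iff)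
          then show ?thesis by (simp add: A_def)
        next
          case 3
          then show ?thesis using straight by (auto simp: A_def I_def q axis_def)
        qed (simp add: A_def z_def)
      qed
      then show ?thesis unfolding path_within_def z_def by (auto intro: order_trans)
    next
      case shift
      define s :: int where "s = (if b then 1 else -1)"
      have 1: "path_within v (v + axis j s) (A q) (nat \<bar>s\<bar> + 1)"
      proof (rule path_within_axis)
        fix k assume "min 0 s \<le> k" "k \<le> max 0 s"
        then have "k = 0 \<or> k = s" by (auto simp: s_def split: if_splits)
        then show "v + axis j k \<in> A q"
          using shift by (auto simp: A_def I_def q axis_def s_def vec_eq_iff)
      qed
      have 2: "path_within (v + axis j s) (v + axis j s + axis i (int n)) (A q) (nat \<bar>int n\<bar> + 1)"
        by (rule path_within_axis) (use shift in \<open>auto simp: A_def I_def q axis_def s_def\<close>)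
      have 3: "path_within (v + axis j s + axis i (int n)) (v + axis j s + axis i (int n) + axis j (-s)) (A q) (nat \<bar>-s\<bar> + 1)"
      proof (rule path_within_axis)
        fix k assume "min 0 (-s) \<le> k" "k \<le> max 0 (-s)"
        then have "k = 0 \<or> k = -s" by (auto simp: s_def split: if_splits)
        then show "v + axis j s + axis i (int n) + axis j k \<in> A q"
          using shift by (auto simp: A_def I_def q axis_def s_def vec_eq_iff z_def)
      qed
      have "v + axis j s + axis i (int n) + axis j (-s) = z" by (auto simp: z_def vec_eq_iff axis_def)
      then have "path_within v z (A q) ((nat \<bar>s\<bar> + 1) + (nat \<bar>int n\<bar> + 1) + (nat \<bar>-s\<bar> + 1))"
        using path_within_trans[OF path_within_trans[OF 1 2] 3] by simp
      then show ?thesis unfolding path_within_def by (auto intro: order_trans simp: s_def split: if_splits)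
    next
      case loop
      let ?a = "v + axis i (-1)"
      let ?b = "?a + axis j0 2"
      let ?c = "?b + axis i (int n + 2)"
      let ?d = "?c + axis j0 (-2)"
      have qi: "q = (i, False)" using loop q by simp
      have 1: "path_within v ?a (A q) (nat \<bar>-1\<bar> + 1)"
      proof (rule path_within_axis)
        fix k :: int assume "min 0 (-1) \<le> k" "k \<le> max 0 (-1)"
        then have "k = 0 \<or> k = -1" by auto
        then show "v + axis i k \<in> A q" by (auto simp: A_def I_def qi axis_def vec_eq_iff)
      qed
      have 2: "path_within ?a ?b (A q) (nat \<bar>2\<bar> + 1)"
        by (rule path_within_axis) (use j0 in \<open>auto simp: A_def I_def qi axis_def\<close>)
      have 3: "path_within ?b ?c (A q) (nat \<bar>int n + 2\<bar> + 1)"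
        by (rule path_within_axis) (use j0 in \<open>auto simp: A_def I_def qi axis_def\<close>)
      have 4: "path_within ?c ?d (A q) (nat \<bar>-2\<bar> + 1)"
        by (rule path_within_axis) (use j0 in \<open>auto simp: A_def I_def qi axis_def\<close>)
      have 5: "path_within ?d (?d + axis i (-1)) (A q) (nat \<bar>-1\<bar> + 1)"
      proof (rule path_within_axis)
        fix k :: int assume "min 0 (-1) \<le> k" "k \<le> max 0 (-1)"
        then have "k = 0 \<or> k = -1" by auto
        then show "?d + axis i k \<in> A q" using j0 by (auto simp: A_def I_def qi axis_def vec_eq_iff z_def)
      qed
      have "?d + axis i (-1) = z" by (auto simp: z_def vec_eq_iff axis_def)
      then have "path_within v z (A q) ((nat \<bar>-1\<bar> + 1) + (nat \<bar>2\<bar> + 1) + (nat \<bar>int n + 2\<bar> + 1) + (nat \<bar>-2\<bar> + 1) + (nat \<bar>-1\<bar> + 1))"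
        using path_within_trans[OF path_within_trans[OF path_within_trans[OF path_within_trans[OF 1 2] 3] 4] 5] by simp
      moreover have "(nat \<bar>-1\<bar> + 1) + (nat \<bar>2\<bar> + 1) + (nat \<bar>int n + 2\<bar> + 1) + (nat \<bar>-2\<bar> + 1) + (nat \<bar>-1\<bar> + 1) \<le> n + 13" by simp
      ultimately show ?thesis unfolding path_within_def by (auto intro: order_trans)
    qed
  qed
  then have "\<exists>P. \<forall>q. path_between v z (P q) \<and> set (P q) \<subseteq> A q \<and> length (P q) \<le> n + 13"
    unfolding path_within_def by (intro choice) auto
  then obtain P where P: "\<And>q. path_between v z (P q)" "\<And>q. set (P q) \<subseteq> A q" "\<And>q. length (P q) \<le> n + 13" by blast
  have "path_edges (P q) \<inter> path_edges (P q') = {}" if "q \<noteq> q'" for q q'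
  proof -
    have False if e: "e \<in> path_edges (P q)" "e \<in> path_edges (P q')" for e
    proof -
      have "A q \<inter> A q' \<subseteq> {v, z}" using I_inj \<open>q \<noteq> q'\<close> unfolding A_def by blast
      then have sub: "e \<subseteq> {v, z}"
        using path_edges_vertices[OF e(1)] path_edges_vertices[OF e(2)] P(2)[of q] P(2)[of q'] by blast
      have "e \<in> edges" using path_between_edges[OF P(1)] e by blast
      then obtain x y where xy: "e = {x, y}" "l1 (x - y) = 1" by (rule edgeE)
      then have "x \<noteq> y" by auto
      then have "(x = v \<and> y = z) \<or> (x = z \<and> y = v)" using sub xy by auto
      then have "l1 (z - v) = 1" using xy l1_minus_commute by metis
      then show False using assms by (simp add: z_def)
    qed
    then show ?thesis by auto
  qed
  then show ?thesis using P(1,3) unfolding z_def by (intro exI[of _ P] conjI allI impI) simp_all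
qed

section \<open>Moments and upper bounds for passage times\<close>

text \<open>The terms of degree zero and one in \<open>x\<close> are kept exactly because the linear one has mean zero in the
application. Every other term of the binomial expansion is bounded by that of degree two or
by that of the highest degree, according to which of \<open>s\<close> and \<open>x\<close> is larger.\<close>

lemma even_power_add_le:
  fixes s x :: real
  shows "(s + x) ^ (2 * Suc m) \<le> s ^ (2 * Suc m) + real (2 * Suc m) * (s ^ Suc (2 * m) * x) +
     4 ^ Suc m * (s ^ (2 * m) * x ^ 2 + x ^ (2 * Suc m))"
proof -
  let ?N = "2 * Suc m"
  let ?R = "s ^ (2 * m) * x ^ 2 + x ^ ?N"
  have xN: "0 \<le> x ^ ?N" by (rule zero_le_even_power) simp
  have sx: "0 \<le> s ^ (2 * m) * x ^ 2" by (intro mult_nonneg_nonneg zero_le_even_power) auto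
  have R: "0 \<le> ?R" by (intro add_nonneg_nonneg mult_nonneg_nonneg zero_le_even_power) auto
  have tm: "x ^ j * s ^ (?N - j) \<le> ?R" if "2 \<le> j" "j \<le> ?N" for j
  proof (cases "\<bar>x\<bar> \<le> \<bar>s\<bar>")
    case True
    have "x ^ j * s ^ (?N - j) \<le> \<bar>x\<bar> ^ j * \<bar>s\<bar> ^ (?N - j)"
      by (metis abs_ge_self abs_mult power_abs)
    also have "\<bar>x\<bar> ^ j = \<bar>x\<bar> ^ (j - 2) * \<bar>x\<bar> ^ 2" using that by (metis le_add_diff_inverse2 power_add)
    also have "\<bar>x\<bar> ^ (j - 2) * \<bar>x\<bar> ^ 2 * \<bar>s\<bar> ^ (?N - j) \<le> \<bar>s\<bar> ^ (j - 2) * \<bar>x\<bar> ^ 2 * \<bar>s\<bar> ^ (?N - j)"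
      using True by (intro mult_right_mono power_mono) auto
    also have "\<dots> = \<bar>s\<bar> ^ (j - 2 + (?N - j)) * \<bar>x\<bar> ^ 2" by (simp add: power_add)
    also have "j - 2 + (?N - j) = 2 * m" using that by simp
    also have "\<bar>s\<bar> ^ (2 * m) * \<bar>x\<bar> ^ 2 = s ^ (2 * m) * x ^ 2" by (simp add: power_even_abs)
    also have "\<dots> \<le> ?R" using xN by linarith
    finally show ?thesis .
  next
    case False
    have "x ^ j * s ^ (?N - j) \<le> \<bar>x\<bar> ^ j * \<bar>s\<bar> ^ (?N - j)"
      by (metis abs_ge_self abs_mult power_abs)
    also have "\<dots> \<le> \<bar>x\<bar> ^ j * \<bar>x\<bar> ^ (?N - j)"
      using False by (intro mult_left_mono power_mono) auto
    also have "\<dots> = \<bar>x\<bar> ^ ?N" using that by (simp add: power_add[symmetric])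
    also have "\<dots> = x ^ ?N" by (rule power_even_abs) simp
    also have "\<dots> \<le> ?R" using sx by linarith
    finally show ?thesis .
  qed
  have "(s + x) ^ ?N = (\<Sum>j\<le>?N. real (?N choose j) * x ^ j * s ^ (?N - j))"
    by (subst add.commute) (rule binomial_ring)
  also have "{..?N} = {0, 1} \<union> {2..?N}" by auto
  also have "(\<Sum>j\<in>{0, 1} \<union> {2..?N}. real (?N choose j) * x ^ j * s ^ (?N - j))
     = (\<Sum>j\<in>{0, 1}. real (?N choose j) * x ^ j * s ^ (?N - j)) + (\<Sum>j\<in>{2..?N}. real (?N choose j) * x ^ j * s ^ (?N - j))"
    by (rule sum.union_disjoint) auto
  also have "(\<Sum>j\<in>{0, 1}. real (?N choose j) * x ^ j * s ^ (?N - j)) = s ^ ?N + real ?N * (s ^ Suc (2 * m) * x)"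
    by simp
  also have "(\<Sum>j\<in>{2..?N}. real (?N choose j) * x ^ j * s ^ (?N - j)) \<le> (\<Sum>j\<in>{2..?N}. real (?N choose j) * ?R)"
    using tm by (intro sum_mono) (auto simp: mult.assoc intro!: mult_left_mono)
  also have "\<dots> \<le> (\<Sum>j\<le>?N. real (?N choose j) * ?R)"
    using R by (intro sum_mono2) (auto intro!: mult_nonneg_nonneg)
  also have "\<dots> = 4 ^ Suc m * ?R"
  proof -
    have "(\<Sum>j\<le>?N. real (?N choose j)) = real (2 ^ ?N)" by (metis choose_row_sum of_nat_sum)
    then show ?thesis by (simp add: sum_distrib_right[symmetric] power_mult)
  qed
  finally show ?thesis by simp
qed

lemma (in prob_space) integrable_power_le:
  fixes X :: "'a \<Rightarrow> real"
  assumes "integrable M (\<lambda>\<omega>. X \<omega> ^ (2 * m))" "X \<in> borel_measurable M" "k \<le> 2 * m"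
  shows "integrable M (\<lambda>\<omega>. X \<omega> ^ k)"
proof (rule Bochner_Integration.integrable_bound[of M "\<lambda>\<omega>. 1 + X \<omega> ^ (2 * m)"])
  show "AE \<omega> in M. norm (X \<omega> ^ k) \<le> norm (1 + X \<omega> ^ (2 * m))"
  proof (rule AE_I2)
    fix \<omega>
    have "\<bar>X \<omega>\<bar> ^ k \<le> 1 + \<bar>X \<omega>\<bar> ^ (2 * m)"
    proof (cases "\<bar>X \<omega>\<bar> \<le> 1")
      case True
      then have "\<bar>X \<omega>\<bar> ^ k \<le> 1" by (simp add: power_le_one)
      then show ?thesis by (simp add: add_increasing2)
    next
      case False
      then have "\<bar>X \<omega>\<bar> ^ k \<le> \<bar>X \<omega>\<bar> ^ (2 * m)" using assms(3) by (intro power_increasing) auto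
      then show ?thesis by simp
    qed
    then show "norm (X \<omega> ^ k) \<le> norm (1 + X \<omega> ^ (2 * m))"
      by (simp add: power_abs power_even_abs add_nonneg_nonneg zero_le_even_power)
  qed
qed (use assms in auto)

text \<open>Moments of sums of independent centred variables grow like those of a Gaussian: an
  additional summand increases the moment of order \<open>2 * m + 2\<close> by at most a multiple of the
  moment of order \<open>2 * m\<close>, as the term that is linear in the new summand has mean zero.\<close>

lemma (in prob_space) even_moment_sum_le:
  fixes X :: "'i \<Rightarrow> 'a \<Rightarrow> real"
  assumes ind: "indep_vars (\<lambda>_. borel) X I"
    and int: "\<And>i. i \<in> I \<Longrightarrow> integrable M (\<lambda>\<omega>. X i \<omega> ^ (2 * m))"
    and zero: "\<And>i. i \<in> I \<Longrightarrow> expectation (X i) = 0"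
    and K: "\<And>i k. i \<in> I \<Longrightarrow> k \<le> m \<Longrightarrow> expectation (\<lambda>\<omega>. X i \<omega> ^ (2 * k)) \<le> K"
  shows "\<exists>C>0. \<forall>J. finite J \<and> J \<subseteq> I \<longrightarrow> integrable M (\<lambda>\<omega>. (\<Sum>i\<in>J. X i \<omega>) ^ (2 * m)) \<and>
    expectation (\<lambda>\<omega>. (\<Sum>i\<in>J. X i \<omega>) ^ (2 * m)) \<le> C * real (card J) ^ m"
  using int K
proof (induction m)
  case 0
  show ?case by (intro exI[of _ 1]) (auto simp: prob_space)
next
  case (Suc m)
  have meas: "X i \<in> borel_measurable M" if "i \<in> I" for i
    using ind that by (auto simp: indep_vars_def)
  have intX: "integrable M (\<lambda>\<omega>. X i \<omega> ^ k)" if "i \<in> I" "k \<le> 2 * Suc m" for i k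
    using integrable_power_le[OF Suc.prems(1)[OF that(1)] meas[OF that(1)] that(2)] .
  have "\<exists>C>0. \<forall>J. finite J \<and> J \<subseteq> I \<longrightarrow> integrable M (\<lambda>\<omega>. (\<Sum>i\<in>J. X i \<omega>) ^ (2 * m)) \<and>
    expectation (\<lambda>\<omega>. (\<Sum>i\<in>J. X i \<omega>) ^ (2 * m)) \<le> C * real (card J) ^ m"
    by (rule Suc.IH) (use intX Suc.prems(2) in auto)
  then obtain C where C: "0 < C" "\<And>J. finite J \<Longrightarrow> J \<subseteq> I \<Longrightarrow> integrable M (\<lambda>\<omega>. (\<Sum>i\<in>J. X i \<omega>) ^ (2 * m))"
    "\<And>J. finite J \<Longrightarrow> J \<subseteq> I \<Longrightarrow> expectation (\<lambda>\<omega>. (\<Sum>i\<in>J. X i \<omega>) ^ (2 * m)) \<le> C * real (card J) ^ m" by blast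
  define K' where "K' = max K 1"
  define C' where "C' = 4 ^ Suc m * (K' * (C + 1))"
  have K': "expectation (\<lambda>\<omega>. X i \<omega> ^ (2 * k)) \<le> K'" "1 \<le> K'" if "i \<in> I" "k \<le> Suc m" for i k
    using Suc.prems(2)[OF that] by (auto simp: K'_def)
  have K'1: "1 \<le> K'" by (simp add: K'_def)
  have C': "0 < C'" using C(1) K'1 by (simp add: C'_def)
  have "integrable M (\<lambda>\<omega>. (\<Sum>i\<in>J. X i \<omega>) ^ (2 * Suc m)) \<and>
    expectation (\<lambda>\<omega>. (\<Sum>i\<in>J. X i \<omega>) ^ (2 * Suc m)) \<le> C' * real (card J) ^ Suc m"
    if "finite J" "J \<subseteq> I" for J
    using that
  proof (induction J rule: finite_induct)
    case empty
    then show ?case by simp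
  next
    case (insert i J)
    let ?S = "\<lambda>\<omega>. \<Sum>i\<in>J. X i \<omega>"
    let ?n = "real (card J)"
    have i: "i \<in> I" and J: "J \<subseteq> I" "finite J" "i \<notin> J" using insert by auto
    have mS: "?S \<in> borel_measurable M" using J meas by (intro borel_measurable_sum) auto
    note mX = meas[OF i]
    have IHJ: "integrable M (\<lambda>\<omega>. ?S \<omega> ^ (2 * Suc m))" "expectation (\<lambda>\<omega>. ?S \<omega> ^ (2 * Suc m)) \<le> C' * ?n ^ Suc m"
      using insert.IH J by auto
    have iS: "integrable M (\<lambda>\<omega>. ?S \<omega> ^ k)" if "k \<le> 2 * Suc m" for k
      using integrable_power_le[OF IHJ(1) mS that] .
    have "indep_var borel (X i) borel ?S"
      using J i ind by (intro indep_vars_sum) (auto intro: indep_vars_subset)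
    then have iv: "indep_var borel (\<lambda>\<omega>. X i \<omega> ^ l) borel (\<lambda>\<omega>. ?S \<omega> ^ k)" for k l
      using indep_var_compose[of borel "X i" borel ?S "\<lambda>x. x ^ l" borel "\<lambda>x. x ^ k" borel]
      by (simp add: comp_def)
    have pr: "integrable M (\<lambda>\<omega>. ?S \<omega> ^ k * X i \<omega> ^ l)"
      "expectation (\<lambda>\<omega>. ?S \<omega> ^ k * X i \<omega> ^ l) = expectation (\<lambda>\<omega>. ?S \<omega> ^ k) * expectation (\<lambda>\<omega>. X i \<omega> ^ l)"
      if "k \<le> 2 * Suc m" "l \<le> 2 * Suc m" for k l
      using indep_var_integrable[OF iv intX[OF i that(2)] iS[OF that(1)]]
        indep_var_lebesgue_integral[OF iv intX[OF i that(2)] iS[OF that(1)]] by (simp_all add: mult.commute)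
    let ?g = "\<lambda>\<omega>. ?S \<omega> ^ (2 * Suc m) + real (2 * Suc m) * (?S \<omega> ^ Suc (2 * m) * X i \<omega> ^ 1) +
     4 ^ Suc m * (?S \<omega> ^ (2 * m) * X i \<omega> ^ 2 + X i \<omega> ^ (2 * Suc m))"
    have sum: "(\<Sum>i\<in>insert i J. X i \<omega>) = ?S \<omega> + X i \<omega>" for \<omega> using J by simp
    have le: "(\<Sum>i\<in>insert i J. X i \<omega>) ^ (2 * Suc m) \<le> ?g \<omega>" for \<omega>
      unfolding sum power_one_right by (rule even_power_add_le)
    have ig: "integrable M ?g"
      by (intro Bochner_Integration.integrable_add integrable_mult_right pr iS intX i) simp_all
    have int': "integrable M (\<lambda>\<omega>. (\<Sum>i\<in>insert i J. X i \<omega>) ^ (2 * Suc m))"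
    proof (rule Bochner_Integration.integrable_bound[OF ig])
      show "(\<lambda>\<omega>. (\<Sum>i\<in>insert i J. X i \<omega>) ^ (2 * Suc m)) \<in> borel_measurable M"
        unfolding sum using mS mX by measurable
      show "AE \<omega> in M. norm ((\<Sum>i\<in>insert i J. X i \<omega>) ^ (2 * Suc m)) \<le> norm (?g \<omega>)"
      proof (rule AE_I2)
        fix \<omega>
        have "0 \<le> (\<Sum>i\<in>insert i J. X i \<omega>) ^ (2 * Suc m)" by (intro zero_le_even_power) simp
        then show "norm ((\<Sum>i\<in>insert i J. X i \<omega>) ^ (2 * Suc m)) \<le> norm (?g \<omega>)"
          using le[of \<omega>] by (simp only: real_norm_def)
      qed
    qed
    have "expectation (\<lambda>\<omega>. (\<Sum>i\<in>insert i J. X i \<omega>) ^ (2 * Suc m)) \<le> expectation ?g"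
      by (rule integral_mono[OF int' ig le])
    also have "expectation ?g = expectation (\<lambda>\<omega>. ?S \<omega> ^ (2 * Suc m)) +
        real (2 * Suc m) * (expectation (\<lambda>\<omega>. ?S \<omega> ^ Suc (2 * m)) * expectation (\<lambda>\<omega>. X i \<omega> ^ 1)) +
        4 ^ Suc m * (expectation (\<lambda>\<omega>. ?S \<omega> ^ (2 * m)) * expectation (\<lambda>\<omega>. X i \<omega> ^ 2) + expectation (\<lambda>\<omega>. X i \<omega> ^ (2 * Suc m)))"
    proof -
      have lin: "expectation (\<lambda>\<omega>. f \<omega> + c * g \<omega> + d * (h \<omega> + k \<omega>)) =
          expectation f + c * expectation g + d * (expectation h + expectation k)"
        if "integrable M f" "integrable M g" "integrable M h" "integrable M k" for f g h k :: "'a \<Rightarrow> real" and c d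
        using that by simp
      have "Suc (2 * m) \<le> 2 * Suc m" "1 \<le> 2 * Suc m" "2 * m \<le> 2 * Suc m" "2 \<le> 2 * Suc m" by auto
      note b = pr[OF this(1,2)] pr[OF this(3,4)]
      show ?thesis unfolding lin[OF iS[OF order_refl] b(1) b(3) intX[OF i order_refl]] b(2) b(4) ..
    qed
    also have "\<dots> = expectation (\<lambda>\<omega>. ?S \<omega> ^ (2 * Suc m)) +
        4 ^ Suc m * (expectation (\<lambda>\<omega>. ?S \<omega> ^ (2 * m)) * expectation (\<lambda>\<omega>. X i \<omega> ^ 2) + expectation (\<lambda>\<omega>. X i \<omega> ^ (2 * Suc m)))"
      using zero[OF i] by simp
    also have "\<dots> \<le> C' * ?n ^ Suc m + 4 ^ Suc m * ((C * ?n ^ m) * K' + K')"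
    proof (intro add_mono mult_left_mono mult_mono)
      show "expectation (\<lambda>\<omega>. X i \<omega> ^ 2) \<le> K'" using K'(1)[OF i, of 1] by simp
      show "0 \<le> expectation (\<lambda>\<omega>. X i \<omega> ^ 2)" by simp
    qed (use IHJ C(3)[of J] C(1) J K'(1)[OF i, of "Suc m"] in auto)
    also have "\<dots> \<le> C' * ?n ^ Suc m + 4 ^ Suc m * ((C * (?n + 1) ^ m) * K' + K' * (?n + 1) ^ m)"
    proof (intro add_left_mono mult_left_mono add_mono mult_right_mono)
      show "K' \<le> K' * (?n + 1) ^ m" using K'1 one_le_power[of "?n + 1" m] by (simp add: mult_le_cancel_left1)
    qed (use C(1) K'1 in \<open>auto intro!: power_mono\<close>)
    also have "\<dots> = C' * (?n ^ Suc m + (?n + 1) ^ m)" by (simp add: C'_def algebra_simps)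
    also have "\<dots> \<le> C' * (?n * (?n + 1) ^ m + (?n + 1) ^ m)"
      using C' by (intro mult_left_mono add_right_mono) (auto intro!: mult_left_mono power_mono)
    also have "\<dots> = C' * real (card (insert i J)) ^ Suc m" using J by (simp add: algebra_simps)
    finally show ?case using int' by blast
  qed
  then show ?case using C' by blast
qed

subsection \<open>Independent and identically distributed edge weights\<close>

definition ball_edges :: "int ^ 'n::finite \<Rightarrow> nat \<Rightarrow> (int ^ 'n) set set" where
  "ball_edges x r = {e \<in> edges. \<forall>z\<in>e. l1 (z - x) \<le> int r}"

lemma finite_l1_ball: "finite {z :: int ^ 'n::finite. l1 (z - x) \<le> int r}"
proof (rule finite_subset)
  show "{z. l1 (z - x) \<le> int r} \<subseteq> {z. \<forall>j. z $ j \<in> {x $ j - int r..x $ j + int r}}"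
  proof clarify
    fix z j assume "l1 (z - x) \<le> int r"
    then have "\<bar>z $ j - x $ j\<bar> \<le> int r" using abs_component_le_l1[of "z - x" j] by simp
    then show "z $ j \<in> {x $ j - int r..x $ j + int r}" by auto
  qed
qed (rule finite_int_box, simp)

lemma finite_ball_edges [simp]: "finite (ball_edges x r)"
  by (rule finite_subset[of _ "Pow {z. l1 (z - x) \<le> int r}"]) (auto simp: ball_edges_def finite_l1_ball)

lemma ball_edges_subset: "ball_edges x r \<subseteq> edges"
  by (auto simp: ball_edges_def)

lemma ball_edges_mono:
  assumes "l1 (y - x) + int r \<le> int s" shows "ball_edges y r \<subseteq> ball_edges x s"
proof -
  have "l1 (z - x) \<le> l1 (z - y) + l1 (y - x)" for z
    using l1_triangle[of "z - y" "y - x"] by simp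
  then have "l1 (z - y) \<le> int r \<Longrightarrow> l1 (z - x) \<le> int s" for z
    using assms by (smt (verit))
  then show ?thesis unfolding ball_edges_def by blast
qed

lemma path_edges_ball:
  assumes "path_between x y xs" "length xs \<le> r" shows "path_edges xs \<subseteq> ball_edges x r"
proof
  fix e assume e: "e \<in> path_edges xs"
  have "l1 (z - x) \<le> int r" if "z \<in> e" for z
    using path_vertex_l1[OF assms(1), of z] path_edges_vertices[OF e] that assms(2) by auto
  then show "e \<in> ball_edges x r" using e path_between_edges[OF assms(1)] by (auto simp: ball_edges_def)
qed

locale iid_environment = prob_space M for M :: "'a measure" +
  fixes \<tau> :: "(int ^ 'n::finite) set \<Rightarrow> 'a \<Rightarrow> real" and F :: "real measure"
  assumes indep: "indep_vars (\<lambda>_. borel) \<tau> edges"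
    and law: "\<And>e. e \<in> edges \<Longrightarrow> distr M borel (\<tau> e) = F"
    and nonneg: "\<And>e \<omega>. e \<in> edges \<Longrightarrow> \<omega> \<in> space M \<Longrightarrow> 0 \<le> \<tau> e \<omega>"
begin

lemma weight_measurable: "e \<in> edges \<Longrightarrow> \<tau> e \<in> borel_measurable M"
  using indep by (auto simp: indep_vars_def)

lemma prob_weight:
  assumes "e \<in> edges" "B \<in> sets borel"
  shows "prob {\<omega> \<in> space M. \<tau> e \<omega> \<in> B} = measure F B"
proof -
  have "measure F B = prob (\<tau> e -` B \<inter> space M)"
    unfolding law[OF assms(1), symmetric] by (rule measure_distr[OF weight_measurable[OF assms(1)] assms(2)])
  also have "\<tau> e -` B \<inter> space M = {\<omega> \<in> space M. \<tau> e \<omega> \<in> B}" by auto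
  finally show ?thesis by simp
qed

lemma nonneg_env: "\<omega> \<in> space M \<Longrightarrow> nonneg_env (\<lambda>e. \<tau> e \<omega>)"
  by (simp add: nonneg_env_def nonneg)

text \<open>The \<open>\<sigma>\<close>-algebra of the weights on \<open>J\<close>, encoded as a measure space so that functions of these weights
can be shown to be measurable by the usual rules.\<close>

definition field :: "(int ^ 'n) set set \<Rightarrow> 'a measure" where
  "field J = sigma (space M) (\<Union>e\<in>J. {\<tau> e -` B \<inter> space M | B. B \<in> sets borel})"

lemma field_gen: "(\<Union>e\<in>J. {\<tau> e -` B \<inter> space M | B. B \<in> sets borel}) \<subseteq> Pow (space M)"
  by auto

lemma space_field [simp]: "space (field J) = space M"
  unfolding field_def by (rule space_measure_of[OF field_gen])

lemma sets_field: "sets (field J) = sigma_sets (space M) (\<Union>e\<in>J. {\<tau> e -` B \<inter> space M | B. B \<in> sets borel})"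
  unfolding field_def by (rule sets_measure_of[OF field_gen])

lemma weight_field: "e \<in> J \<Longrightarrow> \<tau> e \<in> borel_measurable (field J)"
  by (rule measurableI) (auto simp: sets_field intro!: sigma_sets.Basic)

lemma field_mono: "J \<subseteq> J' \<Longrightarrow> sets (field J) \<subseteq> sets (field J')"
  unfolding sets_field by (intro sigma_sets_mono') auto

lemma field_events: "J \<subseteq> edges \<Longrightarrow> A \<in> sets (field J) \<Longrightarrow> A \<in> events"
proof -
  assume J: "J \<subseteq> edges" and A: "A \<in> sets (field J)"
  have "sigma_sets (space M) (\<Union>e\<in>J. {\<tau> e -` B \<inter> space M | B. B \<in> sets borel}) \<subseteq> events"
    using J by (intro sets.sigma_sets_subset) (auto intro!: measurable_sets[OF weight_measurable])
  then show ?thesis using A by (auto simp: sets_field)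
qed

text \<open>Events that depend on disjoint sets of edges are independent, by grouping the independent families
of all edges.\<close>

lemma field_indep:
  assumes "finite I" "I \<noteq> {}" "\<And>i. i \<in> I \<Longrightarrow> J i \<subseteq> edges" "disjoint_family_on J I"
    "\<And>i. i \<in> I \<Longrightarrow> A i \<in> sets (field (J i))"
  shows "prob (\<Inter>i\<in>I. A i) = (\<Prod>i\<in>I. prob (A i))"
proof -
  have "indep_sets (\<lambda>e. {\<tau> e -` B \<inter> space M | B. B \<in> sets borel}) (\<Union>i\<in>I. J i)"
    by (rule indep_sets_mono_index[of _ edges]) (use indep assms(3) in \<open>auto simp: indep_vars_def2\<close>)
  moreover have "Int_stable {\<tau> e -` B \<inter> space M | B. B \<in> sets borel}" for e
  proof (rule Int_stableI)
    fix a b assume "a \<in> {\<tau> e -` B \<inter> space M | B. B \<in> sets borel}" "b \<in> {\<tau> e -` B \<inter> space M | B. B \<in> sets borel}"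
    then obtain B B' where B: "B \<in> sets borel" "B' \<in> sets borel" "a = \<tau> e -` B \<inter> space M" "b = \<tau> e -` B' \<inter> space M" by auto
    then have "a \<inter> b = \<tau> e -` (B \<inter> B') \<inter> space M" "B \<inter> B' \<in> sets borel" by auto
    then show "a \<inter> b \<in> {\<tau> e -` B \<inter> space M | B. B \<in> sets borel}" by blast
  qed
  ultimately have "indep_sets (\<lambda>i. sigma_sets (space M) (\<Union>e\<in>J i. {\<tau> e -` B \<inter> space M | B. B \<in> sets borel})) I"
    by (intro indep_sets_collect_sigma assms(4))
  then show ?thesis
    by (rule indep_setsD) (use assms in \<open>auto simp: sets_field\<close>)
qed

lemma field_indep2:
  assumes "J1 \<subseteq> edges" "J2 \<subseteq> edges" "J1 \<inter> J2 = {}" "A \<in> sets (field J1)" "B \<in> sets (field J2)"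
  shows "prob (A \<inter> B) = prob A * prob B"
  using field_indep[of UNIV "\<lambda>b. if b then J1 else J2" "\<lambda>b. if b then A else B"] assms
  by (auto simp: UNIV_bool disjoint_family_on_def Int_commute)

lemma conn_sets:
  assumes "finite R" "\<And>e. e \<in> R \<Longrightarrow> \<eta> e \<in> borel_measurable N"
  shows "{\<omega> \<in> space N. conn (\<lambda>e. \<eta> e \<omega>) R x y c} \<in> sets N"
proof -
  let ?E = "{path_edges xs | xs. path_between x y xs \<and> path_edges xs \<subseteq> R}"
  have "finite ?E" by (rule finite_subset[of _ "Pow R"]) (use assms(1) in auto)
  moreover have "{\<omega> \<in> space N. conn (\<lambda>e. \<eta> e \<omega>) R x y c} = (\<Union>E\<in>?E. {\<omega> \<in> space N. (\<Sum>e\<in>E. \<eta> e \<omega>) \<le> c})"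
    by (auto simp: conn_def passage_time_def)
  moreover have "{\<omega> \<in> space N. (\<Sum>e\<in>E. \<eta> e \<omega>) \<le> c} \<in> sets N" if "E \<in> ?E" for E
  proof -
    have "(\<lambda>\<omega>. \<Sum>e\<in>E. \<eta> e \<omega>) \<in> borel_measurable N" using that assms(2) by (intro borel_measurable_sum) auto
    then show ?thesis by measurable
  qed
  ultimately show ?thesis by (auto intro!: sets.finite_UN)
qed

end

context iid_environment
begin

text \<open>Markov's inequality for the moment of order \<open>2 * m\<close> of the centred sum, which is of the order of
\<open>card J ^ m\<close>.\<close>

lemma tail_sum:
  assumes int: "\<forall>e\<in>edges. integrable M (\<lambda>\<omega>. \<tau> e \<omega> ^ (2 * m))" and m: "1 \<le> m"
  shows "\<exists>C>0. \<exists>\<mu>\<ge>0. \<forall>J N. finite J \<and> J \<subseteq> edges \<and> 0 < N \<longrightarrow>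
    prob {\<omega> \<in> space M. \<mu> * real (card J) + N \<le> (\<Sum>e\<in>J. \<tau> e \<omega>)} \<le> C * real (card J) ^ m / N ^ (2 * m)"
proof -
  define \<mu> where "\<mu> = max 0 (\<integral>x. x \<partial>F)"
  define X where "X = (\<lambda>e \<omega>. \<tau> e \<omega> - \<mu>)"
  have intk: "integrable M (\<lambda>\<omega>. \<tau> e \<omega> ^ k)" if "e \<in> edges" "k \<le> 2 * m" for e k
    using integrable_power_le[OF bspec[OF int that(1)] weight_measurable[OF that(1)] that(2)] .
  have int1: "integrable M (\<tau> e)" if "e \<in> edges" for e using intk[OF that, of 1] m by simp
  have fdistr: "expectation (\<lambda>\<omega>. f (\<tau> e \<omega>)) = (\<integral>x. f x \<partial>F)"
    if "e \<in> edges" "f \<in> borel_measurable borel" for e and f :: "real \<Rightarrow> real"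
    unfolding law[OF that(1), symmetric]
    by (rule integral_distr[symmetric]) (use weight_measurable that in auto)
  have mu: "expectation (\<tau> e) = \<mu>" if "e \<in> edges" for e
  proof -
    have "0 \<le> expectation (\<tau> e)" by (rule integral_nonneg_AE) (use nonneg that in auto)
    then show ?thesis using fdistr[OF that, of "\<lambda>x. x"] by (simp add: \<mu>_def)
  qed
  have intX: "integrable M (\<lambda>\<omega>. X e \<omega> ^ k)" if "e \<in> edges" "k \<le> 2 * m" for e k
  proof -
    have "X e \<omega> ^ k = (\<Sum>j\<le>k. real (k choose j) * \<tau> e \<omega> ^ j * (- \<mu>) ^ (k - j))" for \<omega>
      unfolding X_def using binomial_ring[of "\<tau> e \<omega>" "- \<mu>" k] by simp
    then show ?thesis using that intk
      by (simp add: mult.assoc mult.left_commute[of _ "\<tau> e _ ^ _"]) (intro Bochner_Integration.integrable_sum integrable_mult_right integrable_mult_left, auto)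
  qed
  define K where "K = Max ((\<lambda>k. \<integral>x. (x - \<mu>) ^ (2 * k) \<partial>F) ` {..m})"
  have indX: "indep_vars (\<lambda>_. borel) X edges"
    unfolding X_def by (rule indep_vars_compose2[OF indep]) auto
  obtain C where C: "0 < C" "\<And>J. finite J \<Longrightarrow> J \<subseteq> edges \<Longrightarrow> integrable M (\<lambda>\<omega>. (\<Sum>i\<in>J. X i \<omega>) ^ (2 * m))"
    "\<And>J. finite J \<Longrightarrow> J \<subseteq> edges \<Longrightarrow> expectation (\<lambda>\<omega>. (\<Sum>i\<in>J. X i \<omega>) ^ (2 * m)) \<le> C * real (card J) ^ m"
  proof -
    have "\<exists>C>0. \<forall>J. finite J \<and> J \<subseteq> edges \<longrightarrow> integrable M (\<lambda>\<omega>. (\<Sum>i\<in>J. X i \<omega>) ^ (2 * m)) \<and>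
      expectation (\<lambda>\<omega>. (\<Sum>i\<in>J. X i \<omega>) ^ (2 * m)) \<le> C * real (card J) ^ m"
    proof (rule even_moment_sum_le[OF indX])
      fix e :: "(int ^ 'n) set" assume e: "e \<in> edges"
      show "integrable M (\<lambda>\<omega>. X e \<omega> ^ (2 * m))" using intX[OF e] by simp
      show "expectation (X e) = 0" using mu[OF e] int1[OF e] by (simp add: X_def prob_space)
      fix k assume "k \<le> m"
      then show "expectation (\<lambda>\<omega>. X e \<omega> ^ (2 * k)) \<le> K"
        unfolding X_def K_def using fdistr[OF e, of "\<lambda>x. (x - \<mu>) ^ (2 * k)"] by (auto intro!: Max_ge)
    qed
    then show ?thesis using that by blast
  qed
  have "prob {\<omega> \<in> space M. \<mu> * real (card J) + N \<le> (\<Sum>e\<in>J. \<tau> e \<omega>)} \<le> C * real (card J) ^ m / N ^ (2 * m)"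
    if J: "finite J" "J \<subseteq> edges" and N: "0 < N" for J and N :: real
  proof -
    let ?S = "\<lambda>\<omega>. \<Sum>e\<in>J. X e \<omega>"
    have "?S \<omega> = (\<Sum>e\<in>J. \<tau> e \<omega>) - \<mu> * real (card J)" for \<omega>
      unfolding X_def by (simp add: sum_subtractf mult.commute)
    then have "{\<omega> \<in> space M. \<mu> * real (card J) + N \<le> (\<Sum>e\<in>J. \<tau> e \<omega>)} \<subseteq> {\<omega> \<in> space M. N ^ (2 * m) \<le> ?S \<omega> ^ (2 * m)}"
      using N by (auto intro!: power_mono)
    moreover have "{\<omega> \<in> space M. N ^ (2 * m) \<le> ?S \<omega> ^ (2 * m)} \<in> events"
    proof -
      have "(\<lambda>\<omega>. ?S \<omega> ^ (2 * m)) \<in> borel_measurable M" using C(2)[OF J] by auto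
      then show ?thesis by measurable
    qed
    ultimately have "prob {\<omega> \<in> space M. \<mu> * real (card J) + N \<le> (\<Sum>e\<in>J. \<tau> e \<omega>)} \<le> prob {\<omega> \<in> space M. N ^ (2 * m) \<le> ?S \<omega> ^ (2 * m)}"
      by (rule finite_measure_mono)
    also have "\<dots> \<le> expectation (\<lambda>\<omega>. ?S \<omega> ^ (2 * m)) / N ^ (2 * m)"
      by (rule integral_Markov_inequality_measure[OF C(2)[OF J], of "{}"]) (use N in auto)
    also have "\<dots> \<le> C * real (card J) ^ m / N ^ (2 * m)"
      using C(3)[OF J] N by (intro divide_right_mono) auto
    finally show ?thesis .
  qed
  moreover have "0 \<le> \<mu>" by (simp add: \<mu>_def)
  ultimately show ?thesis using C(1) by (intro exI[of _ C] exI[of _ \<mu>] conjI allI impI) simp_all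
qed

text \<open>Connections that are fast for the raised weights remain fast when some of the weights are replaced
by numbers up to \<open>a\<close>. This permits the upper bounds for passage times to be used next to a region in
which weights have been prescribed.\<close>

abbreviation raised :: "real \<Rightarrow> 'a \<Rightarrow> (int ^ 'n) set \<Rightarrow> real" where
  "raised a \<omega> \<equiv> (\<lambda>e. \<tau> e \<omega> + a)"

lemma conn_raised_sets: "{\<omega> \<in> space M. conn (raised a \<omega>) (ball_edges x r) y z c} \<in> events"
proof (rule conn_sets[OF finite_ball_edges])
  fix e assume "e \<in> ball_edges x r"
  then have "e \<in> edges" using ball_edges_subset by blast
  then show "(\<lambda>\<omega>. raised a \<omega> e) \<in> borel_measurable M" using weight_measurable by simp
qed

lemma not_conn_raised_sets: "{\<omega> \<in> space M. \<not> conn (raised a \<omega>) (ball_edges x r) y z c} \<in> events"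
proof -
  have "{\<omega> \<in> space M. \<not> conn (raised a \<omega>) (ball_edges x r) y z c} = space M - {\<omega> \<in> space M. conn (raised a \<omega>) (ball_edges x r) y z c}"
    by auto
  then show ?thesis using conn_raised_sets by auto
qed

lemma nonneg_env_raised: "\<omega> \<in> space M \<Longrightarrow> 0 \<le> a \<Longrightarrow> nonneg_env (raised a \<omega>)"
  by (simp add: nonneg_env_def nonneg)

text \<open>A passage from \<open>v\<close> to \<open>v + axis i n\<close> is slow only if all of the \<open>2 * CARD('n)\<close> edge-disjoint paths
are. Their times are independent, and each of them is slow with probability of the order of
\<open>N powr (- m)\<close>.\<close>

lemma axis_passage_long:
  assumes int: "\<forall>e\<in>edges. integrable M (\<lambda>\<omega>. \<tau> e \<omega> ^ (2 * m))" and m: "1 \<le> m"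
    and d: "2 \<le> CARD('n)" and a: "0 \<le> a"
  shows "\<exists>B>0. \<exists>C>0. \<forall>N\<ge>1. \<forall>v i n. 2 \<le> n \<and> n \<le> 3 * N \<longrightarrow>
    prob {\<omega> \<in> space M. \<not> conn (raised a \<omega>) (ball_edges v (16 * N)) v (v + axis i (int n)) (B * real N)}
      \<le> C / real N ^ (2 * CARD('n) * m)"
proof -
  obtain C \<mu> where C: "0 < C" "0 \<le> \<mu>" and tail0: "\<forall>J N. finite J \<and> J \<subseteq> edges \<and> 0 < N \<longrightarrow>
    prob {\<omega> \<in> space M. \<mu> * real (card J) + N \<le> (\<Sum>e\<in>J. \<tau> e \<omega>)} \<le> C * real (card J) ^ m / N ^ (2 * m)"
    using tail_sum[OF int m] by (elim exE conjE)
  have tail: "prob {\<omega> \<in> space M. \<mu> * real (card J) + N \<le> (\<Sum>e\<in>J. \<tau> e \<omega>)} \<le> C * real (card J) ^ m / N ^ (2 * m)"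
    if "finite J" "J \<subseteq> edges" "0 < N" for J N
    using tail0 that by simp
  define B where "B = 16 * (\<mu> + a) + 1"
  have B: "0 < B" using C a by (simp add: B_def add_nonneg_pos)
  have "prob {\<omega> \<in> space M. \<not> conn (raised a \<omega>) (ball_edges v (16 * N)) v (v + axis i (int n)) (B * real N)}
      \<le> (C * 16 ^ m) ^ (2 * CARD('n)) / real N ^ (2 * CARD('n) * m)"
    if N: "1 \<le> N" and n: "2 \<le> n" "n \<le> 3 * N" for N v i n
  proof -
    obtain P :: "'n \<times> bool \<Rightarrow> (int ^ 'n) list" where
      P0: "\<forall>q. path_between v (v + axis i (int n)) (P q) \<and> length (P q) \<le> n + 13"
      "\<forall>q q'. q \<noteq> q' \<longrightarrow> path_edges (P q) \<inter> path_edges (P q') = {}"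
      using axis_edge_disjoint_paths[OF d n(1), of v i] by (elim exE conjE)
    have P: "path_between v (v + axis i (int n)) (P q)" "length (P q) \<le> n + 13"
      "q \<noteq> q' \<Longrightarrow> path_edges (P q) \<inter> path_edges (P q') = {}" for q q'
      using P0 by blast+
    have len: "length (P q) \<le> 16 * N" for q using P(2)[of q] n N by linarith
    have sub: "path_edges (P q) \<subseteq> edges" for q using path_between_edges[OF P(1)] .
    define A where "A = (\<lambda>q. {\<omega> \<in> space M. B * real N < (\<Sum>e\<in>path_edges (P q). \<tau> e \<omega> + a)})"
    have Am: "A q \<in> sets (field (path_edges (P q)))" for q
    proof -
      have "(\<lambda>\<omega>. \<Sum>e\<in>path_edges (P q). \<tau> e \<omega> + a) \<in> borel_measurable (field (path_edges (P q)))"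
        by (intro borel_measurable_sum borel_measurable_add weight_field) auto
      then have "{\<omega> \<in> space (field (path_edges (P q))). B * real N < (\<Sum>e\<in>path_edges (P q). \<tau> e \<omega> + a)} \<in> sets (field (path_edges (P q)))"
        by measurable
      then show ?thesis by (simp add: A_def)
    qed
    have Aev: "A q \<in> events" for q using field_events[OF sub Am] .
    have pA: "prob (A q) \<le> C * 16 ^ m / real N ^ m" for q
    proof -
      let ?J = "path_edges (P q)"
      have card: "card ?J \<le> 16 * N" using card_path_edges[of "P q"] len[of q] by linarith
      then have cr: "real (card ?J) \<le> 16 * real N" by (metis of_nat_le_iff of_nat_mult of_nat_numeral)
      have "A q \<subseteq> {\<omega> \<in> space M. \<mu> * real (card ?J) + real N \<le> (\<Sum>e\<in>?J. \<tau> e \<omega>)}"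
      proof
        fix \<omega> assume "\<omega> \<in> A q"
        then have w: "\<omega> \<in> space M" "B * real N < (\<Sum>e\<in>?J. \<tau> e \<omega>) + real (card ?J) * a"
          by (auto simp: A_def sum.distrib)
        have "(\<mu> + a) * real (card ?J) \<le> (\<mu> + a) * (16 * real N)"
          using cr C a by (intro mult_left_mono) auto
        then have "\<mu> * real (card ?J) + real N \<le> (\<Sum>e\<in>?J. \<tau> e \<omega>)"
          using w(2) by (simp add: B_def algebra_simps)
        then show "\<omega> \<in> {\<omega> \<in> space M. \<mu> * real (card ?J) + real N \<le> (\<Sum>e\<in>?J. \<tau> e \<omega>)}" using w by simp
      qed
      moreover have "{\<omega> \<in> space M. \<mu> * real (card ?J) + real N \<le> (\<Sum>e\<in>?J. \<tau> e \<omega>)} \<in> events"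
      proof -
        have "(\<lambda>\<omega>. \<Sum>e\<in>?J. \<tau> e \<omega>) \<in> borel_measurable M"
          using sub[of q] weight_measurable by (intro borel_measurable_sum) auto
        then show ?thesis by measurable
      qed
      ultimately have "prob (A q) \<le> prob {\<omega> \<in> space M. \<mu> * real (card ?J) + real N \<le> (\<Sum>e\<in>?J. \<tau> e \<omega>)}"
        by (rule finite_measure_mono)
      also have "\<dots> \<le> C * real (card ?J) ^ m / real N ^ (2 * m)"
        by (rule tail) (use sub N in auto)
      also have "\<dots> \<le> C * (16 * real N) ^ m / real N ^ (2 * m)"
        using cr C by (intro divide_right_mono mult_left_mono power_mono) auto
      also have "\<dots> = C * 16 ^ m / real N ^ m"
        using N by (simp add: power_mult_distrib mult_2 power_add)
      finally show ?thesis .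
    qed
    have "{\<omega> \<in> space M. \<not> conn (raised a \<omega>) (ball_edges v (16 * N)) v (v + axis i (int n)) (B * real N)} \<subseteq> (\<Inter>q\<in>UNIV. A q)"
    proof (intro subsetI INT_I)
      fix \<omega> q assume w: "\<omega> \<in> {\<omega> \<in> space M. \<not> conn (raised a \<omega>) (ball_edges v (16 * N)) v (v + axis i (int n)) (B * real N)}"
      have "path_edges (P q) \<subseteq> ball_edges v (16 * N)" by (rule path_edges_ball[OF P(1) len])
      then have "\<not> passage_time (raised a \<omega>) (P q) \<le> B * real N" using w P(1)[of q] by (auto simp: conn_def)
      then show "\<omega> \<in> A q" using w by (simp add: A_def passage_time_def)
    qed
    moreover have "(\<Inter>q\<in>UNIV. A q) \<in> events" using Aev by (intro sets.finite_INT) auto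
    ultimately have "prob {\<omega> \<in> space M. \<not> conn (raised a \<omega>) (ball_edges v (16 * N)) v (v + axis i (int n)) (B * real N)} \<le> prob (\<Inter>q\<in>UNIV. A q)"
      by (rule finite_measure_mono)
    also have "\<dots> = (\<Prod>q\<in>UNIV. prob (A q))"
      by (rule field_indep[where J = "\<lambda>q. path_edges (P q)"]) (use sub P(3) Am in \<open>auto simp: disjoint_family_on_def\<close>)
    also have "\<dots> \<le> (\<Prod>q\<in>(UNIV :: ('n \<times> bool) set). C * 16 ^ m / real N ^ m)"
      by (intro prod_mono conjI pA) auto
    also have "\<dots> = (C * 16 ^ m) ^ (2 * CARD('n)) / real N ^ (2 * CARD('n) * m)"
      by (simp add: power_divide power_mult[symmetric] mult.commute mult.left_commute)
    finally show ?thesis .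
  qed
  moreover have "0 < (C * 16 ^ m) ^ (2 * CARD('n))" using C by simp
  ultimately show ?thesis using B by (intro exI[of _ B] exI[of _ "(C * 16 ^ m) ^ (2 * CARD('n))"] conjI allI impI) simp_all
qed

text \<open>The edge-disjoint paths exist only between points at distance at least two. A short passage is
composed of two long ones, by way of a common point further along the axis; a negative direction is
the reversal of a positive one.\<close>

lemma axis_passage:
  assumes int: "\<forall>e\<in>edges. integrable M (\<lambda>\<omega>. \<tau> e \<omega> ^ (2 * m))" and m: "1 \<le> m"
    and d: "2 \<le> CARD('n)" and a: "0 \<le> a"
  shows "\<exists>B>0. \<exists>C>0. \<forall>N\<ge>1. \<forall>v i c. \<bar>c\<bar> \<le> int N \<longrightarrow>
    prob {\<omega> \<in> space M. \<not> conn (raised a \<omega>) (ball_edges v (20 * N)) v (v + axis i c) (B * real N)}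
      \<le> C / real N ^ (2 * CARD('n) * m)"
proof -
  obtain B C where B: "0 < B" "0 < C" and long0: "\<forall>N\<ge>1. \<forall>v i n. 2 \<le> n \<and> n \<le> 3 * N \<longrightarrow>
    prob {\<omega> \<in> space M. \<not> conn (raised a \<omega>) (ball_edges v (16 * N)) v (v + axis i (int n)) (B * real N)}
      \<le> C / real N ^ (2 * CARD('n) * m)"
    using axis_passage_long[OF assms] by (elim exE conjE)
  have long: "prob {\<omega> \<in> space M. \<not> conn (raised a \<omega>) (ball_edges v (16 * N)) v (v + axis i (int n)) (B * real N)}
      \<le> C / real N ^ (2 * CARD('n) * m)" if "1 \<le> N" "2 \<le> n" "n \<le> 3 * N" for N v i n
    using long0 that by simp
  have pos: "prob {\<omega> \<in> space M. \<not> conn (raised a \<omega>) (ball_edges v (19 * N)) v (v + axis i (int n)) (2 * B * real N)}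
      \<le> 2 * C / real N ^ (2 * CARD('n) * m)" if N: "1 \<le> N" and n: "n \<le> N" for N v i n
  proof -
    let ?z = "v + axis i (int n)"
    let ?w = "v + axis i (int (n + 2))"
    have w: "?w = ?z + axis i (int 2)" by (auto simp: vec_eq_iff axis_def)
    let ?A = "{\<omega> \<in> space M. \<not> conn (raised a \<omega>) (ball_edges v (16 * N)) v ?w (B * real N)}"
    let ?B = "{\<omega> \<in> space M. \<not> conn (raised a \<omega>) (ball_edges ?z (16 * N)) ?z ?w (B * real N)}"
    have b1: "ball_edges v (16 * N) \<subseteq> ball_edges v (19 * N)" by (rule ball_edges_mono) simp
    have b2: "ball_edges ?z (16 * N) \<subseteq> ball_edges v (19 * N)" by (rule ball_edges_mono) (use n in simp)
    have "{\<omega> \<in> space M. \<not> conn (raised a \<omega>) (ball_edges v (19 * N)) v ?z (2 * B * real N)} \<subseteq> ?A \<union> ?B"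
    proof (rule subsetI, rule ccontr)
      fix \<omega> assume w: "\<omega> \<in> {\<omega> \<in> space M. \<not> conn (raised a \<omega>) (ball_edges v (19 * N)) v ?z (2 * B * real N)}" "\<omega> \<notin> ?A \<union> ?B"
      then have c: "conn (raised a \<omega>) (ball_edges v (16 * N)) v ?w (B * real N)"
        "conn (raised a \<omega>) (ball_edges ?z (16 * N)) ?z ?w (B * real N)" and sp: "\<omega> \<in> space M" by auto
      have "conn (raised a \<omega>) (ball_edges v (19 * N)) v ?z (B * real N + B * real N)"
        by (rule conn_trans[OF nonneg_env_raised[OF sp a] conn_mono[OF c(1) b1 order_refl] conn_sym[OF conn_mono[OF c(2) b2 order_refl]]])
      then show False using w(1) by (simp add: mult.assoc)
    qed
    moreover have "?A \<in> events" "?B \<in> events" by (rule not_conn_raised_sets)+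
    ultimately have "prob {\<omega> \<in> space M. \<not> conn (raised a \<omega>) (ball_edges v (19 * N)) v ?z (2 * B * real N)} \<le> prob ?A + prob ?B"
      by (meson finite_measure_mono measure_Un_le order_trans sets.Un)
    also have "\<dots> \<le> C / real N ^ (2 * CARD('n) * m) + C / real N ^ (2 * CARD('n) * m)"
    proof (rule add_mono)
      show "prob ?A \<le> C / real N ^ (2 * CARD('n) * m)" by (rule long) (use N n in auto)
      show "prob ?B \<le> C / real N ^ (2 * CARD('n) * m)" unfolding w by (rule long) (use N n in auto)
    qed
    finally show ?thesis by simp
  qed
  have "prob {\<omega> \<in> space M. \<not> conn (raised a \<omega>) (ball_edges v (20 * N)) v (v + axis i c) (2 * B * real N)}
      \<le> 2 * C / real N ^ (2 * CARD('n) * m)" if N: "1 \<le> N" and c: "\<bar>c\<bar> \<le> int N" for N v i c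
  proof (cases "0 \<le> c")
    case True
    then have cn: "c = int (nat c)" "nat c \<le> N" using c by auto
    have "ball_edges v (19 * N) \<subseteq> ball_edges v (20 * N)" by (rule ball_edges_mono) simp
    then have "{\<omega> \<in> space M. \<not> conn (raised a \<omega>) (ball_edges v (20 * N)) v (v + axis i c) (2 * B * real N)}
      \<subseteq> {\<omega> \<in> space M. \<not> conn (raised a \<omega>) (ball_edges v (19 * N)) v (v + axis i (int (nat c))) (2 * B * real N)}"
      using cn conn_mono by fastforce
    from order_trans[OF finite_measure_mono[OF this not_conn_raised_sets] pos[OF N cn(2)]] show ?thesis .
  next
    case False
    let ?z = "v + axis i c"
    have cn: "nat (-c) \<le> N" "int (nat (-c)) = -c" using c False by auto
    have z: "?z + axis i (int (nat (-c))) = v" using cn by (auto simp: vec_eq_iff axis_def)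
    have b: "ball_edges ?z (19 * N) \<subseteq> ball_edges v (20 * N)" by (rule ball_edges_mono) (use c in simp)
    have "{\<omega> \<in> space M. \<not> conn (raised a \<omega>) (ball_edges v (20 * N)) v ?z (2 * B * real N)}
      \<subseteq> {\<omega> \<in> space M. \<not> conn (raised a \<omega>) (ball_edges ?z (19 * N)) ?z (?z + axis i (int (nat (-c)))) (2 * B * real N)}"
      unfolding z using conn_sym conn_mono[OF _ b order_refl] by blast
    from order_trans[OF finite_measure_mono[OF this not_conn_raised_sets] pos[OF N cn(1)]] show ?thesis .
  qed
  moreover have "0 < 2 * B" "0 < 2 * C" using B by auto
  ultimately show ?thesis by (intro exI[of _ "2 * B"] exI[of _ "2 * C"] conjI allI impI) simp_all
qed

text \<open>General displacements are treated by changing one coordinate at a time.\<close>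

lemma passage_upper_bound:
  assumes int: "\<forall>e\<in>edges. integrable M (\<lambda>\<omega>. \<tau> e \<omega> ^ (2 * m))" and m: "1 \<le> m"
    and d: "2 \<le> CARD('n)" and a: "0 \<le> a"
  shows "\<exists>B>0. \<exists>C>0. \<forall>N\<ge>1. \<forall>x y. (\<forall>j. \<bar>y $ j - x $ j\<bar> \<le> int N) \<longrightarrow>
    prob {\<omega> \<in> space M. \<not> conn (raised a \<omega>) (ball_edges x ((20 + CARD('n)) * N)) x y (B * real N)}
      \<le> C / real N ^ (2 * CARD('n) * m)"
proof -
  obtain B C where B: "0 < B" "0 < C" and ax0: "\<forall>N\<ge>1. \<forall>v i c. \<bar>c\<bar> \<le> int N \<longrightarrow>
    prob {\<omega> \<in> space M. \<not> conn (raised a \<omega>) (ball_edges v (20 * N)) v (v + axis i c) (B * real N)}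
      \<le> C / real N ^ (2 * CARD('n) * m)"
    using axis_passage[OF assms] by (elim exE conjE)
  have ax: "prob {\<omega> \<in> space M. \<not> conn (raised a \<omega>) (ball_edges v (20 * N)) v (v + axis i c) (B * real N)}
      \<le> C / real N ^ (2 * CARD('n) * m)" if "1 \<le> N" "\<bar>c\<bar> \<le> int N" for N v i c
    using ax0 that by simp
  let ?I = "UNIV :: ('n set \<times> 'n) set"
  define C' where "C' = real (card ?I) * C"
  have "card ?I > 0" by (simp add: card_gt_0_iff)
  then have C': "0 < C'" using B by (simp add: C'_def)
  have "prob {\<omega> \<in> space M. \<not> conn (raised a \<omega>) (ball_edges x ((20 + CARD('n)) * N)) x y (real CARD('n) * B * real N)}
      \<le> C' / real N ^ (2 * CARD('n) * m)" if N: "1 \<le> N" and xy: "\<forall>j. \<bar>y $ j - x $ j\<bar> \<le> int N" for N x y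
  proof -
    let ?A = "\<lambda>(S, i). {\<omega> \<in> space M. \<not> conn (raised a \<omega>) (ball_edges (mix S x y) (20 * N)) (mix S x y)
      (mix S x y + axis i (y $ i - x $ i)) (B * real N)}"
    have b: "ball_edges (mix S x y) (20 * N) \<subseteq> ball_edges x ((20 + CARD('n)) * N)" for S
    proof (rule ball_edges_mono)
      have "l1 (mix S x y - x) \<le> (\<Sum>j\<in>(UNIV :: 'n set). int N)"
        unfolding l1_def using xy by (intro sum_mono) auto
      then show "l1 (mix S x y - x) + int (20 * N) \<le> int ((20 + CARD('n)) * N)"
        by (simp add: algebra_simps)
    qed
    have "{\<omega> \<in> space M. \<not> conn (raised a \<omega>) (ball_edges x ((20 + CARD('n)) * N)) x y (real CARD('n) * B * real N)} \<subseteq> (\<Union>q\<in>?I. ?A q)"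
    proof (rule subsetI, rule ccontr)
      fix \<omega> assume w: "\<omega> \<in> {\<omega> \<in> space M. \<not> conn (raised a \<omega>) (ball_edges x ((20 + CARD('n)) * N)) x y (real CARD('n) * B * real N)}" "\<omega> \<notin> (\<Union>q\<in>?I. ?A q)"
      then have sp: "\<omega> \<in> space M" by simp
      have "conn (raised a \<omega>) (ball_edges x ((20 + CARD('n)) * N)) x y (real CARD('n) * (B * real N))"
      proof (rule conn_mix[OF nonneg_env_raised[OF sp a]])
        fix S :: "'n set" and i assume i: "i \<notin> S"
        have "conn (raised a \<omega>) (ball_edges (mix S x y) (20 * N)) (mix S x y) (mix S x y + axis i (y $ i - x $ i)) (B * real N)"
          using w(2) sp by auto
        then show "conn (raised a \<omega>) (ball_edges x ((20 + CARD('n)) * N)) (mix S x y) (mix (insert i S) x y) (B * real N)"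
          unfolding mix_insert[OF i] by (rule conn_mono[OF _ b order_refl])
      qed (use B in simp)
      then show False using w(1) by (simp add: mult.assoc)
    qed
    moreover have Am: "?A q \<in> events" for q :: "'n set \<times> 'n" by (cases q) (simp only: prod.case not_conn_raised_sets)
    ultimately have "prob {\<omega> \<in> space M. \<not> conn (raised a \<omega>) (ball_edges x ((20 + CARD('n)) * N)) x y (real CARD('n) * B * real N)} \<le> prob (\<Union>q\<in>?I. ?A q)"
      by (intro finite_measure_mono sets.finite_UN) auto
    also have "\<dots> \<le> (\<Sum>q\<in>?I. prob (?A q))"
      by (rule finite_measure_subadditive_finite) (use Am in auto)
    also have "\<dots> \<le> (\<Sum>q\<in>?I. C / real N ^ (2 * CARD('n) * m))"
    proof (rule sum_mono)
      fix q :: "'n set \<times> 'n"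
      obtain S i where q: "q = (S, i)" by (metis surj_pair)
      show "prob (?A q) \<le> C / real N ^ (2 * CARD('n) * m)"
        unfolding q prod.case by (rule ax) (use N xy in auto)
    qed
    also have "\<dots> = C' / real N ^ (2 * CARD('n) * m)" by (simp add: C'_def)
    finally show ?thesis .
  qed
  moreover have "0 < real CARD('n) * B" using B by simp
  ultimately show ?thesis using C' by (intro exI[of _ "real CARD('n) * B"] exI[of _ C'] conjI allI impI) simp_all
qed

end

section \<open>Linear lower bounds for passage times\<close>

text \<open>The complement of the support is covered by open null sets, countably many of which suffice.\<close>

lemma support_null:
  fixes F :: "real measure"
  assumes "prob_space F" "sets F = sets borel" "open W" "W \<inter> measure_support F = {}"
  shows "measure F W = 0"
proof -
  interpret prob_space F by fact
  define U where "U = {V. open V \<and> measure F V = 0}"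
  have "W \<subseteq> \<Union>U"
  proof
    fix x assume "x \<in> W"
    then have "x \<notin> measure_support F" using assms by auto
    then obtain V where "open V" "x \<in> V" "\<not> 0 < measure F V" by (auto simp: measure_support_def)
    then have "V \<in> U" by (simp add: U_def) (metis measure_nonneg order_le_less)
    then show "x \<in> \<Union>U" using \<open>x \<in> V\<close> by auto
  qed
  obtain U' where U': "U' \<subseteq> U" "countable U'" "\<Union>U' = \<Union>U"
    using Lindelof[of U] by (auto simp: U_def)
  have "(\<Union>V\<in>U'. V) \<in> null_sets F"
  proof (rule null_sets_UN'[OF U'(2)])
    fix V assume "V \<in> U'"
    then have "open V" "measure F V = 0" using U' by (auto simp: U_def)
    then show "V \<in> null_sets F" using assms(2) by (auto simp: null_sets_def emeasure_eq_measure)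
  qed
  then have "W \<in> null_sets F"
    using \<open>W \<subseteq> \<Union>U\<close> U'(3) assms(2,3) null_sets_subset[of "\<Union>U'" F W] by auto
  then show ?thesis by (simp add: null_sets_def measure_def)
qed

lemma F_minus_facts:
  fixes F :: "real measure"
  assumes "prob_space F" "sets F = sets borel" "measure F {..<0} = 0"
  shows "0 \<le> F_minus F" "measure F {..<F_minus F} = 0" "0 < \<eta> \<Longrightarrow> 0 < measure F {..F_minus F + \<eta>}"
proof -
  interpret prob_space F by fact
  have ne: "measure_support F \<noteq> {}"
  proof
    assume "measure_support F = {}"
    then have "measure F UNIV = 0" by (intro support_null[OF assms(1,2)]) auto
    moreover have "space F = UNIV" using assms(2) sets_eq_imp_space_eq by fastforce
    ultimately show False using prob_space by simp
  qed
  have nn: "0 \<le> x" if "x \<in> measure_support F" for x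
  proof (rule ccontr)
    assume "\<not> 0 \<le> x"
    then have "0 < measure F {..<0}" using that by (auto simp: measure_support_def)
    then show False using assms(3) by simp
  qed
  have bdd: "bdd_below (measure_support F)" by (rule bdd_belowI[of _ 0]) (rule nn)
  show "0 \<le> F_minus F" unfolding F_minus_def using ne nn by (intro cInf_greatest) auto
  show "measure F {..<F_minus F} = 0"
  proof (rule support_null[OF assms(1,2)])
    show "{..<F_minus F} \<inter> measure_support F = {}"
      unfolding F_minus_def using cInf_lower[OF _ bdd] by fastforce
  qed simp
  assume "0 < \<eta>"
  then obtain s where s: "s \<in> measure_support F" "s < F_minus F + \<eta>"
    using cInf_less_iff[OF ne bdd, of "F_minus F + \<eta>"] by (auto simp: F_minus_def)
  then have "0 < measure F {..<F_minus F + \<eta>}" by (auto simp: measure_support_def)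
  also have "\<dots> \<le> measure F {..F_minus F + \<eta>}" using assms(2) by (intro finite_measure_mono) auto
  finally show "0 < measure F {..F_minus F + \<eta>}" .
qed

lemma measure_atMost_limit:
  fixes F :: "real measure"
  assumes "prob_space F" "sets F = sets borel" "measure F {..<a} = 0" "measure F {a} < p"
  shows "\<exists>\<eta>>0. measure F {..a + \<eta>} < p"
proof -
  interpret prob_space F by fact
  have "(\<lambda>n. measure F {..a + 1 / real (Suc n)}) \<longlonglongrightarrow> measure F (\<Inter>n. {..a + 1 / real (Suc n)})"
  proof (rule finite_Lim_measure_decseq)
    show "range (\<lambda>n. {..a + 1 / real (Suc n)}) \<subseteq> events" unfolding assms(2) by (rule image_subsetI) simp
    show "decseq (\<lambda>n. {..a + 1 / real (Suc n)})"
      unfolding decseq_Suc_iff atMost_subset_iff by (simp add: frac_le)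
  qed
  also have "(\<Inter>n. {..a + 1 / real (Suc n)}) = {..<a} \<union> {a}"
  proof (intro equalityI subsetI)
    fix x assume x: "x \<in> (\<Inter>n. {..a + 1 / real (Suc n)})"
    have "x \<le> a"
    proof (rule field_le_epsilon)
      fix e :: real assume "0 < e"
      then obtain n where "inverse (real (Suc n)) < e" using reals_Archimedean by blast
      then show "x \<le> a + e" using x by (auto simp: inverse_eq_divide dest!: spec[of _ n])
    qed
    then show "x \<in> {..<a} \<union> {a}" by auto
  next
    fix x assume "x \<in> {..<a} \<union> {a}"
    then have "x \<le> a" by auto
    then show "x \<in> (\<Inter>n. {..a + 1 / real (Suc n)})" by (auto intro: add_increasing2)
  qed
  also have "measure F ({..<a} \<union> {a}) = measure F {a}"
    using assms(2,3) by (subst finite_measure_Union) auto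
  finally have "\<forall>\<^sub>F n in sequentially. measure F {..a + 1 / real (Suc n)} < p"
    by (rule order_tendstoD(2)) (rule assms(4))
  then obtain n where "measure F {..a + 1 / real (Suc n)} < p" by (auto simp: eventually_sequentially)
  then show ?thesis by (intro exI[of _ "1 / real (Suc n)"]) auto
qed

subsection \<open>Levels in a coordinate orthant\<close>

text \<open>The signs \<open>\<sigma>\<close> select an orthant. Reflecting it to the positive orthant makes the results on oriented
percolation available, and \<open>lev \<sigma>\<close> corresponds to the sum of the coordinates there. If \<open>\<sigma>\<close> are the
signs of \<open>z - x\<close>, then \<open>lev \<sigma>\<close> increases by \<open>l1 (z - x)\<close> between \<open>x\<close> and \<open>z\<close>.\<close>

definition reflect :: "('n \<Rightarrow> int) \<Rightarrow> int ^ 'n::finite \<Rightarrow> int ^ 'n" where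
  "reflect \<sigma> x = (\<chi> i. \<sigma> i * x $ i)"

definition lev :: "('n \<Rightarrow> int) \<Rightarrow> int ^ 'n::finite \<Rightarrow> int" where
  "lev \<sigma> x = (\<Sum>i\<in>UNIV. \<sigma> i * x $ i)"

lemma reflect_nth [simp]: "reflect \<sigma> x $ i = \<sigma> i * x $ i"
  by (simp add: reflect_def)

lemma lev_add: "lev \<sigma> (x + y) = lev \<sigma> x + lev \<sigma> y"
  and lev_diff: "lev \<sigma> (x - y) = lev \<sigma> x - lev \<sigma> y"
  by (simp_all add: lev_def sum.distrib sum_subtractf algebra_simps)

lemma lev_axis [simp]: "lev \<sigma> (axis i c) = \<sigma> i * c"
proof -
  have "lev \<sigma> (axis i c) = (\<Sum>j\<in>UNIV. axis i (\<sigma> i * c) $ j)"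
    unfolding lev_def by (intro sum.cong) (auto simp: axis_def)
  then show ?thesis by (simp add: sum_axis)
qed

context
  fixes \<sigma> :: "'n::finite \<Rightarrow> int"
  assumes \<sigma>: "\<forall>i. \<bar>\<sigma> i\<bar> = 1"
begin

lemma sigma_square: "\<sigma> i * \<sigma> i = 1"
  using spec[OF \<sigma>, of i] by (metis abs_mult_self_eq mult_1)

lemma reflect_involution [simp]: "reflect \<sigma> (reflect \<sigma> x) = x"
  by (simp add: vec_eq_iff mult.assoc[symmetric] sigma_square)

lemma lev_reflect: "lev \<sigma> (reflect \<sigma> x) = (\<Sum>i\<in>UNIV. x $ i)"
  by (simp add: lev_def mult.assoc[symmetric] sigma_square)

lemma edge_step:
  assumes "{x, y} \<in> edges"
  obtains i c where "y = x + axis i c" "\<bar>c\<bar> = 1" "lev \<sigma> y = lev \<sigma> x + \<sigma> i * c"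
proof -
  have "l1 (y - x) = 1" using assms l1_minus_commute[of x y] by (simp add: edge_iff)
  then obtain i where i: "\<bar>(y - x) $ i\<bar> = 1" "y - x = axis i ((y - x) $ i)" by (rule l1_eq_1D)
  then have y: "y = x + axis i ((y - x) $ i)" by (metis add.commute diff_add_cancel)
  moreover have "lev \<sigma> y = lev \<sigma> x + \<sigma> i * ((y - x) $ i)" by (subst y) (simp add: lev_add)
  ultimately show ?thesis using i(1) that by blast
qed

lemma lev_edge: "{x, y} \<in> edges \<Longrightarrow> lev \<sigma> y = lev \<sigma> x + 1 \<or> lev \<sigma> y = lev \<sigma> x - 1"
proof (elim edge_step)
  fix i c assume *: "\<bar>c\<bar> = 1" "lev \<sigma> y = lev \<sigma> x + \<sigma> i * c"
  have "\<bar>\<sigma> i * c\<bar> = 1" using * spec[OF \<sigma>, of i] by (simp add: abs_mult)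
  then show ?thesis using * by linarith
qed

text \<open>A step has a defect unless it follows an oriented edge of the orthant whose weight is at most \<open>h\<close>.\<close>

fun defects :: "real \<Rightarrow> ((int ^ 'n) set \<Rightarrow> real) \<Rightarrow> (int ^ 'n) list \<Rightarrow> nat" where
  "defects h t (x # y # zs) = (if lev \<sigma> y = lev \<sigma> x + 1 \<and> t {x, y} \<le> h then 0 else 1) + defects h t (y # zs)"
| "defects h t _ = 0"

lemma defects_append: "defects h t (xs @ u # zs) = defects h t (xs @ [u]) + defects h t (u # zs)"
  by (induction xs rule: induct_list012) auto

text \<open>Only a step with a defect can lower the level, which bounds the length of a path by its gain in level
and the number of its defects.\<close>

lemma length_le_defects:
  "xs \<noteq> [] \<Longrightarrow> successively (\<lambda>x y. {x, y} \<in> edges) xs \<Longrightarrow>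
    int (length xs) \<le> 1 + (lev \<sigma> (last xs) - lev \<sigma> (hd xs)) + 2 * int (defects h t xs)"
proof (induction xs rule: induct_list012)
  case (3 x y zs)
  then show ?case using lev_edge[of x y] by (auto split: if_splits)
qed auto

text \<open>If no weight is smaller than \<open>a\<close>, a step without defect costs at least \<open>a\<close> and gains one level. A
defect costs at least \<open>\<kappa>\<close> more: either the weight exceeds \<open>h \<ge> a + \<kappa>\<close>, or the level decreases and
\<open>2 * a \<ge> \<kappa>\<close> is wasted.\<close>

lemma passage_time_defects:
  assumes "0 \<le> a" "\<kappa> \<le> 2 * a" "a + \<kappa> \<le> h" "0 \<le> \<kappa>"
  shows "xs \<noteq> [] \<Longrightarrow> distinct xs \<Longrightarrow> successively (\<lambda>x y. {x, y} \<in> edges) xs \<Longrightarrow> \<forall>e\<in>edges. a \<le> t e \<Longrightarrow>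
    a * real_of_int (lev \<sigma> (last xs) - lev \<sigma> (hd xs)) + \<kappa> * real (defects h t xs) \<le> passage_time t xs"
proof (induction xs rule: induct_list012)
  case (3 x y zs)
  have xy: "{x, y} \<in> edges" "a \<le> t {x, y}" using 3 by auto
  have "{x, y} \<notin> path_edges (y # zs)"
    using path_edges_vertices[of "{x, y}" "y # zs"] "3.prems" by auto
  then have pt: "passage_time t (x # y # zs) = t {x, y} + passage_time t (y # zs)"
    by (simp add: passage_time_def)
  have IH: "a * real_of_int (lev \<sigma> (last (y # zs)) - lev \<sigma> y) + \<kappa> * real (defects h t (y # zs)) \<le> passage_time t (y # zs)"
    using "3.IH"(2) "3.prems" by auto
  have step: "a * real_of_int (lev \<sigma> y - lev \<sigma> x) + \<kappa> * (if lev \<sigma> y = lev \<sigma> x + 1 \<and> t {x, y} \<le> h then 0 else 1) \<le> t {x, y}"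
    using lev_edge[OF xy(1)] xy(2) assms by auto
  define w :: real where "w = (if lev \<sigma> y = lev \<sigma> x + 1 \<and> t {x, y} \<le> h then 0 else 1)"
  have "real (defects h t (x # y # zs)) = w + real (defects h t (y # zs))" by (simp add: w_def)
  moreover have "a * real_of_int (lev \<sigma> (last (x # y # zs)) - lev \<sigma> (hd (x # y # zs))) =
      a * real_of_int (lev \<sigma> (last (y # zs)) - lev \<sigma> y) + a * real_of_int (lev \<sigma> y - lev \<sigma> x)"
    by (simp add: algebra_simps)
  ultimately show ?case using IH step unfolding pt w_def[symmetric] by (simp only: distrib_left)
qed (auto simp: passage_time_def)

text \<open>The first \<open>k\<close> levels of oriented percolation from \<open>x\<close> in the orthant of \<open>\<sigma>\<close>, reflected into the
positive orthant; an edge is open if its weight is at most \<open>h\<close>.\<close>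

definition fwd :: "nat \<Rightarrow> real \<Rightarrow> ((int ^ 'n) set \<Rightarrow> real) \<Rightarrow> int ^ 'n \<Rightarrow> ((int ^ 'n) \<times> (int ^ 'n)) set" where
  "fwd k h t x = {e \<in> ostep_box k. t {x + reflect \<sigma> (fst e), x + reflect \<sigma> (snd e)} \<le> h}"

lemma no_defects_fwd:
  assumes "xs \<noteq> []" "successively (\<lambda>x y. {x, y} \<in> edges) xs" "defects h t xs = 0"
    and "lev \<sigma> (last xs) - lev \<sigma> (hd xs) \<le> int k"
  shows "(0, reflect \<sigma> (last xs - hd xs)) \<in> (fwd k h t (hd xs))\<^sup>* \<and> (\<forall>j. 0 \<le> reflect \<sigma> (last xs - hd xs) $ j)"
  using assms
proof (induction xs rule: rev_induct)
  case (snoc z ys)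
  show ?case
  proof (cases "ys = []")
    case True
    then show ?thesis by (simp add: reflect_def zero_vec_def)
  next
    case False
    define u where "u = last ys"
    define x where "x = hd ys"
    obtain ws where ys: "ys = ws @ [u]" using False u_def by (metis append_butlast_last_id)
    have ysz: "ys @ [z] = ws @ u # [z]" by (simp add: ys)
    have d: "defects h t ys = 0" "lev \<sigma> z = lev \<sigma> u + 1" "t {u, z} \<le> h"
      using snoc.prems(3) unfolding ysz defects_append[of h t ws u "[z]"] by (auto simp: ys split: if_splits)
    have e: "{u, z} \<in> edges" using snoc.prems(2) False by (simp add: successively_append_iff u_def)
    have hd: "hd (ys @ [z]) = x" "last (ys @ [z]) = z" using False by (simp_all add: x_def)
    have lz: "lev \<sigma> z - lev \<sigma> x \<le> int k" using snoc.prems(4) hd by simp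
    have IH: "(0, reflect \<sigma> (u - x)) \<in> (fwd k h t x)\<^sup>*" "\<forall>j. 0 \<le> reflect \<sigma> (u - x) $ j"
      using snoc.IH[OF False _ d(1)] snoc.prems(2) lz d(2) by (auto simp: successively_append_iff u_def[symmetric] x_def[symmetric])
    obtain i c where ic: "z = u + axis i c" "\<bar>c\<bar> = 1" "lev \<sigma> z = lev \<sigma> u + \<sigma> i * c" using e by (rule edge_step)
    have c: "\<sigma> i * c = 1" using ic(3) d(2) by simp
    have zx: "reflect \<sigma> (z - x) = reflect \<sigma> (u - x) + axis i 1"
      using c by (auto simp: vec_eq_iff ic(1) axis_def algebra_simps)
    have "(\<Sum>j\<in>UNIV. reflect \<sigma> (u - x) $ j) = lev \<sigma> u - lev \<sigma> x" by (simp add: lev_def sum_subtractf algebra_simps)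
    then have "(\<Sum>j\<in>UNIV. reflect \<sigma> (u - x) $ j) < int k" using lz d(2) by simp
    then have "(reflect \<sigma> (u - x), reflect \<sigma> (z - x)) \<in> ostep_box k"
      unfolding ostep_box_def zx using IH(2) by blast
    moreover have "x + reflect \<sigma> (reflect \<sigma> (u - x)) = u" "x + reflect \<sigma> (reflect \<sigma> (z - x)) = z" by simp_all
    ultimately have "(reflect \<sigma> (u - x), reflect \<sigma> (z - x)) \<in> fwd k h t x"
      unfolding fwd_def using d(3) by simp
    then have "(0, reflect \<sigma> (z - x)) \<in> (fwd k h t x)\<^sup>*" using IH(1) by (rule rtrancl_into_rtrancl[rotated])
    moreover have "\<forall>j. 0 \<le> reflect \<sigma> (z - x) $ j" using IH(2) unfolding zx by (auto simp: axis_def)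
    ultimately show ?thesis unfolding hd by simp
  qed
qed simp

text \<open>A path that climbs \<open>J * k\<close> levels with at most \<open>D\<close> defects, seen only at the vertices where it first
reaches each multiple of \<open>k\<close>. A block without defects is an oriented path of open edges. Of a block
with \<open>D' \<ge> 1\<close> defects only the position of its last vertex is remembered, which is confined by its
length. The blocks refer to disjoint layers of edges, so that a union bound over the blocks can use
independence; this would be lost for events that quantify over whole paths.\<close>

fun chain :: "nat \<Rightarrow> real \<Rightarrow> nat \<Rightarrow> nat \<Rightarrow> ((int ^ 'n) set \<Rightarrow> real) \<Rightarrow> int ^ 'n \<Rightarrow> bool" where
  "chain k h 0 D t x \<longleftrightarrow> True"
| "chain k h (Suc J) D t x \<longleftrightarrow>
    (\<exists>y\<in>{y. (\<forall>j. 0 \<le> y $ j) \<and> (\<Sum>j\<in>UNIV. y $ j) = int k}. (0, y) \<in> (fwd k h t x)\<^sup>* \<and> chain k h J D t (x + reflect \<sigma> y)) \<or>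
    (\<exists>D'\<in>{1..D}. \<exists>u\<in>{u. l1 (u - x) \<le> int (k + 2 * D') \<and> lev \<sigma> u = lev \<sigma> x + int k}. chain k h J (D - D') t u)"

text \<open>Cut the path at the first vertex whose level exceeds the initial one by \<open>k\<close>. All its predecessors
have smaller levels, and the remainder of the path is treated by induction with the remaining
defects.\<close>

lemma path_chain:
  assumes "1 \<le> k"
  shows "xs \<noteq> [] \<Longrightarrow> successively (\<lambda>x y. {x, y} \<in> edges) xs \<Longrightarrow> defects h t xs \<le> D \<Longrightarrow>
    int (J * k) \<le> lev \<sigma> (last xs) - lev \<sigma> (hd xs) \<Longrightarrow> chain k h J D t (hd xs)"
proof (induction J arbitrary: xs D)
  case (Suc J)
  define x where "x = hd xs"
  define L where "L = lev \<sigma> x + int k"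
  have "int (Suc J * k) = int k + int (J * k)" by simp
  then have "L \<le> lev \<sigma> (last xs)" using Suc.prems(4) unfolding L_def x_def by linarith
  then have "\<exists>v\<in>set xs. L \<le> lev \<sigma> v" using Suc.prems(1) by (intro bexI[of _ "last xs"]) auto
  then obtain ys u zs where xs: "xs = ys @ u # zs" "L \<le> lev \<sigma> u" "\<forall>y\<in>set ys. \<not> L \<le> lev \<sigma> y"
    by (rule split_list_first_propE)
  have "ys \<noteq> []"
  proof
    assume "ys = []"
    then have "u = x" by (simp add: xs x_def)
    then show False using xs(2) assms by (simp add: L_def)
  qed
  then have "{last ys, u} \<in> edges" using Suc.prems(2) by (auto simp: xs(1) successively_append_iff)
  moreover have "lev \<sigma> (last ys) < L" using xs(3) last_in_set[OF \<open>ys \<noteq> []\<close>] by (simp add: not_le)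
  ultimately have u: "lev \<sigma> u = L" using lev_edge[of "last ys" u] xs(2) by linarith
  have s1: "successively (\<lambda>x y. {x, y} \<in> edges) (ys @ [u])" and s2: "successively (\<lambda>x y. {x, y} \<in> edges) (u # zs)"
    using Suc.prems(2) by (auto simp: xs(1) successively_append_iff)
  have hd1: "hd (ys @ [u]) = x" using \<open>ys \<noteq> []\<close> by (simp add: x_def xs(1))
  define D' where "D' = defects h t (ys @ [u])"
  have dd: "D' + defects h t (u # zs) \<le> D" using Suc.prems(3) unfolding xs(1) defects_append[of h t ys u zs] D'_def .
  have rest: "chain k h J (D - D') t u"
  proof -
    have "chain k h J (D - D') t (hd (u # zs))"
    proof (rule Suc.IH)
      show "int (J * k) \<le> lev \<sigma> (last (u # zs)) - lev \<sigma> (hd (u # zs))"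
        using Suc.prems(4) u by (simp add: xs(1) L_def x_def algebra_simps)
    qed (use s2 dd in auto)
    then show ?thesis by simp
  qed
  show ?case
  proof (cases "D' = 0")
    case True
    have "(0, reflect \<sigma> (last (ys @ [u]) - hd (ys @ [u]))) \<in> (fwd k h t (hd (ys @ [u])))\<^sup>* \<and>
       (\<forall>j. 0 \<le> reflect \<sigma> (last (ys @ [u]) - hd (ys @ [u])) $ j)"
      by (rule no_defects_fwd) (use s1 True D'_def hd1 u in \<open>auto simp: L_def\<close>)
    then have *: "(0, reflect \<sigma> (u - x)) \<in> (fwd k h t x)\<^sup>*" "\<forall>j. 0 \<le> reflect \<sigma> (u - x) $ j" unfolding hd1 by auto
    have "(\<Sum>j\<in>UNIV. reflect \<sigma> (u - x) $ j) = lev \<sigma> u - lev \<sigma> x" by (simp add: lev_def sum_subtractf algebra_simps)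
    then have "(\<Sum>j\<in>UNIV. reflect \<sigma> (u - x) $ j) = int k" using u by (simp add: L_def)
    moreover have "chain k h J D t (x + reflect \<sigma> (reflect \<sigma> (u - x)))" using rest True by simp
    ultimately show ?thesis unfolding chain.simps x_def[symmetric] using * by blast
  next
    case False
    have pb: "path_between x u (ys @ [u])" using s1 hd1 by (simp add: path_between_def)
    have "l1 (u - x) < int (length (ys @ [u]))" by (rule path_vertex_l1[OF pb]) simp
    also have "\<dots> \<le> 1 + (lev \<sigma> u - lev \<sigma> x) + 2 * int D'"
      using length_le_defects[OF _ s1, of h t] hd1 by (simp add: D'_def)
    finally have "l1 (u - x) \<le> int (k + 2 * D')" using u by (simp add: L_def)
    moreover have "D' \<in> {1..D}" using False dd by auto
    ultimately show ?thesis unfolding chain.simps x_def[symmetric] using rest u L_def by blast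
  qed
qed simp

end

text \<open>A defect block with \<open>i\<close> defects has polynomially many possible ends, which the weight \<open>r ^ i\<close>
compensates.\<close>

lemma geometric_budget: "\<exists>r::real. 0 < r \<and> r < 1 \<and> (\<forall>D. (\<Sum>i=1..D. (2 * real (k + 2 * i) + 1) ^ d * r ^ i) \<le> 1 / 4)"
proof -
  define A where "A = exp (real d * (2 * real k + 1))"
  define s where "s = 1 / (8 * A)"
  define r where "r = s * exp (- 4 * real d)"
  have A: "1 \<le> A" by (simp add: A_def)
  then have s: "0 < s" "s \<le> 1 / 8" by (auto simp: s_def field_simps)
  have r: "0 < r" "r < 1"
  proof -
    show "0 < r" using s by (simp add: r_def)
    have "r \<le> s * 1" unfolding r_def using s by (intro mult_left_mono) auto
    then show "r < 1" using s by simp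
  qed
  have term_le: "(2 * real (k + 2 * i) + 1) ^ d * r ^ i \<le> A * s ^ i" for i
  proof -
    have "(2 * real (k + 2 * i) + 1) ^ d \<le> exp (2 * real (k + 2 * i) + 1) ^ d"
      by (intro power_mono) (auto intro: less_imp_le[OF exp_gt_self] simp: exp_ge_add_one_self[THEN order_trans[rotated]])
    also have "\<dots> = A * exp (4 * real d) ^ i"
      by (simp add: A_def exp_of_nat_mult[symmetric] exp_add[symmetric] algebra_simps)
    finally have "(2 * real (k + 2 * i) + 1) ^ d * r ^ i \<le> A * exp (4 * real d) ^ i * r ^ i"
      using r by (intro mult_right_mono) auto
    also have "\<dots> = A * (exp (4 * real d) * r) ^ i" by (simp add: power_mult_distrib)
    also have "exp (4 * real d) * r = s" by (simp add: r_def exp_minus)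
    finally show ?thesis .
  qed
  have geo: "(\<Sum>i=1..D. s ^ i) + 2 * s ^ Suc D \<le> 2 * s" for D
  proof (induction D)
    case (Suc D)
    have "s * s ^ Suc D \<le> 1 / 2 * s ^ Suc D" using s by (intro mult_right_mono) auto
    then show ?case using Suc by simp
  qed simp
  have "(\<Sum>i=1..D. (2 * real (k + 2 * i) + 1) ^ d * r ^ i) \<le> 1 / 4" for D
  proof -
    have "(\<Sum>i=1..D. (2 * real (k + 2 * i) + 1) ^ d * r ^ i) \<le> (\<Sum>i=1..D. A * s ^ i)"
      by (intro sum_mono term_le)
    also have "\<dots> = A * (\<Sum>i=1..D. s ^ i)" by (simp add: sum_distrib_left)
    also have "(\<Sum>i=1..D. s ^ i) \<le> 2 * s" using geo[of D] s zero_le_power[of s "Suc D"] by linarith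
    then have "A * (\<Sum>i=1..D. s ^ i) \<le> A * (2 * s)" using A by (intro mult_left_mono) auto
    also have "\<dots> = 1 / 4" using A by (simp add: s_def)
    finally show ?thesis .
  qed
  then show ?thesis using r by blast
qed

lemma card_int_box_le:
  assumes "\<And>x :: int ^ 'n::finite. x \<in> V \<Longrightarrow> \<forall>j. \<bar>x $ j - c $ j\<bar> \<le> int K"
  shows "finite V \<and> card V \<le> (2 * K + 1) ^ CARD('n)"
proof -
  let ?f = "\<lambda>x :: int ^ 'n. ($) x"
  let ?P = "PiE (UNIV :: 'n set) (\<lambda>j. {c $ j - int K..c $ j + int K})"
  have inj: "inj_on ?f V" by (auto intro!: inj_onI simp: vec_eq_iff fun_eq_iff)
  have "x $ j \<in> {c $ j - int K..c $ j + int K}" if "x \<in> V" for x j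
    using spec[OF assms[OF that], of j] by (simp add: abs_le_iff)
  then have sub: "?f ` V \<subseteq> ?P" by blast
  have fin: "finite ?P" by (intro finite_PiE) auto
  have "card V = card (?f ` V)" by (rule card_image[OF inj, symmetric])
  also have "\<dots> \<le> card ?P" by (rule card_mono[OF fin sub])
  also have "\<dots> = (2 * K + 1) ^ CARD('n)"
  proof -
    have "card {c $ j - int K..c $ j + int K} = 2 * K + 1" for j by (auto simp: nat_eq_iff)
    then show ?thesis by (simp add: card_PiE)
  qed
  finally show ?thesis using finite_subset[OF sub fin] inj by (auto dest: finite_imageD)
qed

lemma open_set_sets:
  assumes "finite D" "\<And>e. e \<in> D \<Longrightarrow> {\<omega> \<in> space N. Y e \<omega>} \<in> sets N"
  shows "{\<omega> \<in> space N. P {e \<in> D. Y e \<omega>}} \<in> sets N"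
proof -
  let ?E = "\<lambda>S. {\<omega> \<in> space N. \<forall>e\<in>D. Y e \<omega> \<longleftrightarrow> e \<in> S}"
  have "?E S \<in> sets N" for S
  proof (rule sets.sets_Collect_finite_All[OF _ assms(1)])
    fix e assume "e \<in> D"
    then show "{\<omega> \<in> space N. Y e \<omega> \<longleftrightarrow> e \<in> S} \<in> sets N"
      using assms(2)[of e] sets.sets_Collect_neg[of N "Y e"] by (cases "e \<in> S") auto
  qed
  moreover have "{\<omega> \<in> space N. P {e \<in> D. Y e \<omega>}} = (\<Union>S\<in>{S \<in> Pow D. P S}. ?E S)"
  proof (intro equalityI subsetI)
    fix \<omega> assume "\<omega> \<in> {\<omega> \<in> space N. P {e \<in> D. Y e \<omega>}}"
    then show "\<omega> \<in> (\<Union>S\<in>{S \<in> Pow D. P S}. ?E S)" by (intro UN_I[of "{e \<in> D. Y e \<omega>}"]) auto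
  next
    fix \<omega> assume "\<omega> \<in> (\<Union>S\<in>{S \<in> Pow D. P S}. ?E S)"
    then obtain S where S: "S \<subseteq> D" "P S" "\<omega> \<in> space N" "\<forall>e\<in>D. Y e \<omega> \<longleftrightarrow> e \<in> S" by auto
    then have "{e \<in> D. Y e \<omega>} = S" by auto
    then show "\<omega> \<in> {\<omega> \<in> space N. P {e \<in> D. Y e \<omega>}}" using S by simp
  qed
  ultimately show ?thesis using assms(1) by (simp add: sets.finite_UN)
qed

text \<open>An edge whose endpoints both have level \<open>u\<close> does not exist, which makes \<open>slab \<sigma> l u\<close> and
\<open>upper \<sigma> u\<close> disjoint.\<close>

definition slab :: "('n \<Rightarrow> int) \<Rightarrow> int \<Rightarrow> int \<Rightarrow> (int ^ 'n::finite) set set" where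
  "slab \<sigma> l u = {e \<in> edges. \<forall>z\<in>e. l \<le> lev \<sigma> z \<and> lev \<sigma> z \<le> u}"

definition upper :: "('n \<Rightarrow> int) \<Rightarrow> int \<Rightarrow> (int ^ 'n::finite) set set" where
  "upper \<sigma> l = {e \<in> edges. \<forall>z\<in>e. l \<le> lev \<sigma> z}"

context iid_environment
begin

lemma ex_edge: "\<exists>e :: (int ^ 'n) set. e \<in> edges"
  using axis_edge(1) by blast

lemma prob_space_law: "prob_space F"
  using ex_edge law weight_measurable by (metis prob_space_distr)

lemma sets_law: "sets F = sets borel"
  using ex_edge law by (metis sets_distr)

lemma law_nonneg: "measure F {..<0} = 0"
proof -
  obtain e :: "(int ^ 'n) set" where e: "e \<in> edges" using ex_edge by blast
  have *: "{\<omega> \<in> space M. \<tau> e \<omega> \<in> {..<0}} = {}" using nonneg[OF e] by force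
  show ?thesis using prob_weight[OF e, of "{..<0}"] unfolding * by simp
qed

context
  fixes \<sigma> :: "'n \<Rightarrow> int"
  assumes \<sigma>: "\<forall>i. \<bar>\<sigma> i\<bar> = 1"
begin

lemma slab_upper_disjoint: "slab \<sigma> l u \<inter> upper \<sigma> u = {}"
proof -
  have False if "e \<in> slab \<sigma> l u" "e \<in> upper \<sigma> u" for e
  proof -
    have "e \<in> edges" using that by (simp add: slab_def)
    then obtain x y where e: "e = {x, y}" "l1 (x - y) = 1" by (rule edgeE)
    then have "lev \<sigma> x = u" "lev \<sigma> y = u" using that by (auto simp: slab_def upper_def)
    moreover have "{x, y} \<in> edges" using e(2) by (simp add: edge_iff)
    ultimately show False using lev_edge[OF \<sigma>, of x y] by simp
  qed
  then show ?thesis by auto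
qed

lemma fwd_edge:
  assumes "e \<in> ostep_box k"
  shows "{x + reflect \<sigma> (fst e), x + reflect \<sigma> (snd e)} \<in> slab \<sigma> (lev \<sigma> x) (lev \<sigma> x + int k)"
proof -
  obtain u i where e: "e = (u, u + axis i 1)" "\<forall>j. 0 \<le> u $ j" "(\<Sum>j\<in>UNIV. u $ j) < int k"
    using assms by (auto simp: ostep_box_def)
  have "(x + reflect \<sigma> u) - (x + reflect \<sigma> (u + axis i 1)) = axis i (- \<sigma> i)"
    by (auto simp: vec_eq_iff axis_def algebra_simps)
  then have "{x + reflect \<sigma> u, x + reflect \<sigma> (u + axis i 1)} \<in> edges"
    using spec[OF \<sigma>, of i] by (simp add: edge_iff)
  moreover have "0 \<le> (\<Sum>j\<in>UNIV. u $ j)" using e(2) by (simp add: sum_nonneg)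
  moreover have "(\<Sum>j\<in>UNIV. (u + axis i 1) $ j) = (\<Sum>j\<in>UNIV. u $ j) + 1" by (simp add: sum.distrib sum_axis)
  ultimately show ?thesis using e(3)
    unfolding slab_def e(1) fst_conv snd_conv by (simp add: lev_add lev_reflect[OF \<sigma>])
qed

lemma fwd_field:
  "{\<omega> \<in> space M. (0, y) \<in> (fwd \<sigma> k h (\<lambda>e. \<tau> e \<omega>) x)\<^sup>*} \<in> sets (field (slab \<sigma> (lev \<sigma> x) (lev \<sigma> x + int k)))"
proof -
  let ?N = "field (slab \<sigma> (lev \<sigma> x) (lev \<sigma> x + int k))"
  let ?Y = "\<lambda>e \<omega>. \<tau> {x + reflect \<sigma> (fst e), x + reflect \<sigma> (snd e)} \<omega> \<le> h"
  have "{\<omega> \<in> space ?N. ?Y e \<omega>} \<in> sets ?N" if "e \<in> ostep_box k" for e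
  proof -
    have "\<tau> {x + reflect \<sigma> (fst e), x + reflect \<sigma> (snd e)} \<in> borel_measurable ?N"
      by (rule weight_field[OF fwd_edge[OF that]])
    then show ?thesis by measurable
  qed
  from open_set_sets[where D = "ostep_box k" and Y = ?Y and N = ?N and P = "\<lambda>S. (0, y) \<in> S\<^sup>*", OF finite_ostep_box this]
  show ?thesis by (simp add: fwd_def[OF \<sigma>])
qed

lemma fwd_prob:
  "prob {\<omega> \<in> space M. (0, y) \<in> (fwd \<sigma> k h (\<lambda>e. \<tau> e \<omega>) x)\<^sup>*} =
    expect_subset (measure F {..h}) (ostep_box k) (\<lambda>S. if (0, y) \<in> S\<^sup>* then 1 else 0)"
proof -
  let ?D = "ostep_box k :: ((int ^ 'n) \<times> (int ^ 'n)) set"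
  let ?h = "\<lambda>e :: (int ^ 'n) \<times> (int ^ 'n). {x + reflect \<sigma> (fst e), x + reflect \<sigma> (snd e)}"
  let ?Y = "\<lambda>e \<omega>. \<tau> (?h e) \<omega> \<le> h"
  let ?q = "measure F {..h}"
  have edge: "?h e \<in> edges" if "e \<in> ?D" for e using fwd_edge[OF that, of x] by (simp add: slab_def)
  have inj: "inj_on ?h ?D"
  proof (rule inj_onI)
    fix e e' assume *: "e \<in> ?D" "e' \<in> ?D" "?h e = ?h e'"
    have "inj (\<lambda>z. x + reflect \<sigma> z)"
      by (rule inj_on_inverseI[where g = "\<lambda>z. reflect \<sigma> (z - x)"]) (simp add: reflect_involution[OF \<sigma>])
    moreover have "(\<lambda>z. x + reflect \<sigma> z) ` {fst e, snd e} = (\<lambda>z. x + reflect \<sigma> z) ` {fst e', snd e'}"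
      using *(3) by simp
    ultimately have "{fst e, snd e} = {fst e', snd e'}" by (simp only: inj_image_eq_iff)
    then show "e = e'" using inj_on_edge_ostep_box[of k] * by (auto dest: inj_onD)
  qed
  define A where "A = (\<lambda>S e. {\<omega> \<in> space M. \<tau> (?h e) \<omega> \<in> (if e \<in> S then {..h} else - {..h})})"
  have Af: "A S e \<in> sets (field {?h e})" for S e
  proof -
    have "\<tau> (?h e) \<in> borel_measurable (field {?h e})" by (rule weight_field) simp
    then have "\<tau> (?h e) -` (if e \<in> S then {..h} else - {..h}) \<inter> space (field {?h e}) \<in> sets (field {?h e})"
      by (rule measurable_sets) auto
    moreover have "\<tau> (?h e) -` (if e \<in> S then {..h} else - {..h}) \<inter> space (field {?h e}) = A S e"
      by (auto simp: A_def)
    ultimately show ?thesis by simp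
  qed
  interpret F: prob_space F by (rule prob_space_law)
  note setsF = sets_law
  have pA: "prob (A S e) = (if e \<in> S then ?q else 1 - ?q)" if "e \<in> ?D" for S e
  proof -
    have "space F = UNIV" using setsF sets_eq_imp_space_eq by fastforce
    then have "measure F (- {..h}) = 1 - ?q"
      using F.prob_compl[of "{..h}"] setsF by (simp add: Compl_eq_Diff_UNIV)
    then show ?thesis unfolding A_def using prob_weight[OF edge[OF that]] by simp
  qed
  have E: "{\<omega> \<in> space M. \<forall>e\<in>?D. ?Y e \<omega> \<longleftrightarrow> e \<in> S} = space M \<inter> (\<Inter>e\<in>?D. A S e)" for S
  proof -
    have "\<omega> \<in> A S e \<longleftrightarrow> \<omega> \<in> space M \<and> (?Y e \<omega> \<longleftrightarrow> e \<in> S)" for \<omega> e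
      by (cases "e \<in> S") (auto simp: A_def)
    then show ?thesis by blast
  qed
  have Aev: "A S e \<in> events" if "e \<in> ?D" for S e
    by (rule field_events[OF _ Af]) (use edge[OF that] in simp)
  have 1: "{\<omega> \<in> space M. \<forall>e\<in>?D. ?Y e \<omega> \<longleftrightarrow> e \<in> S} \<in> events" for S
  proof (cases "?D = {}")
    case False
    then show ?thesis unfolding E using Aev finite_ostep_box by (intro sets.Int sets.finite_INT) auto
  qed simp
  have 2: "prob {\<omega> \<in> space M. \<forall>e\<in>?D. ?Y e \<omega> \<longleftrightarrow> e \<in> S} = ?q ^ card S * (1 - ?q) ^ card (?D - S)"
    if S: "S \<subseteq> ?D" for S
  proof (cases "?D = {}")
    case True
    then show ?thesis using S by (simp add: prob_space)
  next
    case False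
    have "space M \<inter> (\<Inter>e\<in>?D. A S e) = (\<Inter>e\<in>?D. A S e)" using False by (auto simp: A_def)
    then have "prob {\<omega> \<in> space M. \<forall>e\<in>?D. ?Y e \<omega> \<longleftrightarrow> e \<in> S} = prob (\<Inter>e\<in>?D. A S e)" unfolding E by simp
    also have "\<dots> = (\<Prod>e\<in>?D. prob (A S e))"
    proof (rule field_indep[where J = "\<lambda>e. {?h e}"])
      show "disjoint_family_on (\<lambda>e. {?h e}) ?D" using inj by (auto simp: disjoint_family_on_def inj_on_def)
    qed (use False edge Af in \<open>auto simp: finite_ostep_box\<close>)
    also have "\<dots> = (\<Prod>e\<in>?D. if e \<in> S then ?q else 1 - ?q)" by (intro prod.cong refl pA)
    also have "\<dots> = ?q ^ card S * (1 - ?q) ^ card (?D - S)"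
      using S finite_ostep_box[of k] by (subst prod.If_cases) (auto simp: Int_absorb1 Diff_eq[symmetric])
    finally show ?thesis .
  qed
  from prob_open_set(2)[where Y = ?Y and P = "\<lambda>S. (0, y) \<in> S\<^sup>*", OF finite_ostep_box 1 2]
  show ?thesis by (simp add: fwd_def[OF \<sigma>])
qed

text \<open>Union bound over the first block. Without defects, the expected number of its possible ends is at
most \<open>1 / 2\<close>, and the further blocks are independent of it as they use only edges above level
\<open>lev \<sigma> x + k\<close>. With \<open>D'\<close> defects the number of ends is polynomial in \<open>D'\<close>, and the factor
\<open>r ^ D'\<close> is available from the induction hypothesis. Altogether each block contributes at most
\<open>1 / 2 + 1 / 4\<close>.\<close>

lemma chain_prob:
  assumes r: "0 < r" "r < 1" "\<And>D. (\<Sum>i=1..D. (2 * real (k + 2 * i) + 1) ^ CARD('n) * r ^ i) \<le> 1 / 4"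
    and lvl: "expect_subset (measure F {..h}) (ostep_box k) (\<lambda>S. real (card {y \<in> S\<^sup>* `` {0 :: int ^ 'n}. (\<Sum>j\<in>UNIV. y $ j) = int k})) \<le> 1 / 2"
  shows "{\<omega> \<in> space M. chain \<sigma> k h J D (\<lambda>e. \<tau> e \<omega>) x} \<in> sets (field (upper \<sigma> (lev \<sigma> x))) \<and>
    prob {\<omega> \<in> space M. chain \<sigma> k h J D (\<lambda>e. \<tau> e \<omega>) x} \<le> (3 / 4) ^ J / r ^ D"
proof (induction J arbitrary: D x)
  case 0
  have "1 \<le> 1 / r ^ D" using r by (simp add: power_le_one)
  moreover have "space M \<in> sets (field (upper \<sigma> (lev \<sigma> x)))" using sets.top[of "field (upper \<sigma> (lev \<sigma> x))"] by simp
  ultimately show ?case by (simp add: prob_space chain.simps[OF \<sigma>])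
next
  case (Suc J)
  let ?E = "\<lambda>J D x. {\<omega> \<in> space M. chain \<sigma> k h J D (\<lambda>e. \<tau> e \<omega>) x}"
  let ?R = "\<lambda>y. {\<omega> \<in> space M. (0, y) \<in> (fwd \<sigma> k h (\<lambda>e. \<tau> e \<omega>) x)\<^sup>*}"
  define Y where "Y = {y :: int ^ 'n. (\<forall>j. 0 \<le> y $ j) \<and> (\<Sum>j\<in>UNIV. y $ j) = int k}"
  define V where "V = (\<lambda>D'. {u. l1 (u - x) \<le> int (k + 2 * D') \<and> lev \<sigma> u = lev \<sigma> x + int k})"
  have up: "upper \<sigma> l \<subseteq> edges" for l by (auto simp: upper_def)
  have sl: "slab \<sigma> l u \<subseteq> edges" for l u by (auto simp: slab_def)
  have upm: "upper \<sigma> l \<subseteq> upper \<sigma> l'" if "l' \<le> l" for l l' using that by (auto simp: upper_def)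
  have slu: "slab \<sigma> l u \<subseteq> upper \<sigma> l" for l u by (auto simp: slab_def upper_def)
  have finY: "finite Y"
  proof -
    have "\<bar>y $ j - 0 $ j\<bar> \<le> int k" if "y \<in> Y" for y j
      using that member_le_sum[of j UNIV "\<lambda>j. y $ j"] by (auto simp: Y_def)
    then show ?thesis using card_int_box_le[of Y 0 k] by blast
  qed
  have V: "finite (V D')" "card (V D') \<le> (2 * (k + 2 * D') + 1) ^ CARD('n)" for D'
  proof -
    have "\<bar>u $ j - x $ j\<bar> \<le> int (k + 2 * D')" if "u \<in> V D'" for u j
      using that abs_component_le_l1[of "u - x" j] by (simp add: V_def)
    then show "finite (V D')" "card (V D') \<le> (2 * (k + 2 * D') + 1) ^ CARD('n)"
      using card_int_box_le[of "V D'" x "k + 2 * D'"] by blast+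
  qed
  have levY: "lev \<sigma> (x + reflect \<sigma> y) = lev \<sigma> x + int k" if "y \<in> Y" for y
    using that by (simp add: Y_def lev_add lev_reflect[OF \<sigma>])
  have levV: "lev \<sigma> u = lev \<sigma> x + int k" if "u \<in> V D'" for u D' using that by (simp add: V_def)
  have split: "?E (Suc J) D x = (\<Union>y\<in>Y. ?R y \<inter> ?E J D (x + reflect \<sigma> y)) \<union> (\<Union>D'\<in>{1..D}. \<Union>u\<in>V D'. ?E J (D - D') u)"
    unfolding Y_def V_def chain.simps[OF \<sigma>] by auto
  have f1: "?R y \<inter> ?E J D (x + reflect \<sigma> y) \<in> sets (field (upper \<sigma> (lev \<sigma> x)))" if "y \<in> Y" for y
  proof (rule sets.Int)
    show "?R y \<in> sets (field (upper \<sigma> (lev \<sigma> x)))" using fwd_field field_mono[OF slu] by blast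
    show "?E J D (x + reflect \<sigma> y) \<in> sets (field (upper \<sigma> (lev \<sigma> x)))"
      using Suc.IH[of D "x + reflect \<sigma> y"] field_mono[OF upm, of "lev \<sigma> x" "lev \<sigma> (x + reflect \<sigma> y)"] levY[OF that] by auto
  qed
  have f2: "?E J (D - D') u \<in> sets (field (upper \<sigma> (lev \<sigma> x)))" if "u \<in> V D'" for u D'
    using Suc.IH[of "D - D'" u] field_mono[OF upm, of "lev \<sigma> x" "lev \<sigma> u"] levV[OF that] by auto
  have "?E (Suc J) D x \<in> sets (field (upper \<sigma> (lev \<sigma> x)))"
    unfolding split
    by (rule sets.Un[OF sets.finite_UN[OF finY f1] sets.finite_UN[OF finite_atLeastAtMost sets.finite_UN[OF V(1) f2]]])
  moreover have "prob (?E (Suc J) D x) \<le> (3 / 4) ^ Suc J / r ^ D"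
  proof -
    let ?b = "(3 / 4) ^ J / r ^ D"
    have b: "0 \<le> ?b" using r by simp
    have e1: "?R y \<inter> ?E J D (x + reflect \<sigma> y) \<in> events" if "y \<in> Y" for y
      by (rule field_events[OF up f1[OF that]])
    have e2: "?E J (D - D') u \<in> events" if "u \<in> V D'" for u D'
      by (rule field_events[OF up f2[OF that]])
    have e3: "(\<Union>y\<in>Y. ?R y \<inter> ?E J D (x + reflect \<sigma> y)) \<in> events"
      by (rule sets.finite_UN[OF finY e1])
    have e4: "(\<Union>u\<in>V D'. ?E J (D - D') u) \<in> events" for D'
      by (rule sets.finite_UN[OF V(1) e2])
    have e5: "(\<Union>D'\<in>{1..D}. \<Union>u\<in>V D'. ?E J (D - D') u) \<in> events"
      by (rule sets.finite_UN[OF finite_atLeastAtMost e4])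
    have "prob (?E (Suc J) D x) \<le> prob (\<Union>y\<in>Y. ?R y \<inter> ?E J D (x + reflect \<sigma> y)) + prob (\<Union>D'\<in>{1..D}. \<Union>u\<in>V D'. ?E J (D - D') u)"
      unfolding split by (rule measure_Un_le[OF e3 e5])
    also have "\<dots> \<le> (\<Sum>y\<in>Y. prob (?R y \<inter> ?E J D (x + reflect \<sigma> y))) + (\<Sum>D'\<in>{1..D}. prob (\<Union>u\<in>V D'. ?E J (D - D') u))"
    proof (rule add_mono)
      show "prob (\<Union>y\<in>Y. ?R y \<inter> ?E J D (x + reflect \<sigma> y)) \<le> (\<Sum>y\<in>Y. prob (?R y \<inter> ?E J D (x + reflect \<sigma> y)))"
        by (rule finite_measure_subadditive_finite[OF finY image_subsetI[OF e1]])
      show "prob (\<Union>D'\<in>{1..D}. \<Union>u\<in>V D'. ?E J (D - D') u) \<le> (\<Sum>D'\<in>{1..D}. prob (\<Union>u\<in>V D'. ?E J (D - D') u))"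
        by (rule finite_measure_subadditive_finite[OF finite_atLeastAtMost image_subsetI[OF e4]])
    qed
    also have "\<dots> \<le> (\<Sum>y\<in>Y. prob (?R y) * ?b) + (\<Sum>D'\<in>{1..D}. (2 * real (k + 2 * D') + 1) ^ CARD('n) * r ^ D' * ?b)"
    proof (intro add_mono sum_mono)
      fix y assume y: "y \<in> Y"
      have "prob (?R y \<inter> ?E J D (x + reflect \<sigma> y)) = prob (?R y) * prob (?E J D (x + reflect \<sigma> y))"
      proof (rule field_indep2[OF sl up])
        show "slab \<sigma> (lev \<sigma> x) (lev \<sigma> x + int k) \<inter> upper \<sigma> (lev \<sigma> (x + reflect \<sigma> y)) = {}"
          unfolding levY[OF y] by (rule slab_upper_disjoint)
      qed (use fwd_field Suc.IH in auto)
      also have "\<dots> \<le> prob (?R y) * ?b" using Suc.IH by (intro mult_left_mono) auto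
      finally show "prob (?R y \<inter> ?E J D (x + reflect \<sigma> y)) \<le> prob (?R y) * ?b" .
    next
      fix D' assume D': "D' \<in> {1..D}"
      have "prob (\<Union>u\<in>V D'. ?E J (D - D') u) \<le> (\<Sum>u\<in>V D'. prob (?E J (D - D') u))"
        by (rule finite_measure_subadditive_finite[OF V(1) image_subsetI[OF e2]])
      also have "\<dots> \<le> (\<Sum>u\<in>V D'. (3 / 4) ^ J / r ^ (D - D'))" using Suc.IH by (intro sum_mono) auto
      also have "\<dots> = real (card (V D')) * ((3 / 4) ^ J / r ^ (D - D'))" by simp
      also have "\<dots> \<le> (2 * real (k + 2 * D') + 1) ^ CARD('n) * ((3 / 4) ^ J / r ^ (D - D'))"
      proof (rule mult_right_mono)
        have "real (card (V D')) \<le> real ((2 * (k + 2 * D') + 1) ^ CARD('n))" using V(2) by (rule of_nat_mono)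
        then show "real (card (V D')) \<le> (2 * real (k + 2 * D') + 1) ^ CARD('n)" by (simp add: add_ac)
      qed (use r in simp)
      also have "(3 / 4) ^ J / r ^ (D - D') = r ^ D' * ?b"
      proof -
        have "r ^ D = r ^ D' * r ^ (D - D')" using D' by (simp add: power_add[symmetric])
        then show ?thesis using r by simp
      qed
      finally show "prob (\<Union>u\<in>V D'. ?E J (D - D') u) \<le> (2 * real (k + 2 * D') + 1) ^ CARD('n) * r ^ D' * ?b"
        by (simp add: mult.assoc)
    qed
    also have "\<dots> = ((\<Sum>y\<in>Y. prob (?R y)) + (\<Sum>D'=1..D. (2 * real (k + 2 * D') + 1) ^ CARD('n) * r ^ D')) * ?b"
      by (simp only: sum_distrib_right distrib_right)
    also have "\<dots> \<le> (1 / 2 + 1 / 4) * ?b"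
    proof (rule mult_right_mono[OF add_mono b])
      have "(\<Sum>y\<in>Y. prob (?R y)) = expect_subset (measure F {..h}) (ostep_box k) (\<lambda>S. \<Sum>y\<in>Y. if (0, y) \<in> S\<^sup>* then 1 else 0)"
        unfolding fwd_prob by (rule expect_subset_sum[symmetric])
      also have "\<dots> = expect_subset (measure F {..h}) (ostep_box k) (\<lambda>S. real (card {y \<in> S\<^sup>* `` {0 :: int ^ 'n}. (\<Sum>j\<in>UNIV. y $ j) = int k}))"
      proof (rule expect_subset_cong)
        fix S :: "((int ^ 'n) \<times> (int ^ 'n)) set" assume S: "S \<subseteq> ostep_box k"
        have "{y \<in> S\<^sup>* `` {0 :: int ^ 'n}. (\<Sum>j\<in>UNIV. y $ j) = int k} = {y \<in> Y. (0, y) \<in> S\<^sup>*}"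
          using ostep_reach[OF _ S, of 0] by (fastforce simp: Y_def)
        then show "(\<Sum>y\<in>Y. if (0, y) \<in> S\<^sup>* then 1 else 0) = real (card {y \<in> S\<^sup>* `` {0 :: int ^ 'n}. (\<Sum>j\<in>UNIV. y $ j) = int k})"
          using finY by (simp add: sum.If_cases Int_def)
      qed
      also have "\<dots> \<le> 1 / 2" by (rule lvl)
      finally show "(\<Sum>y\<in>Y. prob (?R y)) \<le> 1 / 2" .
    qed (rule r(3))
    finally show ?thesis by simp
  qed
  ultimately show ?case ..
qed

end

end

lemma card_path_edges_distinct:
  "distinct xs \<Longrightarrow> card (path_edges xs) = length xs - 1"
proof (induction xs rule: induct_list012)
  case (3 x y zs)
  have "{x, y} \<notin> path_edges (y # zs)" using path_edges_vertices[of "{x, y}" "y # zs"] 3 by auto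
  then show ?case using 3 by simp
qed auto

definition walks :: "int ^ 'n::finite \<Rightarrow> nat \<Rightarrow> (int ^ 'n) list set" where
  "walks x n = {xs. length xs = Suc n \<and> hd xs = x \<and> successively (\<lambda>x y. {x, y} \<in> edges) xs}"

lemma card_walks: "finite (walks x n) \<and> card (walks x n) \<le> (2 * CARD('n)) ^ n" for x :: "int ^ 'n::finite"
proof (induction n)
  case 0
  have "walks x 0 \<subseteq> {[x]}" by (auto simp: walks_def length_Suc_conv)
  then show ?case using card_mono[of "{[x]}" "walks x 0"] by (auto intro: finite_subset)
next
  case (Suc n)
  let ?U = "(\<lambda>(i, b). axis i (if b then 1 else -1 :: int)) ` (UNIV :: ('n \<times> bool) set)"
  let ?f = "\<lambda>(xs, u). xs @ [last xs + u]"
  have sub: "walks x (Suc n) \<subseteq> ?f ` (walks x n \<times> ?U)"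
  proof
    fix ws assume ws: "ws \<in> walks x (Suc n)"
    then have "ws \<noteq> []" by (auto simp: walks_def)
    then obtain xs z where w: "ws = xs @ [z]" by (metis append_butlast_last_id)
    have xs: "xs \<in> walks x n" "xs \<noteq> []" using ws by (auto simp: walks_def w successively_append_iff hd_append split: if_splits)
    have "{last xs, z} \<in> edges" using ws xs(2) by (auto simp: walks_def w successively_append_iff)
    then have "l1 (z - last xs) = 1" by (simp add: edge_iff l1_minus_commute)
    then obtain i where i: "\<bar>(z - last xs) $ i\<bar> = 1" "z - last xs = axis i ((z - last xs) $ i)" by (rule l1_eq_1D)
    define b where "b \<longleftrightarrow> 0 < (z - last xs) $ i"
    have "(z - last xs) $ i = (if b then 1 else -1)" using i(1) by (auto simp: b_def)
    then have "z - last xs = (\<lambda>(i, b). axis i (if b then 1 else -1)) (i, b)" using i(2) by simp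
    then have "z - last xs \<in> ?U" by (rule image_eqI) simp
    then show "ws \<in> ?f ` (walks x n \<times> ?U)"
      by (intro image_eqI[of _ _ "(xs, z - last xs)"]) (use xs w in auto)
  qed
  have U: "finite ?U" "card ?U \<le> 2 * CARD('n)"
    using card_image_le[of "UNIV :: ('n \<times> bool) set" "\<lambda>(i, b). axis i (if b then 1 else -1 :: int)"]
    by (auto simp: mult.commute)
  have fin: "finite (walks x n \<times> ?U)" using Suc U by simp
  have "card (walks x (Suc n)) \<le> card (?f ` (walks x n \<times> ?U))" by (rule card_mono[OF finite_imageI[OF fin] sub])
  also have "\<dots> \<le> card (walks x n \<times> ?U)" by (rule card_image_le[OF fin])
  also have "\<dots> = card (walks x n) * card ?U" by (rule card_cartesian_product)
  also have "\<dots> \<le> (2 * CARD('n)) ^ n * (2 * CARD('n))" using Suc U by (intro mult_mono) auto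
  finally show ?case using finite_subset[OF sub finite_imageI[OF fin]] by (simp add: mult.commute)
qed

context iid_environment
begin

text \<open>The bound concerns the passage times of single paths. It is local in the sense that it may be applied
to the paths inside a region, irrespective of the weights outside.\<close>

definition linear_lower_bound :: "real \<Rightarrow> bool" where
  "linear_lower_bound b \<longleftrightarrow> (\<exists>c>0. \<exists>C>0. \<forall>x z. \<exists>A\<in>events. prob A \<le> C * exp (- c * real_of_int (l1 (z - x))) \<and>
    (\<forall>\<omega>\<in>space M - A. \<forall>xs. path_between x z xs \<and> distinct xs \<longrightarrow>
      b * real_of_int (l1 (z - x)) \<le> passage_time (\<lambda>e. \<tau> e \<omega>) xs))"

lemma lower_weights_null:
  assumes "measure F {..<a} = 0"
  shows "{\<omega> \<in> space M. \<exists>e\<in>edges. \<tau> e \<omega> < a} \<in> null_sets M"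
proof -
  have "(\<Union>e\<in>edges. {\<omega> \<in> space M. \<tau> e \<omega> \<in> {..<a}}) \<in> null_sets M"
  proof (rule null_sets_UN'[OF countable_edges])
    fix e :: "(int ^ 'n) set" assume e: "e \<in> edges"
    have "\<tau> e -` {..<a} \<inter> space M \<in> events" by (rule measurable_sets[OF weight_measurable[OF e]]) simp
    moreover have "\<tau> e -` {..<a} \<inter> space M = {\<omega> \<in> space M. \<tau> e \<omega> \<in> {..<a}}" by auto
    moreover have "prob {\<omega> \<in> space M. \<tau> e \<omega> \<in> {..<a}} = 0" using prob_weight[OF e, of "{..<a}"] assms by simp
    ultimately show "{\<omega> \<in> space M. \<tau> e \<omega> \<in> {..<a}} \<in> null_sets M"
      by (simp add: null_sets_def emeasure_eq_measure)
  qed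
  moreover have "(\<Union>e\<in>edges. {\<omega> \<in> space M. \<tau> e \<omega> \<in> {..<a}}) = {\<omega> \<in> space M. \<exists>e\<in>edges. \<tau> e \<omega> < a}" by auto
  ultimately show ?thesis by simp
qed

text \<open>The weight exceeds \<open>\<eta>\<close> with probability close to one. Among the first \<open>n = l1 (z - x)\<close> edges of a
distinct path at least half have a weight above \<open>\<eta>\<close>, except with a probability that the number of
paths and of subsets of their edges cannot outweigh.\<close>

lemma slow_no_atom_at_zero:
  assumes F0: "F_minus F = 0" "measure F {0} = 0"
  shows "\<exists>a b. 0 \<le> a \<and> a < b \<and> 0 < measure F {..a} \<and> linear_lower_bound b"
proof -
  define d where "d = real CARD('n)"
  have d: "1 \<le> d" by (simp add: d_def Suc_le_eq)
  \<comment> \<open>\<open>2 * d\<close> bounds the number of continuations of a path, a factor two accounts for the choice of a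
    subset of edges, and \<open>2 * d * (2 * s) = 1 / 2\<close> is left\<close>
  define s where "s = 1 / (8 * d)"
  have s: "0 < s" "s \<le> 1" using d by (auto simp: s_def field_simps)
  obtain \<eta> where \<eta>: "0 < \<eta>" "measure F {..0 + \<eta>} < s ^ 2"
    using measure_atMost_limit[OF prob_space_law sets_law, of 0 "s ^ 2"] law_nonneg F0(2) s by auto
  let ?q = "measure F {..\<eta>}"
  have q: "?q \<le> s ^ 2" using \<eta> by simp
  have Fa: "0 < measure F {..\<eta> / 4}"
    using F_minus_facts(3)[OF prob_space_law sets_law law_nonneg, of "\<eta> / 4"] \<eta> F0(1) by simp
  define G where "G = (\<lambda>(xs :: (int ^ 'n) list) n. {G. G \<subseteq> path_edges xs \<and> n \<le> 2 * card G})"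
  have main: "\<exists>A\<in>events. prob A \<le> 1 * exp (- ln 2 * real_of_int (l1 (z - x))) \<and>
    (\<forall>\<omega>\<in>space M - A. \<forall>xs. path_between x z xs \<and> distinct xs \<longrightarrow>
      \<eta> / 2 * real_of_int (l1 (z - x)) \<le> passage_time (\<lambda>e. \<tau> e \<omega>) xs)" for x z :: "int ^ 'n"
  proof (cases "x = z")
    case True
    then show ?thesis by (intro bexI[of _ "space M"]) (auto simp: prob_space)
  next
    case False
    define n where "n = nat (l1 (z - x))"
    have "l1 (z - x) \<noteq> 0" using False by simp
    then have "0 < l1 (z - x)" using l1_nonneg[of "z - x"] by linarith
    then have n: "int n = l1 (z - x)" "1 \<le> n" unfolding n_def by simp_all
    let ?W = "{xs \<in> walks x n. distinct xs}"
    let ?B = "\<lambda>g. {\<omega> \<in> space M. \<forall>e\<in>g. \<tau> e \<omega> \<le> \<eta>}"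
    define A where "A = (\<Union>xs\<in>?W. \<Union>g\<in>G xs n. ?B g)"
    have finW: "finite ?W" using card_walks[of x n] by auto
    have finG: "finite (G xs n)" for xs unfolding G_def by (rule finite_subset[of _ "Pow (path_edges xs)"]) auto
    have g: "finite g" "g \<noteq> {}" "g \<subseteq> edges" if "xs \<in> ?W" "g \<in> G xs n" for xs g
    proof -
      have "path_edges xs \<subseteq> edges" using that(1) by (auto simp: walks_def intro!: path_edges_subset_edges)
      then show "finite g" "g \<noteq> {}" "g \<subseteq> edges" using that n(2) finite_subset[of g "path_edges xs"] by (auto simp: G_def)
    qed
    have Bf: "{\<omega> \<in> space M. \<tau> e \<omega> \<in> {..\<eta>}} \<in> sets (field {e})" for e
    proof -
      have "\<tau> e \<in> borel_measurable (field {e})" by (rule weight_field) simp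
      then have "\<tau> e -` {..\<eta>} \<inter> space (field {e}) \<in> sets (field {e})" by (rule measurable_sets) auto
      moreover have "\<tau> e -` {..\<eta>} \<inter> space (field {e}) = {\<omega> \<in> space M. \<tau> e \<omega> \<in> {..\<eta>}}" by auto
      ultimately show ?thesis by simp
    qed
    have B: "?B g = (\<Inter>e\<in>g. {\<omega> \<in> space M. \<tau> e \<omega> \<in> {..\<eta>}})" if "g \<noteq> {}" for g using that by auto
    have Bev: "?B g \<in> events" if "xs \<in> ?W" "g \<in> G xs n" for xs g
      unfolding B[OF g(2)[OF that]]
    proof (rule sets.finite_INT[OF g(1,2)[OF that]])
      fix e assume "e \<in> g"
      then have "{e} \<subseteq> edges" using g(3)[OF that] by auto
      then show "{\<omega> \<in> space M. \<tau> e \<omega> \<in> {..\<eta>}} \<in> events" by (rule field_events[OF _ Bf])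
    qed
    have Bp: "prob (?B g) \<le> s ^ n" if "xs \<in> ?W" "g \<in> G xs n" for xs g
    proof -
      have "prob (?B g) = (\<Prod>e\<in>g. prob {\<omega> \<in> space M. \<tau> e \<omega> \<in> {..\<eta>}})"
        unfolding B[OF g(2)[OF that]]
        by (rule field_indep[where J = "\<lambda>e. {e}"]) (use g[OF that] Bf in \<open>auto simp: disjoint_family_on_def\<close>)
      also have "\<dots> = (\<Prod>e\<in>g. ?q)"
        by (rule prod.cong[OF refl], rule prob_weight) (use g(3)[OF that] in auto)
      also have "\<dots> = ?q ^ card g" by simp
      also have "\<dots> \<le> (s ^ 2) ^ card g" by (rule power_mono[OF q]) simp
      also have "\<dots> = s ^ (2 * card g)" by (simp add: power_mult)
      also have "\<dots> \<le> s ^ n" using that(2) s by (intro power_decreasing) (auto simp: G_def)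
      finally show ?thesis .
    qed
    have in1: "(\<Union>g\<in>G xs n. ?B g) \<in> events" if "xs \<in> ?W" for xs
      by (rule sets.finite_UN[OF finG Bev[OF that]])
    have Aev: "A \<in> events" unfolding A_def by (rule sets.finite_UN[OF finW in1])
    have "prob A \<le> (\<Sum>xs\<in>?W. prob (\<Union>g\<in>G xs n. ?B g))"
      unfolding A_def by (rule finite_measure_subadditive_finite[OF finW image_subsetI[OF in1]])
    also have "\<dots> \<le> (\<Sum>xs\<in>?W. 2 ^ n * s ^ n)"
    proof (rule sum_mono)
      fix xs assume xs: "xs \<in> ?W"
      have "card (path_edges xs) \<le> n" using xs card_path_edges[of xs] by (auto simp: walks_def)
      then have "(2 :: nat) ^ card (path_edges xs) \<le> 2 ^ n" by (intro power_increasing) auto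
      moreover have "card (G xs n) \<le> card (Pow (path_edges xs))" by (rule card_mono) (auto simp: G_def)
      ultimately have "card (G xs n) \<le> 2 ^ n" by (metis card_Pow finite_path_edges order_trans)
      then have c: "real (card (G xs n)) \<le> 2 ^ n" by (metis of_nat_le_iff of_nat_numeral of_nat_power)
      have "prob (\<Union>g\<in>G xs n. ?B g) \<le> (\<Sum>g\<in>G xs n. prob (?B g))"
        by (rule finite_measure_subadditive_finite[OF finG image_subsetI[OF Bev[OF xs]]])
      also have "\<dots> \<le> (\<Sum>g\<in>G xs n. s ^ n)" by (rule sum_mono[OF Bp[OF xs]])
      also have "\<dots> = real (card (G xs n)) * s ^ n" by simp
      also have "\<dots> \<le> 2 ^ n * s ^ n" using c s by (intro mult_right_mono) auto
      finally show "prob (\<Union>g\<in>G xs n. ?B g) \<le> 2 ^ n * s ^ n" .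
    qed
    also have "\<dots> = real (card ?W) * (2 ^ n * s ^ n)" by simp
    also have "\<dots> \<le> (2 * d) ^ n * (2 ^ n * s ^ n)"
    proof (rule mult_right_mono)
      have "card ?W \<le> card (walks x n)" using card_walks[of x n] by (intro card_mono) auto
      then have "real (card ?W) \<le> real ((2 * CARD('n)) ^ n)" using card_walks[of x n] of_nat_mono order_trans by blast
      then show "real (card ?W) \<le> (2 * d) ^ n" by (simp add: d_def)
    qed (use s in simp)
    also have "\<dots> = (1 / 2) ^ n"
    proof -
      have "(2 * d) ^ n * (2 ^ n * s ^ n) = (2 * d * (2 * s)) ^ n" by (simp only: power_mult_distrib)
      also have "2 * d * (2 * s) = 1 / 2" using d by (simp add: s_def)
      finally show ?thesis .
    qed
    also have "\<dots> = exp (- ln 2 * real n)"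
      by (simp add: exp_minus exp_of_nat2_mult power_one_over inverse_eq_divide)
    finally have pA: "prob A \<le> 1 * exp (- ln 2 * real_of_int (l1 (z - x)))" using n(1) by (metis mult_1 of_int_of_nat_eq)
    have "\<eta> / 2 * real_of_int (l1 (z - x)) \<le> passage_time (\<lambda>e. \<tau> e \<omega>) xs"
      if w: "\<omega> \<in> space M - A" and p: "path_between x z xs" "distinct xs" for \<omega> xs
    proof -
      have "z \<in> set xs" using p(1) by (auto simp: path_between_def)
      then have "int n < int (length xs)" using path_vertex_l1[OF p(1), of z] n(1) by simp
      then have len: "n < length xs" by simp
      define ys where "ys = take (Suc n) xs"
      have xs: "xs = ys @ drop (Suc n) xs" by (simp add: ys_def)
      have lys: "length ys = Suc n" using len by (simp add: ys_def)
      have "successively (\<lambda>x y. {x, y} \<in> edges) (ys @ drop (Suc n) xs)"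
        using p(1) by (simp add: path_between_def ys_def)
      then have ys4: "successively (\<lambda>x y. {x, y} \<in> edges) ys" by (simp add: successively_append_iff)
      have ys: "ys \<noteq> []" "distinct ys" "hd ys = x" "successively (\<lambda>x y. {x, y} \<in> edges) ys"
        using lys p distinct_take[of xs "Suc n"] ys4 by (auto simp: path_between_def ys_def hd_take)
      have ysW: "ys \<in> ?W" using ys lys by (simp add: walks_def)
      have sub: "path_edges ys \<subseteq> path_edges xs"
        using path_edges_append[of ys "drop (Suc n) xs"] ys(1) xs by (cases "drop (Suc n) xs = []") auto
      have card: "card (path_edges ys) = n" using card_path_edges_distinct[OF ys(2)] lys by simp
      define g where "g = {e \<in> path_edges ys. \<tau> e \<omega> \<le> \<eta>}"
      have "g \<notin> G ys n"
      proof
        assume "g \<in> G ys n"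
        moreover have "\<omega> \<in> ?B g" using w by (simp add: g_def)
        ultimately have "\<omega> \<in> A" unfolding A_def using ysW by blast
        then show False using w by simp
      qed
      then have cg: "2 * card g < n" by (auto simp: G_def g_def)
      have en: "path_edges xs \<subseteq> edges" by (rule path_between_edges[OF p(1)])
      have "card (path_edges ys - g) = n - card g" using card by (simp add: g_def card_Diff_subset)
      then have "real n / 2 \<le> real (card (path_edges ys - g))" using cg by (simp add: of_nat_diff)
      then have "\<eta> / 2 * real n \<le> real (card (path_edges ys - g)) * \<eta>" using \<eta>(1) mult_right_mono[of "real n / 2" _ \<eta>] by simp
      also have "\<dots> \<le> (\<Sum>e\<in>path_edges ys - g. \<tau> e \<omega>)"
        by (rule sum_bounded_below) (auto simp: g_def)
      also have "\<dots> \<le> (\<Sum>e\<in>path_edges xs. \<tau> e \<omega>)"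
        using sub en w nonneg by (intro sum_mono2) auto
      finally show ?thesis using n(1) by (simp add: passage_time_def) (metis of_int_of_nat_eq)
    qed
    then show ?thesis using Aev pA by (intro bexI[of _ A]) auto
  qed
  have "linear_lower_bound (\<eta> / 2)"
    unfolding linear_lower_bound_def using main by (intro exI[of _ "ln 2"] exI[of _ 1] conjI allI) auto
  then show ?thesis using Fa \<eta>(1) by (intro exI[of _ "\<eta> / 4"] exI[of _ "\<eta> / 2"]) auto
qed

text \<open>A path from \<open>x\<close> to \<open>z\<close> whose time is close to \<open>F_minus F * l1 (z - x)\<close> has few defects in the orthant
of \<open>z - x\<close>. It then contains many consecutive blocks without defects, and each of them has probability
bounded away from one below the critical probability.\<close>

lemma slow_positive_minimum:
  assumes F0: "0 < F_minus F" "measure F {F_minus F} < p_crit_oriented TYPE('n)"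
  shows "\<exists>a b. 0 \<le> a \<and> a < b \<and> 0 < measure F {..a} \<and> linear_lower_bound b"
proof -
  define a0 where "a0 = F_minus F"
  note Fm = F_minus_facts[OF prob_space_law sets_law law_nonneg, folded a0_def]
  have a0: "0 < a0" using F0 by (simp add: a0_def)
  obtain \<eta> where \<eta>: "0 < \<eta>" "measure F {..a0 + \<eta>} < p_crit_oriented TYPE('n)"
    using measure_atMost_limit[OF prob_space_law sets_law Fm(2)] F0(2) by (auto simp: a0_def)
  define h where "h = a0 + \<eta>"
  obtain k where k: "1 \<le> k"
    "expect_subset (measure F {..h}) (ostep_box k) (\<lambda>S. real (card {y \<in> S\<^sup>* `` {0 :: int ^ 'n}. (\<Sum>j\<in>UNIV. y $ j) = int k})) \<le> 1 / 2"
    using oriented_subcritical_level[OF measure_nonneg \<eta>(2), folded h_def] by (elim exE conjE)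
  obtain r :: real where r: "0 < r" "r < 1" "\<And>D. (\<Sum>i=1..D. (2 * real (k + 2 * i) + 1) ^ CARD('n) * r ^ i) \<le> 1 / 4"
  proof -
    obtain r :: real where "0 < r" "r < 1" "\<forall>D. (\<Sum>i=1..D. (2 * real (k + 2 * i) + 1) ^ CARD('n) * r ^ i) \<le> 1 / 4"
      using geometric_budget[of k "CARD('n)"] by (elim exE conjE)
    then show thesis by (intro that[of r]) simp_all
  qed
  define \<kappa> where "\<kappa> = min (2 * a0) \<eta>"
  define l where "l = ln (4 / 3 :: real)"
  have l: "0 < l" by (simp add: l_def)
  define R where "R = ln (1 / r)"
  have R: "0 < R" using r by (simp add: R_def)
  \<comment> \<open>with at most \<open>\<delta> * n\<close> defects, the factor \<open>1 / r\<close> for each of them consumes only half of the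
    exponential decay \<open>(3 / 4) ^ (n / k)\<close>\<close>
  define \<delta> where "\<delta> = l / (2 * real k * R)"
  have \<kappa>: "0 < \<kappa>" using a0 \<eta> by (simp add: \<kappa>_def)
  have \<delta>: "0 < \<delta>" using l R k by (simp add: \<delta>_def)
  define c where "c = l / (2 * real k)"
  have c: "0 < c" "\<delta> * R = c" using l k R by (simp_all add: c_def \<delta>_def)
  let ?b = "a0 + \<kappa> * \<delta>"
  have main: "\<exists>A\<in>events. prob A \<le> 4 / 3 * exp (- c * real_of_int (l1 (z - x))) \<and>
    (\<forall>\<omega>\<in>space M - A. \<forall>xs. path_between x z xs \<and> distinct xs \<longrightarrow>
      ?b * real_of_int (l1 (z - x)) \<le> passage_time (\<lambda>e. \<tau> e \<omega>) xs)" for x z :: "int ^ 'n"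
  proof -
    define n where "n = nat (l1 (z - x))"
    have n: "int n = l1 (z - x)" by (simp add: n_def)
    then have nr: "real_of_int (l1 (z - x)) = real n" by (metis of_int_of_nat_eq)
    define \<sigma> where "\<sigma> = (\<lambda>i. if x $ i \<le> z $ i then 1 else -1 :: int)"
    have \<sigma>: "\<forall>i. \<bar>\<sigma> i\<bar> = 1" by (simp add: \<sigma>_def)
    have lv: "lev \<sigma> z - lev \<sigma> x = int n"
      unfolding n lev_diff[symmetric] unfolding lev_def l1_def by (intro sum.cong refl) (auto simp: \<sigma>_def)
    define D where "D = nat \<lfloor>\<delta> * real n\<rfloor>"
    define J where "J = n div k"
    have D: "real D \<le> \<delta> * real n" using \<delta> by (simp add: D_def)
    have Jk: "J * k \<le> n" by (simp add: J_def)
    have J: "real n / real k - 1 \<le> real J"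
    proof -
      have "n = J * k + n mod k" "n mod k < k" using k(1) by (simp_all add: J_def)
      then have "n < (J + 1) * k" by (metis add.commute add_less_cancel_right distrib_right mult_1)
      then have "real n < real ((J + 1) * k)" by (rule of_nat_less_iff[THEN iffD2])
      then show ?thesis using k(1) by (simp add: field_simps)
    qed
    define N0 where "N0 = {\<omega> \<in> space M. \<exists>e\<in>edges. \<tau> e \<omega> < a0}"
    have N0: "N0 \<in> events" "prob N0 = 0" using lower_weights_null[OF Fm(2)] by (auto simp: N0_def null_sets_def measure_def)
    define E where "E = {\<omega> \<in> space M. chain \<sigma> k h J D (\<lambda>e. \<tau> e \<omega>) x}"
    have Ef: "E \<in> sets (field (upper \<sigma> (lev \<sigma> x)))" and pE: "prob E \<le> (3 / 4) ^ J / r ^ D"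
      using chain_prob[OF \<sigma> r k(2)] by (auto simp: E_def)
    have Eev: "E \<in> events" by (rule field_events[OF _ Ef]) (auto simp: upper_def)
    have "(3 / 4 :: real) ^ J = exp (- l * real J)"
    proof -
      have "exp (- l) = (3 / 4 :: real)" by (simp add: l_def exp_minus)
      then show ?thesis by (metis exp_of_nat2_mult)
    qed
    also have "\<dots> \<le> exp (- l * (real n / real k - 1))" using J l by simp
    finally have p1: "(3 / 4 :: real) ^ J \<le> exp (- l * (real n / real k - 1))" .
    have "1 / r ^ D = exp (R * real D)"
    proof -
      have "exp R = 1 / r" using r by (simp add: R_def)
      then show ?thesis by (metis exp_of_nat2_mult power_one_over)
    qed
    also have "\<dots> \<le> exp (R * (\<delta> * real n))" using D R by simp
    finally have p2: "1 / r ^ D \<le> exp (R * (\<delta> * real n))" .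
    have "(3 / 4) ^ J / r ^ D = (3 / 4) ^ J * (1 / r ^ D)" by simp
    also have "\<dots> \<le> exp (- l * (real n / real k - 1)) * exp (R * (\<delta> * real n))"
      using p1 p2 r by (intro mult_mono) auto
    also have "\<dots> = exp (l + (- c * real n))"
    proof -
      have "l * (real n / real k) = 2 * c * real n" using k(1) by (simp add: c_def)
      moreover have "R * (\<delta> * real n) = c * real n" using c(2) by (simp add: mult.assoc[symmetric] mult.commute)
      ultimately show ?thesis unfolding exp_add[symmetric] by (intro arg_cong[of _ _ exp]) (simp add: algebra_simps)
    qed
    also have "\<dots> = exp l * exp (- c * real n)" by (rule exp_add)
    also have "exp l = 4 / 3" by (simp add: l_def)
    finally have pE': "prob E \<le> 4 / 3 * exp (- c * real n)" using pE by linarith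
    have "prob (N0 \<union> E) \<le> prob N0 + prob E" by (rule measure_Un_le[OF N0(1) Eev])
    then have pA: "prob (N0 \<union> E) \<le> 4 / 3 * exp (- c * real_of_int (l1 (z - x)))" using N0(2) pE' nr by simp
    have "?b * real n \<le> passage_time (\<lambda>e. \<tau> e \<omega>) xs"
      if w: "\<omega> \<in> space M - (N0 \<union> E)" and p: "path_between x z xs" "distinct xs" for \<omega> xs
    proof (rule ccontr)
      assume "\<not> ?b * real n \<le> passage_time (\<lambda>e. \<tau> e \<omega>) xs"
      then have less: "passage_time (\<lambda>e. \<tau> e \<omega>) xs < ?b * real n" by simp
      have xs: "xs \<noteq> []" "hd xs = x" "last xs = z" "successively (\<lambda>x y. {x, y} \<in> edges) xs"
        using p(1) by (auto simp: path_between_def)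
      let ?d = "defects \<sigma> h (\<lambda>e. \<tau> e \<omega>) xs"
      have "a0 * real_of_int (lev \<sigma> (last xs) - lev \<sigma> (hd xs)) + \<kappa> * real ?d \<le> passage_time (\<lambda>e. \<tau> e \<omega>) xs"
      proof (rule passage_time_defects[OF \<sigma>])
        show "\<forall>e\<in>edges. a0 \<le> \<tau> e \<omega>" using w by (auto simp: N0_def not_less)
      qed (use a0 xs p(2) \<kappa> in \<open>auto simp: \<kappa>_def h_def\<close>)
      then have "a0 * real n + \<kappa> * real ?d \<le> passage_time (\<lambda>e. \<tau> e \<omega>) xs" unfolding xs lv by simp
      then have "\<kappa> * real ?d < \<kappa> * (\<delta> * real n)" using less by (simp add: algebra_simps)
      then have "real ?d < \<delta> * real n" using \<kappa> by simp
      then have "?d \<le> D" unfolding D_def by (simp add: le_nat_floor)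
      moreover have "int (J * k) \<le> lev \<sigma> (last xs) - lev \<sigma> (hd xs)"
        unfolding xs(2,3) lv using Jk by (rule of_nat_mono)
      ultimately have "chain \<sigma> k h J D (\<lambda>e. \<tau> e \<omega>) (hd xs)" by (rule path_chain[OF \<sigma> k(1) xs(1,4)])
      moreover have "\<omega> \<in> space M" using w by simp
      ultimately have "\<omega> \<in> E" unfolding E_def xs(2) by simp
      then show False using w by simp
    qed
    then show ?thesis using N0(1) Eev pA unfolding nr by (intro bexI[of _ "N0 \<union> E"]) auto
  qed
  have "linear_lower_bound ?b"
    unfolding linear_lower_bound_def using main c(1) by (intro exI[of _ c] exI[of _ "4 / 3"] conjI allI) auto
  moreover have "0 < measure F {..a0 + \<kappa> * \<delta> / 2}" using Fm(3)[of "\<kappa> * \<delta> / 2"] \<kappa> \<delta> by simp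
  ultimately show ?thesis using a0 \<kappa> \<delta> by (intro exI[of _ "a0 + \<kappa> * \<delta> / 2"] exI[of _ ?b]) auto
qed

end

section \<open>Local configurations that spoil a convex boundary\<close>

lemma ptime_edge:
  assumes "nonneg_env t" "{x, y} \<in> edges" "t {x, y} \<le> a"
  shows "ptime t y \<le> ptime t x + a"
proof (rule conn_ptime[OF assms(1)])
  show "conn t UNIV x y a" unfolding conn_def
    using assms by (intro exI[of _ "[x, y]"]) (simp add: path_between_def passage_time_def)
qed

lemma path_edges_tail: "e \<in> path_edges (x # vs) \<Longrightarrow> \<exists>y\<in>set vs. y \<in> e"
  by (induction vs arbitrary: x) auto

text \<open>A box of side lengths proportional to the scale \<open>l\<close>, with \<open>w\<close> in the centre of its face of depth
zero and \<open>target\<close> below \<open>w\<close> at depth \<open>s * l\<close>. The surface carries a grid of mesh \<open>l\<close>; it has only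
\<open>O(l)\<close> edges, whereas the surface itself has many more in dimensions above two.\<close>

locale grid_box =
  fixes w :: "int ^ 'n::finite" and k :: 'n and \<sigma> :: int and l W h s :: nat
  assumes \<sigma>: "\<bar>\<sigma>\<bar> = 1" and l: "1 \<le> l" and W: "1 \<le> W" and s: "1 \<le> s" and h: "s < h" and dim: "2 \<le> CARD('n)"
begin

definition depth :: "int ^ 'n \<Rightarrow> int" where
  "depth x = \<sigma> * (w $ k - x $ k)"

definition box :: "(int ^ 'n) set" where
  "box = {x. 0 \<le> depth x \<and> depth x \<le> int (h * l) \<and> (\<forall>j. j \<noteq> k \<longrightarrow> \<bar>x $ j - w $ j\<bar> \<le> int (W * l))}"

definition box_interior :: "(int ^ 'n) set" where
  "box_interior = {x. 0 < depth x \<and> depth x < int (h * l) \<and> (\<forall>j. j \<noteq> k \<longrightarrow> \<bar>x $ j - w $ j\<bar> < int (W * l))}"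

definition shell :: "(int ^ 'n) set" where
  "shell = box - box_interior"

definition target :: "int ^ 'n" where
  "target = w - axis k (\<sigma> * int (s * l))"

definition grid :: "(int ^ 'n) set set" where
  "grid = {{x, x + axis i 1} | x i. x \<in> shell \<and> x + axis i 1 \<in> shell \<and> (\<forall>j. j \<noteq> i \<longrightarrow> int l dvd (x $ j - w $ j))}"

definition inner_edges :: "(int ^ 'n) set set" where
  "inner_edges = {e \<in> edges. e \<inter> box_interior \<noteq> {}}"

text \<open>Every coordinate is moved towards that of \<open>w\<close> to the next multiple of \<open>l\<close>. This preserves the face of
the box and does not increase the distance from \<open>w\<close>.\<close>

definition round :: "int ^ 'n \<Rightarrow> int ^ 'n" where
  "round x = (\<chi> j. w $ j + sgn (x $ j - w $ j) * (int l * (\<bar>x $ j - w $ j\<bar> div int l)))"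

lemma abs_depth: "\<bar>depth x\<bar> = \<bar>x $ k - w $ k\<bar>"
  using \<sigma> by (simp add: depth_def abs_mult abs_minus_commute)

lemma sigma_sq: "\<sigma> * \<sigma> = 1"
  using \<sigma> by (metis abs_mult_self_eq mult_1)

lemma depth_add: "depth (x + axis i c) = depth x - (if i = k then \<sigma> * c else 0)"
  by (auto simp: depth_def axis_def algebra_simps)

lemma depth_target: "depth target = int (s * l)"
  by (simp add: depth_def target_def axis_def mult.assoc[symmetric] sigma_sq)

lemma target_nth: "j \<noteq> k \<Longrightarrow> target $ j = w $ j"
  by (simp add: target_def axis_def)

lemma target_interior: "target \<in> box_interior"
proof -
  have "int (s * l) < int (h * l)" "0 < int (s * l)" "0 < int (W * l)" using h l s W by auto
  then show ?thesis by (simp only: box_interior_def mem_Collect_eq depth_target) (simp add: target_nth)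
qed

lemma shell_cases:
  assumes "x \<in> shell"
  obtains (top) "depth x = 0" | (side) j where "j \<noteq> k" "\<bar>x $ j - w $ j\<bar> = int (W * l)"
    | (bottom) "depth x = int (h * l)"
  using assms unfolding shell_def box_def box_interior_def by fastforce

lemma interior_step:
  assumes "y \<in> box_interior" "{x, y} \<in> edges" shows "x \<in> box"
proof -
  have "l1 (x - y) = 1" using assms(2) by (simp add: edge_iff)
  then have d: "\<bar>x $ j - y $ j\<bar> \<le> 1" for j using abs_component_le_l1[of "x - y" j] by simp
  have "\<bar>depth x - depth y\<bar> \<le> 1"
    using d[of k] \<sigma> by (simp add: depth_def right_diff_distrib[symmetric] abs_mult abs_minus_commute)
  moreover have "\<bar>x $ j - w $ j\<bar> \<le> int (W * l)" if "j \<noteq> k" for j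
  proof -
    have "\<bar>y $ j - w $ j\<bar> < int (W * l)" using assms(1) that by (simp add: box_interior_def)
    then show ?thesis using d[of j] by linarith
  qed
  moreover have "0 < depth y" "depth y < int (h * l)" using assms(1) by (auto simp: box_interior_def)
  ultimately show ?thesis by (auto simp: box_def)
qed

lemma l1_split: "l1 x = \<bar>x $ k\<bar> + (\<Sum>j\<in>UNIV - {k}. \<bar>x $ j\<bar>)"
  unfolding l1_def by (simp add: sum.remove[of _ k])

definition lateral :: "int ^ 'n \<Rightarrow> int" where
  "lateral x = (\<Sum>j\<in>UNIV - {k}. \<bar>x $ j - w $ j\<bar>)"

lemma l1_w: "l1 (x - w) = \<bar>depth x\<bar> + lateral x"
  using l1_split[of "x - w"] abs_depth[of x] by (simp add: lateral_def)

lemma l1_target: "l1 (target - x) = \<bar>depth x - int (s * l)\<bar> + lateral x"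
proof -
  have "depth x - int (s * l) = \<sigma> * (target $ k - x $ k)"
    unfolding depth_target[symmetric] by (simp add: depth_def algebra_simps)
  then have "\<bar>depth x - int (s * l)\<bar> = \<bar>target $ k - x $ k\<bar>" using \<sigma> by (simp add: abs_mult)
  moreover have "(\<Sum>j\<in>UNIV - {k}. \<bar>(target - x) $ j\<bar>) = lateral x"
    unfolding lateral_def by (intro sum.cong refl) (simp add: target_nth abs_minus_commute)
  ultimately show ?thesis using l1_split[of "target - x"] by simp
qed

lemma lateral_ge: "j \<noteq> k \<Longrightarrow> \<bar>x $ j - w $ j\<bar> \<le> lateral x"
  unfolding lateral_def by (rule member_le_sum) auto

lemma lateral_nonneg: "0 \<le> lateral x"
  unfolding lateral_def by (simp add: sum_nonneg)

text \<open>The target has distance of order \<open>l\<close> from the surface, which makes exceptional events for passages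
from the surface to the target exponentially rare in \<open>l\<close>.\<close>

lemma shell_far: "x \<in> shell \<Longrightarrow> int l \<le> l1 (target - x)"
proof (elim shell_cases)
  assume "depth x = 0"
  moreover have "l \<le> s * l" using s by simp
  then have "int l \<le> int (s * l)" by (rule of_nat_mono)
  ultimately show ?thesis using lateral_nonneg[of x] by (simp add: l1_target)
next
  fix j assume "j \<noteq> k" "\<bar>x $ j - w $ j\<bar> = int (W * l)"
  moreover have "l \<le> W * l" using W by simp
  then have "int l \<le> int (W * l)" by (rule of_nat_mono)
  ultimately show ?thesis using lateral_ge[of j x] by (simp add: l1_target)
next
  assume "depth x = int (h * l)"
  moreover have "int l \<le> int (h * l) - int (s * l)"
  proof -
    have "(s + 1) * l \<le> h * l" using h by (intro mult_le_mono1) simp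
    then have "int ((s + 1) * l) \<le> int (h * l)" by (rule of_nat_mono)
    then show ?thesis by (simp add: algebra_simps)
  qed
  ultimately show ?thesis using lateral_nonneg[of x] by (simp add: l1_target)
qed

subsection \<open>The fast grid on the shell\<close>

context
  fixes t :: "(int ^ 'n) set \<Rightarrow> real" and a :: real
  assumes t: "nonneg_env t" and a: "0 \<le> a" and fast: "\<forall>e\<in>grid. t e \<le> a"
begin

lemma grid_step:
  assumes "x \<in> shell" "x + axis i 1 \<in> shell" "\<And>j. j \<noteq> i \<Longrightarrow> int l dvd (x $ j - w $ j)"
  shows "ptime t (x + axis i 1) \<le> ptime t x + a" "ptime t x \<le> ptime t (x + axis i 1) + a"
proof -
  have "{x, x + axis i 1} \<in> grid" using assms by (auto simp: grid_def)
  then have "t {x, x + axis i 1} \<le> a" "t {x + axis i 1, x} \<le> a" using fast by (auto simp: insert_commute)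
  then show "ptime t (x + axis i 1) \<le> ptime t x + a" "ptime t x \<le> ptime t (x + axis i 1) + a"
    using ptime_edge[OF t] axis_edge by blast+
qed

lemma grid_segment:
  assumes "\<And>m. min 0 c \<le> m \<Longrightarrow> m \<le> max 0 c \<Longrightarrow> x + axis i m \<in> shell" "\<And>j. j \<noteq> i \<Longrightarrow> int l dvd (x $ j - w $ j)"
  shows "ptime t (x + axis i c) \<le> ptime t x + a * real_of_int \<bar>c\<bar>"
proof -
  have dv: "int l dvd ((x + axis i m) $ j - w $ j)" if "j \<noteq> i" for j m
    using assms(2)[OF that] that by (simp add: axis_def)
  have plus: "x + axis i (m + 1) = (x + axis i m) + axis i 1" for m by (auto simp: vec_eq_iff axis_def)
  have "ptime t (x + axis i (sgn c * int n)) \<le> ptime t x + a * real n" if "int n \<le> \<bar>c\<bar>" for n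
    using that
  proof (induction n)
    case (Suc n)
    show ?case
    proof (cases "0 < c")
      case True
      have "ptime t ((x + axis i (int n)) + axis i 1) \<le> ptime t (x + axis i (int n)) + a"
        unfolding plus[symmetric] using Suc.prems True
        by (subst plus, intro grid_step(1) dv assms(1)) (auto simp: plus[symmetric] intro!: assms(1))
      then show ?thesis using Suc True plus[of "int n"] by (simp add: algebra_simps)
    next
      case False
      then have c: "sgn c = -1" using Suc.prems by (simp add: sgn_if)
      have e: "- int (Suc n) + 1 = - int n" by simp
      have "ptime t (x + axis i (- int (Suc n))) \<le> ptime t ((x + axis i (- int (Suc n))) + axis i 1) + a"
        using Suc.prems False
        by (intro grid_step(2) dv assms(1)) (auto simp: plus[symmetric] e intro!: assms(1))
      then show ?thesis using Suc unfolding c plus[symmetric] e by (simp add: algebra_simps)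
    qed
  qed simp
  from this[of "nat \<bar>c\<bar>"] show ?thesis by (simp add: mult.commute[of "sgn c"] abs_mult_sgn)
qed

text \<open>On the face of \<open>w\<close>, follow the grid by changing one coordinate after the other.\<close>

lemma grid_top:
  assumes x: "x \<in> box" "depth x = 0" "\<forall>j. int l dvd (x $ j - w $ j)"
  shows "ptime t w \<le> ptime t x + a * real_of_int (l1 (x - w))"
proof -
  have xk: "x $ k = w $ k" using x(2) \<sigma> by (auto simp: depth_def)
  have "ptime t (mix S x w) \<le> ptime t x + a * real_of_int (\<Sum>i\<in>S. \<bar>x $ i - w $ i\<bar>)" if "finite S" for S
    using that
  proof (induction S rule: finite_induct)
    case (insert i S)
    have "ptime t (mix S x w + axis i (w $ i - x $ i)) \<le> ptime t (mix S x w) + a * real_of_int \<bar>w $ i - x $ i\<bar>"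
    proof (rule grid_segment)
      fix m assume m: "min 0 (w $ i - x $ i) \<le> m" "m \<le> max 0 (w $ i - x $ i)"
      let ?y = "mix S x w + axis i m"
      have yk: "?y $ k = w $ k" using xk m by (auto simp: axis_def)
      have "\<bar>?y $ j - w $ j\<bar> \<le> int (W * l)" if "j \<noteq> k" for j
      proof -
        have "\<bar>x $ j - w $ j\<bar> \<le> int (W * l)" using x(1) that by (simp add: box_def)
        then show ?thesis using m insert(2) by (cases "j = i") (auto simp: axis_def)
      qed
      then show "?y \<in> shell" using yk by (auto simp: shell_def box_def box_interior_def depth_def)
    next
      fix j show "int l dvd (mix S x w $ j - w $ j)" using x(3) by simp
    qed
    then show ?case using insert by (simp add: mix_insert algebra_simps abs_minus_commute)
  qed simp
  from this[of UNIV] show ?thesis by (simp add: l1_def)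
qed

text \<open>On a lateral face, first move in the direction \<open>k\<close> to the face of \<open>w\<close>.\<close>

lemma grid_side:
  assumes x: "x \<in> box" "j \<noteq> k" "\<bar>x $ j - w $ j\<bar> = int (W * l)" "\<forall>j. int l dvd (x $ j - w $ j)"
  shows "ptime t w \<le> ptime t x + a * real_of_int (l1 (x - w))"
proof -
  let ?c = "w $ k - x $ k"
  let ?y = "x + axis k ?c"
  have dy: "depth ?y = 0" by (simp add: depth_def axis_def)
  have dep: "0 \<le> \<sigma> * ?c" "\<sigma> * ?c \<le> int (h * l)" using x(1) by (auto simp: box_def depth_def)
  have "ptime t ?y \<le> ptime t x + a * real_of_int \<bar>?c\<bar>"
  proof (rule grid_segment)
    fix m assume m: "min 0 ?c \<le> m" "m \<le> max 0 ?c"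
    have "\<sigma> = 1 \<or> \<sigma> = -1" using \<sigma> by auto
    then have "0 \<le> depth (x + axis k m)" "depth (x + axis k m) \<le> int (h * l)"
      using m dep by (auto simp: depth_def axis_def)
    then show "x + axis k m \<in> shell" using x(1,2,3) by (auto simp: shell_def box_def box_interior_def axis_def)
  qed (use x(4) in simp)
  moreover have "ptime t w \<le> ptime t ?y + a * real_of_int (l1 (?y - w))"
  proof (rule grid_top[OF _ dy])
    show "?y \<in> box" using x(1) dy by (auto simp: box_def axis_def)
    show "\<forall>j. int l dvd (?y $ j - w $ j)" using x(4) by (simp add: axis_def)
  qed
  moreover have "l1 (x - w) = \<bar>?c\<bar> + l1 (?y - w)"
  proof -
    have "lateral ?y = lateral x" unfolding lateral_def by (intro sum.cong refl) (simp add: axis_def)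
    then show ?thesis using dy abs_depth[of x] by (simp add: l1_w abs_minus_commute)
  qed
  ultimately show ?thesis by (simp add: algebra_simps)
qed

text \<open>On the face opposite to \<open>w\<close>, first move to a lateral face; this detour is the additional term.\<close>

lemma grid_bottom:
  assumes x: "x \<in> box" "depth x = int (h * l)" "\<forall>j. int l dvd (x $ j - w $ j)"
  shows "ptime t w \<le> ptime t x + a * real_of_int (l1 (x - w) + 4 * int (W * l))"
proof -
  have "UNIV \<noteq> {k}"
  proof
    assume "UNIV = {k}"
    then have "CARD('n) = card {k}" by (rule arg_cong)
    with dim show False by simp
  qed
  then obtain i where i: "i \<noteq> k" by blast
  let ?c = "w $ i + int (W * l) - x $ i"
  let ?y = "x + axis i ?c"
  have xi: "\<bar>x $ i - w $ i\<bar> \<le> int (W * l)" using x(1) i by (simp add: box_def)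
  have c: "0 \<le> ?c" "?c \<le> 2 * int (W * l)" using xi by linarith+
  have dp: "depth (x + axis i m) = int (h * l)" for m using i x(2) by (simp add: depth_add)
  have in_box: "x + axis i m \<in> box" if m: "0 \<le> m" "m \<le> ?c" for m
  proof -
    have "\<bar>(x + axis i m) $ j - w $ j\<bar> \<le> int (W * l)" if "j \<noteq> k" for j
    proof (cases "j = i")
      case True
      then show ?thesis using m xi by (simp add: axis_def abs_le_iff)
    next
      case False
      then show ?thesis using x(1) that by (simp add: axis_def box_def)
    qed
    then show ?thesis by (simp add: box_def dp)
  qed
  have "ptime t ?y \<le> ptime t x + a * real_of_int \<bar>?c\<bar>"
  proof (rule grid_segment)
    fix m assume "min 0 ?c \<le> m" "m \<le> max 0 ?c"
    then have "x + axis i m \<in> box" using c by (intro in_box) auto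
    then show "x + axis i m \<in> shell" by (simp add: shell_def box_interior_def dp)
  qed (use x(3) in simp)
  moreover have "ptime t w \<le> ptime t ?y + a * real_of_int (l1 (?y - w))"
  proof (rule grid_side[OF _ i])
    show "?y \<in> box" using c by (intro in_box) auto
    show "\<bar>?y $ i - w $ i\<bar> = int (W * l)" by (simp add: axis_def)
    show "\<forall>j. int l dvd (?y $ j - w $ j)"
    proof
      fix j show "int l dvd (?y $ j - w $ j)" using x(3) by (cases "j = i") (simp_all add: axis_def)
    qed
  qed
  moreover have "l1 (?y - w) \<le> l1 (x - w) + \<bar>?c\<bar>"
  proof -
    have "?y - w = (x - w) + axis i ?c" by simp
    then show ?thesis by (metis l1_triangle l1_axis)
  qed
  ultimately have "ptime t w \<le> ptime t x + a * real_of_int \<bar>?c\<bar> + a * real_of_int (l1 (x - w) + \<bar>?c\<bar>)"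
    using a mult_left_mono[of "real_of_int (l1 (?y - w))" "real_of_int (l1 (x - w) + \<bar>?c\<bar>)" a] by linarith
  also have "\<dots> = ptime t x + a * real_of_int (l1 (x - w) + 2 * \<bar>?c\<bar>)" by (simp add: algebra_simps)
  also have "\<dots> \<le> ptime t x + a * real_of_int (l1 (x - w) + 4 * int (W * l))"
    using a c by (intro add_left_mono mult_left_mono of_int_le_iff[THEN iffD2]) auto
  finally show ?thesis .
qed

end

lemma round_props:
  shows "\<bar>round x $ j - x $ j\<bar> \<le> int l" "\<bar>round x $ j - w $ j\<bar> \<le> \<bar>x $ j - w $ j\<bar>" "int l dvd (round x $ j - w $ j)"
    "int l dvd (x $ j - w $ j) \<Longrightarrow> round x $ j = x $ j"
    "x $ j - w $ j = 0 \<or> (0 < x $ j - w $ j \<longrightarrow> 0 \<le> round x $ j - w $ j) \<and> (x $ j - w $ j < 0 \<longrightarrow> round x $ j - w $ j \<le> 0)"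
proof -
  let ?p = "x $ j - w $ j"
  have l0: "0 < int l" using l by simp
  have r: "round x $ j - w $ j = sgn ?p * (int l * (\<bar>?p\<bar> div int l))" by (simp add: round_def)
  define q where "q = int l * (\<bar>?p\<bar> div int l)"
  have dm: "q + \<bar>?p\<bar> mod int l = \<bar>?p\<bar>" by (simp add: q_def)
  have md: "0 \<le> \<bar>?p\<bar> mod int l" "\<bar>?p\<bar> mod int l < int l" using l0 by simp_all
  have nn: "0 \<le> q" using l0 by (simp add: q_def pos_imp_zdiv_nonneg_iff)
  have cases3: "(?p = 0 \<and> round x $ j - w $ j = 0) \<or> (0 < ?p \<and> round x $ j - w $ j = q) \<or> (?p < 0 \<and> round x $ j - w $ j = - q)"
    unfolding r q_def by (auto simp: sgn_if)
  show "\<bar>round x $ j - x $ j\<bar> \<le> int l" using cases3 dm md nn by linarith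
  show "\<bar>round x $ j - w $ j\<bar> \<le> \<bar>x $ j - w $ j\<bar>" using cases3 dm md nn by linarith
  show "int l dvd (round x $ j - w $ j)" unfolding r by simp
  show "?p = 0 \<or> (0 < ?p \<longrightarrow> 0 \<le> round x $ j - w $ j) \<and> (?p < 0 \<longrightarrow> round x $ j - w $ j \<le> 0)"
    using cases3 nn by linarith
  assume "int l dvd ?p"
  then have "\<bar>?p\<bar> mod int l = 0" by simp
  then have "round x $ j - w $ j = ?p" using dm cases3 by linarith
  then show "round x $ j = x $ j" by simp
qed

lemma depth_round: "x \<in> box \<Longrightarrow> 0 \<le> depth (round x) \<and> depth (round x) \<le> depth x"
proof -
  assume "x \<in> box"
  then have "0 \<le> \<sigma> * (w $ k - x $ k)" by (simp add: box_def depth_def)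
  moreover have "\<sigma> = 1 \<or> \<sigma> = -1" using \<sigma> by auto
  ultimately show ?thesis using round_props(2,5)[of x k] unfolding depth_def by auto
qed

lemma round_box: "x \<in> box \<Longrightarrow> round x \<in> box"
proof -
  assume x: "x \<in> box"
  have "\<bar>round x $ j - w $ j\<bar> \<le> int (W * l)" if "j \<noteq> k" for j
  proof -
    have "\<bar>x $ j - w $ j\<bar> \<le> int (W * l)" using x that by (simp add: box_def)
    then show ?thesis using round_props(2)[of x j] by linarith
  qed
  moreover have "depth x \<le> int (h * l)" using x by (simp add: box_def)
  ultimately show ?thesis using depth_round[OF x] by (simp add: box_def)
qed

text \<open>Let \<open>x\<close> be the last vertex outside the interior on an almost optimal path to the target. From \<open>x\<close> on
the path stays inside and pays \<open>b\<close> for every unit of the distance to the target. Instead one can go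
from \<open>x\<close> to the nearby grid point \<open>round x\<close> and along the grid to \<open>w\<close>, at the price of \<open>a\<close> per
unit. From the face of \<open>w\<close> this is cheaper because \<open>w\<close> is closer than the target, which is at depth
\<open>s * l\<close>. From the other faces the distances to \<open>w\<close> and to the target differ by at most a constant
multiple of the smaller scales, and \<open>a < b\<close> decides when \<open>W\<close> and \<open>h\<close> are large.\<close>

lemma grid_block:
  assumes t: "nonneg_env t" and a: "0 \<le> a" "a < b" and B: "0 \<le> B"
    and fast: "\<forall>e\<in>grid. t e \<le> a"
    and slow: "\<And>x xs. x \<in> shell \<Longrightarrow> path_between x target xs \<Longrightarrow> distinct xs \<Longrightarrow> path_edges xs \<subseteq> inner_edges \<Longrightarrow>
      b * real_of_int (l1 (target - x)) \<le> passage_time t xs"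
    and near: "\<And>x. x \<in> shell \<Longrightarrow> conn t UNIV x (round x) (B * real l)"
    and c1: "B + 1 \<le> b * real s" and c2: "B + 1 + a * real s \<le> (b - a) * real W"
    and c3: "B + 1 + b * real s + 4 * a * real W \<le> (b - a) * real h"
    and out: "0 \<notin> box" and T: "ptime t target \<le> T"
  shows "ptime t w \<le> T"
proof -
  obtain ps where ps: "path_between 0 target ps" "passage_time t ps < T + 1"
    using ptime_less_path[of t target "T + 1"] T by auto
  obtain ys where ys: "path_between 0 target ys" "distinct ys" "path_edges ys \<subseteq> path_edges ps"
    using path_distinct[OF ps(1)] by auto
  have "passage_time t ys \<le> passage_time t ps"
    unfolding passage_time_def using ys(3) t path_between_edges[OF ps(1)]
    by (intro sum_mono2) (auto simp: nonneg_env_def)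
  then have pt: "passage_time t ys < T + 1" using ps by simp
  have "0 \<in> set ys" using ys(1) hd_in_set[of ys] by (simp add: path_between_def)
  moreover have "0 \<notin> box_interior" using out by (auto simp: box_def box_interior_def)
  ultimately have "\<exists>y\<in>set ys. y \<notin> box_interior" by blast
  then obtain us x vs where spl: "ys = us @ x # vs" "x \<notin> box_interior" "\<forall>y\<in>set vs. \<not> y \<notin> box_interior"
    by (rule split_list_last_propE)
  have "vs \<noteq> []" using spl ys(1) target_interior by (auto simp: path_between_def)
  then obtain v vs' where v: "vs = v # vs'" by (cases vs) auto
  have succ: "successively (\<lambda>x y. {x, y} \<in> edges) (us @ x # vs)" using ys(1) spl by (simp add: path_between_def)
  then have "{x, v} \<in> edges" by (simp add: successively_append_iff v)
  then have xb: "x \<in> box" using interior_step[of v x] spl(3) v by auto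
  then have xs: "x \<in> shell" using spl(2) by (simp add: shell_def)
  have disj: "path_edges (us @ [x]) \<inter> path_edges (x # vs) = {}"
    by (rule path_edges_distinct_split[OF _ succ]) (use ys(2) spl in simp)
  have p1: "path_between 0 x (us @ [x])"
    using ys(1) succ by (auto simp: path_between_def spl successively_append_iff hd_append)
  have p2: "path_between x target (x # vs)"
    using ys(1) succ \<open>vs \<noteq> []\<close> by (auto simp: path_between_def spl successively_append_iff)
  have "path_edges ys = path_edges (us @ [x]) \<union> path_edges (x # vs)"
    using path_between_append(2)[OF p1 p2] by (simp add: spl)
  then have sum: "passage_time t ys = passage_time t (us @ [x]) + passage_time t (x # vs)"
    unfolding passage_time_def using disj by (simp add: sum.union_disjoint)
  have "path_edges (x # vs) \<subseteq> inner_edges"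
    using path_edges_tail spl(3) path_between_edges[OF p2] by (fastforce simp: inner_edges_def)
  then have sl: "b * real_of_int (l1 (target - x)) \<le> passage_time t (x # vs)"
    using slow[OF xs p2] ys(2) spl by simp
  have x1: "ptime t x + b * real_of_int (l1 (target - x)) < T + 1"
    using ptime_le[OF t p1] sl pt sum by linarith
  have x2: "ptime t (round x) \<le> ptime t x + B * real l" by (rule conn_ptime[OF t near[OF xs]])
  let ?r = "round x"
  have rb: "?r \<in> box" by (rule round_box[OF xb])
  have dv: "\<forall>j. int l dvd (?r $ j - w $ j)" using round_props(3) by simp
  have l1r: "l1 (?r - w) \<le> l1 (x - w)" unfolding l1_def using round_props(2) by (intro sum_mono) simp
  have l1r': "a * real_of_int (l1 (?r - w)) \<le> a * real_of_int (l1 (x - w))" using l1r a by (intro mult_left_mono) auto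
  define D where "D = real_of_int (depth x)"
  define L where "L = real_of_int (lateral x)"
  define L' where "L' = real l"
  have L': "1 \<le> L'" using l by (simp add: L'_def)
  have L: "0 \<le> L" using lateral_nonneg by (simp add: L_def)
  have xw: "real_of_int (l1 (x - w)) = D + L" using xb by (simp add: l1_w D_def L_def box_def)
  have xt: "real_of_int (l1 (target - x)) = \<bar>D - real s * L'\<bar> + L" by (simp add: l1_target D_def L_def L'_def)
  have goal: "ptime t w \<le> T" if "ptime t w \<le> ptime t ?r + a * R" "B * L' + a * R + L' \<le> b * (\<bar>D - real s * L'\<bar> + L)" for R
    using that x1 x2 L' unfolding xt L'_def[symmetric] by linarith
  show ?thesis using xs
  proof (cases rule: shell_cases)
    case top
    then have "depth ?r = 0" using depth_round[OF xb] by simp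
    then have "ptime t w \<le> ptime t ?r + a * real_of_int (l1 (?r - w))"
      by (rule grid_top[OF t a(1) fast rb _ dv])
    then have 1: "ptime t w \<le> ptime t ?r + a * (D + L)" using l1r'[unfolded xw] by linarith
    have "D = 0" using top by (simp add: D_def)
    moreover have "(B + 1) * L' \<le> b * real s * L'" using c1 L' by (intro mult_right_mono) auto
    moreover have "a * L \<le> b * L" using a L by (intro mult_right_mono) auto
    ultimately show ?thesis using L' by (intro goal[OF 1]) (simp add: algebra_simps)
  next
    case (side j)
    have "int l dvd (x $ j - w $ j)"
    proof -
      have "int l dvd \<bar>x $ j - w $ j\<bar>" using side(2) by simp
      then show ?thesis by simp
    qed
    then have "\<bar>?r $ j - w $ j\<bar> = int (W * l)" using round_props(4)[of x j] side(2) by simp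
    then have "ptime t w \<le> ptime t ?r + a * real_of_int (l1 (?r - w))"
      by (rule grid_side[OF t a(1) fast rb side(1) _ dv])
    then have 1: "ptime t w \<le> ptime t ?r + a * (D + L)" using l1r'[unfolded xw] by linarith
    have "real_of_int (int (W * l)) \<le> L"
      unfolding L_def using lateral_ge[OF side(1), of x] side(2) by (intro of_int_le_iff[THEN iffD2]) simp
    then have "real W * L' \<le> L" by (simp add: L'_def)
    then have "(b - a) * (real W * L') \<le> (b - a) * L" using a by (intro mult_left_mono) auto
    moreover have "(B + 1 + a * real s) * L' \<le> (b - a) * real W * L'" using c2 L' by (intro mult_right_mono) auto
    moreover have "a * D \<le> a * (\<bar>D - real s * L'\<bar> + real s * L')" using a by (intro mult_left_mono) auto
    moreover have "a * \<bar>D - real s * L'\<bar> \<le> b * \<bar>D - real s * L'\<bar>" using a by (intro mult_right_mono) auto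
    ultimately show ?thesis by (intro goal[OF 1]) (simp add: algebra_simps)
  next
    case bottom
    have "depth ?r = int (h * l)"
    proof -
      have "\<bar>x $ k - w $ k\<bar> = int (h * l)" using bottom abs_depth[of x] by simp
      then have "int l dvd \<bar>x $ k - w $ k\<bar>" by simp
      then have "?r $ k = x $ k" using round_props(4)[of x k] by simp
      then show ?thesis using bottom by (simp add: depth_def)
    qed
    then have "ptime t w \<le> ptime t ?r + a * real_of_int (l1 (?r - w) + 4 * int (W * l))"
      by (rule grid_bottom[OF t a(1) fast rb _ dv])
    also have "\<dots> \<le> ptime t ?r + a * (D + L + 4 * real W * L')"
      using l1r'[unfolded xw] by (simp add: algebra_simps L'_def)
    finally have 1: "ptime t w \<le> ptime t ?r + a * (D + L + 4 * real W * L')" .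
    have Dh: "D = real h * L'" using bottom by (simp add: D_def L'_def)
    have "real s * L' \<le> real h * L'" using h L' by (intro mult_right_mono) auto
    then have abs: "\<bar>D - real s * L'\<bar> = real h * L' - real s * L'" using Dh by simp
    have "(B + 1 + b * real s + 4 * a * real W) * L' \<le> (b - a) * real h * L'" using c3 L' by (intro mult_right_mono) auto
    moreover have "a * L \<le> b * L" using a L by (intro mult_right_mono) auto
    ultimately have "B * L' + a * (real h * L' + L + 4 * real W * L') + L' \<le> b * (real h * L' - real s * L' + L)"
      by (simp add: algebra_simps)
    then show ?thesis by (intro goal[OF 1]) (simp only: abs, simp only: Dh)
  qed
qed

end

context grid_box
begin

lemma box_coord:
  assumes "x \<in> box" shows "\<bar>x $ j - w $ j\<bar> \<le> int ((W + h) * l)"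
proof (cases "j = k")
  case True
  have "\<bar>x $ k - w $ k\<bar> \<le> int (h * l)" using assms abs_depth[of x] by (simp add: box_def)
  also have "\<dots> \<le> int ((W + h) * l)" by (intro of_nat_mono mult_le_mono1) simp
  finally show ?thesis using True by simp
next
  case False
  then have "\<bar>x $ j - w $ j\<bar> \<le> int (W * l)" using assms by (simp add: box_def)
  also have "\<dots> \<le> int ((W + h) * l)" by (intro of_nat_mono mult_le_mono1) simp
  finally show ?thesis .
qed

lemma box_l1: "x \<in> box \<Longrightarrow> l1 (x - w) \<le> int (CARD('n) * (W + h) * l)"
proof -
  assume x: "x \<in> box"
  have "l1 (x - w) \<le> (\<Sum>j\<in>(UNIV :: 'n set). int ((W + h) * l))"
    unfolding l1_def using box_coord[OF x] by (intro sum_mono) simp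
  then show ?thesis by (simp add: algebra_simps)
qed

lemma finite_box: "finite box" and card_box: "card box \<le> ((2 * (W + h) + 1) * l) ^ CARD('n)"
proof -
  have "finite box \<and> card box \<le> (2 * ((W + h) * l) + 1) ^ CARD('n)"
    using box_coord by (intro card_int_box_le) blast
  moreover have "(2 * ((W + h) * l) + 1) ^ CARD('n) \<le> ((2 * (W + h) + 1) * l) ^ CARD('n)"
    using l by (intro power_mono) (auto simp: algebra_simps)
  ultimately show "finite box" "card box \<le> ((2 * (W + h) + 1) * l) ^ CARD('n)"
    using order_trans by blast+
qed

lemma shell_box: "shell \<subseteq> box"
  by (auto simp: shell_def)

lemma interior_box: "box_interior \<subseteq> box"
  by (auto simp: box_def box_interior_def)

lemma grid_vertices: "e \<in> grid \<Longrightarrow> e \<subseteq> shell"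
  by (auto simp: grid_def)

lemma grid_edges: "grid \<subseteq> edges"
  using axis_edge(1) by (auto simp: grid_def)

lemma inner_vertices: "e \<in> inner_edges \<Longrightarrow> e \<subseteq> box"
proof
  fix y assume e: "e \<in> inner_edges" and y: "y \<in> e"
  then have ed: "e \<in> edges" by (simp add: inner_edges_def)
  obtain u where u: "u \<in> e" "u \<in> box_interior" using e by (auto simp: inner_edges_def)
  obtain p q where pq: "e = {p, q}" using edgeE[OF ed] by metis
  show "y \<in> box"
  proof (cases "y = u")
    case True then show ?thesis using u interior_box by auto
  next
    case False
    then have "e = {y, u}" using pq y u(1) by auto
    then show ?thesis using interior_step[OF u(2)] ed by simp
  qed
qed

lemma grid_inner_disjoint: "grid \<inter> inner_edges = {}"
  using grid_vertices by (fastforce simp: inner_edges_def shell_def)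

lemma card_grid: "finite grid \<and> card grid \<le> CARD('n) * (2 * (W + h) + 1) ^ CARD('n) * l"
proof -
  let ?H = "W + h"
  define V where "V = (\<lambda>i. {x \<in> box. \<forall>j. j \<noteq> i \<longrightarrow> int l dvd (x $ j - w $ j)})"
  have l0: "0 < int l" using l by simp
  have cV: "card (V i) \<le> (2 * ?H + 1) ^ CARD('n) * l" for i
  proof -
    let ?M = "(\<lambda>m. int l * m) ` {- int ?H..int ?H}"
    let ?A = "\<lambda>j. if j = i then {- int (?H * l)..int (?H * l)} else ?M"
    let ?f = "\<lambda>x :: int ^ 'n. \<lambda>j. x $ j - w $ j"
    have inj: "inj_on ?f (V i)" by (auto intro!: inj_onI simp: vec_eq_iff fun_eq_iff)
    have "?f x \<in> PiE UNIV ?A" if x: "x \<in> V i" for x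
    proof (rule PiE_I)
      fix j
      have c: "\<bar>x $ j - w $ j\<bar> \<le> int (?H * l)" using box_coord[of x j] x by (simp add: V_def)
      show "x $ j - w $ j \<in> ?A j"
      proof (cases "j = i")
        case True
        then show ?thesis using c by (simp add: abs_le_iff)
      next
        case False
        then obtain m where m: "x $ j - w $ j = int l * m" using x by (auto simp: V_def)
        have "int l * \<bar>m\<bar> \<le> int l * int ?H" using c m l0 by (simp add: abs_mult algebra_simps)
        then have "\<bar>m\<bar> \<le> int ?H" using l0 by (simp only: mult_le_cancel_left_pos)
        then show ?thesis using m False by (auto simp: abs_le_iff)
      qed
    qed auto
    then have sub: "?f ` V i \<subseteq> PiE UNIV ?A" by auto
    have fin: "finite (PiE UNIV ?A)" by (intro finite_PiE) auto
    have cM: "card ?M \<le> 2 * ?H + 1"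
    proof -
      have "card ?M \<le> card {- int ?H..int ?H}" by (rule card_image_le) simp
      also have "\<dots> = 2 * ?H + 1" by (simp add: nat_eq_iff)
      finally show ?thesis .
    qed
    have "card (V i) = card (?f ` V i)" by (rule card_image[OF inj, symmetric])
    also have "\<dots> \<le> card (PiE UNIV ?A)" by (rule card_mono[OF fin sub])
    also have "\<dots> = (\<Prod>j\<in>UNIV. card (?A j))" by (rule card_PiE) simp
    also have "\<dots> = card (?A i) * (\<Prod>j\<in>UNIV - {i}. card (?A j))" by (rule prod.remove) auto
    also have "(\<Prod>j\<in>UNIV - {i}. card (?A j)) = card ?M ^ (CARD('n) - 1)" by simp
    also have "card (?A i) = 2 * (?H * l) + 1" by (simp add: nat_eq_iff)
    also have "(2 * (?H * l) + 1) * card ?M ^ (CARD('n) - 1) \<le> ((2 * ?H + 1) * l) * (2 * ?H + 1) ^ (CARD('n) - 1)"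
      using l cM by (intro mult_mono power_mono) (auto simp: algebra_simps)
    also have "\<dots> = (2 * ?H + 1) ^ Suc (CARD('n) - 1) * l" by (simp only: power_Suc mult_ac)
    also have "Suc (CARD('n) - 1) = CARD('n)" using dim by simp
    finally show ?thesis .
  qed
  have fV: "finite (V i)" for i using finite_box by (simp add: V_def)
  have sub: "grid \<subseteq> (\<Union>i\<in>UNIV. (\<lambda>x. {x, x + axis i 1}) ` V i)"
    using shell_box by (force simp: grid_def V_def)
  have fU: "finite (\<Union>i\<in>UNIV. (\<lambda>x. {x, x + axis i 1}) ` V i)" using fV by auto
  have "card grid \<le> card (\<Union>i\<in>UNIV. (\<lambda>x. {x, x + axis i 1}) ` V i)" by (rule card_mono[OF fU sub])
  also have "\<dots> \<le> (\<Sum>i\<in>UNIV. card ((\<lambda>x. {x, x + axis i 1}) ` V i))" by (rule card_UN_le) simp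
  also have "\<dots> \<le> (\<Sum>i\<in>(UNIV :: 'n set). (2 * ?H + 1) ^ CARD('n) * l)"
    by (intro sum_mono order_trans[OF card_image_le cV] fV)
  also have "\<dots> = CARD('n) * (2 * ?H + 1) ^ CARD('n) * l" by simp
  finally show ?thesis using finite_subset[OF sub fU] by simp
qed

end

context iid_environment
begin

lemma prob_all_weights:
  assumes "finite J" "J \<subseteq> edges" "B \<in> sets borel"
  shows "{\<omega> \<in> space M. \<forall>e\<in>J. \<tau> e \<omega> \<in> B} \<in> sets (field J)"
    and "prob {\<omega> \<in> space M. \<forall>e\<in>J. \<tau> e \<omega> \<in> B} = measure F B ^ card J"
proof -
  let ?A = "\<lambda>e. {\<omega> \<in> space M. \<tau> e \<omega> \<in> B}"
  have Af: "?A e \<in> sets (field J')" if "e \<in> J'" for e J'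
  proof -
    have "\<tau> e -` B \<inter> space (field J') \<in> sets (field J')" by (rule measurable_sets[OF weight_field[OF that] assms(3)])
    moreover have "\<tau> e -` B \<inter> space (field J') = ?A e" by auto
    ultimately show ?thesis by simp
  qed
  have "{\<omega> \<in> space M. \<forall>e\<in>J. \<tau> e \<omega> \<in> B} \<in> sets (field J) \<and> prob {\<omega> \<in> space M. \<forall>e\<in>J. \<tau> e \<omega> \<in> B} = measure F B ^ card J"
  proof (cases "J = {}")
    case True
    then show ?thesis using sets.top[of "field J"] by (simp add: prob_space)
  next
    case False
    have eq: "{\<omega> \<in> space M. \<forall>e\<in>J. \<tau> e \<omega> \<in> B} = (\<Inter>e\<in>J. ?A e)" using False by auto
    have "prob (\<Inter>e\<in>J. ?A e) = (\<Prod>e\<in>J. prob (?A e))"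
      by (rule field_indep[where J = "\<lambda>e. {e}"]) (use assms False Af in \<open>auto simp: disjoint_family_on_def\<close>)
    also have "\<dots> = (\<Prod>e\<in>J. measure F B)"
      by (rule prod.cong[OF refl], rule prob_weight) (use assms in auto)
    finally have "prob (\<Inter>e\<in>J. ?A e) = measure F B ^ card J" by simp
    moreover have "(\<Inter>e\<in>J. ?A e) \<in> sets (field J)" by (rule sets.finite_INT[OF assms(1) False Af])
    ultimately show ?thesis unfolding eq by blast
  qed
  then show "{\<omega> \<in> space M. \<forall>e\<in>J. \<tau> e \<omega> \<in> B} \<in> sets (field J)"
    "prob {\<omega> \<in> space M. \<forall>e\<in>J. \<tau> e \<omega> \<in> B} = measure F B ^ card J" by blast+
qed

text \<open>At scale \<open>l\<close>, a spoiling event near \<open>w\<close> costs only \<open>exp (- K * l)\<close>, and in its presence \<open>w\<close> is reached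
at time \<open>T\<close> whenever the point at distance \<open>s * l\<close> behind \<open>w\<close> is. The origin has to be outside the
region of the event, as a path that starts inside the region may avoid its fast edges.\<close>

definition spoilable :: "nat \<Rightarrow> nat \<Rightarrow> real \<Rightarrow> bool" where
  "spoilable s A K \<longleftrightarrow> (\<exists>l0. \<forall>l\<ge>l0. \<forall>w k \<sigma>. \<bar>\<sigma>\<bar> = 1 \<longrightarrow>
     (\<exists>G\<in>sets (field (ball_edges w (A * l))). exp (- K * real l) \<le> prob G \<and>
       (\<forall>\<omega>\<in>G. \<forall>T. int (A * l) < l1 w \<longrightarrow> ptime (\<lambda>e. \<tau> e \<omega>) (w - axis k (\<sigma> * int (s * l))) \<le> T \<longrightarrow>
         ptime (\<lambda>e. \<tau> e \<omega>) w \<le> T)))"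

text \<open>If all the edges between the two points have weight zero, they are reached at the same time.\<close>

lemma spoilable_atom:
  assumes "0 < measure F {0}"
  shows "\<exists>K>0. spoilable 1 1 K"
proof -
  interpret F: prob_space F by (rule prob_space_law)
  let ?p = "measure F {0}"
  define K where "K = 1 - ln ?p"
  have p: "0 < ?p" "?p \<le> 1" using assms by auto
  then have "ln ?p \<le> 0" by simp
  then have K: "0 < K" by (simp add: K_def)
  have "\<exists>G\<in>sets (field (ball_edges w (1 * l))). exp (- K * real l) \<le> prob G \<and>
       (\<forall>\<omega>\<in>G. \<forall>T. int (1 * l) < l1 w \<longrightarrow> ptime (\<lambda>e. \<tau> e \<omega>) (w - axis k (\<sigma> * int (1 * l))) \<le> T \<longrightarrow>
         ptime (\<lambda>e. \<tau> e \<omega>) w \<le> T)" if \<sigma>: "\<bar>\<sigma>\<bar> = 1" for l w k \<sigma>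
  proof -
    let ?u = "axis k \<sigma> :: int ^ 'n"
    let ?z = "w - axis k (\<sigma> * int l)"
    let ?e = "\<lambda>i. {?z + int i *s ?u, ?z + int (Suc i) *s ?u}"
    define J where "J = ?e ` {..<l}"
    have u: "l1 ?u = 1" using \<sigma> by simp
    have zw: "?z + int l *s ?u = w" by (auto simp: vec_eq_iff axis_def)
    have J: "finite J" "J \<subseteq> ball_edges w l" "card J \<le> l"
    proof -
      show "finite J" by (simp add: J_def)
      show "card J \<le> l" unfolding J_def using card_image_le[of "{..<l}" ?e] by simp
      show "J \<subseteq> ball_edges w l"
      proof
        fix e assume "e \<in> J"
        then obtain i where i: "i < l" "e = ?e i" by (auto simp: J_def)
        have "(?z + int i *s ?u) - (?z + int (Suc i) *s ?u) = - ?u" by (simp add: vec_eq_iff algebra_simps)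
        then have "e \<in> edges" using u unfolding i(2) edge_iff by (simp add: l1_def)
        moreover have "l1 ((?z + int m *s ?u) - w) \<le> int l" if "m \<le> l" for m
        proof -
          have "(?z + int m *s ?u) - w = axis k (\<sigma> * (int m - int l))" by (auto simp: vec_eq_iff axis_def algebra_simps)
          then have "l1 ((?z + int m *s ?u) - w) = \<bar>int m - int l\<bar>" using \<sigma> by (simp add: abs_mult)
          then show ?thesis using that by simp
        qed
        ultimately show "e \<in> ball_edges w l" using i unfolding ball_edges_def by (simp del: of_nat_Suc)
      qed
    qed
    have Je: "J \<subseteq> edges" using J(2) ball_edges_subset by blast
    let ?G = "{\<omega> \<in> space M. \<forall>e\<in>J. \<tau> e \<omega> \<in> {0}}"
    have G: "?G \<in> sets (field J)" "prob ?G = ?p ^ card J" using prob_all_weights[OF J(1) Je, of "{0}"] by auto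
    have "exp (- K * real l) \<le> exp (ln ?p * real l)" using K_def by (simp add: mult_right_mono)
    also have "\<dots> = ?p ^ l" using p by (metis exp_ln exp_of_nat2_mult)
    also have "\<dots> \<le> ?p ^ card J" using p J(3) by (intro power_decreasing) auto
    finally have "exp (- K * real l) \<le> prob ?G" using G by simp
    moreover have "?G \<in> sets (field (ball_edges w l))" using G(1) field_mono[OF J(2)] by blast
    moreover have "ptime (\<lambda>e. \<tau> e \<omega>) w \<le> T" if w: "\<omega> \<in> ?G" and T: "ptime (\<lambda>e. \<tau> e \<omega>) ?z \<le> T" for \<omega> T
    proof -
      have "conn (\<lambda>e. \<tau> e \<omega>) UNIV ?z (?z + int l *s ?u) (0 * real l)"
      proof (rule conn_straight[OF u])
        fix i assume "i < l"
        then have "?e i \<in> J" by (simp add: J_def)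
        then show "\<tau> (?e i) \<omega> \<le> 0" using w by auto
      qed auto
      then have "conn (\<lambda>e. \<tau> e \<omega>) UNIV ?z w 0" unfolding zw by simp
      from conn_ptime[OF nonneg_env this] w T show ?thesis by simp
    qed
    ultimately show ?thesis by (intro bexI[of _ ?G]) auto
  qed
  then show ?thesis using K unfolding spoilable_def by blast
qed

text \<open>A union bound over the polynomially many points of the surface of the box.\<close>

lemma small_at_scale:
  assumes c: "0 < c" and q: "d < q"
  shows "\<exists>l0. \<forall>l\<ge>l0. real (A * l) ^ d * (C * exp (- c * real l) + C' / real l ^ q) \<le> 1 / 2"
proof -
  have "((\<lambda>x. x ^ d / exp x) \<longlongrightarrow> 0) (at_top :: real filter)" by (rule tendsto_power_div_exp_0)
  moreover have "filterlim (\<lambda>l. c * real l) at_top sequentially"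
    using filterlim_real_sequentially c by (intro filterlim_tendsto_pos_mult_at_top[OF tendsto_const]) auto
  ultimately have t1: "(\<lambda>l. (c * real l) ^ d / exp (c * real l)) \<longlonglongrightarrow> 0" by (rule filterlim_compose)
  have t2: "(\<lambda>l. 1 / real l) \<longlonglongrightarrow> 0" by (rule lim_1_over_n)
  have "(\<lambda>l. real A ^ d * C / c ^ d * ((c * real l) ^ d / exp (c * real l)) + real A ^ d * \<bar>C'\<bar> * (1 / real l)) \<longlonglongrightarrow> real A ^ d * C / c ^ d * 0 + real A ^ d * \<bar>C'\<bar> * 0"
    by (intro tendsto_intros t1 t2)
  then have "\<forall>\<^sub>F l in sequentially. real A ^ d * C / c ^ d * ((c * real l) ^ d / exp (c * real l)) + real A ^ d * \<bar>C'\<bar> * (1 / real l) < 1 / 2"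
    by (rule order_tendstoD(2)) simp
  then obtain l0 where l0: "\<And>l. l \<ge> l0 \<Longrightarrow> real A ^ d * C / c ^ d * ((c * real l) ^ d / exp (c * real l)) + real A ^ d * \<bar>C'\<bar> * (1 / real l) < 1 / 2"
    by (auto simp: eventually_sequentially)
  have "real (A * l) ^ d * (C * exp (- c * real l) + C' / real l ^ q) \<le> 1 / 2" if "l \<ge> max 1 l0" for l
  proof -
    have l: "0 < real l" "l \<ge> l0" using that by auto
    have e1: "real (A * l) ^ d * (C * exp (- c * real l)) = real A ^ d * C / c ^ d * ((c * real l) ^ d / exp (c * real l))"
      using c by (simp add: power_mult_distrib exp_minus divide_simps)
    have "real l ^ Suc d \<le> real l ^ q" using that q by (intro power_increasing) auto
    then have "real l ^ d / real l ^ q \<le> real l ^ d / real l ^ Suc d" using l by (intro divide_left_mono) auto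
    also have "\<dots> = 1 / real l" using l by simp
    finally have "real l ^ d / real l ^ q \<le> 1 / real l" .
    then have r: "(real A ^ d * \<bar>C'\<bar>) * (real l ^ d / real l ^ q) \<le> (real A ^ d * \<bar>C'\<bar>) * (1 / real l)"
      by (intro mult_left_mono) auto
    have "real (A * l) ^ d * (C' / real l ^ q) = (real A ^ d * C') * (real l ^ d / real l ^ q)"
      by (simp add: power_mult_distrib)
    also have "\<dots> \<le> (real A ^ d * \<bar>C'\<bar>) * (real l ^ d / real l ^ q)"
      by (intro mult_right_mono mult_left_mono) auto
    also note r
    finally have e2: "real (A * l) ^ d * (C' / real l ^ q) \<le> (real A ^ d * \<bar>C'\<bar>) * (1 / real l)" .
    have "real (A * l) ^ d * (C * exp (- c * real l) + C' / real l ^ q) =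
        real (A * l) ^ d * (C * exp (- c * real l)) + real (A * l) ^ d * (C' / real l ^ q)"
      by (rule distrib_left)
    also have "\<dots> \<le> real A ^ d * C / c ^ d * ((c * real l) ^ d / exp (c * real l)) + real A ^ d * \<bar>C'\<bar> * (1 / real l)"
      by (rule add_mono[OF eq_refl[OF e1] e2])
    also have "\<dots> \<le> 1 / 2" by (rule less_imp_le[OF l0[OF l(2)]])
    finally show ?thesis .
  qed
  then show ?thesis by blast
qed

text \<open>The event is an intersection of three: the grid is fast, passages through the interior to the target
are slow, and every point of the surface is well connected to its grid point. The first has probability
\<open>p ^ O(l)\<close>. The other two are likely, and as they are formulated without reference to the weights on
the grid, they are independent of the first.\<close>

lemma spoilable_no_atom:
  assumes ab: "0 \<le> a" "a < b" "0 < measure F {..a}" "linear_lower_bound b"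
    and mom: "\<forall>e\<in>edges. integrable M (\<lambda>\<omega>. \<tau> e \<omega> ^ (2 * m))" "1 \<le> m" and dim: "2 \<le> CARD('n)"
  shows "\<exists>s\<ge>1. \<exists>A. \<exists>K>0. spoilable s A K"
proof -
  let ?d = "CARD('n)"
  obtain B C1 where B: "0 < B" "0 < C1" and ub0: "\<forall>N\<ge>1. \<forall>x y. (\<forall>j. \<bar>y $ j - x $ j\<bar> \<le> int N) \<longrightarrow>
    prob {\<omega> \<in> space M. \<not> conn (raised a \<omega>) (ball_edges x ((20 + ?d) * N)) x y (B * real N)}
      \<le> C1 / real N ^ (2 * ?d * m)"
    using passage_upper_bound[OF mom dim ab(1)] by (elim exE conjE)
  have ub: "prob {\<omega> \<in> space M. \<not> conn (raised a \<omega>) (ball_edges x ((20 + ?d) * N)) x y (B * real N)}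
      \<le> C1 / real N ^ (2 * ?d * m)" if "1 \<le> N" "\<forall>j. \<bar>y $ j - x $ j\<bar> \<le> int N" for N x y
    using ub0 that by simp
  obtain c2 C2 where c2: "0 < c2" "0 < C2" and lo0: "\<forall>x z. \<exists>A\<in>events. prob A \<le> C2 * exp (- c2 * real_of_int (l1 (z - x))) \<and>
    (\<forall>\<omega>\<in>space M - A. \<forall>xs. path_between x z xs \<and> distinct xs \<longrightarrow>
      b * real_of_int (l1 (z - x)) \<le> passage_time (\<lambda>e. \<tau> e \<omega>) xs)"
    using ab(4) unfolding linear_lower_bound_def by (elim exE conjE)
  \<comment> \<open>the parameters of the box are chosen one after the other to meet the requirements of \<open>grid_block\<close>\<close>
  obtain s' where s': "B + 1 < real s' * b" using ex_less_of_nat_mult[of b "B + 1"] ab by auto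
  define s where "s = Suc s'"
  have s: "1 \<le> s" "B + 1 \<le> b * real s" using s' ab by (auto simp: s_def algebra_simps)
  obtain W' where W': "B + 1 + a * real s < real W' * (b - a)" using ex_less_of_nat_mult[of "b - a"] ab by auto
  define W where "W = Suc W'"
  have W: "1 \<le> W" "B + 1 + a * real s \<le> (b - a) * real W" using W' ab by (auto simp: W_def algebra_simps)
  obtain h' where h': "B + 1 + b * real s + 4 * a * real W < real h' * (b - a)" using ex_less_of_nat_mult[of "b - a"] ab by auto
  define h where "h = h' + s + 1"
  have "(b - a) * real h' \<le> (b - a) * real h" using ab by (intro mult_left_mono) (auto simp: h_def)
  then have h: "s < h" "B + 1 + b * real s + 4 * a * real W \<le> (b - a) * real h" using h' by (auto simp: h_def mult.commute)
  define H where "H = W + h"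
  define A where "A = ?d * H + 21 + ?d"
  define K1 where "K1 = ?d * (2 * H + 1) ^ ?d"
  let ?p = "measure F {..a}"
  interpret F: prob_space F by (rule prob_space_law)
  have p: "0 < ?p" "?p \<le> 1" using ab by auto
  define K where "K = 1 - ln ?p * real K1"
  have "ln ?p * real K1 \<le> 0" using p by (intro mult_nonpos_nonneg) auto
  then have K: "0 < K" by (simp add: K_def)
  have "?d < 2 * ?d * m"
  proof -
    have "?d * 1 < ?d * (2 * m)" using mom(2) dim by (intro mult_strict_left_mono) auto
    then show ?thesis by (simp add: mult_ac)
  qed
  from small_at_scale[OF c2(1) this, of "2 * H + 1" C2 C1] obtain l0 where
    l0: "\<forall>l\<ge>l0. real ((2 * H + 1) * l) ^ ?d * (C2 * exp (- c2 * real l) + C1 / real l ^ (2 * ?d * m)) \<le> 1 / 2"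
    by (elim exE)
  have main: "\<exists>G\<in>sets (field (ball_edges w (A * l))). exp (- K * real l) \<le> prob G \<and>
       (\<forall>\<omega>\<in>G. \<forall>T. int (A * l) < l1 w \<longrightarrow> ptime (\<lambda>e. \<tau> e \<omega>) (w - axis k (\<sigma> * int (s * l))) \<le> T \<longrightarrow>
         ptime (\<lambda>e. \<tau> e \<omega>) w \<le> T)" if l: "max 1 l0 \<le> l" and \<sigma>: "\<bar>\<sigma>\<bar> = 1" for l w k \<sigma>
  proof -
    have large: "l0 \<le> l" using l by simp
    note scales = s(2) W(2) h(2)
    interpret grid_box w k \<sigma> l W h s
      by unfold_locales (use l \<sigma> W s h dim in auto)
    let ?ball = "ball_edges w (A * l)"
    have in_ball: "e \<in> ?ball" if "e \<in> edges" "e \<subseteq> box" for e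
    proof -
      have "l1 (x - w) \<le> int (A * l)" if "x \<in> box" for x
      proof -
        have "?d * H * l \<le> A * l" by (intro mult_le_mono1) (simp add: A_def)
        then have "int (?d * H * l) \<le> int (A * l)" by (rule of_nat_mono)
        then show ?thesis using box_l1[OF that] by (simp add: H_def)
      qed
      then show ?thesis using that by (auto simp: ball_edges_def)
    qed
    have grid_ball: "grid \<subseteq> ?ball" using in_ball grid_edges grid_vertices shell_box by blast
    have inner_ball: "inner_edges \<subseteq> ?ball" using in_ball inner_vertices by (auto simp: inner_edges_def)
    have near_ball: "ball_edges x ((20 + ?d) * l) \<subseteq> ?ball" if "x \<in> box" for x
    proof (rule ball_edges_mono)
      have "int (?d * H * l) + int ((20 + ?d) * l) \<le> int (A * l)" by (simp add: A_def algebra_simps)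
      then show "l1 (x - w) + int ((20 + ?d) * l) \<le> int (A * l)" using box_l1[OF that] by (simp add: H_def)
    qed
    define Rest where "Rest = ?ball - grid"
    have Rest: "Rest \<subseteq> edges" "inner_edges \<subseteq> Rest" "grid \<inter> Rest = {}"
      using ball_edges_subset inner_ball grid_inner_disjoint by (auto simp: Rest_def)
    have fin_inner: "finite inner_edges" by (rule finite_subset[OF inner_ball finite_ball_edges])
    have fin_shell: "finite shell" by (rule finite_subset[OF shell_box finite_box])
    have card_shell: "real (card shell) \<le> real ((2 * H + 1) * l) ^ ?d"
    proof -
      have "card shell \<le> ((2 * H + 1) * l) ^ ?d"
        using card_mono[OF finite_box shell_box] card_box unfolding H_def by linarith
      then have "real (card shell) \<le> real (((2 * H + 1) * l) ^ ?d)" by (rule of_nat_mono)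
      then show ?thesis by (simp only: of_nat_power)
    qed
    define G1 where "G1 = {\<omega> \<in> space M. \<forall>e\<in>grid. \<tau> e \<omega> \<in> {..a}}"
    have G1: "G1 \<in> sets (field grid)" "prob G1 = ?p ^ card grid"
      unfolding G1_def using prob_all_weights[OF _ grid_edges, of "{..a}"] card_grid by auto
    define PE where "PE = (\<lambda>x. {path_edges xs | xs. path_between x target xs \<and> distinct xs \<and> path_edges xs \<subseteq> inner_edges})"
    have fin_PE: "finite (PE x)" for x by (rule finite_subset[of _ "Pow inner_edges"]) (use fin_inner in \<open>auto simp: PE_def\<close>)
    define G2 where "G2 = {\<omega> \<in> space M. \<forall>x\<in>shell. \<forall>E\<in>PE x. b * real_of_int (l1 (target - x)) \<le> (\<Sum>e\<in>E. \<tau> e \<omega>)}"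
    have G2: "G2 \<in> sets (field Rest)"
    proof -
      have "{\<omega> \<in> space (field Rest). b * real_of_int (l1 (target - x)) \<le> (\<Sum>e\<in>E. \<tau> e \<omega>)} \<in> sets (field Rest)" if "E \<in> PE x" for x E
      proof -
        have "(\<lambda>\<omega>. \<Sum>e\<in>E. \<tau> e \<omega>) \<in> borel_measurable (field Rest)"
          by (intro borel_measurable_sum weight_field) (use that Rest(2) in \<open>auto simp: PE_def\<close>)
        then show ?thesis by measurable
      qed
      then have "{\<omega> \<in> space (field Rest). \<forall>x\<in>shell. \<forall>E\<in>PE x. b * real_of_int (l1 (target - x)) \<le> (\<Sum>e\<in>E. \<tau> e \<omega>)} \<in> sets (field Rest)"
        by (intro sets.sets_Collect_finite_All[OF _ fin_shell] sets.sets_Collect_finite_All[OF _ fin_PE]) auto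
      then show ?thesis by (simp add: G2_def)
    qed
    \<comment> \<open>on the grid the upper bound \<open>a\<close> takes the place of the weight, so that the event below depends only
      on the other edges\<close>
    let ?ta = "\<lambda>\<omega> e. if e \<in> grid then a else \<tau> e \<omega>"
    define G3 where "G3 = {\<omega> \<in> space M. \<forall>x\<in>shell. conn (?ta \<omega>) (ball_edges x ((20 + ?d) * l)) x (round x) (B * real l)}"
    have G3: "G3 \<in> sets (field Rest)"
    proof -
      have "{\<omega> \<in> space (field Rest). conn (?ta \<omega>) (ball_edges x ((20 + ?d) * l)) x (round x) (B * real l)} \<in> sets (field Rest)" if "x \<in> shell" for x
      proof (rule conn_sets[OF finite_ball_edges])
        fix e assume "e \<in> ball_edges x ((20 + ?d) * l)"
        then have "e \<in> ?ball" using near_ball that shell_box by blast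
        then show "(\<lambda>\<omega>. ?ta \<omega> e) \<in> borel_measurable (field Rest)"
          by (cases "e \<in> grid") (auto simp: Rest_def intro: weight_field)
      qed
      then have "{\<omega> \<in> space (field Rest). \<forall>x\<in>shell. conn (?ta \<omega>) (ball_edges x ((20 + ?d) * l)) x (round x) (B * real l)} \<in> sets (field Rest)"
        by (intro sets.sets_Collect_finite_All[OF _ fin_shell]) auto
      then show ?thesis by (simp add: G3_def)
    qed
    have G23: "G2 \<inter> G3 \<in> sets (field Rest)" using G2 G3 by (rule sets.Int)
    have ev2: "G2 \<in> events" "G3 \<in> events" "G2 \<inter> G3 \<in> events"
      using field_events[OF Rest(1)] G2 G3 G23 by blast+
    obtain N where N0: "\<forall>x. N x \<in> events \<and> prob (N x) \<le> C2 * exp (- c2 * real_of_int (l1 (target - x))) \<and>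
      (\<forall>\<omega>\<in>space M - N x. \<forall>xs. path_between x target xs \<and> distinct xs \<longrightarrow>
        b * real_of_int (l1 (target - x)) \<le> passage_time (\<lambda>e. \<tau> e \<omega>) xs)"
    proof -
      define Q where "Q = (\<lambda>x A. A \<in> events \<and> prob A \<le> C2 * exp (- c2 * real_of_int (l1 (target - x))) \<and>
        (\<forall>\<omega>\<in>space M - A. \<forall>xs. path_between x target xs \<and> distinct xs \<longrightarrow>
        b * real_of_int (l1 (target - x)) \<le> passage_time (\<lambda>e. \<tau> e \<omega>) xs))"
      have "\<forall>x. \<exists>A. Q x A"
      proof
        fix x
        obtain A where "A \<in> events" "prob A \<le> C2 * exp (- c2 * real_of_int (l1 (target - x)))"
          "\<forall>\<omega>\<in>space M - A. \<forall>xs. path_between x target xs \<and> distinct xs \<longrightarrow>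
            b * real_of_int (l1 (target - x)) \<le> passage_time (\<lambda>e. \<tau> e \<omega>) xs"
          using spec[OF spec[OF lo0, of x], of target] by (elim bexE conjE)
        then have "Q x A" unfolding Q_def by (intro conjI)
        then show "\<exists>A. Q x A" by (rule exI)
      qed
      from choice[OF this] obtain N where "\<forall>x. Q x (N x)" by (elim exE)
      then show thesis unfolding Q_def by (rule that)
    qed
    let ?U = "\<lambda>x. {\<omega> \<in> space M. \<not> conn (raised a \<omega>) (ball_edges x ((20 + ?d) * l)) x (round x) (B * real l)}"
    have "space M - (G2 \<inter> G3) \<subseteq> (\<Union>x\<in>shell. N x \<union> ?U x)"
    proof (rule subsetI, rule ccontr)
      fix \<omega> assume w: "\<omega> \<in> space M - (G2 \<inter> G3)" "\<omega> \<notin> (\<Union>x\<in>shell. N x \<union> ?U x)"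
      have "\<omega> \<in> G2"
        unfolding G2_def
      proof (intro CollectI conjI ballI)
        fix x E assume x: "x \<in> shell" "E \<in> PE x"
        then obtain xs where xs: "path_between x target xs" "distinct xs" "E = path_edges xs" by (auto simp: PE_def)
        have "\<omega> \<in> space M - N x" using w x by auto
        then show "b * real_of_int (l1 (target - x)) \<le> (\<Sum>e\<in>E. \<tau> e \<omega>)"
          using N0 xs by (simp add: passage_time_def)
      qed (use w in simp)
      moreover have "\<omega> \<in> G3"
        unfolding G3_def
      proof (intro CollectI conjI ballI)
        fix x assume x: "x \<in> shell"
        then have "conn (raised a \<omega>) (ball_edges x ((20 + ?d) * l)) x (round x) (B * real l)" using w by auto
        then show "conn (?ta \<omega>) (ball_edges x ((20 + ?d) * l)) x (round x) (B * real l)"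
          by (rule conn_env_mono) (use w nonneg ab in auto)
      qed (use w in simp)
      ultimately show False using w by simp
    qed
    moreover have NU: "N x \<union> ?U x \<in> events" for x using N0 not_conn_raised_sets by blast
    ultimately have "prob (space M - (G2 \<inter> G3)) \<le> prob (\<Union>x\<in>shell. N x \<union> ?U x)"
      by (intro finite_measure_mono sets.finite_UN[OF fin_shell]) auto
    also have "\<dots> \<le> (\<Sum>x\<in>shell. prob (N x \<union> ?U x))"
      by (rule finite_measure_subadditive_finite[OF fin_shell]) (use NU in auto)
    also have "\<dots> \<le> (\<Sum>x\<in>shell. C2 * exp (- c2 * real l) + C1 / real l ^ (2 * ?d * m))"
    proof (rule sum_mono)
      fix x assume x: "x \<in> shell"
      have "prob (N x \<union> ?U x) \<le> prob (N x) + prob (?U x)"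
        using N0 not_conn_raised_sets by (intro measure_Un_le) blast+
      also have "prob (?U x) \<le> C1 / real l ^ (2 * ?d * m)"
        by (rule ub) (use l round_props(1)[of x] in auto)
      also have "prob (N x) \<le> C2 * exp (- c2 * real_of_int (l1 (target - x)))" using N0 by blast
      also have "\<dots> \<le> C2 * exp (- c2 * real l)"
      proof -
        have "real l \<le> real_of_int (l1 (target - x))" using shell_far[OF x] by linarith
        then show ?thesis using c2 by simp
      qed
      finally show "prob (N x \<union> ?U x) \<le> C2 * exp (- c2 * real l) + C1 / real l ^ (2 * ?d * m)" by simp
    qed
    also have "\<dots> = real (card shell) * (C2 * exp (- c2 * real l) + C1 / real l ^ (2 * ?d * m))" by simp
    also have "\<dots> \<le> real ((2 * H + 1) * l) ^ ?d * (C2 * exp (- c2 * real l) + C1 / real l ^ (2 * ?d * m))"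
      using c2 B by (intro mult_right_mono card_shell) auto
    also have "\<dots> \<le> 1 / 2" using l0 large by (elim allE impE)
    finally have half: "1 / 2 \<le> prob (G2 \<inter> G3)" using prob_compl[OF ev2(3)] by simp
    have fin_grid: "finite grid" "card grid \<le> K1 * l" using card_grid by (auto simp: K1_def H_def)
    have "exp (- K * real l) = exp (- real l) * exp (ln ?p * (real K1 * real l))"
      unfolding exp_add[symmetric] by (simp add: K_def algebra_simps)
    also have "exp (ln ?p * (real K1 * real l)) = ?p ^ (K1 * l)"
      using p exp_of_nat2_mult[of "ln ?p" "K1 * l"] by simp
    also have "exp (- real l) * ?p ^ (K1 * l) \<le> 1 / 2 * ?p ^ card grid"
    proof (intro mult_mono power_decreasing)
      have "2 \<le> 1 + real l" using l by simp
      also have "\<dots> \<le> exp (real l)" by (rule exp_ge_add_one_self)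
      finally show "exp (- real l) \<le> 1 / 2" by (simp add: exp_minus field_simps)
    qed (use p fin_grid in auto)
    also have "\<dots> \<le> prob (G2 \<inter> G3) * prob G1" unfolding G1(2) using half p by (intro mult_right_mono) auto
    also have "\<dots> = prob (G1 \<inter> (G2 \<inter> G3))"
      using field_indep2[OF grid_edges Rest(1,3) G1(1) G23] by simp
    finally have pG: "exp (- K * real l) \<le> prob (G1 \<inter> (G2 \<inter> G3))" .
    have "G1 \<in> sets (field ?ball)" "G2 \<inter> G3 \<in> sets (field ?ball)"
      using G1(1) G23 field_mono[OF grid_ball] field_mono[of Rest ?ball] by (auto simp: Rest_def)
    then have Gf: "G1 \<inter> (G2 \<inter> G3) \<in> sets (field ?ball)" by (rule sets.Int)
    have "ptime (\<lambda>e. \<tau> e \<omega>) w \<le> T"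
      if w: "\<omega> \<in> G1 \<inter> (G2 \<inter> G3)" and far: "int (A * l) < l1 w" and T: "ptime (\<lambda>e. \<tau> e \<omega>) (w - axis k (\<sigma> * int (s * l))) \<le> T" for \<omega> T
    proof -
      have sp: "\<omega> \<in> space M" using w by (simp add: G1_def)
      show ?thesis
      proof (rule grid_block[OF nonneg_env[OF sp] ab(1,2), of B])
        show "\<forall>e\<in>grid. \<tau> e \<omega> \<le> a" using w by (simp add: G1_def)
        show "b * real_of_int (l1 (target - x)) \<le> passage_time (\<lambda>e. \<tau> e \<omega>) xs"
          if "x \<in> shell" "path_between x target xs" "distinct xs" "path_edges xs \<subseteq> inner_edges" for x xs
        proof -
          have "path_edges xs \<in> PE x" using that by (auto simp: PE_def)
          then show ?thesis using w that(1) by (simp add: G2_def passage_time_def)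
        qed
        show "conn (\<lambda>e. \<tau> e \<omega>) UNIV x (round x) (B * real l)" if "x \<in> shell" for x
        proof -
          have "conn (?ta \<omega>) (ball_edges x ((20 + ?d) * l)) x (round x) (B * real l)" using w that by (simp add: G3_def)
          then have "conn (\<lambda>e. \<tau> e \<omega>) (ball_edges x ((20 + ?d) * l)) x (round x) (B * real l)"
            by (rule conn_env_mono) (use w in \<open>auto simp: G1_def\<close>)
          then show ?thesis by (rule conn_mono) auto
        qed
        show "0 \<notin> box"
        proof
          assume "0 \<in> box"
          then have "l1 (0 - w) \<le> int (?d * H * l)" using box_l1[of 0] by (simp add: H_def)
          moreover have "l1 (0 - w) = l1 w" using l1_minus_commute[of 0 w] by simp
          moreover have "int (?d * H * l) \<le> int (A * l)" by (intro of_nat_mono mult_le_mono1) (simp add: A_def)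
          ultimately show False using far by linarith
        qed
        show "ptime (\<lambda>e. \<tau> e \<omega>) target \<le> T" using T by (simp add: target_def)
      qed (use B scales in auto)
    qed
    then show ?thesis by (intro bexI[OF _ Gf] conjI pG ballI allI impI)
  qed
  have "spoilable s A K" unfolding spoilable_def by (intro exI[of _ "max 1 l0"] allI impI main)
  then show ?thesis using s(1) K by (intro exI[of _ s] exI[of _ A] exI[of _ K] conjI)
qed

end

section \<open>Convex sets and fluctuations\<close>

lemma rvec_add: "rvec (x + y) = rvec x + rvec y"
  by (simp add: rvec_def vec_eq_iff)

lemma rvec_diff: "rvec (x - y) = rvec x - rvec y"
  by (simp add: rvec_def vec_eq_iff)

lemma rvec_axis: "rvec (axis k a) = axis k (real_of_int a)"
  by (simp add: rvec_def axis_def vec_eq_iff)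

lemma norm_rvec_le_l1: "norm (rvec x) \<le> real_of_int (l1 x)"
  using norm_le_l1_cart[of "rvec x"] by (simp add: l1_def)

lemma norm_lattice_floor:
  fixes p :: "real ^ 'n::finite"
  shows "norm (rvec (lattice_floor p) - p) \<le> real CARD('n)"
proof -
  have "norm (rvec (lattice_floor p) - p) \<le> (\<Sum>i\<in>(UNIV :: 'n set). \<bar>(rvec (lattice_floor p) - p) $ i\<bar>)"
    by (rule norm_le_l1_cart)
  also have "\<dots> \<le> (\<Sum>i\<in>(UNIV :: 'n set). 1)"
  proof (rule sum_mono)
    fix i
    have "(rvec (lattice_floor p) - p) $ i = of_int \<lfloor>p $ i\<rfloor> - p $ i" by (simp add: lattice_floor_def)
    then show "\<bar>(rvec (lattice_floor p) - p) $ i\<bar> \<le> 1" by linarith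
  qed
  finally show ?thesis by simp
qed

lemma fpp_ball_floor:
  fixes p :: "real ^ 'n::finite"
  shows "p \<in> fpp_ball \<tau> t \<longleftrightarrow> ptime \<tau> (lattice_floor p) \<le> t"
proof -
  have "lattice_floor (0 :: real ^ 'n) = 0" by (simp add: lattice_floor_def vec_eq_iff)
  then show ?thesis by (simp add: fpp_ball_def first_passage_time_def ptime_def)
qed

lemma fluctuation_less:
  assumes "fluctuation C A G \<le> ereal x" "x < y"
  obtains \<delta> where "0 < \<delta>" "\<delta> < y" "inner_part \<delta> G \<inter> C \<subseteq> A" "A \<inter> C \<subseteq> outer_part \<delta> G"
proof -
  have "fluctuation C A G < ereal y" using assms by (simp add: le_less_trans)
  then obtain \<delta> where "0 < \<delta> \<and> inner_part \<delta> G \<inter> C \<subseteq> A \<inter> C \<and> A \<inter> C \<subseteq> outer_part \<delta> G \<inter> C" "\<delta> < y"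
    unfolding fluctuation_def Inf_less_iff by auto
  then show thesis by (intro that[of \<delta>]) auto
qed

text \<open>The infimum in the definition need not be attained, hence the strict inequality: some \<open>\<delta> < y\<close> is
admissible.\<close>

lemma fluctuation_inside:
  assumes f: "fluctuation C A G \<le> ereal x" "x < y" and z: "cball z y \<subseteq> G" "z \<in> C"
  shows "z \<in> A"
proof -
  obtain \<delta> where d: "0 < \<delta>" "\<delta> < y" "inner_part \<delta> G \<inter> C \<subseteq> A" by (rule fluctuation_less[OF f])
  have "ereal \<delta> \<le> edist_set z (- G)"
    unfolding edist_set_def
  proof (rule INF_greatest)
    fix v assume "v \<in> - G"
    then have "v \<notin> cball z y" using z by blast
    then show "ereal \<delta> \<le> ereal (dist z v)" using d by simp
  qed
  moreover have "z \<in> G" using z(1) d by auto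
  ultimately show ?thesis using d z by (auto simp: inner_part_def)
qed

lemma fluctuation_outside:
  assumes f: "fluctuation C A G \<le> ereal x" "x < y" and z: "z \<in> A" "z \<in> C"
  shows "\<exists>v\<in>G. dist z v < y"
proof -
  obtain \<delta> where d: "\<delta> < y" "A \<inter> C \<subseteq> outer_part \<delta> G" by (rule fluctuation_less[OF f])
  then have "edist_set z G < ereal y" using z by (auto simp: outer_part_def intro: le_less_trans)
  then show ?thesis unfolding edist_set_def INF_less_iff by simp
qed

lemma supporting_halfspace:
  fixes \<Gamma> :: "'a::euclidean_space set"
  assumes "closed \<Gamma>" "convex \<Gamma>" "\<Gamma> \<noteq> {}" "\<not> cball q R \<subseteq> \<Gamma>"
  shows "\<exists>u. norm u = 1 \<and> (\<forall>x\<in>\<Gamma>. u \<bullet> x \<le> u \<bullet> q + R)"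
proof -
  obtain z where z: "z \<in> cball q R" "z \<notin> \<Gamma>" using assms(4) by blast
  obtain a b where ab: "a \<bullet> z < b" "\<forall>x\<in>\<Gamma>. b < a \<bullet> x"
    using separating_hyperplane_closed_point[OF assms(2,1) z(2)] by (elim exE conjE)
  have a: "a \<noteq> 0" using ab assms(3) by (auto)
  define u where "u = - (a /\<^sub>R norm a)"
  have u: "norm u = 1" using a by (simp add: u_def)
  have "u \<bullet> x \<le> u \<bullet> q + R" if "x \<in> \<Gamma>" for x
  proof -
    have "a \<bullet> z \<le> a \<bullet> x" using ab that by force
    then have "u \<bullet> x \<le> u \<bullet> z" using a by (simp add: u_def divide_right_mono)
    also have "u \<bullet> z = u \<bullet> q + u \<bullet> (z - q)" by (simp add: inner_diff_right)
    also have "u \<bullet> (z - q) \<le> norm u * norm (z - q)" by (rule norm_cauchy_schwarz)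
    also have "\<dots> \<le> R" using z(1) u by (simp add: dist_norm norm_minus_commute)
    finally show ?thesis by simp
  qed
  then show ?thesis using u by (intro exI[of _ u] conjI ballI)
qed

lemma large_component:
  fixes u :: "real ^ 'n::finite"
  assumes "norm u = 1"
  shows "\<exists>k. 1 \<le> real CARD('n) * \<bar>u $ k\<bar>"
proof (rule ccontr)
  assume "\<nexists>k. 1 \<le> real CARD('n) * \<bar>u $ k\<bar>"
  then have *: "\<bar>u $ k\<bar> < 1 / real CARD('n)" for k by (simp add: field_simps not_le)
  have "norm u \<le> (\<Sum>k\<in>UNIV. \<bar>u $ k\<bar>)" by (rule norm_le_l1_cart)
  also have "\<dots> < (\<Sum>k\<in>(UNIV :: 'n set). 1 / real CARD('n))" by (rule sum_strict_mono) (use * in auto)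
  finally show False using assms by simp
qed

text \<open>The ball of radius \<open>R\<close> around \<open>c\<close> lies in \<open>\<Gamma>\<close>, but after a move by at most one it does not. Then
\<open>\<Gamma>\<close> lies in a half-space with outer normal \<open>u\<close> whose boundary is within distance one of the ball, at
\<open>c + R *\<^sub>R u\<close>. From this point go a distance \<open>L\<close> along the axis in which \<open>u\<close> has its largest
component: outwards this leaves the half-space by \<open>L / CARD('n)\<close> up to a constant, inwards it leads to a point
of the ball of comparable depth, provided that \<open>R\<close> is so large compared with \<open>L\<close> that the curvature of
the ball does not matter.\<close>

lemma exit_points:
  fixes \<Gamma> :: "(real ^ 'n::finite) set" and L :: nat
  assumes \<Gamma>: "closed \<Gamma>" "convex \<Gamma>" and inside: "cball c R \<subseteq> \<Gamma>" and R: "0 \<le> R"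
    and outside: "\<not> cball c' R \<subseteq> \<Gamma>" "norm (c' - c) \<le> 1" and y: "0 \<le> y"
    and L: "2 * real CARD('n) * (y + real CARD('n) + 1) \<le> real L" "real CARD('n) * real L \<le> R"
  shows "\<exists>v k \<sigma>. \<bar>\<sigma>\<bar> = 1 \<and> norm (rvec v - c) \<le> R + real CARD('n) \<and>
    (\<forall>x\<in>\<Gamma>. y \<le> dist (rvec (v + axis k (\<sigma> * int L))) x) \<and> cball (rvec (v - axis k (\<sigma> * int L))) y \<subseteq> \<Gamma>"
proof -
  define d where "d = real CARD('n)"
  have d: "1 \<le> d" by (simp add: d_def Suc_le_eq)
  have "c \<in> \<Gamma>" using inside R by auto
  then obtain u where u: "norm u = 1" "\<forall>x\<in>\<Gamma>. u \<bullet> x \<le> u \<bullet> c' + R"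
    using supporting_halfspace[OF \<Gamma> _ outside(1)] by blast
  obtain k where k: "1 \<le> d * \<bar>u $ k\<bar>" using large_component[OF u(1)] unfolding d_def by (elim exE)
  define \<sigma> :: int where "\<sigma> = (if 0 \<le> u $ k then 1 else - 1)"
  have \<sigma>: "\<bar>\<sigma>\<bar> = 1" "real_of_int \<sigma> * u $ k = \<bar>u $ k\<bar>" "real_of_int \<sigma> * real_of_int \<sigma> = 1" by (auto simp: \<sigma>_def)
  define f where "f = (axis k (real_of_int \<sigma> * real L) :: real ^ 'n)"
  have uf: "u \<bullet> f = real L * \<bar>u $ k\<bar>" using \<sigma>(2) by (simp add: f_def inner_axis algebra_simps)
  have ff: "f \<bullet> f = real L * real L" using \<sigma>(3) by (simp add: f_def inner_axis_axis algebra_simps)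
  define v where "v = lattice_floor (c + R *\<^sub>R u)"
  define e where "e = rvec v - (c + R *\<^sub>R u)"
  have e: "norm e \<le> d" unfolding e_def v_def d_def by (rule norm_lattice_floor)
  have Ld: "y + d + 1 \<le> real L / (2 * d)" "real L \<le> R / d" "real L / d \<le> real L * \<bar>u $ k\<bar>"
  proof -
    show "y + d + 1 \<le> real L / (2 * d)" "real L \<le> R / d" using L d by (simp_all add: d_def[symmetric] field_simps)
    have "real L * 1 \<le> real L * (d * \<bar>u $ k\<bar>)" by (rule mult_left_mono[OF k]) simp
    then show "real L / d \<le> real L * \<bar>u $ k\<bar>" using d by (simp add: field_simps)
  qed
  have half: "real L / d = 2 * (real L / (2 * d))" by simp
  have "norm (rvec v - c) \<le> R + d"
  proof -
    have "rvec v - c = e + R *\<^sub>R u" by (simp add: e_def)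
    then have "norm (rvec v - c) \<le> norm e + norm (R *\<^sub>R u)" using norm_triangle_ineq[of e "R *\<^sub>R u"] by simp
    then show ?thesis using e u R by simp
  qed
  moreover have "y \<le> dist (rvec (v + axis k (\<sigma> * int L))) x" if x: "x \<in> \<Gamma>" for x
  proof -
    have w: "rvec (v + axis k (\<sigma> * int L)) = c + R *\<^sub>R u + e + f" by (simp add: rvec_add rvec_axis f_def e_def)
    have uu: "u \<bullet> u = 1" using u by (simp add: norm_eq_1)
    have ue: "- d \<le> u \<bullet> e" using Cauchy_Schwarz_ineq2[of u e] u e by simp
    have uc: "u \<bullet> c' \<le> u \<bullet> c + 1"
      using norm_cauchy_schwarz[of u "c' - c"] u outside(2) by (simp add: inner_diff_right)
    have "u \<bullet> (c + R *\<^sub>R u + e + f - x) = u \<bullet> c + R + u \<bullet> e + real L * \<bar>u $ k\<bar> - u \<bullet> x"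
      by (simp add: inner_diff_right inner_add_right uu uf)
    moreover have "u \<bullet> x \<le> u \<bullet> c' + R" using u(2) x by simp
    ultimately have "y \<le> u \<bullet> (c + R *\<^sub>R u + e + f - x)" using ue uc Ld half d y by linarith
    also have "\<dots> \<le> norm (c + R *\<^sub>R u + e + f - x)" using norm_cauchy_schwarz[of u "c + R *\<^sub>R u + e + f - x"] u by simp
    finally show ?thesis unfolding w dist_norm .
  qed
  moreover have "cball (rvec (v - axis k (\<sigma> * int L))) y \<subseteq> \<Gamma>"
  proof
    have z: "rvec (v - axis k (\<sigma> * int L)) = c + (R *\<^sub>R u - f) + e" by (simp add: rvec_diff rvec_axis f_def e_def)
    \<comment> \<open>the squared distance of the inner point from \<open>c\<close>, before rounding to the lattice\<close>
    have "(norm (R *\<^sub>R u - f))\<^sup>2 = R * R - 2 * R * (real L * \<bar>u $ k\<bar>) + real L * real L"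
    proof -
      have "(norm (R *\<^sub>R u - f))\<^sup>2 = R * R * (u \<bullet> u) - 2 * R * (u \<bullet> f) + f \<bullet> f"
        unfolding power2_norm_eq_inner by (simp add: inner_diff_left inner_diff_right inner_commute algebra_simps)
      then show ?thesis using u uf ff by (simp add: norm_eq_1)
    qed
    also have "\<dots> \<le> R * R - 2 * R * (real L / d) + real L * (R / d)"
      using Ld R by (intro add_mono diff_mono mult_left_mono) auto
    also have "\<dots> \<le> (R - real L / (2 * d))\<^sup>2"
    proof -
      have "(R - real L / (2 * d))\<^sup>2 = R * R - 2 * R * (real L / d) + real L * (R / d) + (real L / (2 * d))\<^sup>2"
        using d by (simp add: power2_eq_square field_simps)
      then show ?thesis by simp
    qed
    finally have "norm (R *\<^sub>R u - f) \<le> R - real L / (2 * d)"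
    proof (rule power2_le_imp_le)
      have "real L / (2 * d) \<le> real L / 1" using d by (intro divide_left_mono) auto
      moreover have "R / d \<le> R / 1" using d R by (intro divide_left_mono) auto
      ultimately have "real L / (2 * d) \<le> R" using Ld by linarith
      then show "0 \<le> R - real L / (2 * d)" by simp
    qed
    moreover fix x assume "x \<in> cball (rvec (v - axis k (\<sigma> * int L))) y"
    then have "norm (x - (c + (R *\<^sub>R u - f) + e)) \<le> y" by (simp add: z dist_norm norm_minus_commute)
    moreover have "norm (x - c) \<le> norm (x - (c + (R *\<^sub>R u - f) + e)) + (norm (R *\<^sub>R u - f) + norm e)"
    proof -
      have "x - c = (x - (c + (R *\<^sub>R u - f) + e)) + ((R *\<^sub>R u - f) + e)" by simp
      then show ?thesis
        using norm_triangle_ineq[of "x - (c + (R *\<^sub>R u - f) + e)" "(R *\<^sub>R u - f) + e"] norm_triangle_ineq[of "R *\<^sub>R u - f" e]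
        by (smt (verit))
    qed
    ultimately have "norm (x - c) \<le> R" using e Ld by linarith
    then show "x \<in> \<Gamma>" using inside by (auto simp: dist_norm norm_minus_commute)
  qed
  ultimately show ?thesis using \<sigma>(1)
    by (intro exI[of _ v] exI[of _ k] exI[of _ \<sigma>] conjI ballI) (simp_all add: d_def)
qed

text \<open>In the application \<open>S\<close> is the square root of the time \<open>t\<close>; it is the distance between neighbouring
tracks, and the moving balls have radius \<open>S / 4\<close>. The numbers \<open>L\<close>, \<open>g\<close> and \<open>y\<close> are of the order
of \<open>ln t\<close>: the displacement of the exit points, the radius of the region that a spoiling event occupies,
and a strict upper bound for the fluctuation.\<close>

locale track_bundle =
  fixes \<theta> \<eta> :: "real ^ 'n::finite" and \<Gamma> :: "(real ^ 'n) set" and \<epsilon> \<rho> r S y d :: real and L g :: nat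
  assumes d: "d = real CARD('n)" and unit: "norm \<theta> = 1" "norm \<eta> = 1" "\<eta> \<bullet> \<theta> = 0"
    and \<Gamma>: "closed \<Gamma>" "convex \<Gamma>"
    and pos: "0 < \<rho>" "\<rho> \<le> \<epsilon>" "\<rho> \<le> r * \<epsilon>" "0 < S" "1 \<le> \<rho> * S" "0 < y"
    and size: "16 * (1 + d) * (real L + d + real g + y) \<le> S"
    and depth: "2 * d * (y + d + 1) \<le> real L"
    and core: "cball ((\<epsilon> * S\<^sup>2) *\<^sub>R \<theta>) (\<rho> * S\<^sup>2) \<subseteq> \<Gamma>"
begin

text \<open>The \<open>n\<close>-th position of the centre of the ball on the track with number \<open>i\<close>.\<close>

definition centre :: "nat \<Rightarrow> nat \<Rightarrow> real ^ 'n" where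
  "centre i n = (\<epsilon> * S\<^sup>2 + real n) *\<^sub>R \<theta> + (real i * S) *\<^sub>R \<eta>"

lemma dim_pos: "1 \<le> d"
  by (simp add: d Suc_le_eq)

lemma logarithmic: "32 * real L + 32 * d + 32 * real g + 32 * y \<le> S" "16 * (d * real L) \<le> S"
proof -
  let ?D = "real L + d + real g + y"
  have D: "0 \<le> ?D" "real L \<le> ?D"
    using pos(6) dim_pos of_nat_0_le_iff[of L, where ?'a = real] of_nat_0_le_iff[of g, where ?'a = real] by linarith+
  have "16 * 2 * ?D \<le> 16 * (1 + d) * ?D" using dim_pos D by (intro mult_right_mono) auto
  then have "32 * ?D \<le> S" using size by simp
  then show "32 * real L + 32 * d + 32 * real g + 32 * y \<le> S" by (simp only: distrib_left)
  have "16 * (d * real L) \<le> 16 * ((1 + d) * ?D)" using dim_pos D by (intro mult_left_mono mult_mono) auto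
  also have "\<dots> = 16 * (1 + d) * ?D" by (simp only: mult.assoc)
  finally show "16 * (d * real L) \<le> S" using size by linarith
qed

lemma scales: "S \<le> \<rho> * S\<^sup>2" "\<rho> * S\<^sup>2 \<le> \<epsilon> * S\<^sup>2" "\<rho> * S\<^sup>2 \<le> r * (\<epsilon> * S\<^sup>2)"
proof -
  have "1 * S \<le> (\<rho> * S) * S" using pos by (intro mult_right_mono) auto
  then show "S \<le> \<rho> * S\<^sup>2" by (simp add: power2_eq_square mult.assoc)
  show "\<rho> * S\<^sup>2 \<le> \<epsilon> * S\<^sup>2" using pos by (intro mult_right_mono) auto
  have "\<rho> * S\<^sup>2 \<le> (r * \<epsilon>) * S\<^sup>2" using pos by (intro mult_right_mono) auto
  then show "\<rho> * S\<^sup>2 \<le> r * (\<epsilon> * S\<^sup>2)" by (simp add: mult.assoc)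
qed

lemma near_track_in_cone:
  assumes i: "real i * S \<le> \<rho> * S\<^sup>2 / 2" and p: "norm (p - centre i n) \<le> S / 2"
  shows "p \<in> direction_cone \<theta> r"
proof -
  define a where "a = \<epsilon> * S\<^sup>2 + real n"
  have a: "0 < a" "\<epsilon> * S\<^sup>2 \<le> a" using scales pos(4) of_nat_0_le_iff[of n, where ?'a = real] unfolding a_def by linarith+
  have rpos: "0 < r"
  proof (rule ccontr)
    assume "\<not> 0 < r"
    then have "r * \<epsilon> \<le> 0" using pos by (simp add: mult_nonpos_nonneg)
    then show False using pos by simp
  qed
  have "p - a *\<^sub>R \<theta> = (p - centre i n) + (real i * S) *\<^sub>R \<eta>" by (simp add: centre_def a_def)
  then have "norm (p - a *\<^sub>R \<theta>) \<le> norm (p - centre i n) + norm ((real i * S) *\<^sub>R \<eta>)"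
    by (simp only: norm_triangle_ineq)
  also have "\<dots> \<le> S / 2 + \<rho> * S\<^sup>2 / 2" using p i unit pos by simp
  also have "\<dots> \<le> r * (\<epsilon> * S\<^sup>2)" using scales by simp
  also have "\<dots> \<le> r * a" using a rpos by simp
  finally have "norm (p - a *\<^sub>R \<theta>) \<le> a * r" by (simp add: mult.commute)
  moreover have "norm (p - a *\<^sub>R \<theta>) = a * norm (p /\<^sub>R a - \<theta>)"
  proof -
    have "p - a *\<^sub>R \<theta> = a *\<^sub>R (p /\<^sub>R a - \<theta>)" using a by (simp add: scaleR_diff_right)
    then show ?thesis using a by simp
  qed
  ultimately have "norm (p /\<^sub>R a - \<theta>) \<le> r" using a by simp
  then have "p /\<^sub>R a \<in> cball \<theta> r" by (simp add: dist_norm norm_minus_commute)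
  moreover have "p = a *\<^sub>R (p /\<^sub>R a)" using a by simp
  ultimately show ?thesis unfolding direction_cone_def using a by fastforce
qed

lemma track_start:
  assumes i: "real i * S \<le> \<rho> * S\<^sup>2 / 2" shows "cball (centre i 0) (S / 4) \<subseteq> \<Gamma>"
proof -
  have "norm (centre i 0 - (\<epsilon> * S\<^sup>2) *\<^sub>R \<theta>) = real i * S" using unit pos by (simp add: centre_def)
  then have "cball (centre i 0) (S / 4) \<subseteq> cball ((\<epsilon> * S\<^sup>2) *\<^sub>R \<theta>) (\<rho> * S\<^sup>2)"
    using i scales by (subst cball_subset_cball_iff) (auto simp: dist_norm)
  then show ?thesis using core by blast
qed

text \<open>At the place where a track leaves \<open>\<Gamma>\<close>, a set \<open>X\<close> whose fluctuation from \<open>\<Gamma>\<close> is small separates the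
two exit points; \<open>X\<close> will be the random set of the points that are reached at time \<open>t\<close>.\<close>

lemma track_exit:
  assumes i: "real i * S \<le> \<rho> * S\<^sup>2 / 2"
    and c: "cball (centre i n) (S / 4) \<subseteq> \<Gamma>" "\<not> cball (centre i (Suc n)) (S / 4) \<subseteq> \<Gamma>"
  shows "\<exists>w k \<sigma>. \<bar>\<sigma>\<bar> = 1 \<and> norm (rvec w - centre i n) \<le> S / 4 + d + real L \<and>
    (\<forall>X x. fluctuation (direction_cone \<theta> r) X \<Gamma> \<le> ereal x \<longrightarrow> x < y \<longrightarrow>
      rvec (w - axis k (\<sigma> * int (2 * L))) \<in> X \<and> rvec w \<notin> X)"
proof -
  have step: "norm (centre i (Suc n) - centre i n) \<le> 1"
  proof -
    have "centre i (Suc n) - centre i n = \<theta>" by (simp add: centre_def algebra_simps)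
    then show ?thesis using unit by simp
  qed
  have *: "0 \<le> S / 4" "0 \<le> y" "d * real L \<le> S / 4" using pos logarithmic(2) by auto
  obtain v k \<sigma> where v: "\<bar>\<sigma>\<bar> = 1" "norm (rvec v - centre i n) \<le> S / 4 + d"
    and out: "\<forall>x\<in>\<Gamma>. y \<le> dist (rvec (v + axis k (\<sigma> * int L))) x"
    and ins: "cball (rvec (v - axis k (\<sigma> * int L))) y \<subseteq> \<Gamma>"
    using exit_points[OF \<Gamma> c(1) *(1) c(2) step *(2) depth[unfolded d] *(3)[unfolded d]] unfolding d by (elim exE conjE)
  define w where "w = v + axis k (\<sigma> * int L)"
  have nf: "norm (axis k (real_of_int (\<sigma> * int L)) :: real ^ 'n) = real L"
  proof -
    have "norm (axis k (real_of_int (\<sigma> * int L)) :: real ^ 'n) = real_of_int \<bar>\<sigma> * int L\<bar>"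
      by (simp add: norm_eq_sqrt_inner inner_axis_axis)
    also have "\<bar>\<sigma> * int L\<bar> = int L" unfolding abs_mult v(1) by simp
    finally show ?thesis by simp
  qed
  have z: "w - axis k (\<sigma> * int (2 * L)) = v - axis k (\<sigma> * int L)"
    by (auto simp: w_def vec_eq_iff axis_def algebra_simps)
  have near: "norm (rvec (v + axis k (\<sigma> * int L)) - centre i n) \<le> S / 4 + d + real L"
  proof -
    have "rvec (v + axis k (\<sigma> * int L)) - centre i n = (rvec v - centre i n) + axis k (real_of_int (\<sigma> * int L))"
      by (simp only: rvec_add rvec_axis) simp
    then have "norm (rvec (v + axis k (\<sigma> * int L)) - centre i n) \<le> norm (rvec v - centre i n) + norm (axis k (real_of_int (\<sigma> * int L)) :: real ^ 'n)"
      by (simp only: norm_triangle_ineq)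
    then show ?thesis using v(2) unfolding nf by linarith
  qed
  have near': "norm (rvec (v - axis k (\<sigma> * int L)) - centre i n) \<le> S / 4 + d + real L"
  proof -
    have "rvec (v - axis k (\<sigma> * int L)) - centre i n = (rvec v - centre i n) - axis k (real_of_int (\<sigma> * int L))"
      by (simp only: rvec_diff rvec_axis) simp
    then have "norm (rvec (v - axis k (\<sigma> * int L)) - centre i n) \<le> norm (rvec v - centre i n) + norm (axis k (real_of_int (\<sigma> * int L)) :: real ^ 'n)"
      by (simp only: norm_triangle_ineq4)
    then show ?thesis using v(2) unfolding nf by linarith
  qed
  have le: "S / 4 + d + real L \<le> S / 2" using logarithmic(1) pos(4,6) dim_pos of_nat_0_le_iff[of g, where ?'a = real] by linarith
  have cone: "rvec w \<in> direction_cone \<theta> r" "rvec (w - axis k (\<sigma> * int (2 * L))) \<in> direction_cone \<theta> r"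
    using near_track_in_cone[OF i order_trans[OF near le]] near_track_in_cone[OF i order_trans[OF near' le]]
    unfolding z unfolding w_def by blast+
  have in_out: "rvec (w - axis k (\<sigma> * int (2 * L))) \<in> X" "rvec w \<notin> X"
    if f: "fluctuation (direction_cone \<theta> r) X \<Gamma> \<le> ereal x" "x < y" for X x
  proof -
    show "rvec (w - axis k (\<sigma> * int (2 * L))) \<in> X"
      by (rule fluctuation_inside[OF f _ cone(2)]) (use ins in \<open>simp only: z\<close>)
    show "rvec w \<notin> X"
    proof
      assume "rvec w \<in> X"
      from fluctuation_outside[OF f this cone(1)] show False using out unfolding w_def by force
    qed
  qed
  show ?thesis
    by (intro exI[of _ w] exI[of _ k] exI[of _ \<sigma>] conjI allI impI in_out v(1) near[folded w_def])
qed

lemma track_inside: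
  assumes i: "real i * S \<le> \<rho> * S\<^sup>2 / 2" and c: "cball (centre i n) (S / 4) \<subseteq> \<Gamma>"
    and f: "fluctuation (direction_cone \<theta> r) X \<Gamma> \<le> ereal x" "x < y"
  shows "rvec (lattice_floor (centre i n)) \<in> X"
proof (rule fluctuation_inside[OF f])
  let ?z = "rvec (lattice_floor (centre i n))"
  have z: "norm (?z - centre i n) \<le> d" unfolding d by (rule norm_lattice_floor)
  have b: "d + y \<le> S / 4" "d \<le> S / 2" using logarithmic(1) pos(4,6) dim_pos of_nat_0_le_iff[of g, where ?'a = real] of_nat_0_le_iff[of L, where ?'a = real] by linarith+
  have "cball ?z y \<subseteq> cball (centre i n) (S / 4)" using z b by (subst cball_subset_cball_iff) (auto simp: dist_norm)
  then show "cball ?z y \<subseteq> \<Gamma>" using c by blast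
  show "?z \<in> direction_cone \<theta> r" by (rule near_track_in_cone[OF i order_trans[OF z b(2)]])
qed

lemma far_from_origin:
  assumes w: "norm (rvec w - centre i n) \<le> S / 4 + d + real L"
  shows "int g < l1 w"
proof -
  have "\<theta> \<bullet> centre i n = \<epsilon> * S\<^sup>2 + real n"
    using unit by (simp add: centre_def inner_add_right norm_eq_1 inner_commute)
  moreover have "\<bar>\<theta> \<bullet> (rvec w - centre i n)\<bar> \<le> S / 4 + d + real L"
    using Cauchy_Schwarz_ineq2[of \<theta> "rvec w - centre i n"] unit w by simp
  ultimately have "\<epsilon> * S\<^sup>2 + real n - (S / 4 + d + real L) \<le> \<theta> \<bullet> rvec w"
    by (simp add: inner_diff_right abs_le_iff)
  also have "\<dots> \<le> norm (rvec w)" using norm_cauchy_schwarz[of \<theta> "rvec w"] unit by simp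
  also have "\<dots> \<le> real_of_int (l1 w)" by (rule norm_rvec_le_l1)
  finally have "real g < real_of_int (l1 w)" using logarithmic(1) scales(1,2) pos(4,6) dim_pos of_nat_0_le_iff[of L, where ?'a = real] of_nat_0_le_iff[of n, where ?'a = real] by linarith
  then show ?thesis by linarith
qed

lemma balls_disjoint:
  assumes ij: "i \<noteq> j"
    and w: "norm (rvec w - centre i n) \<le> S / 4 + d + real L" "norm (rvec w' - centre j n') \<le> S / 4 + d + real L"
  shows "ball_edges w g \<inter> ball_edges w' g = {}"
proof (rule ccontr)
  assume "ball_edges w g \<inter> ball_edges w' g \<noteq> {}"
  then obtain e where e: "e \<in> ball_edges w g" "e \<in> ball_edges w' g" by blast
  then have ed: "e \<in> edges" by (simp add: ball_edges_def)
  obtain v where "v \<in> e" using edgeE[OF ed] by blast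
  then have v: "l1 (v - w) \<le> int g" "l1 (v - w') \<le> int g" using e by (auto simp: ball_edges_def)
  have "l1 (w - w') \<le> l1 (w - v) + l1 (v - w')" using l1_triangle[of "w - v" "v - w'"] by simp
  then have "l1 (w - w') \<le> 2 * int g" using v l1_minus_commute[of w v] by linarith
  then have dist: "norm (rvec (w - w')) \<le> 2 * real g" using norm_rvec_le_l1[of "w - w'"] by linarith
  have c: "\<eta> \<bullet> centre i n = real i * S" for i n
    using unit by (simp add: centre_def inner_add_right norm_eq_1)
  have "\<bar>\<eta> \<bullet> (rvec w - centre i n)\<bar> \<le> S / 4 + d + real L" "\<bar>\<eta> \<bullet> (rvec w' - centre j n')\<bar> \<le> S / 4 + d + real L"
    using Cauchy_Schwarz_ineq2[of \<eta> "rvec w - centre i n"] Cauchy_Schwarz_ineq2[of \<eta> "rvec w' - centre j n'"] unit w by simp_all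
  moreover have "\<bar>\<eta> \<bullet> (rvec w - rvec w')\<bar> \<le> 2 * real g"
    using Cauchy_Schwarz_ineq2[of \<eta> "rvec w - rvec w'"] unit dist by (simp add: rvec_diff)
  moreover have "\<eta> \<bullet> (rvec w - rvec w') = \<eta> \<bullet> (rvec w - centre i n) - \<eta> \<bullet> (rvec w' - centre j n') + (real i * S - real j * S)"
    by (simp add: inner_diff_right c)
  moreover have "S \<le> \<bar>real i * S - real j * S\<bar>"
  proof -
    have "1 * S \<le> \<bar>real i - real j\<bar> * S" using ij pos by (intro mult_right_mono) (auto simp: abs_if)
    then show ?thesis using pos by (simp add: left_diff_distrib[symmetric] abs_mult)
  qed
  moreover have "S' \<le> z + q'" if "q' = 2 * q" "\<bar>a\<bar> \<le> q" "\<bar>b\<bar> \<le> q" "\<bar>Y\<bar> \<le> z" "Y = a - b + X" "S' \<le> \<bar>X\<bar>" for a b Y X z q q' S' :: real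
    using that by linarith
  moreover have "S / 2 + 2 * d + 2 * real L = 2 * (S / 4 + d + real L)" by simp
  ultimately have "S \<le> 2 * real g + (S / 2 + 2 * d + 2 * real L)" by blast
  then show False using logarithmic(1) pos(4,6) dim_pos of_nat_0_le_iff[of g, where ?'a = real] of_nat_0_le_iff[of L, where ?'a = real] by linarith
qed

end

section \<open>Probability estimates along the tracks\<close>

lemma card_ball_edges: "card (ball_edges (x :: int ^ 'n::finite) r) \<le> ((2 * r + 1) ^ CARD('n))\<^sup>2"
proof -
  let ?V = "{z :: int ^ 'n. l1 (z - x) \<le> int r}"
  have "finite ?V \<and> card ?V \<le> (2 * r + 1) ^ CARD('n)"
  proof (rule card_int_box_le, intro allI)
    fix z j assume "z \<in> ?V"
    then show "\<bar>z $ j - x $ j\<bar> \<le> int r" using abs_component_le_l1[of "z - x" j] by simp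
  qed
  then have V: "finite ?V" "card ?V \<le> (2 * r + 1) ^ CARD('n)" by blast+
  have "ball_edges x r \<subseteq> (\<lambda>(a, b). {a, b}) ` (?V \<times> ?V)"
  proof
    fix e assume e: "e \<in> ball_edges x r"
    then have ed: "e \<in> edges" by (simp add: ball_edges_def)
    obtain a b where ab: "e = {a, b}" using edgeE[OF ed] by metis
    then have "(a, b) \<in> ?V \<times> ?V" using e by (auto simp: ball_edges_def)
    then show "e \<in> (\<lambda>(a, b). {a, b}) ` (?V \<times> ?V)" using ab by force
  qed
  then have "card (ball_edges x r) \<le> card (?V \<times> ?V)" by (rule surj_card_le[rotated]) (use V in simp)
  also have "\<dots> = (card ?V)\<^sup>2" by (simp add: card_cartesian_product power2_eq_square)
  also have "\<dots> \<le> ((2 * r + 1) ^ CARD('n))\<^sup>2" using V by (intro power_mono) auto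
  finally show ?thesis .
qed

text \<open>On the way to \<open>z\<close>, a path enters each of the spheres of radii \<open>r - 1, ..., 0\<close> around \<open>z\<close> through an
edge of its own.\<close>

lemma slow_ball_ptime:
  assumes t: "nonneg_env t" and slow: "\<And>e. e \<in> ball_edges z r \<Longrightarrow> b \<le> t e" and b: "0 \<le> b" and out: "int r < l1 z"
  shows "b * real r \<le> ptime t z"
proof -
  have "b * real r \<le> passage_time t xs" if xs: "path_between 0 z xs" for xs
  proof -
    define f where "f = (\<lambda>i. l1 (xs ! i - z))"
    define lev where "lev = (\<lambda>e. Max ((\<lambda>v. l1 (v - z)) ` e))"
    let ?P = "path_edges xs \<inter> ball_edges z r"
    have ne: "xs \<noteq> []" and suc: "successively (\<lambda>x y. {x, y} \<in> edges) xs" using xs by (auto simp: path_between_def)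
    have f0: "f 0 = l1 z" using xs ne l1_minus_commute[of 0 z] by (simp add: f_def path_between_def hd_conv_nth)
    have fl: "f (length xs - 1) = 0" using xs ne by (simp add: f_def path_between_def last_conv_nth)
    have "\<exists>e\<in>?P. lev e = j" if j: "j \<in> {1..int r}" for j
    proof -
      define i where "i = (LEAST i. f i < j)"
      have ex: "f (length xs - 1) < j" using fl j by simp
      have i: "f i < j" unfolding i_def by (rule LeastI[of _ "length xs - 1"]) (rule ex)
      have il: "i \<le> length xs - 1" unfolding i_def by (rule Least_le) (rule ex)
      have "i \<noteq> 0"
      proof
        assume "i = 0"
        then show False using i f0 out j by simp
      qed
      then obtain k where k: "i = Suc k" by (cases i) auto
      have "\<not> f k < j" using not_less_Least[of k "\<lambda>i. f i < j"] k by (simp add: i_def)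
      moreover have kl: "Suc k < length xs" using il k ne by (cases xs) auto
      have ed: "{xs ! k, xs ! Suc k} \<in> edges" using suc kl by (simp add: successively_conv_nth)
      then have "l1 (xs ! k - xs ! Suc k) = 1" by (simp add: edge_iff)
      then have "f k \<le> f (Suc k) + 1" using l1_triangle[of "xs ! k - xs ! Suc k" "xs ! Suc k - z"] by (simp add: f_def)
      moreover have "f (Suc k) < j" using i k by simp
      ultimately have fk: "f k = j" "f (Suc k) = j - 1" by linarith+
      let ?e = "{xs ! k, xs ! Suc k}"
      have "?e \<in> path_edges xs" using kl unfolding path_edges_def by blast
      moreover have "?e \<in> ball_edges z r" using ed fk j by (auto simp: ball_edges_def f_def)
      moreover have "lev ?e = j" using fk by (simp add: lev_def f_def)
      ultimately show ?thesis by (intro bexI[of _ ?e]) auto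
    qed
    then have "{1..int r} \<subseteq> lev ` ?P" by force
    then have "card {1..int r} \<le> card ?P" by (rule surj_card_le[rotated]) simp
    then have "r \<le> card ?P" by simp
    then have "b * real r \<le> b * real (card ?P)" using b by (intro mult_left_mono) auto
    also have "\<dots> \<le> (\<Sum>e\<in>?P. t e)" using sum_bounded_below[of ?P b t] slow by (simp add: mult.commute)
    also have "\<dots> \<le> passage_time t xs"
      unfolding passage_time_def using t path_between_edges[OF xs] by (intro sum_mono2) (auto simp: nonneg_env_def)
    finally show ?thesis .
  qed
  moreover have "{xs. path_between 0 z xs} \<noteq> {}" using path_exists by auto
  ultimately show ?thesis unfolding ptime_def by (intro cINF_greatest) auto
qed

text \<open>By \<open>ln t \<le> X / (\<kappa> / 2)\<close> for \<open>X = t powr (\<kappa> / 2)\<close>, it suffices that \<open>X\<close> exceeds a constant.\<close>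

lemma log_below_power:
  fixes \<alpha> \<beta> \<gamma> \<kappa> :: real
  assumes "0 < \<gamma>" "0 < \<kappa>"
  shows "\<forall>\<^sub>F t in at_top. \<alpha> + \<beta> * ln t \<le> \<gamma> * t powr \<kappa>"
proof -
  define Z where "Z = max 1 ((\<bar>\<alpha>\<bar> + \<bar>\<beta>\<bar> * (2 / \<kappa>)) / \<gamma>)"
  have Z: "1 \<le> Z" "\<bar>\<alpha>\<bar> + \<bar>\<beta>\<bar> * (2 / \<kappa>) \<le> \<gamma> * Z"
  proof -
    show "1 \<le> Z" by (simp add: Z_def)
    have "(\<bar>\<alpha>\<bar> + \<bar>\<beta>\<bar> * (2 / \<kappa>)) / \<gamma> \<le> Z" by (simp add: Z_def)
    then show "\<bar>\<alpha>\<bar> + \<bar>\<beta>\<bar> * (2 / \<kappa>) \<le> \<gamma> * Z" using assms by (simp only: pos_divide_le_eq mult.commute)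
  qed
  have "\<alpha> + \<beta> * ln t \<le> \<gamma> * t powr \<kappa>" if t: "t \<ge> Z powr (2 / \<kappa>)" for t
  proof -
    define X where "X = t powr (\<kappa> / 2)"
    have t1: "1 \<le> t" using t ge_one_powr_ge_zero[OF Z(1), of "2 / \<kappa>"] assms by simp
    have "(Z powr (2 / \<kappa>)) powr (\<kappa> / 2) \<le> X" unfolding X_def using t assms by (intro powr_mono2) auto
    moreover have "(Z powr (2 / \<kappa>)) powr (\<kappa> / 2) = Z" using Z assms by (simp add: powr_powr)
    ultimately have X: "Z \<le> X" by simp
    have "ln t \<le> X / (\<kappa> / 2)" unfolding X_def using t1 assms by (intro ln_powr_bound) auto
    then have "ln t \<le> (2 / \<kappa>) * X" by (simp add: mult.commute)
    then have "\<bar>\<beta>\<bar> * ln t \<le> \<bar>\<beta>\<bar> * ((2 / \<kappa>) * X)" by (intro mult_left_mono) auto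
    moreover have "\<beta> * ln t \<le> \<bar>\<beta>\<bar> * ln t" using t1 by (intro mult_right_mono) auto
    moreover have "\<alpha> \<le> \<bar>\<alpha>\<bar> * X" using X Z mult_left_mono[of 1 X "\<bar>\<alpha>\<bar>"] by linarith
    ultimately have "\<alpha> + \<beta> * ln t \<le> \<bar>\<alpha>\<bar> * X + \<bar>\<beta>\<bar> * ((2 / \<kappa>) * X)" by linarith
    also have "\<dots> = (\<bar>\<alpha>\<bar> + \<bar>\<beta>\<bar> * (2 / \<kappa>)) * X" by (simp only: distrib_right mult.assoc)
    also have "\<dots> \<le> (\<gamma> * X) * X"
    proof (rule mult_right_mono)
      show "\<bar>\<alpha>\<bar> + \<bar>\<beta>\<bar> * (2 / \<kappa>) \<le> \<gamma> * X" using Z(2) X assms by (intro order_trans[OF Z(2)]) simp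
    qed (use X Z in simp)
    also have "\<dots> = \<gamma> * (X * X)" by simp
    also have "X * X = t powr \<kappa>" by (simp add: X_def powr_add[symmetric])
    finally show ?thesis .
  qed
  then show ?thesis by (intro eventually_at_top_linorderI[of "Z powr (2 / \<kappa>)"])
qed

text \<open>Each of about \<open>\<rho> * sqrt t / 2\<close> independent traps is active with probability \<open>t powr (- 1 / 4)\<close>. Their
expected number is of the order of \<open>t powr (1 / 4)\<close>, so none is active with a probability that decays
faster than any power.\<close>

lemma survival_of_many_traps:
  fixes \<rho> :: real
  assumes "0 < \<rho>"
  shows "\<forall>\<^sub>F t in at_top. \<forall>N::nat. \<rho> * sqrt t / 2 - 1 \<le> real N \<longrightarrow> (1 - exp (- ln t / 4)) ^ N \<le> 1 / t ^ q"
proof -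
  have "\<forall>\<^sub>F t in at_top. 1 + real q * ln t \<le> (\<rho> / 2) * t powr (1 / 4)" using assms by (intro log_below_power) auto
  then show ?thesis
  proof (rule eventually_elim2[OF _ eventually_ge_at_top[of 1]], intro allI impI)
    fix t N assume b: "1 + real q * ln t \<le> (\<rho> / 2) * t powr (1 / 4)" and t: "1 \<le> t" and N: "\<rho> * sqrt t / 2 - 1 \<le> real N"
    define x where "x = exp (- ln t / 4)"
    have x: "0 < x" "x \<le> 1" "x = t powr (- (1 / 4))" using t by (auto simp: x_def powr_def)
    have "1 - x \<le> exp (- x)" using exp_ge_add_one_self[of "- x"] by simp
    then have "(1 - x) ^ N \<le> exp (- x) ^ N" using x by (intro power_mono) auto
    also have "\<dots> = exp (- (real N * x))" by (simp add: exp_of_nat_mult[symmetric])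
    also have "\<dots> \<le> exp (- (real q * ln t))"
    proof -
      have "sqrt t * x = t powr (1 / 4)" using t by (simp add: x(3) powr_half_sqrt[symmetric] powr_add[symmetric])
      then have "(\<rho> * sqrt t / 2 - 1) * x = (\<rho> / 2) * t powr (1 / 4) - x" by (simp add: algebra_simps)
      moreover have "(\<rho> * sqrt t / 2 - 1) * x \<le> real N * x" using N x by (intro mult_right_mono) auto
      ultimately show ?thesis using b x by simp
    qed
    also have "\<dots> = 1 / t ^ q" using t by (simp add: exp_minus exp_of_nat_mult inverse_eq_divide)
    finally show "(1 - exp (- ln t / 4)) ^ N \<le> 1 / t ^ q" by (simp add: x_def)
  qed
qed

context iid_environment
begin

text \<open>The event about the fluctuation refers to uncountably many points and is not known to be measurable.
As \<open>measure\<close> vanishes outside the \<open>\<sigma>\<close>-algebra, an upper bound only requires a measurable superset.\<close>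

lemma measure_le_event: "E \<subseteq> S \<Longrightarrow> S \<in> events \<Longrightarrow> measure M E \<le> prob S"
  by (cases "E \<in> events") (auto intro: finite_measure_mono simp: measure_notin_sets)

lemma avoid_independent_events:
  assumes J: "\<And>i. i < N \<Longrightarrow> J i \<subseteq> edges" "disjoint_family_on J {..<N}"
    and G: "\<And>i. i < N \<Longrightarrow> G i \<in> sets (field (J i))" "\<And>i. i < N \<Longrightarrow> p \<le> prob (G i)"
    and E: "E \<subseteq> space M" "\<And>i. i < N \<Longrightarrow> E \<inter> G i = {}"
  shows "measure M E \<le> (1 - p) ^ N"
proof (cases "N = 0")
  case False
  let ?H = "\<lambda>i. space M - G i"
  have H: "?H i \<in> sets (field (J i))" if "i < N" for i using sets.compl_sets[OF G(1)[OF that]] by simp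
  have ev: "(\<Inter>i<N. ?H i) \<in> events"
    by (rule sets.finite_INT) (use False field_events[OF J(1) H] in auto)
  have "measure M E \<le> prob (\<Inter>i<N. ?H i)" using E by (intro measure_le_event ev) blast
  also have "\<dots> = (\<Prod>i<N. prob (?H i))"
    by (rule field_indep[where J = J]) (use False J H in auto)
  also have "\<dots> \<le> (\<Prod>i<N. 1 - p)"
  proof (rule prod_mono)
    fix i assume "i \<in> {..<N}"
    then have "prob (?H i) = 1 - prob (G i)" "p \<le> prob (G i)" using prob_compl[OF field_events[OF J(1) G(1)]] G(2) by auto
    then show "0 \<le> prob (?H i) \<and> prob (?H i) \<le> 1 - p" by simp
  qed
  finally show ?thesis by simp
qed simp

text \<open>A ball of edges with weights at least \<open>b\<close> and radius \<open>R > t / b\<close> prevents its centre from being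
reached at time \<open>t\<close>. Its probability has a positive lower bound, so among infinitely many disjoint balls
one is of this kind.\<close>

lemma separated_points_slow:
  assumes b: "0 < b" "0 < measure F {b..}" and R: "t < b * real R"
    and z: "\<And>j. int R < l1 (z j)" "\<And>i j. i \<noteq> j \<Longrightarrow> int (2 * R) < l1 (z i - z j)"
    and E: "E \<subseteq> space M" "\<And>\<omega> j. \<omega> \<in> E \<Longrightarrow> ptime (\<lambda>e. \<tau> e \<omega>) (z (j :: nat)) \<le> t"
  shows "measure M E = 0"
proof (rule ccontr)
  interpret F: prob_space F by (rule prob_space_law)
  let ?K = "((2 * R + 1) ^ CARD('n))\<^sup>2"
  define p where "p = measure F {b..} ^ ?K"
  assume "measure M E \<noteq> 0"
  then have mE: "0 < measure M E" by (simp add: zero_less_measure_iff)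
  have "0 < p" using b by (simp add: p_def)
  then obtain N where N: "(1 - p) ^ N < measure M E" using real_arch_pow_inv[OF mE, of "1 - p"] by auto
  let ?G = "\<lambda>j. {\<omega> \<in> space M. \<forall>e\<in>ball_edges (z j) R. \<tau> e \<omega> \<in> {b..}}"
  have G: "?G j \<in> sets (field (ball_edges (z j) R))" "prob (?G j) = measure F {b..} ^ card (ball_edges (z j) R)" for j
    by (rule prob_all_weights[OF finite_ball_edges ball_edges_subset], simp)+
  have "measure M E \<le> (1 - p) ^ N"
  proof (rule avoid_independent_events[where J = "\<lambda>j. ball_edges (z j) R" and G = ?G])
    show "disjoint_family_on (\<lambda>j. ball_edges (z j) R) {..<N}"
      unfolding disjoint_family_on_def
    proof (intro ballI impI, rule ccontr)
      fix i j :: nat assume ij: "i \<noteq> j" and "ball_edges (z i) R \<inter> ball_edges (z j) R \<noteq> {}"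
      then obtain e where e: "e \<in> ball_edges (z i) R" "e \<in> ball_edges (z j) R" by blast
      then have ed: "e \<in> edges" by (simp add: ball_edges_def)
      obtain v where "v \<in> e" using edgeE[OF ed] by blast
      then have "l1 (v - z i) \<le> int R" "l1 (v - z j) \<le> int R" using e by (auto simp: ball_edges_def)
      moreover have "l1 (z i - z j) \<le> l1 (z i - v) + l1 (v - z j)" using l1_triangle[of "z i - v" "v - z j"] by simp
      ultimately show False using z(2)[OF ij] l1_minus_commute[of v "z i"] by simp
    qed
    show "p \<le> prob (?G j)" for j
      unfolding G(2) p_def using b card_ball_edges[of "z j" R] by (intro power_decreasing) auto
    show "E \<inter> ?G j = {}" for j
    proof (rule ccontr)
      assume "E \<inter> ?G j \<noteq> {}"
      then obtain \<omega> where w: "\<omega> \<in> E" "\<omega> \<in> ?G j" by blast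
      then have "b * real R \<le> ptime (\<lambda>e. \<tau> e \<omega>) (z j)"
        by (intro slow_ball_ptime nonneg_env) (use b z in auto)
      then show False using E(2)[OF w(1), of j] R by simp
    qed
  qed (use G E in \<open>auto intro: subsetD[OF ball_edges_subset]\<close>)
  then show False using N by simp
qed

lemma positive_weights:
  assumes "measure F {0} < 1" shows "\<exists>b>0. 0 < measure F {b..}"
proof -
  interpret F: prob_space F by (rule prob_space_law)
  obtain b where b: "0 < b" "measure F {..0 + b} < 1"
    using measure_atMost_limit[OF prob_space_law sets_law law_nonneg assms] by blast
  have sp: "space F = UNIV" using sets_eq_imp_space_eq[OF sets_law] by simp
  have "1 \<le> measure F {..b} + measure F {b..}"
  proof -
    have "{..b} \<union> {b..} = space F" using sp by auto
    then have "1 = measure F ({..b} \<union> {b..})" using F.prob_space by simp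
    also have "\<dots> \<le> measure F {..b} + measure F {b..}" by (rule measure_Un_le) (simp_all add: sets_law)
    finally show ?thesis .
  qed
  then show ?thesis using b by (intro exI[of _ b]) auto
qed

text \<open>This is \<open>passage_upper_bound\<close> with the scale \<open>N\<close> chosen such that \<open>B * N \<le> t\<close>.\<close>

lemma ptime_upper_tail:
  assumes mom: "\<forall>e\<in>edges. integrable M (\<lambda>\<omega>. \<tau> e \<omega> ^ (2 * m))" "1 \<le> m" and dim: "2 \<le> CARD('n)"
  shows "\<exists>\<kappa>>0. \<exists>C>0. \<exists>t0>0. \<forall>t\<ge>t0. \<forall>x. (\<forall>j. \<bar>real_of_int (x $ j)\<bar> \<le> \<kappa> * t) \<longrightarrow>
    (\<exists>A\<in>events. prob A \<le> C / t ^ (2 * CARD('n) * m) \<and> (\<forall>\<omega>\<in>space M - A. ptime (\<lambda>e. \<tau> e \<omega>) x \<le> t))"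
proof -
  let ?q = "2 * CARD('n) * m"
  obtain B C1 where B: "0 < B" "0 < C1" and ub: "\<forall>N\<ge>1. \<forall>x y. (\<forall>j. \<bar>y $ j - x $ j\<bar> \<le> int N) \<longrightarrow>
    prob {\<omega> \<in> space M. \<not> conn (raised 0 \<omega>) (ball_edges x ((20 + CARD('n)) * N)) x y (B * real N)} \<le> C1 / real N ^ ?q"
    using passage_upper_bound[OF mom dim order_refl] by (elim exE conjE)
  have main: "\<exists>A\<in>events. prob A \<le> (C1 * (2 * B) ^ ?q) / t ^ ?q \<and> (\<forall>\<omega>\<in>space M - A. ptime (\<lambda>e. \<tau> e \<omega>) x \<le> t)"
    if t: "2 * B \<le> t" and x: "\<forall>j. \<bar>real_of_int (x $ j)\<bar> \<le> 1 / (2 * B) * t" for t x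
  proof -
    define N where "N = nat \<lfloor>t / B\<rfloor>"
    have tB: "2 \<le> t / B" using t B by (simp add: field_simps)
    have half: "1 / (2 * B) * t = (t / B) / 2" by simp
    have N: "real N \<le> t / B" "t / B - 1 \<le> real N" "1 \<le> N" using tB by (simp_all add: N_def le_nat_iff le_floor_iff)
    have "X / 2 \<le> X - 1" if "2 \<le> X" for X :: real using that by simp
    from order_trans[OF this[OF tB] N(2)] have N2: "(t / B) / 2 \<le> real N" .
    define A where "A = {\<omega> \<in> space M. \<not> conn (raised 0 \<omega>) (ball_edges 0 ((20 + CARD('n)) * N)) 0 x (B * real N)}"
    have "prob A \<le> C1 / real N ^ ?q"
    proof -
      have "\<bar>x $ j - 0 $ j\<bar> \<le> int N" for j using x[rule_format, of j] N2 unfolding half by simp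
      then show ?thesis unfolding A_def using ub N(3) by blast
    qed
    also have "\<dots> \<le> C1 / ((t / B) / 2) ^ ?q" using N2 tB B by (intro divide_left_mono power_mono mult_pos_pos) auto
    also have "\<dots> = (C1 * (2 * B) ^ ?q) / t ^ ?q" by (simp add: power_divide power_mult_distrib)
    finally have pA: "prob A \<le> (C1 * (2 * B) ^ ?q) / t ^ ?q" .
    have "ptime (\<lambda>e. \<tau> e \<omega>) x \<le> t" if w: "\<omega> \<in> space M - A" for \<omega>
    proof -
      have sp: "\<omega> \<in> space M" using w by simp
      have "conn (raised 0 \<omega>) (ball_edges 0 ((20 + CARD('n)) * N)) 0 x (B * real N)" using w by (simp add: A_def)
      then have "conn (\<lambda>e. \<tau> e \<omega>) (ball_edges 0 ((20 + CARD('n)) * N)) 0 x (B * real N)" by simp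
      from conn_ptime[OF nonneg_env[OF sp] this] have "ptime (\<lambda>e. \<tau> e \<omega>) x \<le> ptime (\<lambda>e. \<tau> e \<omega>) 0 + B * real N" .
      also have "ptime (\<lambda>e. \<tau> e \<omega>) 0 \<le> 0"
        using ptime_le[OF nonneg_env[OF sp] path_between_refl[of 0]] by (simp add: passage_time_def path_edges_def)
      also have "B * real N \<le> t" using N(1) B by (simp add: field_simps)
      finally show ?thesis by simp
    qed
    moreover have "A \<in> events" unfolding A_def by (rule not_conn_raised_sets)
    ultimately show ?thesis using pA by (intro bexI[of _ A] conjI ballI)
  qed
  show ?thesis
    using B by (intro exI[of _ "1 / (2 * B)"] exI[of _ "C1 * (2 * B) ^ ?q"] exI[of _ "2 * B"] conjI allI impI main) auto
qed

text \<open>Every track leaves \<open>\<Gamma>\<close>, and a spoiling event at its place of exit would make the outer exit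
point reached at time \<open>t\<close>, since the inner one is. As these events live in disjoint balls of edges, they are
independent, and none of them may occur.\<close>

lemma tracks_avoided:
  assumes tb: "track_bundle \<theta> \<eta> \<Gamma> \<epsilon> \<rho> r S y d (s * h) (A * (2 * h))" and xy: "x < y"
    and N: "real N * S \<le> \<rho> * S\<^sup>2 / 2"
    and spoil: "\<forall>w k \<sigma>. \<bar>\<sigma>\<bar> = 1 \<longrightarrow> (\<exists>G\<in>sets (field (ball_edges w (A * (2 * h)))). p \<le> prob G \<and>
       (\<forall>\<omega>\<in>G. \<forall>T. int (A * (2 * h)) < l1 w \<longrightarrow> ptime (\<lambda>e. \<tau> e \<omega>) (w - axis k (\<sigma> * int (s * (2 * h)))) \<le> T \<longrightarrow>
         ptime (\<lambda>e. \<tau> e \<omega>) w \<le> T))"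
    and exits: "\<And>i. i < N \<Longrightarrow> \<exists>n. \<not> cball (track_bundle.centre \<theta> \<eta> \<epsilon> S i n) (S / 4) \<subseteq> \<Gamma>"
  shows "measure M {\<omega> \<in> space M. fluctuation (direction_cone \<theta> r) (fpp_ball (\<lambda>e. \<tau> e \<omega>) t) \<Gamma> \<le> ereal x} \<le> (1 - p) ^ N"
    (is "measure M ?E \<le> _")
proof -
  interpret track_bundle \<theta> \<eta> \<Gamma> \<epsilon> \<rho> r S y d "s * h" "A * (2 * h)" by (rule tb)
  define Q where "Q = (\<lambda>i v. case v of (w, n, G) \<Rightarrow> norm (rvec w - centre i n) \<le> S / 4 + d + real (s * h) \<and>
    G \<in> sets (field (ball_edges w (A * (2 * h)))) \<and> p \<le> prob G \<and> ?E \<inter> G = {})"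
  have "\<forall>i. \<exists>v. i < N \<longrightarrow> Q i v"
  proof
    fix i
    show "\<exists>v. i < N \<longrightarrow> Q i v"
    proof (cases "i < N")
      case True
      have "real i * S \<le> real N * S" using True pos by (intro mult_right_mono) auto
      then have i: "real i * S \<le> \<rho> * S\<^sup>2 / 2" using N by linarith
      define m where "m = (LEAST n. \<not> cball (centre i n) (S / 4) \<subseteq> \<Gamma>)"
      have m: "\<not> cball (centre i m) (S / 4) \<subseteq> \<Gamma>" unfolding m_def by (rule LeastI_ex[OF exits[OF True]])
      have "m \<noteq> 0" using m track_start[OF i] by (metis)
      then obtain n where n: "m = Suc n" by (cases m) auto
      have n': "cball (centre i n) (S / 4) \<subseteq> \<Gamma>" using not_less_Least[of n "\<lambda>n. \<not> cball (centre i n) (S / 4) \<subseteq> \<Gamma>"] n by (simp add: m_def)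
      obtain w k \<sigma> where w: "\<bar>\<sigma>\<bar> = 1" "norm (rvec w - centre i n) \<le> S / 4 + d + real (s * h)"
        and sep: "\<forall>X x. fluctuation (direction_cone \<theta> r) X \<Gamma> \<le> ereal x \<longrightarrow> x < y \<longrightarrow>
          rvec (w - axis k (\<sigma> * int (2 * (s * h)))) \<in> X \<and> rvec w \<notin> X"
        using track_exit[OF i n' m[unfolded n]] by (elim exE conjE)
      obtain G where G: "G \<in> sets (field (ball_edges w (A * (2 * h))))" "p \<le> prob G"
        and Gs: "\<forall>\<omega>\<in>G. \<forall>T. int (A * (2 * h)) < l1 w \<longrightarrow> ptime (\<lambda>e. \<tau> e \<omega>) (w - axis k (\<sigma> * int (s * (2 * h)))) \<le> T \<longrightarrow>
         ptime (\<lambda>e. \<tau> e \<omega>) w \<le> T"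
        using spoil[rule_format, OF w(1), of w k] by (elim bexE conjE)
      have "?E \<inter> G = {}"
      proof (rule ccontr)
        assume "?E \<inter> G \<noteq> {}"
        then obtain \<omega> where om: "\<omega> \<in> ?E" "\<omega> \<in> G" by blast
        have "rvec (w - axis k (\<sigma> * int (2 * (s * h)))) \<in> fpp_ball (\<lambda>e. \<tau> e \<omega>) t \<and> rvec w \<notin> fpp_ball (\<lambda>e. \<tau> e \<omega>) t"
          by (rule sep[THEN spec, THEN spec, THEN mp, THEN mp, OF _ xy]) (use om(1) in simp)
        moreover have "2 * (s * h) = s * (2 * h)" by simp
        ultimately have "ptime (\<lambda>e. \<tau> e \<omega>) (w - axis k (\<sigma> * int (s * (2 * h)))) \<le> t \<and> \<not> ptime (\<lambda>e. \<tau> e \<omega>) w \<le> t"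
          by (simp only: fpp_ball_rvec simp_thms)
        then show False using Gs om(2) far_from_origin[OF w(2)] by blast
      qed
      then have "Q i (w, n, G)" unfolding Q_def using w(2) G by simp
      then show ?thesis by blast
    qed simp
  qed
  from choice[OF this] obtain v where v: "\<forall>i. i < N \<longrightarrow> Q i (v i)" by (elim exE)
  define w n G where "w = (\<lambda>i. fst (v i))" and "n = (\<lambda>i. fst (snd (v i)))" and "G = (\<lambda>i. snd (snd (v i)))"
  have Q: "norm (rvec (w i) - centre i (n i)) \<le> S / 4 + d + real (s * h)"
    "G i \<in> sets (field (ball_edges (w i) (A * (2 * h))))" "p \<le> prob (G i)" "?E \<inter> G i = {}" if "i < N" for i
    using v[rule_format, OF that] by (auto simp: Q_def w_def n_def G_def split: prod.splits)
  show ?thesis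
  proof (rule avoid_independent_events[where J = "\<lambda>i. ball_edges (w i) (A * (2 * h))" and G = G])
    show "disjoint_family_on (\<lambda>i. ball_edges (w i) (A * (2 * h))) {..<N}"
      unfolding disjoint_family_on_def
    proof (intro ballI impI)
      fix i j assume "i \<in> {..<N}" "j \<in> {..<N}" "i \<noteq> j"
      then show "ball_edges (w i) (A * (2 * h)) \<inter> ball_edges (w j) (A * (2 * h)) = {}"
        by (intro balls_disjoint[OF _ Q(1) Q(1)]) auto
    qed
    show "?E \<subseteq> space M" by auto
  qed (rule ball_edges_subset, (erule Q)+)
qed

text \<open>If a track stays in \<open>\<Gamma>\<close> forever, all the lattice points along it are reached at time \<open>t\<close>.\<close>

lemma track_inside_null:
  assumes tb: "track_bundle \<theta> \<eta> \<Gamma> \<epsilon> \<rho> r S y d L g" and xy: "x < y"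
    and i: "real i * S \<le> \<rho> * S\<^sup>2 / 2" and inside: "\<And>n. cball (track_bundle.centre \<theta> \<eta> \<epsilon> S i n) (S / 4) \<subseteq> \<Gamma>"
    and b: "0 < b" "0 < measure F {b..}"
  shows "measure M {\<omega> \<in> space M. fluctuation (direction_cone \<theta> r) (fpp_ball (\<lambda>e. \<tau> e \<omega>) t) \<Gamma> \<le> ereal x} = 0"
proof -
  interpret track_bundle \<theta> \<eta> \<Gamma> \<epsilon> \<rho> r S y d L g by (rule tb)
  obtain R :: nat where R: "t < real R * b" using ex_less_of_nat_mult[OF b(1)] by blast
  \<comment> \<open>a sparse sequence of positions, at mutual distances that exceed twice the radius \<open>R\<close> after rounding\<close>
  define K where "K = 2 * R + 2 * CARD('n) + 1"
  define z where "z = (\<lambda>j. lattice_floor (centre i (Suc j * K)))"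
  have near: "norm (rvec (z j) - centre i (Suc j * K)) \<le> d" for j unfolding z_def d by (rule norm_lattice_floor)
  have Kd: "real K = 2 * real R + 2 * d + 1" by (simp add: K_def d)
  show ?thesis
  proof (rule separated_points_slow[OF b, where z = z and R = R and t = t])
    show "t < b * real R" using R by (simp add: mult.commute)
    show "int R < l1 (z j)" for j
    proof -
      have "\<theta> \<bullet> centre i (Suc j * K) = \<epsilon> * S\<^sup>2 + real (Suc j * K)"
        using unit by (simp add: centre_def inner_add_right norm_eq_1 inner_commute)
      moreover have "\<bar>\<theta> \<bullet> (rvec (z j) - centre i (Suc j * K))\<bar> \<le> d"
        using Cauchy_Schwarz_ineq2[of \<theta> "rvec (z j) - centre i (Suc j * K)"] unit near[of j] by simp
      ultimately have "\<epsilon> * S\<^sup>2 + real (Suc j * K) - d \<le> \<theta> \<bullet> rvec (z j)"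
        by (simp only: inner_diff_right abs_le_iff) linarith
      also have "\<dots> \<le> norm (rvec (z j))" using norm_cauchy_schwarz[of \<theta> "rvec (z j)"] unit by simp
      also have "\<dots> \<le> real_of_int (l1 (z j))" by (rule norm_rvec_le_l1)
      finally have "\<epsilon> * S\<^sup>2 + real (Suc j * K) - d \<le> real_of_int (l1 (z j))" .
      moreover have "real K \<le> real (Suc j * K)" by (intro of_nat_mono) simp
      ultimately have "real R < real_of_int (l1 (z j))" using Kd scales(1,2) pos(4) dim_pos by linarith
      then show ?thesis by linarith
    qed
    show "int (2 * R) < l1 (z j - z j')" if jj: "j \<noteq> j'" for j j'
    proof -
      have e: "centre i (Suc j * K) - centre i (Suc j' * K) = (real (Suc j * K) - real (Suc j' * K)) *\<^sub>R \<theta>"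
        by (simp add: centre_def algebra_simps)
      have "norm (centre i (Suc j * K) - centre i (Suc j' * K)) = \<bar>real (Suc j * K) - real (Suc j' * K)\<bar>"
        unfolding e using unit by simp
      also have "real (Suc j * K) - real (Suc j' * K) = (real j - real j') * real K" by (simp add: algebra_simps)
      also have "\<bar>(real j - real j') * real K\<bar> = \<bar>real j - real j'\<bar> * real K" by (simp add: abs_mult)
      finally have "norm (centre i (Suc j * K) - centre i (Suc j' * K)) = \<bar>real j - real j'\<bar> * real K" .
      moreover have "1 * real K \<le> \<bar>real j - real j'\<bar> * real K" using jj by (intro mult_right_mono) (auto simp: abs_if)
      moreover have "norm (centre i (Suc j * K) - centre i (Suc j' * K)) \<le>
        norm (rvec (z j) - rvec (z j')) + norm (rvec (z j) - centre i (Suc j * K)) + norm (rvec (z j') - centre i (Suc j' * K))"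
      proof -
        have "norm (a - a') \<le> norm (u - u') + norm (u - a) + norm (u' - a')" for a a' u u' :: "real ^ 'n" by norm
        then show ?thesis .
      qed
      moreover have "norm (rvec (z j) - rvec (z j')) \<le> real_of_int (l1 (z j - z j'))"
        using norm_rvec_le_l1[of "z j - z j'"] by (simp add: rvec_diff)
      ultimately have "2 * real R < real_of_int (l1 (z j - z j'))" using near[of j] near[of j'] Kd by linarith
      then show ?thesis by linarith
    qed
    show "ptime (\<lambda>e. \<tau> e \<omega>) (z j) \<le> t"
      if "\<omega> \<in> {\<omega> \<in> space M. fluctuation (direction_cone \<theta> r) (fpp_ball (\<lambda>e. \<tau> e \<omega>) t) \<Gamma> \<le> ereal x}" for \<omega> j
      using track_inside[OF i inside _ xy, of "fpp_ball (\<lambda>e. \<tau> e \<omega>) t"] that by (simp add: z_def fpp_ball_rvec)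
  qed auto
qed

end

section \<open>The probability of a small fluctuation\<close>

lemma orthogonal_unit_vector:
  fixes \<theta> :: "real ^ 'n::finite"
  assumes "2 \<le> CARD('n)" shows "\<exists>\<eta>. norm \<eta> = 1 \<and> \<eta> \<bullet> \<theta> = 0"
proof -
  have "dim {\<theta>} \<le> 1" using dim_le_card[of "{\<theta>}"] by simp
  then have "dim {\<theta>} < DIM(real ^ 'n)" using assms by simp
  then obtain x where x: "x \<noteq> 0" "\<And>y. y \<in> span {\<theta>} \<Longrightarrow> orthogonal x y"
    by (rule orthogonal_to_subspace_exists) (rule that)
  have "\<theta> \<in> span {\<theta>}" by (simp add: span_base)
  from x(2)[OF this] have "x \<bullet> \<theta> = 0" by (simp add: orthogonal_def)
  then show ?thesis using x(1) by (intro exI[of _ "x /\<^sub>R norm x"]) simp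
qed

context iid_environment
begin

text \<open>If \<open>\<Gamma>\<close> does not contain a ball around \<open>q = (\<epsilon> * t) *\<^sub>R \<theta>\<close>, a half-space separates it from points of
the ball. Going from \<open>q\<close> in the direction of the coordinate axis that is closest to the normal, one finds
a point \<open>p\<close> of the cone at distance more than \<open>y\<close> from \<open>\<Gamma>\<close>. The point depends on \<open>\<Gamma>\<close> but not on the
weights, so its passage time exceeds \<open>t\<close> only with probability \<open>P\<close>.\<close>

lemma core_missing:
  fixes t :: real
  assumes \<theta>: "norm \<theta> = 1" and r: "0 < r" and \<Gamma>: "closed \<Gamma>" "convex \<Gamma>" "0 \<in> \<Gamma>"
    and \<epsilon>: "0 < \<epsilon>" "0 < \<rho>" "2 * real CARD('n) * \<rho> \<le> \<epsilon>" "2 * real CARD('n) * \<rho> \<le> r * \<epsilon>"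
    and t: "0 < t" and xy: "x < y" "y < \<rho> * t"
    and missing: "\<not> cball ((\<epsilon> * t) *\<^sub>R \<theta>) (\<rho> * t) \<subseteq> \<Gamma>"
    and fast: "\<forall>x. (\<forall>j. \<bar>real_of_int (x $ j)\<bar> \<le> 2 * \<epsilon> * t + 1) \<longrightarrow>
      (\<exists>A\<in>events. prob A \<le> P \<and> (\<forall>\<omega>\<in>space M - A. ptime (\<lambda>e. \<tau> e \<omega>) x \<le> t))"
  shows "measure M {\<omega> \<in> space M. fluctuation (direction_cone \<theta> r) (fpp_ball (\<lambda>e. \<tau> e \<omega>) t) \<Gamma> \<le> ereal x} \<le> P"
proof -
  define d where "d = real CARD('n)"
  have d: "1 \<le> d" by (simp add: d_def Suc_le_eq)
  define q where "q = (\<epsilon> * t) *\<^sub>R \<theta>"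
  have "\<Gamma> \<noteq> {}" using \<Gamma> by blast
  from supporting_halfspace[OF \<Gamma>(1,2) this missing] obtain u where
    u: "norm u = 1" "\<forall>x\<in>\<Gamma>. u \<bullet> x \<le> u \<bullet> q + \<rho> * t" unfolding q_def by blast
  obtain k where k: "1 \<le> d * \<bar>u $ k\<bar>" using large_component[OF u(1)] unfolding d_def by (elim exE)
  define a where "a = 2 * d * \<rho>"
  define f where "f = (axis k (a * sgn (u $ k)) :: real ^ 'n)"
  have uk: "u $ k \<noteq> 0" using k by auto
  have a: "0 < a" "a \<le> \<epsilon>" "a \<le> r * \<epsilon>" using \<epsilon> d by (auto simp: a_def d_def)
  have nf: "norm f = a"
    using a uk by (simp add: f_def norm_eq_sqrt_inner inner_axis_axis abs_mult abs_sgn_eq)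
  have uf: "2 * \<rho> \<le> u \<bullet> f"
  proof -
    have "u \<bullet> f = a * \<bar>u $ k\<bar>" by (simp add: f_def inner_axis abs_sgn mult_ac)
    also have "\<dots> = 2 * \<rho> * (d * \<bar>u $ k\<bar>)" by (simp add: a_def)
    finally show ?thesis using k \<epsilon> mult_left_mono[OF k, of "2 * \<rho>"] by simp
  qed
  define p where "p = q + t *\<^sub>R f"
  have cone: "p \<in> direction_cone \<theta> r"
  proof -
    have "p = (\<epsilon> * t) *\<^sub>R (\<theta> + f /\<^sub>R \<epsilon>)" using \<epsilon> by (simp add: p_def q_def scaleR_add_right)
    moreover have "\<theta> + f /\<^sub>R \<epsilon> \<in> cball \<theta> r" using nf a \<epsilon> by (simp add: dist_norm field_simps)
    moreover have "0 \<le> \<epsilon> * t" using \<epsilon> t by simp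
    ultimately show ?thesis unfolding direction_cone_def by blast
  qed
  have "\<bar>real_of_int (lattice_floor p $ j)\<bar> \<le> 2 * \<epsilon> * t + 1" for j
  proof -
    have "\<bar>p $ j\<bar> \<le> norm p" by (rule component_le_norm_cart)
    also have "\<dots> \<le> norm q + norm (t *\<^sub>R f)" unfolding p_def by (rule norm_triangle_ineq)
    also have "\<dots> \<le> \<epsilon> * t + t * \<epsilon>" using \<theta> \<epsilon> t nf a by (simp add: q_def)
    finally have "\<bar>p $ j\<bar> \<le> 2 * \<epsilon> * t" by simp
    then show ?thesis unfolding lattice_floor_def by simp linarith
  qed
  then obtain A where A: "A \<in> events" "prob A \<le> P" "\<forall>\<omega>\<in>space M - A. ptime (\<lambda>e. \<tau> e \<omega>) (lattice_floor p) \<le> t"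
    using fast by blast
  have "{\<omega> \<in> space M. fluctuation (direction_cone \<theta> r) (fpp_ball (\<lambda>e. \<tau> e \<omega>) t) \<Gamma> \<le> ereal x} \<subseteq> A"
  proof (rule subsetI, rule ccontr)
    fix \<omega> assume w: "\<omega> \<in> {\<omega> \<in> space M. fluctuation (direction_cone \<theta> r) (fpp_ball (\<lambda>e. \<tau> e \<omega>) t) \<Gamma> \<le> ereal x}" "\<omega> \<notin> A"
    then have "p \<in> fpp_ball (\<lambda>e. \<tau> e \<omega>) t" using A(3) by (simp add: fpp_ball_floor)
    moreover have "fluctuation (direction_cone \<theta> r) (fpp_ball (\<lambda>e. \<tau> e \<omega>) t) \<Gamma> \<le> ereal x" using w by simp
    ultimately obtain v where v: "v \<in> \<Gamma>" "dist p v < y"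
      using fluctuation_outside[OF _ xy(1) _ cone] by blast
    have "u \<bullet> v \<le> u \<bullet> q + \<rho> * t" using u v by blast
    moreover have "u \<bullet> p = u \<bullet> q + t * (u \<bullet> f)" by (simp add: p_def inner_add_right)
    moreover have "t * (2 * \<rho>) \<le> t * (u \<bullet> f)" using uf t by (intro mult_left_mono) auto
    moreover have "u \<bullet> p - u \<bullet> v \<le> dist p v"
      using norm_cauchy_schwarz[of u "p - v"] u by (simp add: inner_diff_right dist_norm)
    ultimately have "t * (2 * \<rho>) - \<rho> * t < y" using v by linarith
    then show False using xy(2) by (simp add: mult.commute)
  qed
  from order_trans[OF measure_le_event[OF this A(1)] A(2)] show ?thesis .
qed

text \<open>At scale \<open>l = 2 * h\<close> with \<open>h\<close> close to \<open>ln t / (8 * K)\<close>, a spoiling event has probability at least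
\<open>exp (- K * l) \<ge> t powr (- 1 / 4)\<close>. The exit points are displaced by \<open>s * h\<close>, and \<open>c\<close> is so
small that this displacement exceeds the multiple of \<open>y = 2 * c * ln t\<close> that \<open>exit_points\<close> requires.\<close>

lemma fluctuation_tail:
  fixes \<theta> :: "real ^ 'n"
  assumes mom: "\<forall>e\<in>edges. integrable M (\<lambda>\<omega>. \<tau> e \<omega> ^ (2 * m))" "1 \<le> m" and dim: "2 \<le> CARD('n)"
    and sp: "spoilable s A K" "1 \<le> s" "0 < K" and b: "0 < b" "0 < measure F {b..}"
    and \<theta>: "norm \<theta> = 1" and r: "0 < r"
  shows "\<exists>c>0. \<exists>C>0. \<exists>t0\<ge>1. \<forall>t\<ge>t0. \<forall>\<Gamma>. closed \<Gamma> \<and> convex \<Gamma> \<and> 0 \<in> \<Gamma> \<longrightarrow>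
    measure M {\<omega> \<in> space M. fluctuation (direction_cone \<theta> r) (fpp_ball (\<lambda>e. \<tau> e \<omega>) t) \<Gamma> \<le> ereal (c * ln t)}
    \<le> C / t ^ (2 * CARD('n) * m)"
proof -
  let ?q = "2 * CARD('n) * m"
  define d where "d = real CARD('n)"
  have d: "1 \<le> d" by (simp add: d_def Suc_le_eq)
  obtain \<kappa> C1 t1 where \<kappa>: "0 < \<kappa>" "0 < C1" and fast: "\<forall>t\<ge>t1. \<forall>x. (\<forall>j. \<bar>real_of_int (x $ j)\<bar> \<le> \<kappa> * t) \<longrightarrow>
    (\<exists>A\<in>events. prob A \<le> C1 / t ^ ?q \<and> (\<forall>\<omega>\<in>space M - A. ptime (\<lambda>e. \<tau> e \<omega>) x \<le> t))"
    using ptime_upper_tail[OF mom dim] by (elim exE conjE)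
  obtain l0 where l0: "\<forall>l\<ge>l0. \<forall>w k \<sigma>. \<bar>\<sigma>\<bar> = 1 \<longrightarrow>
     (\<exists>G\<in>sets (field (ball_edges w (A * l))). exp (- K * real l) \<le> prob G \<and>
       (\<forall>\<omega>\<in>G. \<forall>T. int (A * l) < l1 w \<longrightarrow> ptime (\<lambda>e. \<tau> e \<omega>) (w - axis k (\<sigma> * int (s * l))) \<le> T \<longrightarrow>
         ptime (\<lambda>e. \<tau> e \<omega>) w \<le> T))"
    using sp(1) unfolding spoilable_def by (elim exE)
  obtain \<eta> :: "real ^ 'n" where \<eta>: "norm \<eta> = 1" "\<eta> \<bullet> \<theta> = 0" using orthogonal_unit_vector[OF dim] by blast
  \<comment> \<open>all the points of the cone that \<open>core_missing\<close> uses have coordinates of size at most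
    \<open>2 * \<epsilon> * t = \<kappa> * t / 2\<close> before rounding\<close>
  define \<epsilon> where "\<epsilon> = \<kappa> / 4"
  define \<rho> where "\<rho> = min \<epsilon> (r * \<epsilon>) / (2 * d)"
  define c where "c = 1 / (128 * d * K)"
  have \<epsilon>: "0 < \<epsilon>" using \<kappa> by (simp add: \<epsilon>_def)
  have \<rho>2: "2 * d * \<rho> = min \<epsilon> (r * \<epsilon>)" using d by (simp add: \<rho>_def)
  have \<rho>: "0 < \<rho>" "2 * d * \<rho> \<le> \<epsilon>" "2 * d * \<rho> \<le> r * \<epsilon>"
    using d \<epsilon> r unfolding \<rho>2 by (simp_all add: \<rho>_def)
  have "1 * \<rho> \<le> 2 * d * \<rho>" using d \<rho>(1) by (intro mult_right_mono) auto
  then have \<rho>': "\<rho> \<le> \<epsilon>" "\<rho> \<le> r * \<epsilon>" using \<rho> by linarith+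
  have c: "0 < c" using sp d by (simp add: c_def)
  \<comment> \<open>\<open>\<alpha> + \<beta> * ln t\<close> dominates all the logarithmic lengths in the condition \<open>size\<close> of \<open>track_bundle\<close>\<close>
  define \<alpha> where "\<alpha> = 16 * (1 + d) * d"
  define \<beta> where "\<beta> = 16 * (1 + d) * ((real s + 2 * real A) / (8 * K) + 2 * c)"
  define Z where "Z = Max {1, 16 * K, 8 * K * real l0, 64 * K * d * (d + 1)}"
  have lnZ: "\<forall>\<^sub>F t in at_top. Z \<le> ln t" using ln_at_top by (simp add: filterlim_at_top)
  have ev: "\<forall>\<^sub>F t in at_top. t1 \<le> t \<and> 1 \<le> t \<and> 2 / \<kappa> \<le> t \<and> (1 / \<rho>)\<^sup>2 \<le> t \<and> Z \<le> ln t \<and>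
    \<alpha> + \<beta> * ln t \<le> 1 * t powr (1 / 2) \<and>
    (\<forall>N::nat. \<rho> * sqrt t / 2 - 1 \<le> real N \<longrightarrow> (1 - exp (- ln t / 4)) ^ N \<le> 1 / t ^ ?q)"
    by (intro eventually_conj eventually_ge_at_top lnZ log_below_power survival_of_many_traps \<rho>(1)) auto
  then obtain t0 where t0: "\<And>t. t0 \<le> t \<Longrightarrow> t1 \<le> t \<and> 1 \<le> t \<and> 2 / \<kappa> \<le> t \<and> (1 / \<rho>)\<^sup>2 \<le> t \<and> Z \<le> ln t \<and>
    \<alpha> + \<beta> * ln t \<le> 1 * t powr (1 / 2) \<and>
    (\<forall>N::nat. \<rho> * sqrt t / 2 - 1 \<le> real N \<longrightarrow> (1 - exp (- ln t / 4)) ^ N \<le> 1 / t ^ ?q)"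
    unfolding eventually_at_top_linorder by blast
  have main: "measure M {\<omega> \<in> space M. fluctuation (direction_cone \<theta> r) (fpp_ball (\<lambda>e. \<tau> e \<omega>) t) \<Gamma> \<le> ereal (c * ln t)} \<le> (C1 + 1) / t ^ ?q"
    (is "?P \<le> _") if t: "max t0 1 \<le> t" and \<Gamma>: "closed \<Gamma> \<and> convex \<Gamma> \<and> 0 \<in> \<Gamma>" for t \<Gamma>
  proof -
    have tt: "t1 \<le> t" "1 \<le> t" "2 / \<kappa> \<le> t" "(1 / \<rho>)\<^sup>2 \<le> t" "Z \<le> ln t" "\<alpha> + \<beta> * ln t \<le> t powr (1 / 2)"
      and surv: "\<And>N::nat. \<rho> * sqrt t / 2 - 1 \<le> real N \<Longrightarrow> (1 - exp (- ln t / 4)) ^ N \<le> 1 / t ^ ?q"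
      using t0[of t] t by simp_all
    have G: "closed \<Gamma>" "convex \<Gamma>" "0 \<in> \<Gamma>" using \<Gamma> by blast+
    have Z: "1 \<le> ln t" "16 * K \<le> ln t" "8 * K * real l0 \<le> ln t" "64 * K * d * (d + 1) \<le> ln t"
      using tt(5) unfolding Z_def by (simp_all)
    have tpos: "0 < t" "0 < t ^ ?q" using tt by simp_all
    define S where "S = sqrt t"
    have S: "0 < S" "S\<^sup>2 = t" using tpos by (auto simp: S_def)
    define y where "y = 2 * c * ln t"
    have y: "0 < y" "c * ln t < y" using c Z(1) by (auto simp: y_def)
    define h where "h = nat \<lfloor>ln t / (8 * K)\<rfloor>"
    have lK: "2 \<le> ln t / (8 * K)" using Z(2) sp(3) by (simp add: field_simps)
    have "real h \<le> ln t / (8 * K) \<and> ln t / (8 * K) - 1 \<le> real h" using lK unfolding h_def by linarith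
    then have h: "real h \<le> ln t / (8 * K)" "ln t / (8 * K) - 1 \<le> real h" by blast+
    have "X / 2 \<le> X - 1" if "2 \<le> X" for X :: real using that by simp
    from order_trans[OF this[OF lK] h(2)] have h2: "ln t / (16 * K) \<le> real h" by simp
    have "h \<le> s * h" using sp(2) by simp
    then have sh: "real h \<le> real (s * h)" by (rule of_nat_mono)
    have rS: "1 \<le> \<rho> * S"
    proof -
      have "1 / \<rho> \<le> S" unfolding S_def using tt(4) by (rule real_le_rsqrt)
      then show ?thesis using \<rho> by (simp add: field_simps)
    qed
    have size: "16 * (1 + d) * (real (s * h) + d + real (A * (2 * h)) + y) \<le> S"
    proof -
      have "(real s + 2 * real A) * real h \<le> (real s + 2 * real A) * (ln t / (8 * K))" using h by (intro mult_left_mono) auto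
      moreover have "real (s * h) + real (A * (2 * h)) = (real s + 2 * real A) * real h" by (simp add: distrib_right)
      moreover have "(real s + 2 * real A) * (ln t / (8 * K)) = (real s + 2 * real A) / (8 * K) * ln t" by simp
      ultimately have "real (s * h) + d + real (A * (2 * h)) + y \<le> d + ((real s + 2 * real A) / (8 * K) + 2 * c) * ln t"
        unfolding y_def distrib_right[of _ _ "ln t"] by linarith
      then have "16 * (1 + d) * (real (s * h) + d + real (A * (2 * h)) + y) \<le> 16 * (1 + d) * (d + ((real s + 2 * real A) / (8 * K) + 2 * c) * ln t)"
        using d by (intro mult_left_mono) auto
      also have "\<dots> = \<alpha> + \<beta> * ln t"
      proof -
        have "a * (d + X * l) = a * d + a * X * l" for a X l :: real by (simp add: algebra_simps)
        then show ?thesis unfolding \<alpha>_def \<beta>_def .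
      qed
      also have "\<dots> \<le> S" using tt(6) tpos by (simp add: S_def powr_half_sqrt)
      finally show ?thesis .
    qed
    have depth: "2 * d * (y + d + 1) \<le> real (s * h)"
    proof -
      have "2 * d * y = ln t / (32 * K)" using d sp(3) by (simp add: y_def c_def)
      moreover have "2 * d * (d + 1) \<le> ln t / (32 * K)" using Z(4) sp(3) by (simp add: field_simps)
      moreover have "2 * d * (y + d + 1) = 2 * d * y + 2 * d * (d + 1)" by (simp add: algebra_simps)
      moreover have "ln t / (32 * K) + ln t / (32 * K) = ln t / (16 * K)" by simp
      ultimately show ?thesis using h2 sh by linarith
    qed
    have yS: "y < \<rho> * t"
    proof -
      have "0 \<le> real (s * h)" "0 \<le> real (A * (2 * h))" by (rule of_nat_0_le_iff)+
      then have "y \<le> real (s * h) + d + real (A * (2 * h)) + y" using d by linarith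
      then have "16 * (1 + d) * y \<le> 16 * (1 + d) * (real (s * h) + d + real (A * (2 * h)) + y)" using d by (intro mult_left_mono) simp_all
      moreover have "1 * y < 16 * (1 + d) * y" using d y by (intro mult_strict_right_mono) auto
      moreover have "1 * S \<le> (\<rho> * S) * S" using rS S by (intro mult_right_mono) auto
      moreover have "(\<rho> * S) * S = \<rho> * t" using S by (simp add: power2_eq_square)
      ultimately show ?thesis using size by linarith
    qed
    have le1: "C1 / t ^ ?q \<le> (C1 + 1) / t ^ ?q" "1 / t ^ ?q \<le> (C1 + 1) / t ^ ?q" "0 \<le> (C1 + 1) / t ^ ?q"
      using \<kappa> tpos(2) by (simp_all add: divide_right_mono)
    show ?thesis
    proof (cases "cball ((\<epsilon> * t) *\<^sub>R \<theta>) (\<rho> * t) \<subseteq> \<Gamma>")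
      case False
      have "?P \<le> C1 / t ^ ?q"
      proof (rule core_missing[OF \<theta> r G \<epsilon> \<rho>[unfolded d_def] tpos(1) y(2) yS False])
        have le: "2 * \<epsilon> * t + 1 \<le> \<kappa> * t" using tt(3) \<kappa> by (simp add: \<epsilon>_def field_simps)
        show "\<forall>x. (\<forall>j. \<bar>real_of_int (x $ j)\<bar> \<le> 2 * \<epsilon> * t + 1) \<longrightarrow>
          (\<exists>A\<in>events. prob A \<le> C1 / t ^ ?q \<and> (\<forall>\<omega>\<in>space M - A. ptime (\<lambda>e. \<tau> e \<omega>) x \<le> t))"
        proof (intro allI impI)
          fix x :: "int ^ 'n" assume "\<forall>j. \<bar>real_of_int (x $ j)\<bar> \<le> 2 * \<epsilon> * t + 1"
          then have "\<forall>j. \<bar>real_of_int (x $ j)\<bar> \<le> \<kappa> * t" using order_trans[OF _ le] by simp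
          then show "\<exists>A\<in>events. prob A \<le> C1 / t ^ ?q \<and> (\<forall>\<omega>\<in>space M - A. ptime (\<lambda>e. \<tau> e \<omega>) x \<le> t)"
            by (rule fast[THEN spec, THEN mp, OF tt(1), THEN spec, THEN mp])
        qed
      qed
      then show ?thesis using le1 by linarith
    next
      case True
      have core: "cball ((\<epsilon> * S\<^sup>2) *\<^sub>R \<theta>) (\<rho> * S\<^sup>2) \<subseteq> \<Gamma>" unfolding S(2) by (rule True)
      have tb: "track_bundle \<theta> \<eta> \<Gamma> \<epsilon> \<rho> r S y d (s * h) (A * (2 * h))"
        by (rule track_bundle.intro[OF d_def \<theta> \<eta> G(1,2) \<rho>(1) \<rho>' S(1) rS y(1) size depth core])
      define N where "N = nat \<lfloor>\<rho> * S / 2\<rfloor>"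
      have "real N \<le> \<rho> * S / 2 \<and> \<rho> * S / 2 - 1 \<le> real N" using rS unfolding N_def by linarith
      then have N: "real N \<le> \<rho> * S / 2" "\<rho> * S / 2 - 1 \<le> real N" by blast+
      have NS: "real N * S \<le> \<rho> * S\<^sup>2 / 2"
      proof -
        have "real N * S \<le> (\<rho> * S / 2) * S" using N S by (intro mult_right_mono) auto
        then show ?thesis by (simp add: power2_eq_square)
      qed
      show ?thesis
      proof (cases "\<exists>i<N. \<forall>n. cball (track_bundle.centre \<theta> \<eta> \<epsilon> S i n) (S / 4) \<subseteq> \<Gamma>")
        case True
        then obtain i where i: "i < N" "\<And>n. cball (track_bundle.centre \<theta> \<eta> \<epsilon> S i n) (S / 4) \<subseteq> \<Gamma>" by blast
        have "real i * S \<le> real N * S" using i S by (intro mult_right_mono) auto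
        then have "real i * S \<le> \<rho> * S\<^sup>2 / 2" using NS by linarith
        from track_inside_null[OF tb y(2) this i(2) b] show ?thesis using le1 by simp
      next
        case False
        then have ex: "\<exists>n. \<not> cball (track_bundle.centre \<theta> \<eta> \<epsilon> S i n) (S / 4) \<subseteq> \<Gamma>" if "i < N" for i using that by blast
        have large: "l0 \<le> 2 * h"
        proof -
          have "real l0 \<le> ln t / (8 * K)" using Z(3) sp(3) by (simp add: field_simps)
          also have "\<dots> = 2 * (ln t / (16 * K))" by simp
          also have "\<dots> \<le> 2 * real h" using h2 by simp
          finally show ?thesis by linarith
        qed
        have cost: "exp (- ln t / 4) \<le> exp (- K * real (2 * h))"
        proof -
          have "K * (2 * real h) \<le> K * (2 * (ln t / (8 * K)))" using h sp(3) by (intro mult_left_mono) auto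
          also have "\<dots> = ln t / 4" using sp(3) by simp
          finally show ?thesis by simp
        qed
        have "?P \<le> (1 - exp (- K * real (2 * h))) ^ N"
          by (rule tracks_avoided[OF tb y(2) NS l0[THEN spec, THEN mp, OF large] ex])
        also have "\<dots> \<le> (1 - exp (- ln t / 4)) ^ N"
        proof (rule power_mono)
          have "0 \<le> K * real (2 * h)" using sp(3) by simp
          then show "0 \<le> 1 - exp (- K * real (2 * h))" by simp
        qed (use cost in linarith)
        also have "\<dots> \<le> 1 / t ^ ?q" using N(2) by (intro surv) (simp add: S_def)
        finally show ?thesis using le1 by linarith
      qed
    qed
  qed
  show ?thesis
    using c \<kappa> by (intro exI[of _ c] exI[of _ "C1 + 1"] exI[of _ "max t0 1"] conjI allI impI main) auto
qed

end

theorem theorem1p5: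
  fixes M :: "'a measure"
    and \<tau> :: "(int ^ 'n::finite) set \<Rightarrow> 'a \<Rightarrow> real"
    and F :: "real measure"
    and m :: nat
    and \<theta> :: "real ^ 'n"
    and r :: real
  assumes "CARD('n) \<ge> 2"
    and "prob_space M"
    and "prob_space.indep_vars M (\<lambda>_. borel) \<tau> edges"
    and "\<And>e. e \<in> edges \<Longrightarrow> distr M borel (\<tau> e) = F"
    and "\<And>e \<omega>. e \<in> edges \<Longrightarrow> \<omega> \<in> space M \<Longrightarrow> 0 \<le> \<tau> e \<omega>"
    and "useful TYPE('n) F"
    and "m \<ge> 1"
    and "\<And>e. e \<in> edges \<Longrightarrow> integrable M (\<lambda>\<omega>. \<tau> e \<omega> ^ (2 * m))"
    and "norm \<theta> = 1"
    and "r > 0"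
  shows "\<exists>c>0. \<exists>C>0. \<forall>t>0. \<forall>\<Gamma>. closed \<Gamma> \<and> convex \<Gamma> \<and> 0 \<in> \<Gamma> \<longrightarrow>
    measure M {\<omega> \<in> space M.
      fluctuation (direction_cone \<theta> r) (fpp_ball (\<lambda>e. \<tau> e \<omega>) t) \<Gamma> \<le> ereal (c * ln t)}
    \<le> C * t powr (- real (2 * CARD('n) * m))"
proof -
  interpret iid_environment M \<tau> F
    by (intro iid_environment.intro iid_environment_axioms.intro assms)
  interpret F: prob_space F by (rule prob_space_law)
  have mom: "\<forall>e\<in>edges. integrable M (\<lambda>\<omega>. \<tau> e \<omega> ^ (2 * m))" using assms(8) by blast
  note minus = F_minus_facts[OF prob_space_law sets_law law_nonneg]
  \<comment> \<open>an atom at zero is the infimum of the support, so that usefulness compares its mass with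
    \<open>p_crit \<le> 1\<close>\<close>
  have atom: "F_minus F = 0" if "0 < measure F {0}"
  proof (rule ccontr)
    assume "F_minus F \<noteq> 0"
    then have "0 < F_minus F" using minus(1) by simp
    then have "measure F {0} \<le> measure F {..<F_minus F}" by (intro F.finite_measure_mono) (auto simp: sets_law)
    then show False using that minus(2) by simp
  qed
  have "measure F {0} < 1"
  proof (cases "0 < measure F {0}")
    case True
    then have "measure F {0} < p_crit TYPE('n)" using atom[OF True] assms(6) by (simp add: useful_def)
    then show ?thesis using p_crit_le_1[where 'n = 'n] by linarith
  qed simp
  from positive_weights[OF this] obtain b where b: "0 < b" "0 < measure F {b..}" by (elim exE conjE)
  have "\<exists>s\<ge>1. \<exists>A. \<exists>K>0. spoilable s A K"
  proof (cases "0 < measure F {0}")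
    case True
    from spoilable_atom[OF this] show ?thesis by (elim exE conjE) (rule exI[of _ 1], rule conjI[OF order_refl], rule exI, rule exI, rule conjI)
  next
    case False
    then have F0: "measure F {0} = 0" by (simp add: zero_less_measure_iff)
    have "\<exists>a b. 0 \<le> a \<and> a < b \<and> 0 < measure F {..a} \<and> linear_lower_bound b"
    proof (cases "F_minus F = 0")
      case True
      then show ?thesis using F0 by (rule slow_no_atom_at_zero)
    next
      case False
      then have "0 < F_minus F" using minus(1) by simp
      moreover from this have "measure F {F_minus F} < p_crit_oriented TYPE('n)" using assms(6) by (simp add: useful_def)
      ultimately show ?thesis by (rule slow_positive_minimum)
    qed
    then obtain a b where "0 \<le> a" "a < b" "0 < measure F {..a}" "linear_lower_bound b" by (elim exE conjE)
    from spoilable_no_atom[OF this mom assms(7,1)] show ?thesis .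
  qed
  then obtain s A K where s: "1 \<le> s" "0 < K" "spoilable s A K" by (elim exE conjE)
  let ?q = "2 * CARD('n) * m"
  let ?P = "\<lambda>c t \<Gamma>. measure M {\<omega> \<in> space M. fluctuation (direction_cone \<theta> r) (fpp_ball (\<lambda>e. \<tau> e \<omega>) t) \<Gamma> \<le> ereal (c * ln t)}"
  obtain c C t0 where c: "0 < c" "0 < C" "1 \<le> t0"
    and tail: "\<forall>t\<ge>t0. \<forall>\<Gamma>. closed \<Gamma> \<and> convex \<Gamma> \<and> 0 \<in> \<Gamma> \<longrightarrow> ?P c t \<Gamma> \<le> C / t ^ ?q"
    using fluctuation_tail[OF mom assms(7,1) s(3,1,2) b assms(9,10)] by (elim exE conjE)
  have "?P c t \<Gamma> \<le> (C + t0 ^ ?q) * t powr (- real ?q)" if t: "0 < t" and \<Gamma>: "closed \<Gamma> \<and> convex \<Gamma> \<and> 0 \<in> \<Gamma>" for t \<Gamma>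
  proof -
    have pw: "t powr (- real ?q) = 1 / t ^ ?q" using t by (simp only: powr_minus powr_realpow inverse_eq_divide)
    have "?P c t \<Gamma> \<le> (C + t0 ^ ?q) / t ^ ?q"
    \<comment> \<open>for \<open>t < t0\<close> the right-hand side is at least one\<close>
    proof (cases "t0 \<le> t")
      case True
      then have "?P c t \<Gamma> \<le> C / t ^ ?q" using tail \<Gamma> by blast
      also have "\<dots> \<le> (C + t0 ^ ?q) / t ^ ?q" using c t by (intro divide_right_mono) auto
      finally show ?thesis .
    next
      case False
      have "t ^ ?q \<le> t0 ^ ?q" using False t by (intro power_mono) auto
      then have "1 * t ^ ?q \<le> C + t0 ^ ?q" using c by linarith
      then have "1 \<le> (C + t0 ^ ?q) / t ^ ?q" using t by (subst pos_le_divide_eq) auto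
      moreover have "?P c t \<Gamma> \<le> 1" by (rule prob_le_1)
      ultimately show ?thesis by linarith
    qed
    then show ?thesis unfolding pw by simp
  qed
  moreover have "0 < C + t0 ^ ?q" using c by (simp add: add_pos_nonneg)
  ultimately show ?thesis using c(1) by (intro exI[of _ c] exI[of _ "C + t0 ^ ?q"] conjI allI impI)
qed

end
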